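(* The weight matrices of $L$ are Hermitian non-negative definite: $\alpha_{nk}=\alpha_{nk}^\dagger\ge0$, $(n,k)\in J$. For each $(n,k)\in J$, $\operatorname{rank}(\alpha_{nk})$ equals the multiplicity of the eigenvalue $\lambda_{nk}$. Furthermore, the following asymptotic formula holds: $$\alpha_n^{(k)}:=\sum_{\substack{s=1,\dots,m\\ r_s=r_k}}\alpha'_{ns}=\frac2\pi(T_1+nT_1^\perp)(A_k+K_{nk})(T_1+nT_1^\perp),\quad n\ge1,\ k=1,\dots,m,$$ where $\{K_{nk}\}$ is a sequence of $(m\times m)$-matrices such that $\{\|K_{nk}\|\}\in l_2$.
   Context: Let $m\ge 1$; $\dagger$ denotes conjugate transpose and $I$ the unit $(m\times m)$-matrix. Let $\sigma\in L_2((0,\pi);\mathbb C^{m\times m})$ with $\sigma(x)=(\sigma(x))^\dagger$. Put $Y^{[1]}:=Y'-\sigma Y$ and $\ell Y:=-(Y^{[1]})'-\sigma Y^{[1]}-\sigma^2Y$. Let $T_j,H_j\in\mathbb C^{m\times m}$, $j=1,2$, satisfy $T_j=T_j^\dagger=T_j^2$, $T_j^\perp:=I-T_j$, $H_j=H_j^\dagger=T_jH_jT_j$. Denote $$V_1(Y):=T_1(Y^{[1]}(0)-H_1Y(0))-T_1^\perp Y(0),\quad V_2(Y):=T_2(Y^{[1]}(\pi)-H_2Y(\pi))-T_2^\perp Y(\pi),\quad V_1^\perp(Y):=T_1Y(0)+T_1^\perp Y^{[1]}(0).$$ $L$ is the boundary value problem $\ell Y=\lambda Y$ on $(0,\pi)$,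 $V_1(Y)=V_2(Y)=0$ (solutions have $Y,Y^{[1]}$ absolutely continuous on $[0,\pi]$). Index set and eigenvalues: let $W^0(\rho):=(T_2T_1+T_2^\perp T_1^\perp)\sin\rho\pi+(T_2^\perp T_1-T_2T_1^\perp)\cos\rho\pi$ and let $r_1\le\dots\le r_m$ be the zeros of $\det W^0(\rho)$ on $[0,1)$, with multiplicities (there are exactly $m$). Let $p^\perp:=\dim(\operatorname{Ker}T_1\cap\operatorname{Ker}T_2)$ and $J:=\{(n,k)\colon n\in\mathbb N,\ k=1,\dots,m\}\cup\{(0,k)\colon k=p^\perp+1,\dots,m\}$, ordered lexicographically, $\mathbb N=\{1,2,\dots\}$. The eigenvalues of $L$ are real and, counted with multiplicity (dimension of the space of eigenfunctions), are numbered as $\{\lambda_{nk}\}_{(n,k)\in J}$ in non-decreasing order; they satisfy $\sqrt{\lambda_{nk}}=n+r_k+\varkappa_{nk}$, $\{\varkappa_{nk}\}\in l_2$. Weight matrices: the Weyl solution $\Phi(x,\lambda)$ is the matrix solution of $\ell\Phi=\lambda\Phi$ with $V_1(\Phi)=I$, $V_2(\Phi)=0$; the Weyl matrix is $M(\lambda):=V_1^\perp(\Phi)$. It is meromorphic in $\lambda$, with simple poles at the eigenvalues of $L$. The weight matrices are $\alpha_{nk}:=\operatorname{Res}_{\lambda=\lambda_{nk}}M(\lambda)$, $(n,k)\in J$. For every maximal group of equal eigenvalues $\lambda_{n_1k_1}=\dots=\lambda_{n_rk_r}$ with $(n_1,k_1)<\dots<(n_r,k_r)$, put $\alpha'_{n_1k_1}:=\alpha_{n_1k_1}$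 and $\alpha'_{n_jk_j}:=0$ for $j=2,\dots,r$. Matrices $A_k$: let $U^0(\rho):=(T_2T_1+T_2^\perp T_1^\perp)\cos\rho\pi+(T_2T_1^\perp-T_2^\perp T_1)\sin\rho\pi$, $E^0(\rho):=(W^0(\rho))^{-1}U^0(\rho)$, and $A_k:=\pi\operatorname{Res}_{\rho=r_k}E^0(\rho)$, $k=1,\dots,m$. $\|A\|$ is the maximal singular value of the matrix $A$. *)

theory Defs
  imports "HOL-Complex_Analysis.Complex_Analysis" "HOL-Library.Function_Algebras"
begin

definition ctranspose :: "complex^'n^'m \<Rightarrow> complex^'m^'n" where
  "ctranspose A = (\<chi> i j. cnj (A $ j $ i))"

definition mscale :: "complex \<Rightarrow> complex^'n^'m \<Rightarrow> complex^'n^'m" (infixr "\<cdot>\<^sub>m" 75) where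
  "c \<cdot>\<^sub>m A = (\<chi> i j. c * A $ i $ j)"

definition hermitian :: "complex^'m^'m \<Rightarrow> bool" where
  "hermitian A \<longleftrightarrow> ctranspose A = A"

text \<open>The quadratic form of a Hermitian matrix is real-valued.\<close>

definition nonneg_definite :: "complex^'m^'m \<Rightarrow> bool" where
  "nonneg_definite A \<longleftrightarrow>
     hermitian A \<and> (\<forall>v. 0 \<le> Re (\<Sum>i\<in>UNIV. cnj (v $ i) * (A *v v) $ i))"

definition singular_values :: "complex^'m^'m \<Rightarrow> real set" where
  "singular_values A =
     {s. 0 \<le> s \<and> (\<exists>v. v \<noteq> 0 \<and> (ctranspose A ** A) *v v = complex_of_real (s\<^sup>2) *s v)}"

definition matrix_norm :: "complex^'m^'m \<Rightarrow> real" where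
  "matrix_norm A = Max (singular_values A)"

definition matrix_residue :: "(complex \<Rightarrow> complex^'m^'m) \<Rightarrow> complex \<Rightarrow> complex^'m^'m" where
  "matrix_residue F z = (\<chi> i j. residue (\<lambda>w. F w $ i $ j) z)"

definition L2_on :: "real set \<Rightarrow> (real \<Rightarrow> complex^'n^'m) \<Rightarrow> bool" where
  "L2_on S f \<longleftrightarrow> f \<in> borel_measurable (lebesgue_on S) \<and>
                integrable (lebesgue_on S) (\<lambda>x. (norm (f x))\<^sup>2)"

text \<open>A \<open>division_of\<close> its own union is a finite family of nonempty closed intervals
  with disjoint interiors.\<close>

definition absolutely_continuous_on :: "real \<Rightarrow> real \<Rightarrow> (real \<Rightarrow> 'a::real_normed_vector) \<Rightarrow> bool" where
  "absolutely_continuous_on a b f \<longleftrightarrow>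
     (\<forall>\<epsilon>>0. \<exists>\<delta>>0. \<forall>d. d division_of \<Union>d \<longrightarrow> \<Union>d \<subseteq> {a..b} \<longrightarrow> (\<Sum>k\<in>d. Sup k - Inf k) < \<delta> \<longrightarrow>
        (\<Sum>k\<in>d. norm (f (Sup k) - f (Inf k))) < \<epsilon>)"

text \<open>The number of columns \<open>'p\<close> is left free: \<open>'p = 'm\<close> gives matrix solutions, \<open>'p = 1\<close>
  gives column vectors. The quasi-derivative \<open>Y\<^sup>[\<^sup>1\<^sup>] = Y' - \<sigma>Y\<close> is determined by \<open>Y\<close> only almost
  everywhere; its boundary values are those of its (unique) absolutely continuous
  representative, so it is carried along as a second function \<open>Z\<close>.\<close>

definition quasi_derivative ::
    "(real \<Rightarrow> complex^'m^'m) \<Rightarrow> (real \<Rightarrow> complex^'p^'m) \<Rightarrow> (real \<Rightarrow> complex^'p^'m) \<Rightarrow> bool" where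
  "quasi_derivative \<sigma> Y Z \<longleftrightarrow> absolutely_continuous_on 0 pi Z \<and>
     (AE x in lebesgue_on {0<..<pi}.
        \<exists>D. (Y has_vector_derivative D) (at x) \<and> Z x = D - \<sigma> x ** Y x)"

definition solves_ell ::
    "(real \<Rightarrow> complex^'m^'m) \<Rightarrow> complex \<Rightarrow> (real \<Rightarrow> complex^'p^'m) \<Rightarrow> (real \<Rightarrow> complex^'p^'m) \<Rightarrow> bool" where
  "solves_ell \<sigma> \<mu> Y Z \<longleftrightarrow> absolutely_continuous_on 0 pi Y \<and> quasi_derivative \<sigma> Y Z \<and>
     (AE x in lebesgue_on {0<..<pi}.
        \<exists>D. (Z has_vector_derivative D) (at x) \<and>
            - D - \<sigma> x ** Z x - (\<sigma> x ** \<sigma> x) ** Y x = \<mu> \<cdot>\<^sub>m Y x)"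

text \<open>In the next three definitions the arguments after the coefficient matrices are \<open>Y\<close> and its
  quasi-derivative.\<close>

definition V1 :: "complex^'m^'m \<Rightarrow> complex^'m^'m \<Rightarrow>
    (real \<Rightarrow> complex^'p^'m) \<Rightarrow> (real \<Rightarrow> complex^'p^'m) \<Rightarrow> complex^'p^'m" where
  "V1 T1 H1 Y Z = T1 ** (Z 0 - H1 ** Y 0) - (mat 1 - T1) ** Y 0"

definition V2 :: "complex^'m^'m \<Rightarrow> complex^'m^'m \<Rightarrow>
    (real \<Rightarrow> complex^'p^'m) \<Rightarrow> (real \<Rightarrow> complex^'p^'m) \<Rightarrow> complex^'p^'m" where
  "V2 T2 H2 Y Z = T2 ** (Z pi - H2 ** Y pi) - (mat 1 - T2) ** Y pi"

definition V1_perp :: "complex^'m^'m \<Rightarrow>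
    (real \<Rightarrow> complex^'p^'m) \<Rightarrow> (real \<Rightarrow> complex^'p^'m) \<Rightarrow> complex^'p^'m" where
  "V1_perp T1 Y Z = T1 ** Y 0 + (mat 1 - T1) ** Z 0"

text \<open>Functions on \<open>[0, \<pi>]\<close> are represented by functions vanishing outside it, so that distinct
  elements of the eigenspace are distinct eigenfunctions.\<close>

definition eigenspace :: "(real \<Rightarrow> complex^'m^'m) \<Rightarrow> complex^'m^'m \<Rightarrow> complex^'m^'m \<Rightarrow>
    complex^'m^'m \<Rightarrow> complex^'m^'m \<Rightarrow> complex \<Rightarrow> (real \<Rightarrow> complex^1^'m) set" where
  "eigenspace \<sigma> T1 T2 H1 H2 \<mu> =
     {Y. (\<forall>x. x \<notin> {0..pi} \<longrightarrow> Y x = 0) \<and>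
         (\<exists>Z. solves_ell \<sigma> \<mu> Y Z \<and> V1 T1 H1 Y Z = 0 \<and> V2 T2 H2 Y Z = 0)}"

text \<open>The multiplicity is \<open>0\<close> when \<open>\<mu>\<close> is not an eigenvalue.\<close>

definition eigen_mult :: "(real \<Rightarrow> complex^'m^'m) \<Rightarrow> complex^'m^'m \<Rightarrow> complex^'m^'m \<Rightarrow>
    complex^'m^'m \<Rightarrow> complex^'m^'m \<Rightarrow> complex \<Rightarrow> nat" where
  "eigen_mult \<sigma> T1 T2 H1 H2 \<mu> =
     vector_space.dim (\<lambda>c Y x. c \<cdot>\<^sub>m Y x) (eigenspace \<sigma> T1 T2 H1 H2 \<mu>)"

definition W0 :: "complex^'m^'m \<Rightarrow> complex^'m^'m \<Rightarrow> complex \<Rightarrow> complex^'m^'m" where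
  "W0 T1 T2 \<rho> =
     sin (\<rho> * of_real pi) \<cdot>\<^sub>m (T2 ** T1 + (mat 1 - T2) ** (mat 1 - T1)) +
     cos (\<rho> * of_real pi) \<cdot>\<^sub>m ((mat 1 - T2) ** T1 - T2 ** (mat 1 - T1))"

definition U0 :: "complex^'m^'m \<Rightarrow> complex^'m^'m \<Rightarrow> complex \<Rightarrow> complex^'m^'m" where
  "U0 T1 T2 \<rho> =
     cos (\<rho> * of_real pi) \<cdot>\<^sub>m (T2 ** T1 + (mat 1 - T2) ** (mat 1 - T1)) +
     sin (\<rho> * of_real pi) \<cdot>\<^sub>m (T2 ** (mat 1 - T1) - (mat 1 - T2) ** T1)"

definition E0 :: "complex^'m^'m \<Rightarrow> complex^'m^'m \<Rightarrow> complex \<Rightarrow> complex^'m^'m" where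
  "E0 T1 T2 \<rho> = matrix_inv (W0 T1 T2 \<rho>) ** U0 T1 T2 \<rho>"

text \<open>\<open>r 1 \<le> \<dots> \<le> r m\<close> are the zeros of \<open>det W0\<close> on \<open>[0, 1)\<close>, repeated according to multiplicity.\<close>

definition zero_enumeration :: "complex^'m^'m \<Rightarrow> complex^'m^'m \<Rightarrow> (nat \<Rightarrow> real) \<Rightarrow> bool" where
  "zero_enumeration T1 T2 r \<longleftrightarrow>
     r ` {1..CARD('m)} \<subseteq> {0..<1} \<and> mono_on {1..CARD('m)} r \<and>
     (\<forall>\<rho>\<in>{0..<1}. int (card {k\<in>{1..CARD('m)}. r k = \<rho>}) =
                   zorder (\<lambda>z. det (W0 T1 T2 z)) (complex_of_real \<rho>))"

definition p_perp :: "complex^'m^'m \<Rightarrow> complex^'m^'m \<Rightarrow> nat" where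
  "p_perp T1 T2 = vec.dim ({v. T1 *v v = 0} \<inter> {v. T2 *v v = 0})"

definition index_set :: "complex^'m^'m \<Rightarrow> complex^'m^'m \<Rightarrow> (nat \<times> nat) set" where
  "index_set T1 T2 = {1..} \<times> {1..CARD('m)} \<union> {0} \<times> {p_perp T1 T2 + 1..CARD('m)}"

abbreviation lex_less :: "((nat \<times> nat) \<times> (nat \<times> nat)) set" where
  "lex_less \<equiv> less_than <*lex*> less_than"

text \<open>\<open>ev\<close> lists all eigenvalues, with multiplicities, in non-decreasing order along the index set.\<close>

definition eigenvalue_enumeration :: "(real \<Rightarrow> complex^'m^'m) \<Rightarrow> complex^'m^'m \<Rightarrow> complex^'m^'m \<Rightarrow>
    complex^'m^'m \<Rightarrow> complex^'m^'m \<Rightarrow> (nat \<times> nat \<Rightarrow> real) \<Rightarrow> bool" where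
  "eigenvalue_enumeration \<sigma> T1 T2 H1 H2 ev \<longleftrightarrow>
     (\<forall>p\<in>index_set T1 T2. \<forall>q\<in>index_set T1 T2. (p, q) \<in> lex_less \<longrightarrow> ev p \<le> ev q) \<and>
     (\<forall>\<mu>. finite {p\<in>index_set T1 T2. complex_of_real (ev p) = \<mu>} \<and>
          card {p\<in>index_set T1 T2. complex_of_real (ev p) = \<mu>} = eigen_mult \<sigma> T1 T2 H1 H2 \<mu>)"

definition weyl_solution :: "(real \<Rightarrow> complex^'m^'m) \<Rightarrow> complex^'m^'m \<Rightarrow> complex^'m^'m \<Rightarrow>
    complex^'m^'m \<Rightarrow> complex^'m^'m \<Rightarrow> complex \<Rightarrow>
    (real \<Rightarrow> complex^'m^'m) \<Rightarrow> (real \<Rightarrow> complex^'m^'m) \<Rightarrow> bool" where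
  "weyl_solution \<sigma> T1 T2 H1 H2 \<mu> \<Phi> \<Psi> \<longleftrightarrow>
     solves_ell \<sigma> \<mu> \<Phi> \<Psi> \<and> V1 T1 H1 \<Phi> \<Psi> = mat 1 \<and> V2 T2 H2 \<Phi> \<Psi> = 0"

text \<open>The Weyl solution exists and is unique on \<open>[0, \<pi>]\<close> when \<open>\<mu>\<close> is not an eigenvalue; at the
  (isolated) eigenvalues the value below is unspecified, which does not affect the residues.\<close>

definition weyl_matrix :: "(real \<Rightarrow> complex^'m^'m) \<Rightarrow> complex^'m^'m \<Rightarrow> complex^'m^'m \<Rightarrow>
    complex^'m^'m \<Rightarrow> complex^'m^'m \<Rightarrow> complex \<Rightarrow> complex^'m^'m" where
  "weyl_matrix \<sigma> T1 T2 H1 H2 \<mu> =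
     (THE M. \<exists>\<Phi> \<Psi>. weyl_solution \<sigma> T1 T2 H1 H2 \<mu> \<Phi> \<Psi> \<and> M = V1_perp T1 \<Phi> \<Psi>)"

definition weight_matrix :: "(real \<Rightarrow> complex^'m^'m) \<Rightarrow> complex^'m^'m \<Rightarrow> complex^'m^'m \<Rightarrow>
    complex^'m^'m \<Rightarrow> complex^'m^'m \<Rightarrow> (nat \<times> nat \<Rightarrow> real) \<Rightarrow> nat \<times> nat \<Rightarrow> complex^'m^'m" where
  "weight_matrix \<sigma> T1 T2 H1 H2 ev p =
     matrix_residue (weyl_matrix \<sigma> T1 T2 H1 H2) (complex_of_real (ev p))"

text \<open>The weight matrix is kept at the first index of each group of equal eigenvalues and
  replaced by zero at the others.\<close>

definition weight_matrix' :: "(real \<Rightarrow> complex^'m^'m) \<Rightarrow> complex^'m^'m \<Rightarrow> complex^'m^'m \<Rightarrow>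
    complex^'m^'m \<Rightarrow> complex^'m^'m \<Rightarrow> (nat \<times> nat \<Rightarrow> real) \<Rightarrow> nat \<times> nat \<Rightarrow> complex^'m^'m" where
  "weight_matrix' \<sigma> T1 T2 H1 H2 ev p =
     (if \<exists>q\<in>index_set T1 T2. (q, p) \<in> lex_less \<and> ev q = ev p then 0
      else weight_matrix \<sigma> T1 T2 H1 H2 ev p)"

definition A_mat :: "complex^'m^'m \<Rightarrow> complex^'m^'m \<Rightarrow> (nat \<Rightarrow> real) \<Rightarrow> nat \<Rightarrow> complex^'m^'m" where
  "A_mat T1 T2 r k = pi *\<^sub>R matrix_residue (E0 T1 T2) (complex_of_real (r k))"

end

theory Submission
 imports Defs
begin

text \<open>The matrix solutions of \<open>\<ell>Y = \<lambda>Y\<close> come from a Volterra equation for \<open>(Y, Y')\<close>, so that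
 \<open>M = - N\<inverse> S\<close> with entire \<open>N = V\<^sub>2(\<phi>)\<close>, \<open>S = V\<^sub>2(\<psi>)\<close>. The Lagrange identity bounds \<open>N(l + i t)\<close> below by a
 multiple of \<open>t\<close>; hence \<open>N\<inverse>\<close> has only simple poles, and the order of the zero \<open>l\<close> of \<open>det N\<close> is the multiplicity.
 The same identity gives \<open>\<alpha> = \<alpha>\<^sup>* Q \<alpha>\<close> with a positive Gram matrix \<open>Q\<close>, whence positivity and rank.
 For the asymptotics, \<open>\<rho> = \<surd>\<lambda>\<close> and the scaled \<open>N\<close> and \<open>S\<close> differ from \<open>W\<^sup>0\<close> and \<open>U\<^sup>0\<close> by
 oscillating integrals of \<open>\<sigma>\<close>. They tend to zero (Riemann-Lebesgue), so Rouche's theorem places the eigenvalues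
 as in the free problem; and they are square summable along \<open>\<rho> = n + z\<close> (Bessel), which bounds the contour
 integrals of \<open>2\<rho> M(\<rho>\<^sup>2)\<close> around \<open>n + r\<^sub>k\<close> that represent the sums of weight matrices.\<close>

text \<open>Since \<sigma> is only square integrable, the equation holds almost everywhere and the
  calculus is that of Lebesgue primitives. The combinations Y +- (i/\<rho>) Z, multiplied by exp(i
  \<rho> x), stay comparable with bounded functions in every half-plane Im \<rho> >= -B. This is
  enough because \<rho> and -\<rho> give the same \<lambda>: a circle in the \<lambda>-plane is seen
  through its roots in the upper half-plane. The scaling of columns by 1 on T1 and \<rho> on
  T1-perp, which makes N comparable with W0, reappears in M and is the origin of the factors T1 + n
  T1-perp. W0 is a sum of two exponentials times unitary matrices; this gives lower bounds on large
  circles and the simple poles of E0 at once. Rouche yields counts only. They identify indices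
  because the sublevel sets of both enumerations are lexicographic initial segments of the index
  set. In the free problem the common kernel of T1 and T2 enlarges the kernel of W0 at 0 without
  contributing an eigenvalue 0, which explains p-perp. The contours have a fixed radius and resolve
  groups of equal r_k, not single eigenvalues. Estimates use the Frobenius norm, which dominates the
  maximal singular value.\<close>

notation mscale (infixr "\<cdot>" 75)

section \<open>Absolutely continuous functions\<close>

text \<open>Division intervals have disjoint interiors, so the integral of the constant 1 over their
  union is the sum of lengths. This transfers the small measure of an open cover to the length
  condition in \<open>absolutely_continuous_on\<close>.\<close>

lemma content_sum_le_measure:
 fixes d :: "real set set"
 assumes d: "d division_of \<Union>d" and U: "\<Union>d \<subseteq> U" "U \<in> lmeasurable"
 shows "(\<Sum>k\<in>d. Sup k - Inf k) <= measure lebesgue U"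
proof -
 have fin: "finite d" using d by auto
 have int: "\<exists>u v. k = {u..v} & u <= v" if "k \<in> d" for k
  using division_ofD(3)[OF d that] division_ofD(4)[OF d that] by (metis atLeastatMost_empty_iff2 box_real(2))
 have "(\<Sum>k\<in>d. Sup k - Inf k) = (\<Sum>k\<in>d. integral k (%x. 1::real))"
  by (intro sum.cong refl) (use int in fastforce)
 also have "... = integral (\<Union>d) (%x. 1::real)"
 proof (rule integral_combine_division_bottomup[symmetric, OF d])
  show "(%x. 1::real) integrable_on k" if "k \<in> d" for k using int[OF that] by (auto intro: integrable_const_ivl)
 qed
 also have "... = measure lebesgue (\<Union>d)" using lmeasurable_division[OF d] by (simp add: lmeasure_integral)
 also have "... <= measure lebesgue U" by (intro measure_mono_fmeasurable U) (use lmeasurable_division[OF d] in auto)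
 finally show ?thesis .
qed

text \<open>The gauge at a point of the exceptional null set \<open>N\<close> is an open superset of \<open>N\<close> of small
 measure, so absolute continuity controls the increments over the intervals tagged in \<open>N\<close>.\<close>

lemma has_integral_derivative_absolutely_continuous:
 fixes f :: "real => 'a::banach"
 assumes ab: "a <= b" and ac: "absolutely_continuous_on a b f" and N: "negligible N"
  and der: "\<And>x. x \<in> {a<..<b} - N ==> (f has_vector_derivative g x) (at x)"
 shows "(g has_integral (f b - f a)) {a..b}"
proof -
 define N' where "N' = N \<union> {a,b}"
 have negN': "negligible N'" unfolding N'_def using N by auto
 \<comment> \<open>With the integrand set to 0 on \<open>N'\<close>, a tag in \<open>N'\<close>
   contributes only an increment of \<open>f\<close>. The endpoints belong to \<open>N'\<close>
   because the derivative is assumed in the open interval only.\<close>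
 define g' where "g' = (%x. if x \<in> N' then 0 else g x)"
 have "(g' has_integral (f b - f a)) {a..b}" unfolding has_integral_real
 proof (intro allI impI)
  fix e :: real assume e: "e > 0"
  \<comment> \<open>The summand 2 keeps the denominator positive when \<open>a = b\<close>.\<close>
  define e1 where "e1 = e / (2 * (b - a) + 2)"
  have e1: "e1 > 0" "e1 * (b - a) < e / 2"
  proof -
   show "e1 > 0" unfolding e1_def using e ab by (intro divide_pos_pos) auto
   have "0 < 2 * (b - a) + 2" using ab by simp
   then show "e1 * (b - a) < e / 2" unfolding e1_def using e by (simp add: field_simps)
  qed
  obtain \<delta> where \<delta>: "\<delta> > 0" and acd: "\<And>d. d division_of \<Union>d ==> \<Union>d \<subseteq> {a..b} ==>
    (\<Sum>k\<in>d. Sup k - Inf k) < \<delta> ==> (\<Sum>k\<in>d. norm (f (Sup k) - f (Inf k))) < e / 2"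
   using ac e unfolding absolutely_continuous_on_def by (meson half_gt_zero)
  obtain U where U: "open U" "N' \<subseteq> U" "U \<in> lmeasurable" "measure lebesgue U < \<delta>"
  proof -
   have N's: "N' \<in> lmeasurable" using negN' negligible_imp_measurable by auto
   obtain U where U: "open U" "N' \<subseteq> U" "U - N' \<in> lmeasurable" "emeasure lebesgue (U - N') < ennreal \<delta>"
    using sets_lebesgue_outer_open[of N' \<delta>] \<delta> N's by (metis fmeasurableD)
   have Um: "U \<in> lmeasurable" using fmeasurable.Un[OF U(3) N's] U(2) by (simp add: Un_absorb2)
   have "measure lebesgue U <= measure lebesgue (U - N') + measure lebesgue N'"
    using measure_Un_le[of "U - N'" lebesgue N'] U(2,3) N's by (auto simp: Un_absorb2 fmeasurableD)
   also have "... < \<delta>" using negligible_imp_measure0[OF negN'] U(3,4) \<delta>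
    by (simp add: emeasure_eq_measure2 ennreal_less_iff)
   finally show ?thesis using that U Um by blast
  qed
  have "\<exists>d>0. \<forall>y. \<bar>y - x\<bar> < d --> norm (f y - f x - (y - x) *\<^sub>R g x) <= e1 * \<bar>y - x\<bar>"
   if x: "x \<in> {a..b} - N'" for x
  proof -
   have "(f has_derivative (%h. h *\<^sub>R g x)) (at x)" using der[of x] x unfolding N'_def has_vector_derivative_def by auto
   then show ?thesis using e1(1) unfolding has_derivative_at_alt by (auto simp: real_norm_def)
  qed
  then obtain D where D: "\<And>x. x \<in> {a..b} - N' ==> D x > 0"
   "\<And>x y. x \<in> {a..b} - N' ==> \<bar>y - x\<bar> < D x ==> norm (f y - f x - (y - x) *\<^sub>R g x) <= e1 * \<bar>y - x\<bar>"
   by metis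
  define \<gamma> where "\<gamma> = (%x. if x \<in> N' then U else if x \<in> {a..b} then ball x (D x) else UNIV)"
  have gg: "gauge \<gamma>" unfolding gauge_def \<gamma>_def using U D(1) by auto
  show "\<exists>\<gamma>. gauge \<gamma> & (\<forall>\<D>. \<D> tagged_division_of {a..b} & \<gamma> fine \<D> -->
       norm ((\<Sum>(x,k)\<in>\<D>. measure lborel k *\<^sub>R g' x) - (f b - f a)) < e)"
  proof (intro exI[of _ \<gamma>] conjI gg allI impI)
   fix \<D> assume "\<D> tagged_division_of {a..b} & \<gamma> fine \<D>"
   then have td: "\<D> tagged_division_of {a..b}" and fine: "\<gamma> fine \<D>" by auto
   have fin: "finite \<D>" using td by auto
   define D2 where "D2 = {t\<in>\<D>. fst t \<in> N'}"
   define D1 where "D1 = \<D> - D2"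
   have split: "\<D> = D1 \<union> D2" "D1 \<inter> D2 = {}" "finite D1" "finite D2" using fin unfolding D1_def D2_def by auto
   let ?h = "%(x,k). measure lborel k *\<^sub>R g' x - (f (Sup k) - f (Inf k))"
   have ints: "\<exists>u v. k = {u..v} & u <= x & x <= v & {u..v} \<subseteq> {a..b}" if "(x,k) \<in> \<D>" for x k
    using tagged_division_ofD(2,3,4)[OF td that] by fastforce
   have 1: "norm (\<Sum>t\<in>D1. ?h t) <= e1 * (b - a)"
   proof -
    have "norm (\<Sum>t\<in>D1. ?h t) <= (\<Sum>t\<in>D1. e1 * (case t of (x,k) => measure lborel k))"
    proof (rule sum_norm_le, clarify)
     fix x k assume xk: "(x,k) \<in> D1"
     then have xN: "x \<notin> N'" and xkD: "(x,k) \<in> \<D>" unfolding D1_def D2_def by auto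
     obtain u v where uv: "k = {u..v}" "u <= x" "x <= v" "{u..v} \<subseteq> {a..b}" using ints[OF xkD] by auto
     have xab: "x \<in> {a..b}" using uv by auto
     have "k \<subseteq> ball x (D x)" using fineD[OF fine xkD] xN xab unfolding \<gamma>_def by auto
     from subsetD[OF this, of u] subsetD[OF this, of v]
     have "u \<in> ball x (D x)" "v \<in> ball x (D x)" using uv by simp_all
     then have "\<bar>u - x\<bar> < D x" "\<bar>v - x\<bar> < D x" by (auto simp: dist_real_def)
     then have "norm (f u - f x - (u - x) *\<^sub>R g x) <= e1 * (x - u)"
      "norm (f v - f x - (v - x) *\<^sub>R g x) <= e1 * (v - x)" using D(2)[of x u] D(2)[of x v] xN xab uv by auto
     moreover have "measure lborel k *\<^sub>R g' x - (f (Sup k) - f (Inf k)) =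
       (f u - f x - (u - x) *\<^sub>R g x) - (f v - f x - (v - x) *\<^sub>R g x)"
      using uv xN unfolding g'_def by (simp add: algebra_simps)
     ultimately have "norm (measure lborel k *\<^sub>R g' x - (f (Sup k) - f (Inf k))) <= e1 * (x - u) + e1 * (v - x)"
      by (simp only:) (rule order_trans[OF norm_triangle_ineq4 add_mono])
     also have "... = e1 * measure lborel k" using uv by (simp add: algebra_simps)
     finally show "norm (measure lborel k *\<^sub>R g' x - (f (Sup k) - f (Inf k))) <= e1 * measure lborel k" .
    qed
    also have "... <= (\<Sum>t\<in>\<D>. e1 * (case t of (x,k) => measure lborel k))"
     by (rule sum_mono2) (use fin e1 in \<open>auto simp: D1_def\<close>)
    also have "... = e1 * (b - a)" using additive_content_tagged_division[of \<D> a b] td ab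
     by (simp add: sum_distrib_left[symmetric] case_prod_unfold)
    finally show ?thesis .
   qed
   have 2: "norm (\<Sum>t\<in>D2. ?h t) < e / 2"
   proof -
    have tp: "D2 tagged_partial_division_of {a..b}"
     by (rule tagged_partial_division_subset[of \<D>]) (use td in \<open>auto simp: D2_def tagged_division_of_def\<close>)
    have td2: "D2 tagged_division_of \<Union>(snd ` D2)" by (rule tagged_partial_division_of_Union_self[OF tp])
    have dv: "snd ` D2 division_of \<Union>(snd ` D2)" by (rule division_of_tagged_division[OF td2])
    have sub: "\<Union>(snd ` D2) \<subseteq> U" "\<Union>(snd ` D2) \<subseteq> {a..b}"
     using fineD[OF fine] tagged_division_ofD(3)[OF td] unfolding D2_def \<gamma>_def by fastforce+
    have "(\<Sum>k\<in>snd ` D2. Sup k - Inf k) < \<delta>" using content_sum_le_measure[OF dv sub(1) U(3)] U(4) by linarith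
    then have A: "(\<Sum>k\<in>snd ` D2. norm (f (Sup k) - f (Inf k))) < e / 2" by (rule acd[OF dv sub(2)])
    have "norm (\<Sum>t\<in>D2. ?h t) <= (\<Sum>(x,k)\<in>D2. norm (f (Sup k) - f (Inf k)))"
     by (rule sum_norm_le) (auto simp: D2_def g'_def norm_minus_commute)
    also have "... = (\<Sum>k\<in>snd ` D2. norm (f (Sup k) - f (Inf k)))"
    proof -
     have ne: "k ~= {}" if "(x,k) \<in> D2" for x k using tagged_division_ofD(2)[OF td2 that] by auto
     \<comment> \<open>The rewriting from tagged pairs to intervals asks for a summand that is 0 on
       every interval with empty interior, including the empty set, where \<open>Sup\<close> and
       \<open>Inf\<close> are unspecified; hence the case distinction.\<close>
     have "(\<Sum>(x,k)\<in>D2. norm (f (Sup k) - f (Inf k))) =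
       (\<Sum>(x,k)\<in>D2. if k = {} then 0 else norm (f (Sup k) - f (Inf k)))" by (intro sum.cong refl) (use ne in auto)
     also have "... = (\<Sum>k\<in>snd ` D2. if k = {} then 0 else norm (f (Sup k) - f (Inf k)))"
      by (rule sum.over_tagged_division_lemma[OF td2]) (auto simp: box_eq_empty not_less le_less)
     also have "... = (\<Sum>k\<in>snd ` D2. norm (f (Sup k) - f (Inf k)))" by (intro sum.cong refl) (use ne in auto)
     finally show ?thesis .
    qed
    finally show ?thesis using A by simp
   qed
   have "(\<Sum>(x,k)\<in>\<D>. measure lborel k *\<^sub>R g' x) - (f b - f a) = (\<Sum>t\<in>\<D>. ?h t)"
    using additive_tagged_division_1[OF ab td, of f] by (simp add: case_prod_unfold sum_subtractf)
   also have "... = (\<Sum>t\<in>D1. ?h t) + (\<Sum>t\<in>D2. ?h t)" using split sum.union_disjoint[of D1 D2 ?h] by simp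
   finally show "norm ((\<Sum>(x,k)\<in>\<D>. measure lborel k *\<^sub>R g' x) - (f b - f a)) < e"
    using 1 2 e1(2) norm_triangle_ineq[of "\<Sum>t\<in>D1. ?h t" "\<Sum>t\<in>D2. ?h t"] by simp
  qed
 qed
 then show ?thesis by (rule has_integral_spike[OF negN', rotated]) (auto simp: g'_def)
qed

text \<open>Truncation: the integral of \<open>min (norm g) n\<close> is at most \<open>n\<close>
  times the total length, while the rest of \<open>norm g\<close> has integral below
  \<open>e / 2\<close> for large \<open>n\<close> by dominated convergence.\<close>

lemma absolutely_continuous_indefinite_integral:
 fixes g :: "real => 'a::euclidean_space"
 assumes g: "g absolutely_integrable_on {a..b}"
  and F: "\<And>u v. a <= u ==> u <= v ==> v <= b ==> F v - F u = integral {u..v} g"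
 shows "absolutely_continuous_on a b F" unfolding absolutely_continuous_on_def
proof (intro allI impI)
 fix e :: real assume e: "e > 0"
 let ?h = "%n x. min (norm (g x)) (real n)"
 have ng: "(%x. norm (g x)) absolutely_integrable_on {a..b}" using absolutely_integrable_norm[OF g] by (simp add: o_def)
 have hi: "(?h n) absolutely_integrable_on {a..b}" for n using absolutely_integrable_min_1[OF ng, of "%x. real n"] by simp
 have "(%n. integral {a..b} (?h n)) \<longlonglongrightarrow> integral {a..b} (%x. norm (g x))"
 proof (rule dominated_convergence(2))
  show "?h n integrable_on {a..b}" for n using hi absolutely_integrable_on_def by blast
  show "(%x. norm (g x)) integrable_on {a..b}" using ng absolutely_integrable_on_def by blast
  show "(%n. ?h n x) \<longlonglongrightarrow> norm (g x)" for x
  proof (rule tendsto_eventually)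
   obtain N where "norm (g x) <= real N" using real_arch_simple by blast
   then show "\<forall>\<^sub>F n in sequentially. ?h n x = norm (g x)"
    by (intro eventually_sequentiallyI[of N]) (auto simp: min_def)
  qed
 qed auto
 then obtain n where n: "norm (integral {a..b} (?h n) - integral {a..b} (%x. norm (g x))) < e / 2"
  using LIMSEQ_D[of _ _ "e/2"] e by (meson half_gt_zero le_refl)
 let ?r = "%x. norm (g x) - ?h n x"
 have r: "?r absolutely_integrable_on {a..b}" using set_integral_diff(1)[OF ng hi[of n]] by simp
 have rint: "integral {a..b} ?r < e / 2"
 proof -
  have "integral {a..b} ?r = integral {a..b} (%x. norm (g x)) - integral {a..b} (?h n)"
   using ng hi[of n] by (intro integral_diff) (auto simp: absolutely_integrable_on_def)
  then show ?thesis using n by (auto simp: real_norm_def abs_if split: if_splits)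
 qed
 \<comment> \<open>\<open>n + 1\<close> in place of \<open>n\<close> covers the case
   \<open>n = 0\<close>.\<close>
 define \<delta> where "\<delta> = e / (2 * (real n + 1))"
 have \<delta>: "\<delta> > 0" "real n * \<delta> <= e / 2" unfolding \<delta>_def using e by (auto simp: field_simps)
 show "\<exists>\<delta>>0. \<forall>d. d division_of \<Union>d --> \<Union>d \<subseteq> {a..b} --> (\<Sum>k\<in>d. Sup k - Inf k) < \<delta> -->
      (\<Sum>k\<in>d. norm (F (Sup k) - F (Inf k))) < e"
 proof (intro exI[of _ \<delta>] conjI \<delta>(1) allI impI)
  fix d assume d: "d division_of \<Union>d" and sub: "\<Union>d \<subseteq> {a..b}" and len: "(\<Sum>k\<in>d. Sup k - Inf k) < \<delta>"
  have int: "\<exists>u v. k = {u..v} & u <= v & a <= u & v <= b" if "k \<in> d" for k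
  proof -
   have "k ~= {}" "\<exists>u v. k = cbox u v" using division_ofD(3)[OF d that] division_ofD(4)[OF d that] by auto
   then obtain u v where uv: "k = {u..v}" "u <= v" by (metis atLeastatMost_empty_iff2 box_real(2))
   then have "u \<in> k" "v \<in> k" by auto
   then have "u \<in> {a..b}" "v \<in> {a..b}" using sub that by auto
   then show ?thesis using uv by auto
  qed
  have k1: "norm (F (Sup k) - F (Inf k)) <= integral k ?r + real n * (Sup k - Inf k)" if k: "k \<in> d" for k
  proof -
   obtain u v where uv: "k = {u..v}" "u <= v" "a <= u" "v <= b" using int[OF k] by blast
   have s: "{u..v} \<subseteq> {a..b}" using uv by auto
   have gi: "g absolutely_integrable_on {u..v}" by (rule absolutely_integrable_on_subinterval[OF g s])
   have ngi: "(%x. norm (g x)) integrable_on {u..v}" using gi absolutely_integrable_on_def by blast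
   have ri: "?r integrable_on {u..v}" using absolutely_integrable_on_subinterval[OF r s] absolutely_integrable_on_def by blast
   have "norm (F (Sup k) - F (Inf k)) = norm (integral {u..v} g)" using F uv by simp
   also have "... <= integral {u..v} (%x. norm (g x))"
    by (rule integral_norm_bound_integral) (use gi ngi in \<open>auto simp: absolutely_integrable_on_def\<close>)
   also have "... <= integral {u..v} (%x. ?r x + real n)"
    by (rule integral_le) (use ngi ri in \<open>auto intro!: integrable_add integrable_const_ivl\<close>)
   also have "... = integral {u..v} ?r + integral {u..v} (%x. real n)"
    by (rule integral_add) (use ri in \<open>auto intro: integrable_const_ivl\<close>)
   finally show ?thesis using uv by (simp add: mult.commute)
  qed
  have rk: "?r integrable_on k" if "k \<in> d" for k
   using int[OF that] absolutely_integrable_on_subinterval[OF r] absolutely_integrable_on_def by force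
  have "(\<Sum>k\<in>d. norm (F (Sup k) - F (Inf k))) <= (\<Sum>k\<in>d. integral k ?r + real n * (Sup k - Inf k))"
   by (rule sum_mono[OF k1])
  also have "... = integral (\<Union>d) ?r + real n * (\<Sum>k\<in>d. Sup k - Inf k)"
   using integral_combine_division_bottomup[OF d rk] by (simp add: sum.distrib sum_distrib_left)
  also have "integral (\<Union>d) ?r <= integral {a..b} ?r" by (rule integral_subset_le[OF sub])
    (use r rk d in \<open>auto simp: absolutely_integrable_on_def intro: integrable_combine_division\<close>)
  also have "real n * (\<Sum>k\<in>d. Sup k - Inf k) <= real n * \<delta>" using len by (intro mult_left_mono) auto
  finally show "(\<Sum>k\<in>d. norm (F (Sup k) - F (Inf k))) < e" using rint \<delta> by linarith
 qed
qed

text \<open>At a point of \<open>Bad k\<close> the increment of the integral misses the linear one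
  by more than \<open>1 / (k + 1)\<close> times the length, at arbitrarily small scales. Vitali's
  theorem selects disjoint intervals of this kind that cover almost all of \<open>Bad k\<close>;
  Henstock's lemma bounds their total error, hence their total length, by an arbitrarily small
  \<open>e\<close>.\<close>

lemma indefinite_integral_has_derivative_ae:
 fixes g :: "real => 'a::euclidean_space"
 assumes g: "g integrable_on {a..b}"
 obtains N where "negligible N" "\<And>x. x \<in> {a<..<b} - N ==> ((%x. integral {a..x} g) has_vector_derivative g x) (at x)"
proof -
 define F where "F = (%x. integral {a..x} g)"
 define P where "P = (%k x y. y \<in> {a<..<b} & y ~= x \<and>
    norm (F y - F x - (y - x) *\<^sub>R g x) > \<bar>y - x\<bar> / (real k + 1))"
 define Bad where "Bad = (%k. {x\<in>{a<..<b}. \<forall>d>0. \<exists>y. P k x y & \<bar>y - x\<bar> < d})"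
 have Fdiff: "F v - F u = integral {u..v} g" if "a <= u" "u <= v" "v <= b" for u v
  using Henstock_Kurzweil_Integration.integral_combine[of a u v g] that integrable_subinterval_real[OF g, of a v]
  unfolding F_def by (auto simp: algebra_simps)
 have neg: "negligible (Bad k)" for k unfolding negligible_outer_le
 proof (intro allI impI)
  fix e :: real assume e: "e > 0"
  define e' where "e' = e / (real k + 1)"
  have "e' > 0" unfolding e'_def using e by simp
  then obtain \<gamma> where \<gamma>: "gauge \<gamma>"
   and hen: "\<And>p. p tagged_partial_division_of (cbox a b) ==> \<gamma> fine p ==>
       (\<Sum>(x,k)\<in>p. norm (measure lborel k *\<^sub>R g x - integral k g)) < e'"
   using Henstock_lemma[of g a b e'] g by (auto simp: box_real)
  \<comment> \<open>Pairs of a bad point and a witness whose interval fits the gauge.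
    \<open>c\<close>, \<open>r\<close> and \<open>I\<close> present that interval as a closed ball,
    the form in which the covering theorem is stated.\<close>
  define K where "K = {(x,y). x \<in> Bad k & P k x y & {min x y..max x y} \<subseteq> \<gamma> x}"
  define c where "c = (%(x::real,y::real). (x + y) / 2)"
  define r where "r = (%(x::real,y::real). \<bar>y - x\<bar> / 2)"
  define I where "I = (%(x::real,y::real). {min x y..max x y})"
  have cball: "cball (c i) (r i) = I i" for i unfolding c_def r_def I_def
   by (cases i) (auto simp: cball_eq_atLeastAtMost min_def max_def abs_if field_simps)
  have "\<And>x d. x \<in> Bad k ==> 0 < d ==> \<exists>i. i \<in> K & x \<in> cball (c i) (r i) & r i < d"
  proof -
   fix x d :: real assume x: "x \<in> Bad k" and d: "0 < d"
   have "open (\<gamma> x)" "x \<in> \<gamma> x" using \<gamma> unfolding gauge_def by auto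
   then obtain d0 where d0: "d0 > 0" "ball x d0 \<subseteq> \<gamma> x" by (meson openE)
   have "min d d0 > 0" using d d0 by simp
   then obtain y where y: "P k x y" "\<bar>y - x\<bar> < min d d0" using x unfolding Bad_def by blast
   have "{min x y..max x y} \<subseteq> ball x d0" using y(2) by (auto simp: dist_real_def)
   then have "(x,y) \<in> K" unfolding K_def using x y(1) d0(2) by auto
   moreover have "x \<in> cball (c (x,y)) (r (x,y))" unfolding cball I_def by auto
   moreover have "r (x,y) < d" unfolding r_def using y(2) by auto
   ultimately show "\<exists>i. i \<in> K & x \<in> cball (c i) (r i) & r i < d" by blast
  qed
  moreover have "\<And>i. i \<in> K ==> 0 < r i" unfolding K_def r_def P_def by auto
  ultimately obtain C where C: "countable C" "C \<subseteq> K"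
   "pairwise (%i j. disjnt (I i) (I j)) C" "negligible (Bad k - (\<Union>i\<in>C. I i))"
   using Vitali_covering_theorem_cballs[of K r "Bad k" c] unfolding cball by metis
  have Ilm: "I i \<in> lmeasurable" for i unfolding cball[symmetric] by simp
  have bound: "measure lebesgue (\<Union>i\<in>F'. I i) <= e" if F': "F' \<subseteq> C" "finite F'" for F'
  proof -
   \<comment> \<open>Disjointness turns the chosen intervals into a tagged partial division, each
     tagged by its bad endpoint, so that the Henstock bound applies.\<close>
   define p where "p = (%i. (fst i, I i)) ` F'"
   have nonempty: "I i ~= {}" for i unfolding I_def by (cases i) auto
   have inj: "inj_on (%i. (fst i, I i)) F'"
   proof (rule inj_onI)
    fix i j assume ij: "i \<in> F'" "j \<in> F'" "(fst i, I i) = (fst j, I j)"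
    show "i = j"
    proof (rule ccontr)
     assume "i ~= j"
     then have "disjnt (I i) (I j)" using C(3) F' ij unfolding pairwise_def by blast
     then show False using ij nonempty unfolding disjnt_def by auto
    qed
   qed
   have sub: "x \<in> {a<..<b}" "y \<in> {a<..<b}" "P k x y" "I (x,y) \<subseteq> \<gamma> x" if "(x,y) \<in> F'" for x y
    using that F' C(2) unfolding K_def Bad_def P_def I_def by auto
   have "p tagged_partial_division_of (cbox a b)" unfolding tagged_partial_division_of_def
   proof (intro conjI allI impI)
    show "finite p" unfolding p_def using F' by auto
    fix x L assume "(x,L) \<in> p"
    then obtain y where y: "(x,y) \<in> F'" "L = I (x,y)" unfolding p_def by auto
    show "x \<in> L" using y unfolding I_def by auto
    show "L \<subseteq> cbox a b" using y sub[OF y(1)] unfolding I_def by auto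
    show "\<exists>a b. L = cbox a b" using y unfolding I_def by (auto simp: box_real)
   next
    fix x1 K1 x2 K2 assume "(x1,K1) \<in> p & (x2,K2) \<in> p & (x1,K1) ~= (x2,K2)"
    then obtain i j where "i \<in> F'" "j \<in> F'" "K1 = I i" "K2 = I j" "i ~= j" unfolding p_def by auto
    then have "disjnt K1 K2" using C(3) F' unfolding pairwise_def by blast
    then show "interior K1 \<inter> interior K2 = {}" unfolding disjnt_def using interior_subset by blast
   qed
   moreover have "\<gamma> fine p"
   proof (rule fineI)
    fix x L assume "(x,L) \<in> p"
    then obtain y where "(x,y) \<in> F'" "L = I (x,y)" unfolding p_def by auto
    then show "L \<subseteq> \<gamma> x" using sub(4) by simp
   qed
   ultimately have "(\<Sum>(x,k)\<in>p. norm (measure lborel k *\<^sub>R g x - integral k g)) < e'" by (rule hen)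
   also have "(\<Sum>(x,k)\<in>p. norm (measure lborel k *\<^sub>R g x - integral k g)) =
     (\<Sum>i\<in>F'. norm (measure lborel (I i) *\<^sub>R g (fst i) - integral (I i) g))"
    unfolding p_def by (subst sum.reindex[OF inj]) (simp add: o_def)
   finally have 1: "(\<Sum>i\<in>F'. norm (measure lborel (I i) *\<^sub>R g (fst i) - integral (I i) g)) < e'" .
   have 2: "measure lborel (I i) / (real k + 1) <= norm (measure lborel (I i) *\<^sub>R g (fst i) - integral (I i) g)"
    if i: "i \<in> F'" for i
   proof -
    obtain x y where xy: "i = (x,y)" by (cases i)
    note s = sub[OF i[unfolded xy]]
    have P: "norm (F y - F x - (y - x) *\<^sub>R g x) > \<bar>y - x\<bar> / (real k + 1)" using s(3) unfolding P_def by auto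
    show ?thesis
    proof (cases "x <= y")
     case True
     have "F y - F x = integral {x..y} g" using Fdiff[of x y] s True by auto
     then show ?thesis using P True unfolding xy I_def by (simp add: norm_minus_commute min_def max_def)
    next
     case False
     have "F x - F y = integral {y..x} g" using Fdiff[of y x] s False by auto
     then have "measure lborel (I i) *\<^sub>R g (fst i) - integral (I i) g = F y - F x - (y - x) *\<^sub>R g x"
      using False unfolding xy I_def by (simp add: algebra_simps min_def max_def)
     then show ?thesis using P False unfolding xy I_def by (simp add: min_def max_def)
    qed
   qed
   have "measure lebesgue (\<Union>i\<in>F'. I i) <= (\<Sum>i\<in>F'. measure lebesgue (I i))"
    by (rule measure_UNION_le) (use F' Ilm in \<open>auto simp: fmeasurableD\<close>)
   also have "... = (\<Sum>i\<in>F'. measure lborel (I i))" by (intro sum.cong refl) (auto simp: I_def measure_completion)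
   also have "... = (real k + 1) * (\<Sum>i\<in>F'. measure lborel (I i) / (real k + 1))"
    by (simp add: sum_divide_distrib[symmetric])
   also have "... <= (real k + 1) * e'" by (intro mult_left_mono less_imp_le[OF le_less_trans[OF sum_mono[OF 2] 1]]) auto
   also have "... = e" unfolding e'_def by simp
   finally show ?thesis .
  qed
  have CU: "(\<Union>i\<in>C. I i) \<in> lmeasurable" "measure lebesgue (\<Union>i\<in>C. I i) <= e"
   by (rule fmeasurable_UN_bound measure_UN_bound; use C Ilm bound in blast)+
  let ?R = "Bad k - (\<Union>i\<in>C. I i)"
  show "\<exists>T. Bad k \<subseteq> T & T \<in> lmeasurable & measure lebesgue T <= e"
  proof (intro exI[of _ "(\<Union>i\<in>C. I i) \<union> ?R"] conjI)
   show "Bad k \<subseteq> (\<Union>i\<in>C. I i) \<union> ?R" by auto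
   have R: "?R \<in> lmeasurable" "measure lebesgue ?R = 0" using C(4) negligible_imp_measurable negligible_imp_measure0 by auto
   show "(\<Union>i\<in>C. I i) \<union> ?R \<in> lmeasurable" by (rule fmeasurable.Un[OF CU(1) R(1)])
   show "measure lebesgue ((\<Union>i\<in>C. I i) \<union> ?R) <= e"
    using measure_Un_le[of "\<Union>i\<in>C. I i" lebesgue ?R] CU R by (auto simp: fmeasurableD)
  qed
 qed
 show thesis
 proof (rule that[of "\<Union>k. Bad k"])
  show "negligible (\<Union>k. Bad k)" using neg by (intro negligible_Union_nat) auto
  fix x assume x: "x \<in> {a<..<b} - (\<Union>k. Bad k)"
  have "(F has_derivative (%h. h *\<^sub>R g x)) (at x within {a<..<b})" unfolding has_derivative_within_alt
  proof (intro conjI allI impI)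
   show "bounded_linear (%h. h *\<^sub>R g x)" by (rule bounded_linear_scaleR_left)
   fix e :: real assume e: "e > 0"
   then obtain k where k: "1 / (real k + 1) < e" using reals_Archimedean[OF e] by (auto simp: inverse_eq_divide add.commute)
   have "x \<notin> Bad k" using x by auto
   then have "\<not> (\<forall>d>0. \<exists>y. P k x y & \<bar>y - x\<bar> < d)" using x unfolding Bad_def by simp
   then obtain d where d: "d > 0" "\<And>y. \<bar>y - x\<bar> < d ==> \<not> P k x y" by auto
   show "\<exists>d>0. \<forall>y\<in>{a<..<b}. norm (y - x) < d --> norm (F y - F x - (y - x) *\<^sub>R g x) <= e * norm (y - x)"
   proof (intro exI[of _ d] conjI d(1) ballI impI)
    fix y assume y: "y \<in> {a<..<b}" "norm (y - x) < d"
    then have "norm (F y - F x - (y - x) *\<^sub>R g x) <= \<bar>y - x\<bar> / (real k + 1)"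
     using d(2)[of y] unfolding P_def by fastforce
    also have "... = 1 / (real k + 1) * \<bar>y - x\<bar>" by simp
    also have "... <= e * \<bar>y - x\<bar>" using k by (intro mult_right_mono) auto
    finally show "norm (F y - F x - (y - x) *\<^sub>R g x) <= e * norm (y - x)" by simp
   qed
  qed
  then show "((%x. integral {a..x} g) has_vector_derivative g x) (at x)"
   using x at_within_open[of x "{a<..<b}"] unfolding has_vector_derivative_def F_def by auto
 qed
qed

section \<open>Lebesgue primitives and their calculus\<close>

lemma AE_lebesgue_on_negligible:
 assumes "S \<in> sets lebesgue"
 shows "(AE x in lebesgue_on S. P x) \<longleftrightarrow> (\<exists>N. negligible N & (\<forall>x\<in>S - N. P x))"
proof -
 have "(AE x in lebesgue_on S. P x) \<longleftrightarrow> (AE x in lebesgue. x \<in> S --> P x)"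
  by (rule AE_restrict_space_iff) (use assms in auto)
 also have "... \<longleftrightarrow> (\<exists>N. negligible N & {x. \<not> (x \<in> S --> P x)} \<subseteq> N)"
  by (rule eventually_ae_filter_negligible)
 also have "... \<longleftrightarrow> (\<exists>N. negligible N & (\<forall>x\<in>S - N. P x))" by (intro ex_cong) auto
 finally show ?thesis .
qed

text \<open>The Lebesgue form of \<open>f' = g\<close>. Carrying the density \<open>g\<close> along
  turns the differential system and its algebra into statements about integrals, without choosing
  derivatives at single points.\<close>

definition primitive_on :: "real => real => (real => 'a::euclidean_space) => (real => 'a) => bool" where
 "primitive_on a b f g \<longleftrightarrow> g absolutely_integrable_on {a..b} & (\<forall>x\<in>{a..b}. f x = f a + integral {a..x} g)"

lemma primitive_on_integrable:
 assumes "primitive_on a b f g"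
 shows "g absolutely_integrable_on {a..b}" "g integrable_on {a..b}" "a <= c ==> d <= b ==> g integrable_on {c..d}"
proof -
 show 1: "g absolutely_integrable_on {a..b}" using assms by (simp add: primitive_on_def)
 show 2: "g integrable_on {a..b}" by (rule absolutely_integrable_on_def[THEN iffD1, THEN conjunct1, OF 1])
 show "a <= c ==> d <= b ==> g integrable_on {c..d}" by (rule integrable_subinterval_real[OF 2]) auto
qed

lemma primitive_onD:
 assumes "primitive_on a b f g" "a <= x" "x <= b"
 shows "f x = f a + integral {a..x} g"
proof -
 have "\<forall>x\<in>{a..b}. f x = f a + integral {a..x} g" using assms(1) unfolding primitive_on_def by (rule conjunct2)
 then show ?thesis by (rule bspec) (use assms(2,3) in simp)
qed

lemma primitive_on_diff:
 assumes f: "primitive_on a b f g" and uv: "a <= u" "u <= v" "v <= b"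
 shows "f v - f u = integral {u..v} g"
proof -
 have comb: "integral {a..u} g + integral {u..v} g = integral {a..v} g"
  by (rule Henstock_Kurzweil_Integration.integral_combine) (use uv primitive_on_integrable(3)[OF f] in auto)
 have "f v = f a + integral {a..v} g" "f u = f a + integral {a..u} g" by (rule primitive_onD[OF f]; use uv in linarith)+
 then have "f v - f u = integral {a..v} g - integral {a..u} g" by (simp only: add_diff_cancel_left)
 also have "... = integral {u..v} g" using comb[symmetric] by simp
 finally show ?thesis .
qed

lemma primitive_on_absolutely_continuous:
 assumes "primitive_on a b f g"
 shows "absolutely_continuous_on a b f"
 by (rule absolutely_continuous_indefinite_integral[OF primitive_on_integrable(1)[OF assms] primitive_on_diff[OF assms]])

lemma primitive_on_continuous:
 assumes "primitive_on a b f g"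
 shows "continuous_on {a..b} f"
proof -
 have "continuous_on {a..b} (%x. f a + integral {a..x} g)" by (intro continuous_intros indefinite_integral_continuous_1)
    (rule primitive_on_integrable[OF assms])
 then show ?thesis by (rule continuous_on_eq) (rule primitive_onD[OF assms, symmetric]; simp)
qed

lemma primitive_on_derivative_ae:
 assumes "primitive_on a b f g"
 obtains N where "negligible N" "\<And>x. x \<in> {a<..<b} - N ==> (f has_vector_derivative g x) (at x)"
proof -
 from indefinite_integral_has_derivative_ae[OF primitive_on_integrable(2)[OF assms]] obtain N where N: "negligible N"
  "\<And>x. x \<in> {a<..<b} - N ==> ((%x. integral {a..x} g) has_vector_derivative g x) (at x)" by blast
 show thesis
 proof (rule that[OF N(1)])
  fix x assume x: "x \<in> {a<..<b} - N"
  have "((%x. f a + integral {a..x} g) has_vector_derivative g x) (at x)"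
   using has_vector_derivative_add[OF has_vector_derivative_const N(2)[OF x]] by simp
  then show "(f has_vector_derivative g x) (at x)" by (rule has_vector_derivative_transform_within_open[where S="{a<..<b}"])
    (use x in \<open>auto intro!: primitive_onD[OF assms, symmetric]\<close>)
 qed
qed

lemma absolutely_continuous_on_subset:
 assumes f: "absolutely_continuous_on a b f" and cd: "a <= c" "d <= b"
 shows "absolutely_continuous_on c d f" unfolding absolutely_continuous_on_def
proof (intro allI impI)
 fix e :: real assume "e > 0"
 then obtain \<delta> where \<delta>: "\<delta> > 0" "\<And>D. D division_of \<Union>D ==> \<Union>D \<subseteq> {a..b} ==>
   (\<Sum>k\<in>D. Sup k - Inf k) < \<delta> ==> (\<Sum>k\<in>D. norm (f (Sup k) - f (Inf k))) < e"
  using f unfolding absolutely_continuous_on_def by meson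
 have "{c..d} \<subseteq> {a..b}" using cd by auto
 then show "\<exists>\<delta>>0. \<forall>D. D division_of \<Union>D --> \<Union>D \<subseteq> {c..d} --> (\<Sum>k\<in>D. Sup k - Inf k) < \<delta> -->
   (\<Sum>k\<in>D. norm (f (Sup k) - f (Inf k))) < e"
  by (intro exI[of _ \<delta>] conjI allI impI \<delta>(1) \<delta>(2)) blast+
qed

text \<open>Converts a derivative known almost everywhere into an integral equation, by the
  fundamental theorem on each \<open>{a..x}\<close>; absolute continuity is what excludes functions
  of Cantor type.\<close>

lemma primitive_onI:
 fixes f :: "real => 'a::euclidean_space"
 assumes ac: "absolutely_continuous_on a b f" and N: "negligible N"
  and der: "\<And>x. x \<in> {a<..<b} - N ==> (f has_vector_derivative g x) (at x)"
  and g: "g absolutely_integrable_on {a..b}"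
 shows "primitive_on a b f g" unfolding primitive_on_def
proof (intro conjI g ballI)
 fix x assume x: "x \<in> {a..b}"
 have "(g has_integral f x - f a) {a..x}"
  by (rule has_integral_derivative_absolutely_continuous[OF _ absolutely_continuous_on_subset[OF ac] N]) (use x der in auto)
 then show "f x = f a + integral {a..x} g" by (simp add: integral_unique)
qed

lemma abs_integrable_bilinear_left:
 fixes h :: "'a::euclidean_space => 'b::euclidean_space => 'c::euclidean_space"
 assumes h: "bounded_bilinear h" and f: "continuous_on {a..b::real} f" and g: "g absolutely_integrable_on {a..b}"
 shows "(%x. h (f x) (g x)) absolutely_integrable_on {a..b}"
proof (rule absolutely_integrable_bounded_measurable_product[where h=h and f=f and g=g])
 show "bilinear h" using h bilinear_conv_bounded_bilinear by blast
 show "f \<in> borel_measurable (lebesgue_on {a..b})" by (rule continuous_imp_measurable_on_sets_lebesgue[OF f]) auto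
 show "bounded (f ` {a..b})" by (intro compact_imp_bounded compact_continuous_image f) auto
qed (use g in auto)

lemma abs_integrable_bilinear_right:
 fixes h :: "'a::euclidean_space => 'b::euclidean_space => 'c::euclidean_space"
 assumes h: "bounded_bilinear h" and g: "continuous_on {a..b::real} g" and f: "f absolutely_integrable_on {a..b}"
 shows "(%x. h (f x) (g x)) absolutely_integrable_on {a..b}"
 by (rule abs_integrable_bilinear_left[OF bounded_bilinear.flip[OF h] g f])

lemma absolutely_continuous_on_bilinear:
 fixes h :: "'a::euclidean_space => 'b::euclidean_space => 'c::euclidean_space"
 assumes h: "bounded_bilinear h" and f: "absolutely_continuous_on a b f" "continuous_on {a..b} f"
  and g: "absolutely_continuous_on a b g" "continuous_on {a..b} g"
 shows "absolutely_continuous_on a b (%x. h (f x) (g x))"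
proof -
 obtain B where B: "B > 0" "\<And>x y. norm (h x y) <= norm x * norm y * B" using bounded_bilinear.pos_bounded[OF h] by blast
 obtain C where C: "C > 0" "\<And>x. x \<in> {a..b} ==> norm (f x) <= C"
  using compact_imp_bounded[OF compact_continuous_image[OF f(2)]] by (auto simp: bounded_pos)
 obtain D where D: "D > 0" "\<And>x. x \<in> {a..b} ==> norm (g x) <= D"
  using compact_imp_bounded[OF compact_continuous_image[OF g(2)]] by (auto simp: bounded_pos)
 show ?thesis unfolding absolutely_continuous_on_def
 proof (intro allI impI)
  fix e :: real assume e: "e > 0"
  define e1 where "e1 = e / (2 * B * D)"
  define e2 where "e2 = e / (2 * B * C)"
  have e12: "e1 > 0" "e2 > 0" unfolding e1_def e2_def using e B C D by auto
  obtain d1 where d1: "d1 > 0" "\<And>d. d division_of \<Union>d ==> \<Union>d \<subseteq> {a..b} ==> (\<Sum>k\<in>d. Sup k - Inf k) < d1 ==>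
    (\<Sum>k\<in>d. norm (f (Sup k) - f (Inf k))) < e1" using f(1) e12 unfolding absolutely_continuous_on_def by meson
  obtain d2 where d2: "d2 > 0" "\<And>d. d division_of \<Union>d ==> \<Union>d \<subseteq> {a..b} ==> (\<Sum>k\<in>d. Sup k - Inf k) < d2 ==>
    (\<Sum>k\<in>d. norm (g (Sup k) - g (Inf k))) < e2" using g(1) e12 unfolding absolutely_continuous_on_def by meson
  show "\<exists>\<delta>>0. \<forall>d. d division_of \<Union>d --> \<Union>d \<subseteq> {a..b} --> (\<Sum>k\<in>d. Sup k - Inf k) < \<delta> -->
      (\<Sum>k\<in>d. norm (h (f (Sup k)) (g (Sup k)) - h (f (Inf k)) (g (Inf k)))) < e"
  proof (intro exI[of _ "min d1 d2"] conjI allI impI)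
   show "min d1 d2 > 0" using d1 d2 by auto
   fix d assume d: "d division_of \<Union>d" "\<Union>d \<subseteq> {a..b}" "(\<Sum>k\<in>d. Sup k - Inf k) < min d1 d2"
   have 1: "norm (h (f (Sup k)) (g (Sup k)) - h (f (Inf k)) (g (Inf k))) \<le>
     B * D * norm (f (Sup k) - f (Inf k)) + B * C * norm (g (Sup k) - g (Inf k))" if k: "k \<in> d" for k
   proof -
    have "k ~= {}" "\<exists>u v. k = cbox u v" using division_ofD(3)[OF d(1) k] division_ofD(4)[OF d(1) k] by auto
    then obtain u v where uv: "k = {u..v}" "u <= v" by (metis atLeastatMost_empty_iff2 box_real(2))
    then have "u \<in> k" "v \<in> k" by auto
    then have uab: "u \<in> {a..b}" "v \<in> {a..b}" using d(2) k by auto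
    have eq: "h (f v) (g v) - h (f u) (g u) = h (f v - f u) (g v) + h (f u) (g v - g u)"
     by (simp add: bounded_bilinear.diff_left[OF h] bounded_bilinear.diff_right[OF h])
    have "norm (h (f v) (g v) - h (f u) (g u)) <= norm (f v - f u) * norm (g v) * B + norm (f u) * norm (g v - g u) * B"
     unfolding eq by (rule norm_triangle_le[OF add_mono[OF B(2) B(2)]])
    also have "... <= norm (f v - f u) * D * B + C * norm (g v - g u) * B"
     by (intro add_mono mult_right_mono mult_left_mono D C uab) (use B in auto)
    finally show ?thesis using uv by (simp add: mult_ac)
   qed
   have "(\<Sum>k\<in>d. norm (h (f (Sup k)) (g (Sup k)) - h (f (Inf k)) (g (Inf k)))) \<le>
     (\<Sum>k\<in>d. B * D * norm (f (Sup k) - f (Inf k)) + B * C * norm (g (Sup k) - g (Inf k)))" by (rule sum_mono[OF 1])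
   also have "... = B * D * (\<Sum>k\<in>d. norm (f (Sup k) - f (Inf k))) + B * C * (\<Sum>k\<in>d. norm (g (Sup k) - g (Inf k)))"
    by (simp add: sum.distrib sum_distrib_left)
   also have "... < B * D * e1 + B * C * e2"
    by (intro add_strict_mono mult_strict_left_mono d1(2) d2(2)) (use d B C D in auto)
   also have "... = e" unfolding e1_def e2_def using B C D by (simp add: field_simps)
   finally show "(\<Sum>k\<in>d. norm (h (f (Sup k)) (g (Sup k)) - h (f (Inf k)) (g (Inf k)))) < e" .
  qed
 qed
qed

text \<open>The product is absolutely continuous and the pointwise product rule holds off a null
  set, so it can be integrated. This is the integration by parts behind Lagrange's identity.\<close>

lemma primitive_on_bilinear:
 fixes h :: "'a::euclidean_space => 'b::euclidean_space => 'c::euclidean_space"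
 assumes h: "bounded_bilinear h" and f: "primitive_on a b f f'" and g: "primitive_on a b g g'"
 shows "primitive_on a b (%x. h (f x) (g x)) (%x. h (f x) (g' x) + h (f' x) (g x))"
proof -
 note c = primitive_on_continuous[OF f] primitive_on_continuous[OF g]
 obtain M where M: "negligible M" "\<And>x. x \<in> {a<..<b} - M ==> (f has_vector_derivative f' x) (at x)"
  using primitive_on_derivative_ae[OF f] by blast
 obtain N where N: "negligible N" "\<And>x. x \<in> {a<..<b} - N ==> (g has_vector_derivative g' x) (at x)"
  using primitive_on_derivative_ae[OF g] by blast
 show ?thesis
 proof (rule primitive_onI[where N="M \<union> N"])
  show "absolutely_continuous_on a b (%x. h (f x) (g x))"
   by (rule absolutely_continuous_on_bilinear[OF h primitive_on_absolutely_continuous[OF f] c(1)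
      primitive_on_absolutely_continuous[OF g] c(2)])
  show "negligible (M \<union> N)" using M N by auto
  show "((%x. h (f x) (g x)) has_vector_derivative h (f x) (g' x) + h (f' x) (g x)) (at x)"
   if "x \<in> {a<..<b} - (M \<union> N)" for x
   by (rule bounded_bilinear.has_vector_derivative[OF h M(2) N(2)]) (use that in auto)
  show "(%x. h (f x) (g' x) + h (f' x) (g x)) absolutely_integrable_on {a..b}"
   by (rule set_integral_add(1)[OF abs_integrable_bilinear_left[OF h c(1) primitive_on_integrable(1)[OF g]]
    abs_integrable_bilinear_right[OF h c(2) primitive_on_integrable(1)[OF f]]])
 qed
qed

lemma primitive_on_C1:
 fixes f :: "real => 'a::euclidean_space"
 assumes "a <= b" "\<And>x. x \<in> {a..b} ==> (f has_vector_derivative g x) (at x)" "continuous_on {a..b} g"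
 shows "primitive_on a b f g" unfolding primitive_on_def
proof (intro conjI ballI)
 show "g absolutely_integrable_on {a..b}" using absolutely_integrable_continuous_real[OF assms(3)] .
 fix x assume x: "x \<in> {a..b}"
 have "(g has_integral f x - f a) {a..x}"
 proof (rule fundamental_theorem_of_calculus)
  show "(f has_vector_derivative g y) (at y within {a..x})" if "y \<in> {a..x}" for y
   by (rule has_vector_derivative_at_within[OF assms(2)]) (use x that in auto)
 qed (use x in auto)
 then show "f x = f a + integral {a..x} g" by (simp add: integral_unique)
qed

lemma primitive_on_add:
 assumes f: "primitive_on a b f f'" and g: "primitive_on a b g g'"
 shows "primitive_on a b (%x. f x + g x) (%x. f' x + g' x)" unfolding primitive_on_def
proof (intro conjI ballI)
 show "(%x. f' x + g' x) absolutely_integrable_on {a..b}"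
  using set_integral_add(1)[OF primitive_on_integrable(1)[OF f] primitive_on_integrable(1)[OF g]] .
 fix x assume x: "x \<in> {a..b}"
 have "f x = f a + integral {a..x} f'" "g x = g a + integral {a..x} g'"
  by (rule primitive_onD[OF f] primitive_onD[OF g]; use x in simp)+
 moreover have "integral {a..x} (%x. f' x + g' x) = integral {a..x} f' + integral {a..x} g'"
  by (rule integral_add) (use x primitive_on_integrable(3)[OF f] primitive_on_integrable(3)[OF g] in auto)
 ultimately show "f x + g x = f a + g a + integral {a..x} (%x. f' x + g' x)" by (simp only: add_ac)
qed

lemma primitive_on_linear:
 assumes h: "bounded_linear h" and f: "primitive_on a b f f'"
 shows "primitive_on a b (%x. h (f x)) (%x. h (f' x))" unfolding primitive_on_def
proof (intro conjI ballI)
 show "(%x. h (f' x)) absolutely_integrable_on {a..b}"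
  using absolutely_integrable_linear[OF primitive_on_integrable(1)[OF f] h] by (simp add: o_def)
 fix x assume x: "x \<in> {a..b}"
 have i: "f' integrable_on {a..x}" using x primitive_on_integrable(3)[OF f] by auto
 have "h (f x) = h (f a + integral {a..x} f')" by (rule arg_cong[where f=h]) (rule primitive_onD[OF f]; use x in simp)
 also have "... = h (f a) + integral {a..x} (%x. h (f' x))"
  using integral_linear[OF i h] by (simp add: o_def linear_add[OF bounded_linear.linear[OF h]])
 finally show "h (f x) = h (f a) + integral {a..x} (%x. h (f' x))" .
qed

lemma primitive_on_cong:
 assumes f: "primitive_on a b f f'" and eq: "\<And>x. x \<in> {a..b} ==> f x = g x" "\<And>x. x \<in> {a..b} ==> f' x = g' x"
 shows "primitive_on a b g g'" unfolding primitive_on_def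
proof (intro conjI ballI)
 show "g' absolutely_integrable_on {a..b}"
  by (rule absolutely_integrable_spike[OF primitive_on_integrable(1)[OF f] negligible_empty]) (use eq in auto)
 fix x assume x: "x \<in> {a..b}"
 have "integral {a..x} f' = integral {a..x} g'" by (rule integral_cong) (use x eq in auto)
 moreover have "f x = f a + integral {a..x} f'" by (rule primitive_onD[OF f]; use x in simp)
 moreover have "f x = g x" "f a = g a" using x eq by auto
 ultimately show "g x = g a + integral {a..x} g'" by argo
qed

text \<open>Meant for compositions such as \<open>exp\<close> of a bounded absolutely continuous
  function, whose increments are controlled by those of the inner function.\<close>

lemma absolutely_continuous_on_lipschitz:
 assumes f: "absolutely_continuous_on a b f" and K: "K > 0"
  "\<And>u v. u \<in> {a..b} ==> v \<in> {a..b} ==> norm (g v - g u) <= K * norm (f v - f u)"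
 shows "absolutely_continuous_on a b g" unfolding absolutely_continuous_on_def
proof (intro allI impI)
 fix e :: real assume e: "e > 0"
 then have "e / K > 0" using K by simp
 then obtain \<delta> where d: "\<delta> > 0" "\<And>d. d division_of \<Union>d ==> \<Union>d \<subseteq> {a..b} ==> (\<Sum>k\<in>d. Sup k - Inf k) < \<delta> ==>
    (\<Sum>k\<in>d. norm (f (Sup k) - f (Inf k))) < e / K" using f unfolding absolutely_continuous_on_def by meson
 show "\<exists>\<delta>>0. \<forall>d. d division_of \<Union>d --> \<Union>d \<subseteq> {a..b} --> (\<Sum>k\<in>d. Sup k - Inf k) < \<delta> -->
      (\<Sum>k\<in>d. norm (g (Sup k) - g (Inf k))) < e"
 proof (intro exI[of _ \<delta>] conjI allI impI d(1))
  fix d assume dd: "d division_of \<Union>d" "\<Union>d \<subseteq> {a..b}" "(\<Sum>k\<in>d. Sup k - Inf k) < \<delta>"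
  have "norm (g (Sup k) - g (Inf k)) <= K * norm (f (Sup k) - f (Inf k))" if k: "k \<in> d" for k
  proof -
   have "k ~= {}" "\<exists>u v. k = cbox u v" using division_ofD(3)[OF dd(1) k] division_ofD(4)[OF dd(1) k] by auto
   then obtain u v where uv: "k = {u..v}" "u <= v" by (metis atLeastatMost_empty_iff2 box_real(2))
   then have "u \<in> k" "v \<in> k" by auto
   then have "u \<in> {a..b}" "v \<in> {a..b}" using dd(2) k by auto
   then show ?thesis using K(2) uv by auto
  qed
  then have "(\<Sum>k\<in>d. norm (g (Sup k) - g (Inf k))) <= (\<Sum>k\<in>d. K * norm (f (Sup k) - f (Inf k)))"
   by (rule sum_mono)
  also have "... = K * (\<Sum>k\<in>d. norm (f (Sup k) - f (Inf k)))" by (simp add: sum_distrib_left)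
  also have "... < K * (e / K)" by (intro mult_strict_left_mono d(2) dd K(1))
  finally show "(\<Sum>k\<in>d. norm (g (Sup k) - g (Inf k))) < e" using K by simp
 qed
qed

lemma exp_lipschitz_le:
 fixes x y M :: real
 assumes "x <= M" "y <= M"
 shows "\<bar>exp x - exp y\<bar> <= exp M * \<bar>x - y\<bar>"
proof -
 have *: "exp u - exp v <= exp M * (u - v)" if "v <= u" "u <= M" for u v :: real
 proof -
  have "exp u - exp v = exp u * (1 - exp (v - u))" by (simp add: exp_diff right_diff_distrib)
  also have "... <= exp u * (u - v)" using exp_ge_add_one_self[of "v - u"] by (intro mult_left_mono) (linarith, simp)
  also have "... <= exp M * (u - v)" using that by (intro mult_right_mono) auto
  finally show ?thesis .
 qed
 show ?thesis
 proof (cases "y <= x")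
  case True
  then show ?thesis using *[of y x] assms by simp
 next
  case False
  then show ?thesis using *[of x y] assms by (simp add: abs_minus_commute)
 qed
qed

lemma primitive_on_exp:
 fixes L :: "real => real"
 assumes L: "primitive_on a b L l"
 shows "primitive_on a b (%x. exp (L x)) (%x. exp (L x) * l x)"
proof -
 have "bounded (L ` {a..b})" using compact_imp_bounded[OF compact_continuous_image[OF primitive_on_continuous[OF L]]] by simp
 then obtain M where "\<forall>y\<in>L ` {a..b}. norm y <= M" unfolding bounded_iff by blast
 then have M: "\<And>x. x \<in> {a..b} ==> norm (L x) <= M" by blast
 obtain N where N: "negligible N" "\<And>x. x \<in> {a<..<b} - N ==> (L has_vector_derivative l x) (at x)"
  using primitive_on_derivative_ae[OF L] by blast
 show ?thesis
 proof (rule primitive_onI[OF _ N(1)])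
  show "absolutely_continuous_on a b (%x. exp (L x))"
  proof (rule absolutely_continuous_on_lipschitz[OF primitive_on_absolutely_continuous[OF L], of "exp M"])
   fix u v assume "u \<in> {a..b}" "v \<in> {a..b}"
   then have "L u <= M" "L v <= M" using M by force+
   then show "norm (exp (L v) - exp (L u)) <= exp M * norm (L v - L u)" using exp_lipschitz_le by (simp add: real_norm_def)
  qed simp
  show "((%x. exp (L x)) has_vector_derivative exp (L x) * l x) (at x)" if "x \<in> {a<..<b} - N" for x
   using N(2)[OF that] unfolding has_real_derivative_iff_has_vector_derivative[symmetric] by (auto intro!: derivative_eq_intros)
  show "(%x. exp (L x) * l x) absolutely_integrable_on {a..b}" by (rule abs_integrable_bilinear_left[OF bounded_bilinear_mult])
     (auto intro!: continuous_intros primitive_on_continuous[OF L] primitive_on_integrable[OF L])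
 qed
qed

section \<open>Matrices and the Volterra equation\<close>

lemma norm_matrix_sq: "(norm (A::complex^'n^'m))^2 = (\<Sum>i\<in>UNIV. \<Sum>j\<in>UNIV. (cmod (A$i$j))^2)"
 unfolding norm_vec_def L2_set_def by (simp add: sum_nonneg)

text \<open>\<open>norm\<close> on matrices is the Frobenius norm, an L2 norm of the L2 norms of the
  rows. Cauchy-Schwarz on each entry of the product makes it submultiplicative with constant
  1.\<close>

lemma norm_matmul_le: "norm ((A::complex^'n^'m) ** (B::complex^'p^'n)) <= norm A * norm B"
proof (rule power2_le_imp_le)
 have 1: "(cmod ((A ** B) $ i $ k))^2 <= (\<Sum>j\<in>UNIV. (cmod (A$i$j))^2) * (\<Sum>j\<in>UNIV. (cmod (B$j$k))^2)" for i k
 proof -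
  have "cmod ((A ** B) $ i $ k) <= (\<Sum>j\<in>UNIV. cmod (A$i$j) * cmod (B$j$k))"
   unfolding matrix_matrix_mult_def by (simp add: norm_mult[symmetric] sum_norm_le)
  then have "(cmod ((A ** B) $ i $ k))^2 <= (\<Sum>j\<in>UNIV. cmod (A$i$j) * cmod (B$j$k))^2" by (intro power_mono) auto
  also have "... <= (\<Sum>j\<in>UNIV. (cmod (A$i$j))^2) * (\<Sum>j\<in>UNIV. (cmod (B$j$k))^2)"
   by (rule Cauchy_Schwarz_ineq_sum)
  finally show ?thesis .
 qed
 have "(norm (A ** B))^2 <= (\<Sum>i\<in>UNIV. \<Sum>k\<in>UNIV. (\<Sum>j\<in>UNIV. (cmod (A$i$j))^2) * (\<Sum>j\<in>UNIV. (cmod (B$j$k))^2))"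
  unfolding norm_matrix_sq by (intro sum_mono 1)
 also have "... = (norm A)^2 * (\<Sum>k\<in>UNIV. \<Sum>j\<in>UNIV. (cmod (B$j$k))^2)"
  unfolding norm_matrix_sq by (simp add: sum_product)
 also have "(\<Sum>k\<in>UNIV. \<Sum>j\<in>UNIV. (cmod (B$j$k))^2) = (norm B)^2" unfolding norm_matrix_sq by (rule sum.swap)
 finally show "(norm (A ** B))^2 <= (norm A * norm B)^2" by (simp add: power_mult_distrib)
qed simp

lemma bounded_bilinear_matrix_mult: "bounded_bilinear ((**) :: complex^'n^'m => complex^'p^'n => complex^'p^'m)"
proof
 show "\<exists>K. \<forall>A B. norm ((A::complex^'n^'m) ** (B::complex^'p^'n)) <= norm A * norm B * K"
  by (rule exI[of _ 1]) (simp add: norm_matmul_le)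
qed (simp_all add: matrix_matrix_mult_def vec_eq_iff scaleR_sum_right sum.distrib distrib_left distrib_right)

interpretation mm: bounded_bilinear "(**) :: complex^'n^'m => complex^'p^'n => complex^'p^'m"
 by (rule bounded_bilinear_matrix_mult)

lemma mscale_nth [simp]: "(c \<cdot> A) $ i $ j = c * A $ i $ j" by (simp add: mscale_def)

lemma norm_mscale: "norm (c \<cdot> A) = cmod c * norm A"
proof -
 have "(norm (c \<cdot> A))^2 = (cmod c * norm A)^2"
  unfolding power_mult_distrib norm_matrix_sq by (simp add: norm_mult power_mult_distrib sum_distrib_left)
 then show ?thesis by (simp add: power2_eq_iff_nonneg)
qed

lemma bounded_bilinear_mscale: "bounded_bilinear ((\<cdot>) :: complex => complex^'n^'m => complex^'n^'m)"
proof
 show "\<exists>K. \<forall>a b. norm (a \<cdot> (b::complex^'n^'m)) <= norm a * norm b * K"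
  by (rule exI[of _ 1]) (simp add: norm_mscale)
qed (simp_all add: vec_eq_iff algebra_simps)

interpretation ms: bounded_bilinear "(\<cdot>) :: complex => complex^'n^'m => complex^'n^'m"
 by (rule bounded_bilinear_mscale)

lemma mscale_one [simp]: "1 \<cdot> A = A"
 and mscale_mscale [simp]: "a \<cdot> b \<cdot> A = (a * b) \<cdot> A" by (simp_all add: vec_eq_iff mult.assoc)

lemma mscale_of_real: "complex_of_real r \<cdot> A = r *\<^sub>R (A :: complex^'n^'m)"
 by (simp add: vec_eq_iff) (simp add: scaleR_conv_of_real)

lemma mscale_mult_left: "(c \<cdot> A) ** B = c \<cdot> (A ** B)"
 and mscale_mult_right: "A ** (c \<cdot> B) = c \<cdot> (A ** B)"
 by (simp_all add: vec_eq_iff matrix_matrix_mult_def sum_distrib_left mult_ac)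

lemma ctranspose_nth [simp]: "ctranspose A $ i $ j = cnj (A $ j $ i)" by (simp add: ctranspose_def)

lemma ctranspose_ctranspose [simp]: "ctranspose (ctranspose A) = A"
 and ctranspose_add: "ctranspose (A + B) = ctranspose A + ctranspose B"
 and ctranspose_diff: "ctranspose (A - B) = ctranspose A - ctranspose B"
 and ctranspose_minus: "ctranspose (- A) = - ctranspose A"
 and ctranspose_zero [simp]: "ctranspose 0 = 0"
 and ctranspose_mscale: "ctranspose (c \<cdot> A) = cnj c \<cdot> ctranspose A" by (simp_all add: vec_eq_iff)

lemma ctranspose_mult: "ctranspose (A ** B) = ctranspose B ** ctranspose A"
 by (simp add: vec_eq_iff matrix_matrix_mult_def mult.commute)

lemma ctranspose_mat1 [simp]: "ctranspose (mat 1) = (mat 1 :: complex^'n^'n)" by (simp add: vec_eq_iff mat_def)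

lemma norm_ctranspose [simp]: "norm (ctranspose A) = norm A"
proof -
 have "(norm (ctranspose A))^2 = (norm A)^2" unfolding norm_matrix_sq by (subst sum.swap) simp
 then show ?thesis by (simp add: power2_eq_iff_nonneg)
qed

lemma bounded_linear_ctranspose: "bounded_linear ctranspose" by (rule bounded_linear_intro[where K=1])
   (simp_all add: ctranspose_add vec_eq_iff)

text \<open>The integrand is the derivative of \<open>exp (2 * L x) / 2\<close>. The 2 in the
  exponent is the source of the factor 1/2 that closes the Gronwall bound and makes the Picard
  iteration contract.\<close>

lemma exp_weight_integral_le:
 fixes a :: "real => real"
 assumes a: "a absolutely_integrable_on {0..b}" and x: "0 <= x" "x <= b"
 defines "L \<equiv> %x. integral {0..x} a"
 shows "(%t. a t * exp (2 * L t)) integrable_on {0..x}"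
  and "integral {0..x} (%t. a t * exp (2 * L t)) <= exp (2 * L x) / 2"
proof -
 have "primitive_on 0 b L a" unfolding primitive_on_def L_def using a by auto
 from primitive_on_linear[OF bounded_linear_mult_right[of 2] this]
 have "primitive_on 0 b (%x. exp (2 * L x)) (%x. exp (2 * L x) * (2 * a x))" by (rule primitive_on_exp)
 note p = primitive_on_linear[OF bounded_linear_mult_right[of "1/2"] this]
 then have p: "primitive_on 0 b (%x. exp (2 * L x) / 2) (%t. a t * exp (2 * L t))" by (simp add: mult.commute)
 show "(%t. a t * exp (2 * L t)) integrable_on {0..x}" using primitive_on_integrable(3)[OF p, of 0 x] x by simp
 have "exp (2 * L x) / 2 - exp (2 * L 0) / 2 = integral {0..x} (%t. a t * exp (2 * L t))"
  by (rule primitive_on_diff[OF p]) (use x in auto)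
 then show "integral {0..x} (%t. a t * exp (2 * L t)) <= exp (2 * L x) / 2" by (simp add: L_def)
qed

text \<open>Gronwall's inequality with a non-optimal constant: the supremum \<open>m\<close> of
 \<open>u e\<^sup>-\<^sup>2\<^sup>L\<close> satisfies \<open>m <= C + m / 2\<close>.\<close>

lemma gronwall_bound:
 fixes u a :: "real => real"
 assumes a: "a absolutely_integrable_on {0..b}" "\<And>t. t \<in> {0..b} ==> 0 <= a t"
  and u: "continuous_on {0..b} u" and C: "0 <= C"
  and le: "\<And>x. x \<in> {0..b} ==> u x <= C + integral {0..x} (%t. a t * u t)"
  and x: "x \<in> {0..b}"
 shows "u x <= 2 * C * exp (2 * integral {0..b} a)"
proof -
 define L where "L = (%x. integral {0..x} a)"
 have Lp: "primitive_on 0 b L a" unfolding primitive_on_def L_def using a by auto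
 have Lc: "continuous_on {0..b} L" by (rule primitive_on_continuous[OF Lp])
 have b: "0 <= b" using x by auto
 let ?w = "%x. u x * exp (- 2 * L x)"
 have "continuous_on {0..b} ?w" by (intro continuous_intros u Lc)
 then obtain x0 where x0: "x0 \<in> {0..b}" "\<And>y. y \<in> {0..b} ==> ?w y <= ?w x0"
  using continuous_attains_sup[of "{0..b}" ?w] b by fastforce
 define m where "m = ?w x0"
 have ai: "a integrable_on {0..y}" if "y \<in> {0..b}" for y using primitive_on_integrable(3)[OF Lp, of 0 y] that by auto
 have Lmono: "L y <= L b" if y: "y \<in> {0..b}" for y unfolding L_def by (rule integral_subset_le) (use y b a ai in auto)
 have ub: "u y <= m * exp (2 * L y)" if "y \<in> {0..b}" for y
  using x0(2)[OF that] unfolding m_def[symmetric] by (simp add: exp_minus field_simps)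
 have "m <= 2 * C"
 proof (cases "m <= 0")
  case False
  have "u x0 <= C + integral {0..x0} (%t. a t * u t)" by (rule le[OF x0(1)])
  also have "integral {0..x0} (%t. a t * u t) <= integral {0..x0} (%t. m * (a t * exp (2 * L t)))"
  proof (rule integral_le)
   have "(%t. a t * u t) absolutely_integrable_on {0..b}"
    by (rule abs_integrable_bilinear_right[OF bounded_bilinear_mult u a(1)])
   then show "(%t. a t * u t) integrable_on {0..x0}"
    using x0(1) unfolding absolutely_integrable_on_def by (auto intro: integrable_subinterval_real)
   show "(%t. m * (a t * exp (2 * L t))) integrable_on {0..x0}"
    using exp_weight_integral_le(1)[OF a(1), of x0] x0(1) unfolding L_def by (intro integrable_on_mult_right) auto
   show "a t * u t <= m * (a t * exp (2 * L t))" if "t \<in> {0..x0}" for t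
    using mult_left_mono[OF ub[of t] a(2)[of t]] that x0(1) by (auto simp: mult_ac)
  qed
  also have "... = m * integral {0..x0} (%t. a t * exp (2 * L t))" by simp
  also have "... <= m * (exp (2 * L x0) / 2)"
   using exp_weight_integral_le(2)[OF a(1), of x0] x0(1) False unfolding L_def by (intro mult_left_mono) auto
  finally have "u x0 * exp (- 2 * L x0) <= (C + m * (exp (2 * L x0) / 2)) * exp (- 2 * L x0)" by (intro mult_right_mono) auto
  also have "... = C * exp (- 2 * L x0) + m / 2" by (simp add: exp_minus field_simps)
  also have "C * exp (- 2 * L x0) <= C * 1"
  proof (intro mult_left_mono C)
   have "L x0 \<ge> 0" unfolding L_def by (rule integral_nonneg) (use x0 a ai in auto)
   then show "exp (- 2 * L x0) <= 1" by simp
  qed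
  finally show ?thesis unfolding m_def by simp
 qed (use C in simp)
 have "u x <= m * exp (2 * L x)" by (rule ub[OF x])
 also have "... <= 2 * C * exp (2 * L x)" using \<open>m <= 2 * C\<close> by (intro mult_right_mono) auto
 also have "... <= 2 * C * exp (2 * L b)" using Lmono[OF x] C by (intro mult_left_mono) auto
 finally show ?thesis unfolding L_def .
qed

section \<open>Volterra equations with an integrable operator bound\<close>

locale volterra =
 fixes b :: real and A :: "real => 'a::euclidean_space => 'a" and a :: "real => real"
 assumes b: "0 <= b"
  and A_linear: "\<And>t. linear (A t)"
  and A_bound: "\<And>t x. t \<in> {0..b} ==> norm (A t x) <= a t * norm x"
  and a_nonneg: "\<And>t. t \<in> {0..b} ==> 0 <= a t"
  and a_int: "a absolutely_integrable_on {0..b}"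
  and A_int: "\<And>X. continuous_on {0..b} X ==> (%t. A t (X t)) absolutely_integrable_on {0..b}"
begin

text \<open>Continuity belongs to the notion because it makes the integrand integrable:
  \<open>A_int\<close> is the assumption that stands for measurability of the kernel.\<close>

definition solution :: "(real => 'a) => (real => 'a) => bool" where
 "solution f X \<longleftrightarrow> continuous_on {0..b} X & (\<forall>x\<in>{0..b}. X x = f x + integral {0..x} (%t. A t (X t)))"

lemma integrable_A: "continuous_on {0..b} X ==> x <= b ==> (%t. A t (X t)) integrable_on {0..x}"
 using A_int[of X] unfolding absolutely_integrable_on_def by (auto intro: integrable_subinterval_real)

lemma integrable_a: "continuous_on {0..b} u ==> x <= b ==> (%t. a t * u t) integrable_on {0..x}"
 using abs_integrable_bilinear_right[OF bounded_bilinear_mult _ a_int, of u]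
 unfolding absolutely_integrable_on_def by (auto intro: integrable_subinterval_real)

lemma norm_integral_A_le:
 assumes "continuous_on {0..b} X" "x \<in> {0..b}"
 shows "norm (integral {0..x} (%t. A t (X t))) <= integral {0..x} (%t. a t * norm (X t))"
 by (rule integral_norm_bound_integral)
   (use assms A_bound in \<open>auto intro!: integrable_A integrable_a continuous_intros\<close>)

lemma solution_bound:
 assumes X: "solution f X" and C: "\<And>x. x \<in> {0..b} ==> norm (f x) <= C" and x: "x \<in> {0..b}"
 shows "norm (X x) <= 2 * C * exp (2 * integral {0..b} a)"
proof (rule gronwall_bound[OF a_int a_nonneg _ _ _ x])
 have Xc: "continuous_on {0..b} X" using X unfolding solution_def by blast
 show "continuous_on {0..b} (%x. norm (X x))" by (intro continuous_intros Xc)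
 show "0 <= C" by (rule order_trans[OF norm_ge_zero C[OF x]])
 show "norm (X y) <= C + integral {0..y} (%t. a t * norm (X t))" if y: "y \<in> {0..b}" for y
 proof -
  have "norm (X y) = norm (f y + integral {0..y} (%t. A t (X t)))"
   by (rule arg_cong[where f=norm]) (use X y in \<open>unfold solution_def, blast\<close>)
  also have "... <= norm (f y) + norm (integral {0..y} (%t. A t (X t)))" by (rule norm_triangle_ineq)
  finally show ?thesis using C[OF y] norm_integral_A_le[OF Xc y] by linarith
 qed
qed

lemma solution_diff:
 assumes X: "solution f X" and Y: "solution g Y"
 shows "solution (%x. f x - g x) (%x. X x - Y x)" unfolding solution_def
proof (intro conjI ballI)
 have c: "continuous_on {0..b} X" "continuous_on {0..b} Y" using X Y unfolding solution_def by auto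
 show "continuous_on {0..b} (%x. X x - Y x)" by (intro continuous_intros c)
 fix x assume x: "x \<in> {0..b}"
 have "integral {0..x} (%t. A t (X t - Y t)) = integral {0..x} (%t. A t (X t) - A t (Y t))"
  by (simp add: linear_diff[OF A_linear])
 also have "... = integral {0..x} (%t. A t (X t)) - integral {0..x} (%t. A t (Y t))"
  by (rule integral_diff) (use x c integrable_A in auto)
 moreover have "X x = f x + integral {0..x} (%t. A t (X t))" "Y x = g x + integral {0..x} (%t. A t (Y t))"
  using X Y x unfolding solution_def by blast+
 ultimately show "X x - Y x = f x - g x + integral {0..x} (%t. A t (X t - Y t))" by (simp only:) (simp add: algebra_simps)
qed

lemma solution_unique:
 assumes "solution f X" "solution f Y" "x \<in> {0..b}"
 shows "X x = Y x" using solution_bound[OF solution_diff[OF assms(1,2)], of 0] assms(3) by auto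

primrec iterate :: "(real => 'a) => nat => real => 'a" where "iterate f 0 = f"
| "iterate f (Suc n) = (%x. f x + integral {0..x} (%t. A t (iterate f n t)))"

text \<open>Picard iteration. Measured with the weight \<open>exp (2 * L x)\<close>, each step
  halves the distance of consecutive iterates, so the telescoping series is dominated by a geometric
  one on the whole interval, however large the integral of \<open>a\<close> is.\<close>

lemma solution_exists:
 assumes f: "continuous_on {0..b} f"
 obtains X where "solution f X"
proof -
 let ?X = "iterate f"
 define L where "L = (%x. integral {0..x} a)"
 have Lc: "continuous_on {0..b} L"
  by (rule primitive_on_continuous[where g=a]) (use a_int in \<open>auto simp: primitive_on_def L_def\<close>)
 have Xc: "continuous_on {0..b} (?X n)" for n
 proof (induction n)
  case (Suc n)
  then show ?case using f integrable_A[OF Suc, of b] by (auto intro!: continuous_intros indefinite_integral_continuous_1)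
 qed (use f in simp)
 define D where "D = (%n x. ?X (Suc n) x - ?X n x)"
 have Dc: "continuous_on {0..b} (D n)" for n unfolding D_def by (intro continuous_intros Xc)
 have "bounded (D 0 ` {0..b})" using compact_continuous_image[OF Dc, of 0] compact_imp_bounded by auto
 then obtain M where M: "\<And>x. x \<in> {0..b} ==> norm (D 0 x) <= M" unfolding bounded_iff by blast
 have M0: "0 <= M" using order_trans[OF norm_ge_zero M[of 0]] b by simp
 have DSuc: "D (Suc n) x = integral {0..x} (%t. A t (D n t))" if "x \<in> {0..b}" for n x
 proof -
  have "integral {0..x} (%t. A t (D n t)) = integral {0..x} (%t. A t (?X (Suc n) t) - A t (?X n t))"
   unfolding D_def by (simp add: linear_diff[OF A_linear])
  also have "... = integral {0..x} (%t. A t (?X (Suc n) t)) - integral {0..x} (%t. A t (?X n t))"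
   by (rule integral_diff[OF integrable_A[OF Xc] integrable_A[OF Xc]]) (use that in auto)
  finally show ?thesis unfolding D_def by simp
 qed
 have L0: "0 <= L x" "L x <= L b" if "x \<in> {0..b}" for x
 proof -
  have i: "a integrable_on {0..y}" if "y <= b" for y
   using a_int that unfolding absolutely_integrable_on_def by (auto intro: integrable_subinterval_real)
  show "0 <= L x" unfolding L_def by (rule integral_nonneg) (use that a_nonneg i in auto)
  show "L x <= L b" unfolding L_def by (rule integral_subset_le) (use that a_nonneg i in auto)
 qed
 have Dbd: "norm (D n x) <= M * (1/2)^n * exp (2 * L x)" if "x \<in> {0..b}" for n x using that
 proof (induction n arbitrary: x)
  case 0
  have "M * 1 <= M * exp (2 * L x)" using L0[OF 0] M0 by (intro mult_left_mono) auto
  then show ?case using M[OF 0] by simp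
 next
  case (Suc n)
  have "norm (D (Suc n) x) <= integral {0..x} (%t. a t * norm (D n t))"
   unfolding DSuc[OF Suc.prems] by (rule norm_integral_A_le[OF Dc Suc.prems])
  also have "... <= integral {0..x} (%t. M * (1/2)^n * (a t * exp (2 * L t)))"
  proof (rule integral_le)
   show "(%t. a t * norm (D n t)) integrable_on {0..x}" using Suc.prems by (intro integrable_a continuous_intros Dc) auto
   show "(%t. M * (1/2)^n * (a t * exp (2 * L t))) integrable_on {0..x}"
    using exp_weight_integral_le(1)[OF a_int, of x] Suc.prems unfolding L_def by (intro integrable_on_mult_right) auto
   fix t assume "t \<in> {0..x}"
   then have t: "t \<in> {0..b}" using Suc.prems by auto
   show "a t * norm (D n t) <= M * (1/2)^n * (a t * exp (2 * L t))"
    using mult_left_mono[OF Suc.IH[OF t] a_nonneg[OF t]] by (simp add: mult_ac)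
  qed
  also have "... = M * (1/2)^n * integral {0..x} (%t. a t * exp (2 * L t))" by simp
  also have "... <= M * (1/2)^n * (exp (2 * L x) / 2)"
   using exp_weight_integral_le(2)[OF a_int, of x] Suc.prems M0 unfolding L_def by (intro mult_left_mono) auto
  finally show ?case by (simp add: field_simps)
 qed
 have Dbd': "norm (D n x) <= M * exp (2 * L b) * (1/2)^n" if "x \<in> {0..b}" for n x
 proof -
  have "M * (1/2)^n * exp (2 * L x) <= M * (1/2)^n * exp (2 * L b)" using L0[OF that] M0 by (intro mult_left_mono) auto
  then show ?thesis using Dbd[OF that, of n] by (simp add: mult_ac)
 qed
 have "uniform_limit {0..b} (%n x. \<Sum>i<n. D i x) (%x. suminf (%i. D i x)) sequentially"
  by (rule Weierstrass_m_test[where M="%n. M * exp (2 * L b) * (1/2)^n"]) (use Dbd' in \<open>auto intro!: summable_mult summable_geometric\<close>)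
 moreover have "(\<Sum>i<n. D i x) = ?X n x - f x" for n x unfolding D_def by (subst sum_lessThan_telescope) simp
 ultimately have ul0: "uniform_limit {0..b} (%n x. ?X n x - f x) (%x. suminf (%i. D i x)) sequentially" by simp
 define X where "X = (%x. f x + suminf (%i. D i x))"
 have ul: "uniform_limit {0..b} ?X X sequentially"
 proof -
  have "uniform_limit {0..b} (%_::nat. f) f sequentially" by (rule uniform_limit_const)
  from uniform_limit_add[OF this ul0] show ?thesis unfolding X_def by simp
 qed
 have cX: "continuous_on {0..b} X" by (rule uniform_limit_theorem[OF _ ul]) (use Xc in auto)
 have "solution f X" unfolding solution_def
 proof (intro conjI cX ballI)
  fix x assume x: "x \<in> {0..b}"
  have "(%n. ?X (Suc n) x) \<longlonglongrightarrow> X x" using tendsto_uniform_limitI[OF ul x] by (rule LIMSEQ_Suc)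
  moreover have "(%n. ?X (Suc n) x) \<longlonglongrightarrow> f x + integral {0..x} (%t. A t (X t))"
  proof (rule LIMSEQ_I)
   fix e :: real assume e: "e > 0"
   \<comment> \<open>If iterate and limit differ by less than \<open>e1\<close> everywhere, their
     integrals differ by at most \<open>e1 * L b\<close>, which is below \<open>e\<close>.\<close>
   define e1 where "e1 = e / (2 * (L b + 1))"
   have Lb: "L b \<ge> 0" using L0[of b] b by auto
   have e1: "e1 > 0" "e1 * L b < e" unfolding e1_def using e Lb by (auto simp: field_simps intro!: add_nonneg_pos mult_nonneg_nonneg)
   obtain N where N: "\<And>n t. n \<ge> N ==> t \<in> {0..b} ==> dist (?X n t) (X t) < e1"
    using uniform_limitD[OF ul e1(1)] unfolding eventually_sequentially by blast
   show "\<exists>no. \<forall>n\<ge>no. norm (?X (Suc n) x - (f x + integral {0..x} (%t. A t (X t)))) < e"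
   proof (intro exI[of _ N] allI impI)
    fix n assume n: "N <= n"
    have ia: "a integrable_on {0..x}"
     using a_int x unfolding absolutely_integrable_on_def by (auto intro: integrable_subinterval_real)
    have "?X (Suc n) x - (f x + integral {0..x} (%t. A t (X t))) = integral {0..x} (%t. A t (?X n t - X t))"
     using x integral_diff[OF integrable_A[OF Xc, of x n] integrable_A[OF cX, of x]] by (simp add: linear_diff[OF A_linear])
    also have "norm ... <= integral {0..x} (%t. a t * norm (?X n t - X t))"
     by (rule norm_integral_A_le) (use x in \<open>auto intro!: continuous_intros Xc cX\<close>)
    also have "... <= integral {0..x} (%t. e1 * a t)"
    proof (rule integral_le)
     show "(%t. a t * norm (?X n t - X t)) integrable_on {0..x}"
      by (rule integrable_a) (use x in \<open>auto intro!: continuous_intros Xc cX\<close>)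
     show "(%t. e1 * a t) integrable_on {0..x}" using ia by (intro integrable_on_mult_right)
     fix t assume "t \<in> {0..x}"
     then have t: "t \<in> {0..b}" using x by auto
     have "norm (?X n t - X t) <= e1" using N[OF n t] by (simp add: dist_norm)
     then show "a t * norm (?X n t - X t) <= e1 * a t" using mult_left_mono[of _ e1, OF _ a_nonneg[OF t]] by (metis mult.commute)
    qed
    also have "... = e1 * L x" unfolding L_def by simp
    also have "... <= e1 * L b" using L0[OF x] e1 by (intro mult_left_mono) auto
    also have "... < e" by (rule e1)
    finally show "norm (?X (Suc n) x - (f x + integral {0..x} (%t. A t (X t)))) < e" .
   qed
  qed
  ultimately show "X x = f x + integral {0..x} (%t. A t (X t))" by (rule LIMSEQ_unique)
 qed
 then show thesis by (rule that)
qed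

end

lemma absolutely_continuous_on_imp_continuous:
 assumes "absolutely_continuous_on a b f"
 shows "continuous_on {a..b} f" unfolding continuous_on_iff
proof (intro ballI allI impI)
 fix x e :: real assume x: "x \<in> {a..b}" and e: "e > 0"
 obtain \<delta> where \<delta>: "\<delta> > 0" "\<And>d. d division_of \<Union>d ==> \<Union>d \<subseteq> {a..b} ==> (\<Sum>k\<in>d. Sup k - Inf k) < \<delta> ==>
    (\<Sum>k\<in>d. norm (f (Sup k) - f (Inf k))) < e" using assms e unfolding absolutely_continuous_on_def by meson
 have *: "norm (f v - f u) < e" if "u \<in> {a..b}" "v \<in> {a..b}" "u <= v" "v - u < \<delta>" for u v
 proof -
  have "{cbox u v} division_of \<Union>{cbox u v}" using division_of_self[of u v] that(3) by simp
  from \<delta>(2)[OF this] show ?thesis using that by simp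
 qed
 show "\<exists>d>0. \<forall>x'\<in>{a..b}. dist x' x < d --> dist (f x') (f x) < e"
 proof (intro exI[of _ \<delta>] conjI \<delta>(1) ballI impI)
  fix y assume y: "y \<in> {a..b}" "dist y x < \<delta>"
  show "dist (f y) (f x) < e" using *[of x y] *[of y x] x y by (cases "x <= y") (auto simp: dist_norm norm_minus_commute)
 qed
qed

lemma absolutely_integrable_norm_le:
 fixes f :: "real => 'a::euclidean_space"
 assumes "f \<in> borel_measurable (lebesgue_on {a<..<b})" "integrable (lebesgue_on {a<..<b}) g" "\<And>x. norm (f x) <= g x"
 shows "f absolutely_integrable_on {a..b::real}" unfolding absolutely_integrable_on_Icc_iff_Ioo
 by (rule measurable_bounded_by_integrable_imp_absolutely_integrable[OF assms(1), where g=g])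
   (use assms(2,3) in \<open>auto simp: integrable_on_lebesgue_on\<close>)

section \<open>Solutions of the differential equation\<close>

text \<open>The first order form: \<open>Z = Y' - \<sigma> Y\<close> solved for \<open>Y'\<close>,
  and the equation solved for \<open>Z'\<close>. In integrated form it is a Volterra equation for
  the pair.\<close>

definition sl_system :: "(real => complex^'m^'m) => complex => (real => complex^'p^'m) => (real => complex^'p^'m) => bool" where
 "sl_system \<sigma> \<mu> Y Z \<longleftrightarrow> primitive_on 0 pi Y (%x. \<sigma> x ** Y x + Z x) \<and>
   primitive_on 0 pi Z (%x. - (\<sigma> x ** Z x) - (\<sigma> x ** \<sigma> x) ** Y x - \<mu> \<cdot> Y x)"

definition sys_op :: "(real => complex^'m^'m) => complex => real => (complex^'p^'m) \<times> (complex^'p^'m) => (complex^'p^'m) \<times> (complex^'p^'m)" where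
 "sys_op \<sigma> \<mu> t X = (\<sigma> t ** fst X + snd X, - (\<sigma> t ** snd X) - (\<sigma> t ** \<sigma> t) ** fst X - \<mu> \<cdot> fst X)"

text \<open>An operator bound for \<open>sys_op\<close>. Since \<sigma> enters squared, its
  integrability is where square integrability of \<sigma> is used.\<close>

definition sys_bound :: "(real => complex^'m^'m) => complex => real => real" where
 "sys_bound \<sigma> \<mu> t = 2 * norm (\<sigma> t) + (norm (\<sigma> t))^2 + 1 + cmod \<mu>"

locale sl_potential =
 fixes \<sigma> :: "real => complex^'m^'m"
 assumes L2: "L2_on {0<..<pi} \<sigma>"
begin

lemma sigma_measurable: "\<sigma> \<in> borel_measurable (lebesgue_on {0<..<pi})"
 and norm_sq_integrable: "integrable (lebesgue_on {0<..<pi}) (%x. (norm (\<sigma> x))^2)" using L2 unfolding L2_on_def by auto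

lemma norm_sq_absolutely_integrable: "(%x. (norm (\<sigma> x))^2) absolutely_integrable_on {0..pi}"
 by (rule absolutely_integrable_norm_le[OF _ norm_sq_integrable]) (use norm_sq_integrable in auto)

lemma sigma_sq_absolutely_integrable: "(%x. \<sigma> x ** \<sigma> x) absolutely_integrable_on {0..pi}"
proof (rule absolutely_integrable_norm_le[OF _ norm_sq_integrable])
 have "continuous_on UNIV (%A::complex^'m^'m. A ** A)" by (intro mm.continuous_on continuous_intros)
 then have "(%A::complex^'m^'m. A ** A) \<in> borel_measurable borel" by (rule borel_measurable_continuous_onI)
 from measurable_compose[OF sigma_measurable this]
 show "(%x. \<sigma> x ** \<sigma> x) \<in> borel_measurable (lebesgue_on {0<..<pi})" .
 show "norm (\<sigma> x ** \<sigma> x) <= (norm (\<sigma> x))^2" for x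
  using norm_matmul_le[of "\<sigma> x" "\<sigma> x"] by (simp add: power2_eq_square)
qed

lemma sigma_absolutely_integrable: "\<sigma> absolutely_integrable_on {0..pi}"
proof (rule absolutely_integrable_norm_le[OF sigma_measurable])
 have "finite_measure (lebesgue_on {0<..<pi})" by (rule finite_measure_lebesgue_on) auto
 then show "integrable (lebesgue_on {0<..<pi}) (%x. 1 + (norm (\<sigma> x))^2)"
  using norm_sq_integrable by (intro Bochner_Integration.integrable_add finite_measure.integrable_const)
 show "norm (\<sigma> x) <= 1 + (norm (\<sigma> x))^2" for x
  using zero_le_power2[of "norm (\<sigma> x) - 1"] by (simp add: power2_eq_square algebra_simps) (use norm_ge_zero[of "\<sigma> x"] in linarith)
qed

lemma norm_sigma_absolutely_integrable: "(%x. norm (\<sigma> x)) absolutely_integrable_on {0..pi}"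
 using absolutely_integrable_norm[OF sigma_absolutely_integrable] by (simp add: o_def)

lemma sys_bound_absolutely_integrable: "sys_bound \<sigma> \<mu> absolutely_integrable_on {0..pi}" unfolding sys_bound_def
 by (intro set_integral_add(1) absolutely_integrable_on_const norm_sq_absolutely_integrable
   set_integrable_mult_right norm_sigma_absolutely_integrable) auto

lemma volterra_sys: "volterra pi (sys_op \<sigma> \<mu> :: real => (complex^'p^'m) \<times> (complex^'p^'m) => _) (sys_bound \<sigma> \<mu>)"
proof (rule volterra.intro)
 show "0 <= pi" by simp
 show "linear (sys_op \<sigma> \<mu> t :: (complex^'p^'m) \<times> (complex^'p^'m) => _)" for t
  by (rule linearI) (auto simp: sys_op_def mm.add_right mm.scaleR_right ms.add_right ms.scaleR_right algebra_simps)
 show "0 <= sys_bound \<sigma> \<mu> t" if "t \<in> {0..pi}" for t unfolding sys_bound_def by simp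
 show "sys_bound \<sigma> \<mu> absolutely_integrable_on {0..pi}" by (rule sys_bound_absolutely_integrable)
 show "norm (sys_op \<sigma> \<mu> t X) <= sys_bound \<sigma> \<mu> t * norm X" if "t \<in> {0..pi}" for t and X :: "(complex^'p^'m) \<times> (complex^'p^'m)"
 proof -
  obtain Y Z where X: "X = (Y,Z)" by (cases X)
  have YZ: "norm Y <= norm X" "norm Z <= norm X" using norm_fst_le[of Y Z] norm_snd_le[of Z Y] X by auto
  have s: "norm (\<sigma> t ** W) <= norm (\<sigma> t) * norm X" if "norm W <= norm X" for W :: "complex^'p^'m"
   by (rule order_trans[OF norm_matmul_le mult_left_mono[OF that]]) simp
  have s2: "norm ((\<sigma> t ** \<sigma> t) ** Y) <= (norm (\<sigma> t))^2 * norm X"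
   by (rule order_trans[OF norm_matmul_le mult_mono])
     (use YZ norm_matmul_le[of "\<sigma> t" "\<sigma> t"] in \<open>auto simp: power2_eq_square\<close>)
  have m: "norm (\<mu> \<cdot> Y) <= cmod \<mu> * norm X" unfolding norm_mscale by (rule mult_left_mono[OF YZ(1)]) simp
  have "norm (sys_op \<sigma> \<mu> t X) <= norm (\<sigma> t ** Y + Z) + norm (- (\<sigma> t ** Z) - (\<sigma> t ** \<sigma> t) ** Y - \<mu> \<cdot> Y)"
   unfolding sys_op_def X by (simp add: norm_Pair sqrt_sum_squares_le_sum)
  also have "norm (\<sigma> t ** Y + Z) <= norm (\<sigma> t) * norm X + norm X"
   by (rule order_trans[OF norm_triangle_ineq add_mono[OF s YZ(2)]]) (rule YZ)
  also have "norm (- (\<sigma> t ** Z) - (\<sigma> t ** \<sigma> t) ** Y - \<mu> \<cdot> Y) \<le>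
    norm (\<sigma> t) * norm X + (norm (\<sigma> t))^2 * norm X + cmod \<mu> * norm X"
   by (rule order_trans[OF norm_triangle_ineq4 add_mono[OF order_trans[OF norm_triangle_ineq4 add_mono[OF _ s2]] m]])
     (use s[OF YZ(2)] in simp)
  finally show ?thesis unfolding sys_bound_def by (simp add: algebra_simps)
 qed
 show "(%t. sys_op \<sigma> \<mu> t (X t)) absolutely_integrable_on {0..pi}"
  if X: "continuous_on {0..pi} X" for X :: "real => (complex^'p^'m) \<times> (complex^'p^'m)"
 proof -
  have c: "continuous_on {0..pi} (%t. fst (X t))" "continuous_on {0..pi} (%t. snd (X t))" by (intro continuous_intros X)+
  have 1: "(%t. \<sigma> t ** fst (X t) + snd (X t)) absolutely_integrable_on {0..pi}"
   by (rule set_integral_add(1)[OF abs_integrable_bilinear_right[OF bounded_bilinear_matrix_mult c(1) sigma_absolutely_integrable]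
      absolutely_integrable_continuous_real[OF c(2)]])
  have 21: "(%t. - (\<sigma> t ** snd (X t))) absolutely_integrable_on {0..pi}"
   using absolutely_integrable_linear[OF abs_integrable_bilinear_right[OF bounded_bilinear_matrix_mult c(2) sigma_absolutely_integrable] bounded_linear_minus[OF bounded_linear_ident]]
   by (simp add: o_def)
  have 22: "(%t. (\<sigma> t ** \<sigma> t) ** fst (X t)) absolutely_integrable_on {0..pi}"
   by (rule abs_integrable_bilinear_right[OF bounded_bilinear_matrix_mult c(1) sigma_sq_absolutely_integrable])
  have 23: "(%t. \<mu> \<cdot> fst (X t)) absolutely_integrable_on {0..pi}"
   by (rule absolutely_integrable_continuous_real) (intro ms.continuous_on continuous_on_const c)
  have 2: "(%t. - (\<sigma> t ** snd (X t)) - (\<sigma> t ** \<sigma> t) ** fst (X t) - \<mu> \<cdot> fst (X t)) absolutely_integrable_on {0..pi}"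
   by (rule set_integral_diff(1)[OF set_integral_diff(1)[OF 21 22] 23])
  have l1: "bounded_linear (%y::complex^'p^'m. (y, 0::complex^'p^'m))"
   and l2: "bounded_linear (%y::complex^'p^'m. (0::complex^'p^'m, y))"
   by (auto intro!: bounded_linear_Pair bounded_linear_ident bounded_linear_zero)
  show ?thesis using set_integral_add(1)[OF absolutely_integrable_linear[OF 1 l1] absolutely_integrable_linear[OF 2 l2]]
   by (simp add: o_def sys_op_def)
 qed
qed

lemma sl_system_iff_primitive:
 fixes Y Z :: "real => complex^'p^'m"
 shows "sl_system \<sigma> \<mu> Y Z \<longleftrightarrow> primitive_on 0 pi (%x. (Y x, Z x)) (%x. sys_op \<sigma> \<mu> x (Y x, Z x))"
proof
 assume s: "sl_system \<sigma> \<mu> Y Z"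
 have l1: "bounded_linear (%y::complex^'p^'m. (y, 0::complex^'p^'m))"
  and l2: "bounded_linear (%y::complex^'p^'m. (0::complex^'p^'m, y))"
  by (auto intro!: bounded_linear_Pair bounded_linear_ident bounded_linear_zero)
 show "primitive_on 0 pi (%x. (Y x, Z x)) (%x. sys_op \<sigma> \<mu> x (Y x, Z x))"
  using primitive_on_add[OF primitive_on_linear[OF l1 conjunct1[OF s[unfolded sl_system_def]]]
    primitive_on_linear[OF l2 conjunct2[OF s[unfolded sl_system_def]]]] by (simp add: sys_op_def)
next
 assume p: "primitive_on 0 pi (%x. (Y x, Z x)) (%x. sys_op \<sigma> \<mu> x (Y x, Z x))"
 show "sl_system \<sigma> \<mu> Y Z"
  using primitive_on_linear[OF bounded_linear_fst p] primitive_on_linear[OF bounded_linear_snd p]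
  unfolding sl_system_def by (simp add: sys_op_def)
qed

lemma sl_system_iff_solution:
 fixes Y Z :: "real => complex^'p^'m"
 shows "sl_system \<sigma> \<mu> Y Z \<longleftrightarrow> volterra.solution pi (sys_op \<sigma> \<mu>) (%x. (Y 0, Z 0)) (%x. (Y x, Z x))"
proof -
 interpret V: volterra pi "sys_op \<sigma> \<mu> :: real => (complex^'p^'m) \<times> (complex^'p^'m) => _" "sys_bound \<sigma> \<mu>"
  by (rule volterra_sys)
 let ?X = "%x. (Y x, Z x)"
 show ?thesis unfolding sl_system_iff_primitive V.solution_def
 proof (intro iffI conjI)
  assume p: "primitive_on 0 pi ?X (%x. sys_op \<sigma> \<mu> x (?X x))"
  show "continuous_on {0..pi} ?X" by (rule primitive_on_continuous[OF p])
  show "\<forall>x\<in>{0..pi}. ?X x = ?X 0 + integral {0..x} (%t. sys_op \<sigma> \<mu> t (?X t))"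
   using p unfolding primitive_on_def by (rule conjunct2)
 next
  assume a: "continuous_on {0..pi} ?X & (\<forall>x\<in>{0..pi}. ?X x = ?X 0 + integral {0..x} (%t. sys_op \<sigma> \<mu> t (?X t)))"
  show "primitive_on 0 pi ?X (%x. sys_op \<sigma> \<mu> x (?X x))"
   unfolding primitive_on_def by (rule conjI[OF V.A_int[OF conjunct1[OF a]] conjunct2[OF a]])
 qed
qed

text \<open>The unknowns are continuous, so the right-hand sides are integrable. Absolutely
  continuous functions with these derivatives almost everywhere are their primitives, and primitives
  have these derivatives almost everywhere.\<close>

lemma solves_ell_iff:
 fixes Y Z :: "real => complex^'p^'m"
 shows "solves_ell \<sigma> \<mu> Y Z \<longleftrightarrow> sl_system \<sigma> \<mu> Y Z"
proof
 assume s: "solves_ell \<sigma> \<mu> Y Z"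
 have acY: "absolutely_continuous_on 0 pi Y" and acZ: "absolutely_continuous_on 0 pi Z"
  using s unfolding solves_ell_def quasi_derivative_def by auto
 have c: "continuous_on {0..pi} Y" "continuous_on {0..pi} Z"
  using acY acZ by (auto intro: absolutely_continuous_on_imp_continuous)
 obtain N1 where N1: "negligible N1" "\<forall>x\<in>{0<..<pi} - N1. \<exists>D. (Y has_vector_derivative D) (at x) & Z x = D - \<sigma> x ** Y x"
  using s unfolding solves_ell_def quasi_derivative_def by (auto simp: AE_lebesgue_on_negligible)
 obtain N2 where N2: "negligible N2" "\<forall>x\<in>{0<..<pi} - N2. \<exists>D. (Z has_vector_derivative D) (at x) \<and>
      - D - \<sigma> x ** Z x - (\<sigma> x ** \<sigma> x) ** Y x = \<mu> \<cdot> Y x"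
  using s unfolding solves_ell_def quasi_derivative_def by (auto simp: AE_lebesgue_on_negligible)
 have "(%t. sys_op \<sigma> \<mu> t (Y t, Z t)) absolutely_integrable_on {0..pi}"
  by (rule volterra.A_int[OF volterra_sys]) (intro continuous_intros c)
 from absolutely_integrable_linear[OF this bounded_linear_fst] absolutely_integrable_linear[OF this bounded_linear_snd]
 have i: "(%x. \<sigma> x ** Y x + Z x) absolutely_integrable_on {0..pi}"
  "(%x. - (\<sigma> x ** Z x) - (\<sigma> x ** \<sigma> x) ** Y x - \<mu> \<cdot> Y x) absolutely_integrable_on {0..pi}"
  by (auto simp: sys_op_def o_def)
 show "sl_system \<sigma> \<mu> Y Z" unfolding sl_system_def
 proof
  show "primitive_on 0 pi Y (%x. \<sigma> x ** Y x + Z x)"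
  proof (rule primitive_onI[OF acY N1(1) _ i(1)])
   fix x assume "x \<in> {0<..<pi} - N1"
   then obtain D where "(Y has_vector_derivative D) (at x)" "Z x = D - \<sigma> x ** Y x" using N1(2) by blast
   then show "(Y has_vector_derivative \<sigma> x ** Y x + Z x) (at x)" by simp
  qed
  show "primitive_on 0 pi Z (%x. - (\<sigma> x ** Z x) - (\<sigma> x ** \<sigma> x) ** Y x - \<mu> \<cdot> Y x)"
  proof (rule primitive_onI[OF acZ N2(1) _ i(2)])
   fix x assume "x \<in> {0<..<pi} - N2"
   then obtain D where "(Z has_vector_derivative D) (at x)"
    "- D - \<sigma> x ** Z x - (\<sigma> x ** \<sigma> x) ** Y x = \<mu> \<cdot> Y x" using N2(2) by blast
   moreover from this(2)[symmetric] have "D = - (\<sigma> x ** Z x) - (\<sigma> x ** \<sigma> x) ** Y x - \<mu> \<cdot> Y x"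
    by simp
   ultimately show "(Z has_vector_derivative - (\<sigma> x ** Z x) - (\<sigma> x ** \<sigma> x) ** Y x - \<mu> \<cdot> Y x) (at x)" by simp
  qed
 qed
next
 assume s: "sl_system \<sigma> \<mu> Y Z"
 then have p: "primitive_on 0 pi Y (%x. \<sigma> x ** Y x + Z x)"
  "primitive_on 0 pi Z (%x. - (\<sigma> x ** Z x) - (\<sigma> x ** \<sigma> x) ** Y x - \<mu> \<cdot> Y x)" unfolding sl_system_def by auto
 obtain N1 where N1: "negligible N1" "\<And>x. x \<in> {0<..<pi} - N1 ==> (Y has_vector_derivative \<sigma> x ** Y x + Z x) (at x)"
  using primitive_on_derivative_ae[OF p(1)] by blast
 obtain N2 where N2: "negligible N2" "\<And>x. x \<in> {0<..<pi} - N2 ==>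
   (Z has_vector_derivative - (\<sigma> x ** Z x) - (\<sigma> x ** \<sigma> x) ** Y x - \<mu> \<cdot> Y x) (at x)"
  using primitive_on_derivative_ae[OF p(2)] by blast
 have 1: "\<exists>N. negligible N & (\<forall>x\<in>{0<..<pi} - N. \<exists>D. (Y has_vector_derivative D) (at x) & Z x = D - \<sigma> x ** Y x)"
 proof (intro exI[of _ N1] conjI ballI N1(1))
  fix x assume "x \<in> {0<..<pi} - N1"
  from N1(2)[OF this] show "\<exists>D. (Y has_vector_derivative D) (at x) & Z x = D - \<sigma> x ** Y x"
   by (intro exI[of _ "\<sigma> x ** Y x + Z x"]) simp
 qed
 have 2: "\<exists>N. negligible N & (\<forall>x\<in>{0<..<pi} - N. \<exists>D. (Z has_vector_derivative D) (at x) \<and>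
      - D - \<sigma> x ** Z x - (\<sigma> x ** \<sigma> x) ** Y x = \<mu> \<cdot> Y x)"
 proof (intro exI[of _ N2] conjI ballI N2(1))
  fix x assume "x \<in> {0<..<pi} - N2"
  from N2(2)[OF this] show "\<exists>D. (Z has_vector_derivative D) (at x) \<and>
      - D - \<sigma> x ** Z x - (\<sigma> x ** \<sigma> x) ** Y x = \<mu> \<cdot> Y x"
   by (intro exI[of _ "- (\<sigma> x ** Z x) - (\<sigma> x ** \<sigma> x) ** Y x - \<mu> \<cdot> Y x"]) simp
 qed
 show "solves_ell \<sigma> \<mu> Y Z" unfolding solves_ell_def quasi_derivative_def
  using 1 2 p by (auto simp: AE_lebesgue_on_negligible primitive_on_absolutely_continuous)
qed

end

section \<open>Dependence of the solutions on the spectral parameter\<close>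

lemma cmod_entry_le: "cmod ((A::complex^'n^'m) $ i $ j) <= norm A"
 using order_trans[OF Finite_Cartesian_Product.norm_nth_le Finite_Cartesian_Product.norm_nth_le] .

lemma has_field_derivative_quadratic:
 fixes g :: "complex => complex"
 assumes "\<And>w. cmod (w - z) <= 1 ==> cmod (g w - g z - (w - z) * d) <= C * (cmod (w - z))^2"
 shows "(g has_field_derivative d) (at z)" unfolding has_field_derivative_def has_derivative_at_alt
proof (intro conjI allI impI)
 show "bounded_linear ((*) d)" by (rule bounded_linear_mult_right)
 fix e :: real assume e: "e > 0"
 have C: "0 <= C" using order_trans[OF norm_ge_zero assms[of "z + 1"]] by simp
 define r where "r = min 1 (e / (C + 1))"
 have r: "r > 0" "r <= 1" "C * r <= e"
 proof -
  show "r > 0" "r <= 1" unfolding r_def using e C by auto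
  have "C * r <= C * (e / (C + 1))" unfolding r_def using C by (intro mult_left_mono) auto
  also have "... <= e" using C e by (simp add: field_simps)
  finally show "C * r <= e" .
 qed
 show "\<exists>r>0. \<forall>w. norm (w - z) < r --> norm (g w - g z - d * (w - z)) <= e * norm (w - z)"
 proof (intro exI[of _ r] conjI r(1) allI impI)
  fix w assume w: "norm (w - z) < r"
  have "norm (g w - g z - d * (w - z)) <= C * (cmod (w - z))^2" using assms[of w] w r by (simp add: mult.commute)
  also have "... = (C * cmod (w - z)) * cmod (w - z)" by (simp add: power2_eq_square)
  also have "... <= e * cmod (w - z)" using mult_left_mono[OF less_imp_le[OF w] C] r(3) by (intro mult_right_mono) auto
  finally show "norm (g w - g z - d * (w - z)) <= e * norm (w - z)" .
 qed
qed

text \<open>The locale \<open>volterra\<close> is real linear, and so is the scalar multiplication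
  on pairs; complex multiples of solutions go through this bounded linear map.\<close>

definition pscale :: "complex => (complex^'p^'m) \<times> (complex^'p^'m) => (complex^'p^'m) \<times> (complex^'p^'m)" where
 "pscale c X = (c \<cdot> fst X, c \<cdot> snd X)"

lemma bounded_linear_pscale: "bounded_linear (pscale c)" unfolding pscale_def
 by (intro bounded_linear_Pair bounded_linear_compose[OF ms.bounded_linear_right] bounded_linear_fst bounded_linear_snd)

lemma sys_op_pscale: "sys_op \<sigma> \<mu> t (pscale c X) = pscale c (sys_op \<sigma> \<mu> t X)"
 by (simp add: sys_op_def pscale_def mscale_mult_right ms.add_right ms.diff_right ms.minus_right mult.commute)

lemma bounded_bilinear_ctranspose_mult: "bounded_bilinear (%(A::complex^'q^'m) (B::complex^'p^'m). ctranspose A ** B)"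
 by (rule bounded_bilinear.comp1[OF bounded_bilinear_matrix_mult bounded_linear_ctranspose])

context sl_potential
begin

text \<open>The choice is unique on \<open>{0..pi}\<close> by \<open>sl_system_eq_sol\<close>; the
  values outside that interval are arbitrary.\<close>

definition sol :: "complex => complex^'p^'m => complex^'p^'m => real => (complex^'p^'m) \<times> (complex^'p^'m)" where
 "sol \<mu> y z = (SOME X. sl_system \<sigma> \<mu> (%x. fst (X x)) (%x. snd (X x)) & X 0 = (y, z))"

lemma sol_system: "sl_system \<sigma> \<mu> (%x. fst (sol \<mu> y z x)) (%x. snd (sol \<mu> y z x))"
 and sol_0: "sol \<mu> y z 0 = (y, z)"
proof -
 interpret V: volterra pi "sys_op \<sigma> \<mu> :: real => (complex^'p^'m) \<times> (complex^'p^'m) => _" "sys_bound \<sigma> \<mu>"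
  by (rule volterra_sys)
 obtain X where X: "V.solution (%_. (y, z)) X" using V.solution_exists[of "%_. (y, z)"] by auto
 then have "X 0 = (y, z)" unfolding V.solution_def by auto
 moreover then have "sl_system \<sigma> \<mu> (%x. fst (X x)) (%x. snd (X x))"
  unfolding sl_system_iff_solution using X by simp
 ultimately have "\<exists>X. sl_system \<sigma> \<mu> (%x. fst (X x)) (%x. snd (X x)) & X 0 = (y, z)" by blast
 from someI_ex[OF this]
 show "sl_system \<sigma> \<mu> (%x. fst (sol \<mu> y z x)) (%x. snd (sol \<mu> y z x))" "sol \<mu> y z 0 = (y, z)"
  unfolding sol_def by auto
qed

lemma sol_solution: "volterra.solution pi (sys_op \<sigma> \<mu>) (%x. (y, z)) (sol \<mu> y z)"
 using sol_system[of \<mu> y z] unfolding sl_system_iff_solution by (simp add: sol_0)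

lemma sl_system_eq_sol:
 assumes "sl_system \<sigma> \<mu> Y Z" "x \<in> {0..pi}"
 shows "(Y x, Z x) = sol \<mu> (Y 0) (Z 0) x"
 by (rule volterra.solution_unique[OF volterra_sys assms(1)[unfolded sl_system_iff_solution] sol_solution assms(2)])

lemma sol_continuous: "continuous_on {0..pi} (sol \<mu> y z)"
 using sol_solution[of \<mu> y z] unfolding volterra.solution_def[OF volterra_sys] by blast

text \<open>The Gronwall constant common to all \<mu> of modulus at most \<open>R\<close>; the
  Lipschitz and differentiability estimates compare two such parameters and use this
  uniformity.\<close>

definition sol_const :: "real => real" where "sol_const R = 2 * exp (2 * integral {0..pi} (sys_bound \<sigma> (of_real R)))"

lemma sol_const_pos: "sol_const R > 0" unfolding sol_const_def by simp

lemma solution_bound':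
 assumes X: "volterra.solution pi (sys_op \<sigma> \<mu>) f X" and \<mu>: "cmod \<mu> <= R"
  and f: "\<And>x. x \<in> {0..pi} ==> norm (f x) <= C" and x: "x \<in> {0..pi}"
 shows "norm (X x) <= sol_const R * C"
proof -
 have i: "integral {0..pi} (sys_bound \<sigma> \<mu>) <= integral {0..pi} (sys_bound \<sigma> (of_real R))"
  by (rule integral_le)
    (use sys_bound_absolutely_integrable \<mu> in \<open>auto simp: absolutely_integrable_on_def sys_bound_def\<close>)
 have C: "0 <= C" by (rule order_trans[OF norm_ge_zero f[OF x]])
 have "norm (X x) <= 2 * C * exp (2 * integral {0..pi} (sys_bound \<sigma> \<mu>))"
  by (rule volterra.solution_bound[OF volterra_sys X f x])
 also have "... <= 2 * C * exp (2 * integral {0..pi} (sys_bound \<sigma> (of_real R)))"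
  using i C by (intro mult_left_mono) auto
 finally show ?thesis unfolding sol_const_def by (simp add: mult_ac)
qed

lemma sol_bound:
 assumes "cmod \<mu> <= R" "x \<in> {0..pi}"
 shows "norm (sol \<mu> y z x) <= sol_const R * norm (y, z)"
 by (rule solution_bound'[OF sol_solution assms(1) _ assms(2)]) simp

lemma integrable_snd_sol: "x <= pi ==> (%t. (0::complex^'p^'m, c \<cdot> fst (sol \<nu> y z t))) integrable_on {0..x}"
 by (intro integrable_continuous_real continuous_intros ms.continuous_on continuous_on_subset[OF sol_continuous]) auto

text \<open>The operators at \<nu> and \<mu> differ by the term
  \<open>(0, (\<mu> - \<nu>) \<cdot> Y)\<close>. Moved into the inhomogeneity, it makes a solution
  at \<nu> one of the equation at \<mu>, so different parameters are compared by the solution bound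
  alone.\<close>

lemma sol_perturb: "volterra.solution pi (sys_op \<sigma> \<mu>)
   (%x. (y, z) + integral {0..x} (%t. (0, (\<mu> - \<nu>) \<cdot> fst (sol \<nu> y z t)))) (sol \<nu> y z)"
 unfolding volterra.solution_def[OF volterra_sys]
proof (intro conjI ballI sol_continuous)
 fix x :: real assume x: "x \<in> {0..pi}"
 have eq: "sys_op \<sigma> \<nu> t X = (0, (\<mu> - \<nu>) \<cdot> fst X) + sys_op \<sigma> \<mu> t X" for t and X :: "(complex^'p^'m) \<times> (complex^'p^'m)"
  by (simp add: sys_op_def ms.diff_left)
 have "sol \<nu> y z x = (y, z) + integral {0..x} (%t. sys_op \<sigma> \<nu> t (sol \<nu> y z t))"
  using sol_solution[of \<nu> y z] x unfolding volterra.solution_def[OF volterra_sys] by blast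
 also have "integral {0..x} (%t. sys_op \<sigma> \<nu> t (sol \<nu> y z t)) =
   integral {0..x} (%t. (0, (\<mu> - \<nu>) \<cdot> fst (sol \<nu> y z t))) + integral {0..x} (%t. sys_op \<sigma> \<mu> t (sol \<nu> y z t))"
  unfolding eq by (rule integral_add[OF integrable_snd_sol volterra.integrable_A[OF volterra_sys sol_continuous]]) (use x in auto)
 finally show "sol \<nu> y z x = (y, z) + integral {0..x} (%t. (0, (\<mu> - \<nu>) \<cdot> fst (sol \<nu> y z t)))
   + integral {0..x} (%t. sys_op \<sigma> \<mu> t (sol \<nu> y z t))" by (simp only: add.assoc)
qed

lemma norm_integral_le_pi:
 fixes f :: "real => 'a::euclidean_space"
 assumes "f integrable_on {0..x}" "\<And>t. t \<in> {0..x} ==> norm (f t) <= C" "x \<in> {0..pi}" "0 <= C"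
 shows "norm (integral {0..x} f) <= pi * C"
proof -
 have "norm (integral {0..x} f) <= integral {0..x} (%_. C)" by (rule integral_norm_bound_integral) (use assms in auto)
 also have "... <= pi * C" using assms(3,4) by (simp add: mult_right_mono)
 finally show ?thesis .
qed

lemma sol_lipschitz:
 fixes y z :: "complex^'p^'m"
 assumes R: "cmod \<mu> <= R" "cmod \<nu> <= R" and x: "x \<in> {0..pi}"
 shows "norm (sol \<nu> y z x - sol \<mu> y z x) <= sol_const R * (pi * (cmod (\<nu> - \<mu>) * (sol_const R * norm (y, z))))"
proof (rule solution_bound'[OF volterra.solution_diff[OF volterra_sys sol_perturb[of \<mu> y z \<nu>] sol_solution[of \<mu> y z]] R(1) _ x])
 fix x :: real assume x: "x \<in> {0..pi}"
 show "norm ((y, z) + integral {0..x} (%t. (0, (\<mu> - \<nu>) \<cdot> fst (sol \<nu> y z t))) - (y, z)) \<le>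
    pi * (cmod (\<nu> - \<mu>) * (sol_const R * norm (y, z)))"
 proof -
  have "norm (integral {0..x} (%t. (0::complex^'p^'m, (\<mu> - \<nu>) \<cdot> fst (sol \<nu> y z t)))) \<le>
    pi * (cmod (\<nu> - \<mu>) * (sol_const R * norm (y, z)))"
  proof (rule norm_integral_le_pi[OF integrable_snd_sol _ x])
   show "0 <= cmod (\<nu> - \<mu>) * (sol_const R * norm (y, z))" using less_imp_le[OF sol_const_pos] by (intro mult_nonneg_nonneg) auto
   fix t assume "t \<in> {0..x}"
   then have t: "t \<in> {0..pi}" using x by auto
   have "norm (fst (sol \<nu> y z t)) <= sol_const R * norm (y, z)"
    by (rule order_trans[OF _ sol_bound[OF R(2) t]]) (metis norm_fst_le prod.collapse)
   then show "norm (0::complex^'p^'m, (\<mu> - \<nu>) \<cdot> fst (sol \<nu> y z t)) <= cmod (\<nu> - \<mu>) * (sol_const R * norm (y, z))"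
    by (simp add: norm_mscale norm_Pair norm_minus_commute mult_left_mono)
  qed (use x in auto)
  then show ?thesis by simp
 qed
qed

text \<open>\<open>D\<close> solves the equation differentiated in \<mu>, driven by the integral of
  \<open>(0, - Y)\<close>. After subtracting its multiple by \<nu> - \<mu>, the difference of
  solutions satisfies a Volterra equation whose inhomogeneity is of second order, by
  \<open>sol_lipschitz\<close>.\<close>

lemma sol_derivative:
 fixes y z :: "complex^'p^'m"
 obtains D where "\<And>x i j. x \<in> {0..pi} ==> ((%\<nu>. fst (sol \<nu> y z x) $ i $ j) has_field_derivative fst (D x) $ i $ j) (at \<mu>)"
  "\<And>x i j. x \<in> {0..pi} ==> ((%\<nu>. snd (sol \<nu> y z x) $ i $ j) has_field_derivative snd (D x) $ i $ j) (at \<mu>)"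
proof -
 interpret V: volterra pi "sys_op \<sigma> \<mu> :: real => (complex^'p^'m) \<times> (complex^'p^'m) => _" "sys_bound \<sigma> \<mu>"
  by (rule volterra_sys)
 let ?g = "%t. (0::complex^'p^'m, (-1) \<cdot> fst (sol \<mu> y z t))"
 have "?g integrable_on {0..pi}" by (rule integrable_snd_sol) simp
 then have "continuous_on {0..pi} (%x. integral {0..x} ?g)" by (rule indefinite_integral_continuous_1)
 then obtain D where D: "V.solution (%x. integral {0..x} ?g) D" by (rule V.solution_exists)
 \<comment> \<open>The increment \<nu> - \<mu> is complex, so linearity over the reals does not give
   its multiple of \<open>D\<close>; \<open>sys_op_pscale\<close> supplies complex
   homogeneity.\<close>
 have scaleD: "V.solution (%x. pscale c (integral {0..x} ?g)) (%x. pscale c (D x))" for c unfolding V.solution_def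
 proof (intro conjI ballI)
  have cD: "continuous_on {0..pi} D" using D unfolding V.solution_def by blast
  show "continuous_on {0..pi} (%x. pscale c (D x))" by (rule bounded_linear.continuous_on[OF bounded_linear_pscale cD])
  fix x :: real assume x: "x \<in> {0..pi}"
  have i: "(%t. sys_op \<sigma> \<mu> t (D t)) integrable_on {0..x}" using V.integrable_A[OF cD] x by auto
  have "pscale c (D x) = pscale c (integral {0..x} ?g + integral {0..x} (%t. sys_op \<sigma> \<mu> t (D t)))"
   by (rule arg_cong[where f="pscale c"]) (use D x in \<open>unfold V.solution_def, blast\<close>)
  also have "... = pscale c (integral {0..x} ?g) + integral {0..x} (%t. sys_op \<sigma> \<mu> t (pscale c (D t)))"
   using integral_linear[OF i bounded_linear_pscale[of c]]
   by (simp add: linear_add[OF bounded_linear.linear[OF bounded_linear_pscale]] o_def sys_op_pscale)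
  finally show "pscale c (D x) = pscale c (integral {0..x} ?g) + integral {0..x} (%t. sys_op \<sigma> \<mu> t (pscale c (D t)))" .
 qed
 define R where "R = cmod \<mu> + 1"
 define C where "C = sol_const R * (pi * (sol_const R * (pi * (sol_const R * norm (y, z)))))"
 have est: "norm (sol \<nu> y z x - sol \<mu> y z x - pscale (\<nu> - \<mu>) (D x)) <= C * (cmod (\<nu> - \<mu>))^2"
  if \<nu>: "cmod (\<nu> - \<mu>) <= 1" and x: "x \<in> {0..pi}" for \<nu> x
 proof -
  have R: "cmod \<mu> <= R" "cmod \<nu> <= R" using \<nu> norm_triangle_ineq[of "\<nu> - \<mu>" \<mu>] unfolding R_def by auto
  let ?h = "%t. (0::complex^'p^'m, (\<mu> - \<nu>) \<cdot> fst (sol \<nu> y z t))"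
  have "norm (sol \<nu> y z x - sol \<mu> y z x - pscale (\<nu> - \<mu>) (D x)) \<le>
    sol_const R * (pi * (cmod (\<nu> - \<mu>) * (sol_const R * (pi * (cmod (\<nu> - \<mu>) * (sol_const R * norm (y, z)))))))"
  proof (rule solution_bound'[OF V.solution_diff[OF V.solution_diff[OF sol_perturb[of \<mu> y z \<nu>] sol_solution[of \<mu> y z]] scaleD[of "\<nu> - \<mu>"]] R(1) _ x])
   fix x :: real assume x: "x \<in> {0..pi}"
   have i: "?h integrable_on {0..x}" "?g integrable_on {0..x}" using x by (auto intro!: integrable_snd_sol)
   have i2: "(%t. pscale (\<nu> - \<mu>) (?g t)) integrable_on {0..x}"
    using integrable_linear[OF i(2) bounded_linear_pscale] by (simp add: o_def)
   have "(y, z) + integral {0..x} ?h - (y, z) - pscale (\<nu> - \<mu>) (integral {0..x} ?g) =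
     integral {0..x} (%t. ?h t - pscale (\<nu> - \<mu>) (?g t))"
    using integral_linear[OF i(2) bounded_linear_pscale[of "\<nu> - \<mu>"]] integral_diff[OF i(1) i2] by (simp add: o_def)
   also have "norm ... <= pi * (cmod (\<nu> - \<mu>) * (sol_const R * (pi * (cmod (\<nu> - \<mu>) * (sol_const R * norm (y, z))))))"
   proof (rule norm_integral_le_pi[OF integrable_diff[OF i(1) i2] _ x])
    show "0 <= cmod (\<nu> - \<mu>) * (sol_const R * (pi * (cmod (\<nu> - \<mu>) * (sol_const R * norm (y, z)))))"
     using less_imp_le[OF sol_const_pos] by (intro mult_nonneg_nonneg) auto
    fix t assume "t \<in> {0..x}"
    then have t: "t \<in> {0..pi}" using x by auto
    have "?h t - pscale (\<nu> - \<mu>) (?g t) = (0, (\<mu> - \<nu>) \<cdot> (fst (sol \<nu> y z t - sol \<mu> y z t)))"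
     by (simp add: pscale_def ms.diff_right ms.diff_left ms.zero_right algebra_simps)
    then have "norm (?h t - pscale (\<nu> - \<mu>) (?g t)) = cmod (\<nu> - \<mu>) * norm (fst (sol \<nu> y z t - sol \<mu> y z t))"
     by (simp only: norm_Pair norm_mscale norm_zero) (simp add: norm_minus_commute norm_mult[symmetric])
    also have "norm (fst (sol \<nu> y z t - sol \<mu> y z t)) <= norm (sol \<nu> y z t - sol \<mu> y z t)"
     by (metis norm_fst_le prod.collapse)
    also have "... <= sol_const R * (pi * (cmod (\<nu> - \<mu>) * (sol_const R * norm (y, z))))"
     by (rule sol_lipschitz[OF R t])
    finally show "norm (?h t - pscale (\<nu> - \<mu>) (?g t)) <= cmod (\<nu> - \<mu>) * (sol_const R * (pi * (cmod (\<nu> - \<mu>) * (sol_const R * norm (y, z)))))"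
     by (simp add: mult_left_mono)
   qed
   finally show "norm ((y, z) + integral {0..x} ?h - (y, z) - pscale (\<nu> - \<mu>) (integral {0..x} ?g)) \<le>
     pi * (cmod (\<nu> - \<mu>) * (sol_const R * (pi * (cmod (\<nu> - \<mu>) * (sol_const R * norm (y, z))))))" .
  qed
  then show ?thesis unfolding C_def by (simp add: power2_eq_square mult_ac)
 qed
 show thesis
 proof (rule that[of D])
  fix x :: real and i j assume x: "x \<in> {0..pi}"
  show "((%\<nu>. fst (sol \<nu> y z x) $ i $ j) has_field_derivative fst (D x) $ i $ j) (at \<mu>)"
  proof (rule has_field_derivative_quadratic[where C=C])
   fix w assume w: "cmod (w - \<mu>) <= 1"
   have "cmod (fst (sol w y z x - sol \<mu> y z x - pscale (w - \<mu>) (D x)) $ i $ j) <= C * (cmod (w - \<mu>))^2"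
    by (rule order_trans[OF cmod_entry_le order_trans[OF _ est[OF w x]]]) (metis norm_fst_le prod.collapse)
   then show "cmod (fst (sol w y z x) $ i $ j - fst (sol \<mu> y z x) $ i $ j - (w - \<mu>) * fst (D x) $ i $ j) <= C * (cmod (w - \<mu>))^2"
    by (simp add: pscale_def)
  qed
  show "((%\<nu>. snd (sol \<nu> y z x) $ i $ j) has_field_derivative snd (D x) $ i $ j) (at \<mu>)"
  proof (rule has_field_derivative_quadratic[where C=C])
   fix w assume w: "cmod (w - \<mu>) <= 1"
   have "cmod (snd (sol w y z x - sol \<mu> y z x - pscale (w - \<mu>) (D x)) $ i $ j) <= C * (cmod (w - \<mu>))^2"
    by (rule order_trans[OF cmod_entry_le order_trans[OF _ est[OF w x]]]) (metis norm_snd_le prod.collapse)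
   then show "cmod (snd (sol w y z x) $ i $ j - snd (sol \<mu> y z x) $ i $ j - (w - \<mu>) * snd (D x) $ i $ j) <= C * (cmod (w - \<mu>))^2"
    by (simp add: pscale_def)
  qed
 qed
qed

lemma sol_holomorphic:
 assumes "x \<in> {0..pi}"
 shows "(%\<nu>. fst (sol \<nu> y z x) $ i $ j) holomorphic_on S" "(%\<nu>. snd (sol \<nu> y z x) $ i $ j) holomorphic_on S"
proof -
 have "(%\<nu>. fst (sol \<nu> y z x) $ i $ j) field_differentiable at \<mu>" "(%\<nu>. snd (sol \<nu> y z x) $ i $ j) field_differentiable at \<mu>" for \<mu>
  using sol_derivative[of y z \<mu>] assms unfolding field_differentiable_def by metis+
 then show "(%\<nu>. fst (sol \<nu> y z x) $ i $ j) holomorphic_on S" "(%\<nu>. snd (sol \<nu> y z x) $ i $ j) holomorphic_on S"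
  by (auto simp: holomorphic_on_def intro: field_differentiable_at_within)
qed

lemma sl_system_mult:
 assumes "sl_system \<sigma> \<mu> Y Z"
 shows "sl_system \<sigma> \<mu> (%x. Y x ** C) (%x. Z x ** C)"
proof -
 have p: "primitive_on 0 pi Y (%x. \<sigma> x ** Y x + Z x)"
   "primitive_on 0 pi Z (%x. - (\<sigma> x ** Z x) - (\<sigma> x ** \<sigma> x) ** Y x - \<mu> \<cdot> Y x)"
  using assms unfolding sl_system_def by auto
 show ?thesis unfolding sl_system_def
  using primitive_on_linear[OF mm.bounded_linear_left[of C] p(1)] primitive_on_linear[OF mm.bounded_linear_left[of C] p(2)]
  by (simp add: mm.add_left mm.diff_left mm.minus_left matrix_mul_assoc mscale_mult_left)
qed

lemma sl_system_add:
 assumes Y: "sl_system \<sigma> \<mu> Y Z" and U: "sl_system \<sigma> \<mu> U W"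
 shows "sl_system \<sigma> \<mu> (%x. Y x + U x) (%x. Z x + W x)"
proof -
 have p: "primitive_on 0 pi Y (%x. \<sigma> x ** Y x + Z x)"
   "primitive_on 0 pi Z (%x. - (\<sigma> x ** Z x) - (\<sigma> x ** \<sigma> x) ** Y x - \<mu> \<cdot> Y x)"
  "primitive_on 0 pi U (%x. \<sigma> x ** U x + W x)"
   "primitive_on 0 pi W (%x. - (\<sigma> x ** W x) - (\<sigma> x ** \<sigma> x) ** U x - \<mu> \<cdot> U x)"
  using assms unfolding sl_system_def by auto
 show ?thesis unfolding sl_system_def using primitive_on_add[OF p(1,3)] primitive_on_add[OF p(2,4)]
  by (simp add: mm.add_right ms.add_right algebra_simps)
qed

text \<open>In the derivative of the bracket the terms with \<sigma> come in adjoint pairs, which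
  cancel wherever \<sigma> is Hermitian, that is almost everywhere. Only the spectral terms
  survive.\<close>

lemma lagrange_identity:
 fixes Y Z :: "real => complex^'p^'m" and U W :: "real => complex^'q^'m"
 assumes herm: "AE x in lebesgue_on {0<..<pi}. \<sigma> x = ctranspose (\<sigma> x)"
  and Y: "sl_system \<sigma> \<mu> Y Z" and U: "sl_system \<sigma> \<nu> U W"
 shows "ctranspose (U pi) ** Z pi - ctranspose (W pi) ** Y pi - (ctranspose (U 0) ** Z 0 - ctranspose (W 0) ** Y 0)
   = (cnj \<nu> - \<mu>) \<cdot> integral {0..pi} (%x. ctranspose (U x) ** Y x)"
proof -
 obtain N where N: "negligible N" "\<forall>x\<in>{0<..<pi} - N. \<sigma> x = ctranspose (\<sigma> x)"
  using herm by (auto simp: AE_lebesgue_on_negligible)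
 have p: "primitive_on 0 pi Y (%x. \<sigma> x ** Y x + Z x)"
   "primitive_on 0 pi Z (%x. - (\<sigma> x ** Z x) - (\<sigma> x ** \<sigma> x) ** Y x - \<mu> \<cdot> Y x)"
  "primitive_on 0 pi U (%x. \<sigma> x ** U x + W x)"
   "primitive_on 0 pi W (%x. - (\<sigma> x ** W x) - (\<sigma> x ** \<sigma> x) ** U x - \<nu> \<cdot> U x)"
  using Y U unfolding sl_system_def by auto
 have q: "primitive_on 0 pi (%x. - (ctranspose (W x) ** Y x))
   (%x. - (ctranspose (W x) ** (\<sigma> x ** Y x + Z x) + ctranspose (- (\<sigma> x ** W x) - (\<sigma> x ** \<sigma> x) ** U x - \<nu> \<cdot> U x) ** Y x))"
  by (rule primitive_on_linear[OF bounded_linear_minus[OF bounded_linear_ident]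
     primitive_on_bilinear[OF bounded_bilinear_ctranspose_mult p(4) p(1)]])
 note r = primitive_on_add[OF primitive_on_bilinear[OF bounded_bilinear_ctranspose_mult p(3) p(2)] q]
 let ?G = "%x. ctranspose (U x) ** (- (\<sigma> x ** Z x) - \<sigma> x ** \<sigma> x ** Y x - \<mu> \<cdot> Y x) +
     ctranspose (\<sigma> x ** U x + W x) ** Z x +
     - (ctranspose (W x) ** (\<sigma> x ** Y x + Z x) + ctranspose (- (\<sigma> x ** W x) - (\<sigma> x ** \<sigma> x) ** U x - \<nu> \<cdot> U x) ** Y x)"
 have "integral {0..pi} ?G = integral {0..pi} (%x. (cnj \<nu> - \<mu>) \<cdot> (ctranspose (U x) ** Y x))"
 proof (rule integral_spike)
  show "negligible (N \<union> {0,pi})" using N by auto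
  fix x assume "x \<in> {0..pi} - (N \<union> {0,pi})"
  then have "x \<in> {0<..<pi} - N" by auto
  from bspec[OF N(2) this, symmetric] have "ctranspose (\<sigma> x) = \<sigma> x" .
  then show "(cnj \<nu> - \<mu>) \<cdot> (ctranspose (U x) ** Y x) = ?G x"
   by (simp add: ctranspose_add ctranspose_diff ctranspose_minus ctranspose_mult ctranspose_mscale
     mm.add_left mm.add_right mm.diff_left mm.diff_right mm.minus_left mm.minus_right
     mscale_mult_left mscale_mult_right ms.diff_left matrix_mul_assoc)
 qed
 also have "... = (cnj \<nu> - \<mu>) \<cdot> integral {0..pi} (%x. ctranspose (U x) ** Y x)"
 proof -
  have "continuous_on {0..pi} (%x. ctranspose (U x) ** Y x)"
   by (intro mm.continuous_on bounded_linear.continuous_on[OF bounded_linear_ctranspose]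
     primitive_on_continuous[OF p(1)] primitive_on_continuous[OF p(3)])
  then have "(%x. ctranspose (U x) ** Y x) integrable_on {0..pi}" by (rule integrable_continuous_real)
  from integral_linear[OF this ms.bounded_linear_right[of "cnj \<nu> - \<mu>"]] show ?thesis by (simp add: o_def)
 qed
 finally have "integral {0..pi} ?G = (cnj \<nu> - \<mu>) \<cdot> integral {0..pi} (%x. ctranspose (U x) ** Y x)" .
 with primitive_on_diff[OF r, of 0 pi] show ?thesis by (simp add: algebra_simps)
qed

end

section \<open>Kernels, determinants and inverses of matrices\<close>

lemma norm_matvec_le: "norm ((A::complex^'n^'m) *v x) <= norm A * norm x"
proof (rule power2_le_imp_le)
 have nx: "(norm x)^2 = (\<Sum>j\<in>UNIV. (cmod (x$j))^2)" unfolding norm_vec_def L2_set_def by (simp add: sum_nonneg)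
 have ny: "(norm (A *v x))^2 = (\<Sum>i\<in>UNIV. (cmod ((A *v x)$i))^2)"
  unfolding norm_vec_def L2_set_def by (simp add: sum_nonneg)
 have 1: "(cmod ((A *v x) $ i))^2 <= (\<Sum>j\<in>UNIV. (cmod (A$i$j))^2) * (\<Sum>j\<in>UNIV. (cmod (x$j))^2)" for i
 proof -
  have "cmod ((A *v x) $ i) <= (\<Sum>j\<in>UNIV. cmod (A$i$j) * cmod (x$j))"
   unfolding matrix_vector_mult_def by (simp add: norm_mult[symmetric] sum_norm_le)
  then have "(cmod ((A *v x) $ i))^2 <= (\<Sum>j\<in>UNIV. cmod (A$i$j) * cmod (x$j))^2" by (intro power_mono) auto
  also have "... <= (\<Sum>j\<in>UNIV. (cmod (A$i$j))^2) * (\<Sum>j\<in>UNIV. (cmod (x$j))^2)"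
   by (rule Cauchy_Schwarz_ineq_sum)
  finally show ?thesis .
 qed
 show "(norm (A *v x))^2 <= (norm A * norm x)^2" unfolding power_mult_distrib nx ny norm_matrix_sq
  by (subst sum_distrib_right) (rule sum_mono[OF 1])
qed simp

lemma matrix_inv_inverse:
 fixes A :: "'a::field^'n^'n"
 assumes "det A ~= 0"
 shows "A ** matrix_inv A = mat 1" "matrix_inv A ** A = mat 1"
proof -
 have "invertible A" using assms invertible_det_nz by blast
 then have "\<exists>A'. A ** A' = mat 1 & A' ** A = mat 1" unfolding invertible_def .
 from someI_ex[OF this] show "A ** matrix_inv A = mat 1" "matrix_inv A ** A = mat 1" unfolding matrix_inv_def by auto
qed

lemma matrix_inv_eqI:
 fixes A :: "'a::field^'n^'n"
 assumes "A ** B = mat 1"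
 shows "matrix_inv A = B" "det A ~= 0"
proof -
 show d: "det A ~= 0" using assms det_mul[of A B] by auto
 have "matrix_inv A = matrix_inv A ** (A ** B)" unfolding assms by simp
 also have "... = B" unfolding matrix_mul_assoc matrix_inv_inverse(2)[OF d] by simp
 finally show "matrix_inv A = B" .
qed

lemma det_eq_0_iff_kernel:
 fixes A :: "complex^'m^'m"
 shows "det A = 0 \<longleftrightarrow> (\<exists>v. v ~= 0 & A *v v = 0)"
proof
 assume "det A = 0"
 then have "\<not> (\<exists>B. B ** A = mat 1)" using det_mul[of _ A] by (metis det_I mult_zero_right zero_neq_one)
 then show "\<exists>v. v ~= 0 & A *v v = 0" unfolding matrix_left_invertible_ker by auto
next
 assume "\<exists>v. v ~= 0 & A *v v = 0"
 then obtain v where v: "v ~= 0" "A *v v = 0" by blast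
 show "det A = 0"
 proof (rule ccontr)
  assume d: "det A ~= 0"
  have "v = matrix_inv A *v (A *v v)" by (simp add: matrix_vector_mul_assoc matrix_inv_inverse[OF d])
  then show False using v by simp
 qed
qed

lemma matrix_vector_mult_axis: "(A *v axis k 1) $ i = (A::complex^'n^'m) $ i $ k"
proof -
 have "A $ i $ j * axis k 1 $ j = (if j = k then A $ i $ k else 0)" for j by (simp add: axis_def)
 then show ?thesis by (simp add: matrix_vector_mult_def)
qed

text \<open>Cramer's rule with a unit vector as right-hand side. It exhibits the entries of the
  inverse as quotients of determinants, which is how holomorphy passes to the inverse.\<close>

lemma matrix_inv_entry:
 fixes A :: "complex^'n^'n"
 assumes "det A ~= 0"
 shows "matrix_inv A $ k $ j = det (\<chi> i l. if l = k then axis j 1 $ i else A$i$l) / det A"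
proof -
 have "A *v (matrix_inv A *v axis j 1) = axis j 1" using assms by (simp add: matrix_vector_mul_assoc matrix_inv_inverse)
 then have "matrix_inv A *v axis j 1 = (\<chi> k. det (\<chi> i l. if l = k then axis j 1 $ i else A$i$l) / det A)"
  using cramer[OF assms, of _ "axis j 1"] by blast
 then have "(matrix_inv A *v axis j 1) $ k = det (\<chi> i l. if l = k then axis j 1 $ i else A$i$l) / det A" by simp
 then show ?thesis by (simp only: matrix_vector_mult_axis)
qed

section \<open>Holomorphic matrix functions\<close>

definition mholo :: "(complex => complex^'n^'m) => complex set => bool" where
 "mholo F S \<longleftrightarrow> (\<forall>i j. (%z. F z $ i $ j) holomorphic_on S)"

lemma mholoD: "mholo F S ==> (%z. F z $ i $ j) holomorphic_on S" by (simp add: mholo_def)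

lemma mholo_const [simp]: "mholo (%_. A) S" by (simp add: mholo_def)

lemma mholo_add: "mholo F S ==> mholo G S ==> mholo (%z. F z + G z) S"
 and mholo_diff: "mholo F S ==> mholo G S ==> mholo (%z. F z - G z) S"
 and mholo_minus: "mholo F S ==> mholo (%z. - F z) S"
 and mholo_mscale: "f holomorphic_on S ==> mholo F S ==> mholo (%z. f z \<cdot> F z) S"
 by (auto simp: mholo_def intro!: holomorphic_intros)

lemma mholo_mult:
 fixes F :: "complex => complex^'n^'m" and G :: "complex => complex^'p^'n"
 shows "mholo F S ==> mholo G S ==> mholo (%z. F z ** G z) S"
 by (auto simp: mholo_def matrix_matrix_mult_def intro!: holomorphic_intros)

lemma mholo_subset: "mholo F S ==> T \<subseteq> S ==> mholo F T" by (auto simp: mholo_def intro: holomorphic_on_subset)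

lemma mholo_det: "mholo F S ==> (%z. det (F z)) holomorphic_on S"
 unfolding det_def mholo_def by (intro holomorphic_intros) auto

lemma mholo_inv:
 fixes F :: "complex => complex^'n^'n"
 assumes F: "mholo F S" and d: "\<And>z. z \<in> S ==> det (F z) ~= 0"
 shows "mholo (%z. matrix_inv (F z)) S" unfolding mholo_def
proof (intro allI)
 fix k j
 have "mholo (%z. \<chi> i l. if l = k then axis j 1 $ i else F z$i$l) S" unfolding mholo_def
 proof (intro allI)
  fix i l
  show "(%z. (\<chi> i l. if l = k then axis j 1 $ i else F z$i$l) $ i $ l) holomorphic_on S"
   using mholoD[OF F] by (cases "l = k") auto
 qed
 then have "(%z. det (\<chi> i l. if l = k then axis j 1 $ i else F z$i$l) / det (F z)) holomorphic_on S"
  by (intro holomorphic_intros mholo_det F d)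
 then show "(%z. matrix_inv (F z) $ k $ j) holomorphic_on S" by (rule holomorphic_transform) (simp add: matrix_inv_entry d)
qed

lemma continuous_on_matrixI:
 fixes F :: "'a::topological_space => complex^'n^'m"
 assumes "\<And>i j. continuous_on S (%z. F z $ i $ j)"
 shows "continuous_on S F"
 using assms by (intro continuous_on_vec_lambda[of S "%i z. F z $ i", simplified] continuous_on_vec_lambda[where f="%j z. F z $ i $ j" for i, simplified])

lemma mholo_continuous_on: "mholo F S ==> continuous_on S F"
 by (intro continuous_on_matrixI holomorphic_on_imp_continuous_on mholoD)

section \<open>Simple poles of the inverse of a holomorphic matrix\<close>

definition dmat :: "'n set => complex => complex => complex^'n^'n" where
 "dmat I a b = (\<chi> i j. if i = j then (if j \<in> I then a else b) else 0)"

lemma mult_dmat: "(A ** dmat I a b) $ i $ j = A $ i $ j * (if j \<in> I then a else b)"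
proof -
 have "A $ i $ k * dmat I a b $ k $ j = (if k = j then A $ i $ j * (if j \<in> I then a else b) else 0)" for k
  by (simp add: dmat_def)
 then show ?thesis by (simp add: matrix_matrix_mult_def)
qed

lemma dmat_vector: "(dmat I a b *v v) $ j = (if j \<in> I then a else b) * v $ j"
proof -
 have "dmat I a b $ j $ k * v $ k = (if k = j then (if j \<in> I then a else b) * v $ j else 0)" for k by (simp add: dmat_def)
 then show ?thesis by (simp add: matrix_vector_mult_def)
qed

lemma dmat_mult: "dmat I a b ** dmat I c d = dmat I (a * c) (b * d)"
 by (auto simp: vec_eq_iff mult_dmat) (auto simp: dmat_def)

lemma det_dmat: "det (dmat I a b) = a ^ card I * b ^ card (- I)"
proof -
 have "det (dmat I a b) = (\<Prod>j\<in>UNIV. if j \<in> I then a else b)" by (subst det_diagonal) (auto simp: dmat_def)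
 also have "... = a ^ card I * b ^ card (- I)" by (simp add: prod.If_cases Compl_eq_Diff_UNIV)
 finally show ?thesis .
qed

text \<open>A basis of the kernel is extended to the whole space and its vectors become the columns
  of \<open>P\<close>; \<open>I\<close> marks the columns from the kernel. The last conclusion
  describes the kernel as the image under \<open>P\<close> of the vectors supported in
  \<open>I\<close>.\<close>

lemma kernel_adapted_basis:
 fixes A :: "complex^'m^'m"
 obtains P I where "det P ~= 0" "card I = vec.dim {v. A *v v = 0}" "\<And>i j. j \<in> I ==> (A ** P) $ i $ j = 0"
  "\<And>v. A *v v = 0 ==> \<exists>u. v = P *v u & (\<forall>j. j \<notin> I --> u $ j = 0)"
proof -
 define V where "V = {v. A *v v = 0}"
 obtain B where B: "B \<subseteq> V" "vec.independent B" "V \<subseteq> vec.span B" "card B = vec.dim V"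
  using vec.basis_exists by blast
 obtain C where C: "B \<subseteq> C" "vec.independent C" "UNIV \<subseteq> vec.span C"
  using vec.maximal_independent_subset_extend[of B UNIV] B by auto
 have finC: "finite C" using C vec.finiteI_independent by blast
 have "vec.span C = UNIV" using C(3) by auto
 then have "card C = CARD('m)" using vec.dim_eq_card[of C UNIV] C(2) by (simp add: vec.dim_UNIV card_cart_basis)
 then obtain f where f: "bij_betw f (UNIV::'m set) C" using finite_same_card_bij[of "UNIV::'m set" C] finC by auto
 define P :: "complex^'m^'m" where "P = (\<chi> i j. f j $ i)"
 define I where "I = {j. f j \<in> B}"
 have colP: "column j P = f j" for j unfolding P_def column_def by (simp add: vec_eq_iff)
 have Pv: "P *v u = (\<Sum>j\<in>UNIV. u $ j *s f j)" for u
  by (simp add: vec_eq_iff matrix_vector_mult_def P_def sum_component mult.commute)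
 show thesis
 proof (rule that[of P I])
  have "columns P = C" unfolding columns_def colP using f by (auto simp: bij_betw_def)
  then have "\<exists>B. P ** B = mat 1" unfolding matrix_right_invertible_span_columns using C(3) by auto
  then show "det P ~= 0" using matrix_inv_eqI(2) by blast
  have "bij_betw f I B" unfolding I_def using f C(1) by (auto simp: bij_betw_def inj_on_def)
  then show "card I = vec.dim {v. A *v v = 0}" using B(4) bij_betw_same_card unfolding V_def by metis
  show "(A ** P) $ i $ j = 0" if "j \<in> I" for i j
  proof -
   have "A *v f j = 0" using that B(1) unfolding I_def V_def by auto
   then have "(A *v f j) $ i = 0" by simp
   then show ?thesis unfolding matrix_matrix_mult_def matrix_vector_mult_def P_def by simp
  qed
  fix v assume "A *v v = 0"
  then have "v \<in> vec.span B" using B(3) unfolding V_def by auto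
  moreover have "vec.span B \<subseteq> {P *v u | u. \<forall>j. j \<notin> I --> u $ j = 0}"
  proof (rule vec.span_minimal)
   show "B \<subseteq> {P *v u | u. \<forall>j. j \<notin> I --> u $ j = 0}"
   proof
    fix b assume b: "b \<in> B"
    then obtain j where j: "f j = b" using f C(1) unfolding bij_betw_def by (metis imageE subsetD)
    have "b = P *v axis j 1" by (simp add: vec_eq_iff matrix_vector_mult_axis P_def j[symmetric])
    moreover have "\<forall>k. k \<notin> I --> axis j (1::complex) $ k = 0" using b j unfolding I_def axis_def by auto
    ultimately show "b \<in> {P *v u | u. \<forall>j. j \<notin> I --> u $ j = 0}" by blast
   qed
   show "vec.subspace {P *v u | u. \<forall>j. j \<notin> I --> u $ j = 0}"
   proof (rule vec.subspaceI)
    show "0 \<in> {P *v u | u. \<forall>j. j \<notin> I --> u $ j = 0}" by (auto intro!: exI[of _ 0])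
   next
    fix x y assume "x \<in> {P *v u | u. \<forall>j. j \<notin> I --> u $ j = 0}" "y \<in> {P *v u | u. \<forall>j. j \<notin> I --> u $ j = 0}"
    then obtain u w where "x = P *v u" "y = P *v w" "\<forall>j. j \<notin> I --> u $ j = 0" "\<forall>j. j \<notin> I --> w $ j = 0" by auto
    then show "x + y \<in> {P *v u | u. \<forall>j. j \<notin> I --> u $ j = 0}"
     by (intro CollectI exI[of _ "u + w"]) (simp add: matrix_vector_right_distrib)
   next
    fix c x assume "x \<in> {P *v u | u. \<forall>j. j \<notin> I --> u $ j = 0}"
    then obtain u where "x = P *v u" "\<forall>j. j \<notin> I --> u $ j = 0" by auto
    then show "c *s x \<in> {P *v u | u. \<forall>j. j \<notin> I --> u $ j = 0}"
     by (intro CollectI exI[of _ "c *s u"]) (simp add: vec.scale)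
   qed
  qed
  ultimately show "\<exists>u. v = P *v u & (\<forall>j. j \<notin> I --> u $ j = 0)" by blast
 qed
qed

text \<open>Dividing the columns of \<open>N(z) P\<close> that vanish at \<open>z\<^sub>0\<close> by \<open>z - z\<^sub>0\<close> gives \<open>G(z)\<close>.
 The growth bound on \<open>N\<^sup>-\<^sup>1\<close> along the vertical ray forces \<open>G(z\<^sub>0)\<close> to be invertible.\<close>

lemma simple_pole_matrix_inverse:
 fixes N :: "complex => complex^'m^'m"
 assumes S: "open S" "z0 \<in> S" and N: "mholo N S" and c: "c > 0" "e0 > 0"
  and bound: "\<And>t v. 0 < t ==> t < e0 ==> c * t * norm v <= norm (N (z0 + \<i> * complex_of_real t) *v v)"
 obtains r B where "r > 0" "ball z0 r \<subseteq> S" "\<And>z. z \<in> ball z0 r - {z0} ==> det (N z) ~= 0"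
  "mholo B (ball z0 r)" "\<And>z. z \<in> ball z0 r - {z0} ==> B z = (z - z0) \<cdot> matrix_inv (N z)"
  "N z0 ** B z0 = 0" "zorder (%z. det (N z)) z0 = int (vec.dim {v. N z0 *v v = 0})"
proof -
 obtain P I where PI: "det P ~= 0" "card I = vec.dim {v. N z0 *v v = 0}"
  "\<And>i j. j \<in> I ==> (N z0 ** P) $ i $ j = 0"
  "\<And>v. N z0 *v v = 0 ==> \<exists>u. v = P *v u & (\<forall>j. j \<notin> I --> u $ j = 0)"
  using kernel_adapted_basis[of "N z0"] by blast
 define Q where "Q = (%z. N z ** P)"
 have Q: "mholo Q S" unfolding Q_def by (intro mholo_mult N mholo_const)
 define G :: "complex => complex^'m^'m" where
  "G = (%z. \<chi> i j. if j \<in> I then (if z = z0 then deriv (%z. Q z $ i $ j) z0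
                  else (Q z $ i $ j - Q z0 $ i $ j) / (z - z0)) else Q z $ i $ j)"
 have G: "mholo G S" unfolding mholo_def
 proof (intro allI)
  fix i j
  show "(%z. G z $ i $ j) holomorphic_on S" using pole_lemma[OF mholoD[OF Q, of i j], of z0] mholoD[OF Q, of i j] S
   unfolding G_def by (cases "j \<in> I") (auto simp: interior_open)
 qed
 have QG: "Q z = G z ** dmat I (z - z0) 1" if "z \<in> S" for z
 proof -
  have "Q z $ i $ j = (G z ** dmat I (z - z0) 1) $ i $ j" for i j
   using PI(3)[of j i] unfolding mult_dmat G_def by (auto simp: Q_def)
  then show ?thesis by (simp add: vec_eq_iff)
 qed
 have Pinj: "u = w" if "P *v u = P *v w" for u w
 proof -
  have "matrix_inv P *v (P *v u) = matrix_inv P *v (P *v w)" using that by simp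
  then show ?thesis by (simp add: matrix_vector_mul_assoc matrix_inv_inverse PI(1))
 qed
 have G0: "det (G z0) ~= 0"
 proof
  assume "det (G z0) = 0"
  then have "\<not> (\<exists>B. B ** G z0 = mat 1)" using det_mul[of _ "G z0"] by (metis det_I mult_zero_right zero_neq_one)
  then obtain u where u: "G z0 *v u = 0" "u ~= 0" unfolding matrix_left_invertible_ker by auto
  \<comment> \<open>\<open>w t\<close> is chosen so that the diagonal factor at
    \<open>z0 + \<i> t\<close> maps it to the fixed vector \<open>u\<close>; its components in
    \<open>I\<close> grow like \<open>1 / t\<close> unless those of \<open>u\<close> vanish.\<close>
  define w where "w = (%t::real. dmat I (1 / (\<i> * complex_of_real t)) 1 *v u)"
  define \<gamma> where "\<gamma> = (%t::real. z0 + \<i> * complex_of_real t)"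
  define K where "K = norm (matrix_inv P)"
  obtain e1 where e1: "e1 > 0" "ball z0 e1 \<subseteq> S" using S by (meson openE)
  have est: "c * t * norm (w t) <= K * norm (G (\<gamma> t) *v u)" if t: "0 < t" "t < min e0 e1" for t
  proof -
   have \<gamma>: "\<gamma> t \<in> S" "\<gamma> t - z0 = \<i> * complex_of_real t" using e1 t unfolding \<gamma>_def by (auto simp: dist_norm norm_mult subset_iff)
   have "N (\<gamma> t) *v (P *v w t) = Q (\<gamma> t) *v w t" unfolding Q_def by (simp add: matrix_vector_mul_assoc)
   also have "... = G (\<gamma> t) *v (dmat I (\<i> * complex_of_real t) 1 *v w t)"
    unfolding QG[OF \<gamma>(1)] \<gamma>(2) by (simp add: matrix_vector_mul_assoc)
   also have "dmat I (\<i> * complex_of_real t) 1 *v w t = u"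
    unfolding w_def by (simp add: vec_eq_iff dmat_vector) (use t in auto)
   finally have e: "N (\<gamma> t) *v (P *v w t) = G (\<gamma> t) *v u" .
   have "w t = matrix_inv P *v (P *v w t)" by (simp add: matrix_vector_mul_assoc matrix_inv_inverse PI(1))
   then have "norm (w t) <= K * norm (P *v w t)" unfolding K_def by (metis norm_matvec_le)
   then have "c * t * norm (w t) <= K * (c * t * norm (P *v w t))"
    using mult_left_mono[of "norm (w t)" "K * norm (P *v w t)" "c * t"] c t by (simp add: mult_ac)
   also have "... <= K * norm (G (\<gamma> t) *v u)"
    using bound[of t "P *v w t"] e t unfolding \<gamma>_def K_def by (intro mult_left_mono) auto
   finally show ?thesis .
  qed
  have lim: "((%t. K * norm (G (\<gamma> t) *v u)) \<longlongrightarrow> K * norm (G z0 *v u)) (at_right 0)"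
  proof -
   have "((%t. \<gamma> t) \<longlongrightarrow> \<gamma> 0) (at_right 0)" unfolding \<gamma>_def by (intro tendsto_intros)
   then have g: "((%t. \<gamma> t) \<longlongrightarrow> z0) (at_right 0)" unfolding \<gamma>_def by simp
   have Gc: "isCont G z0" using mholo_continuous_on[OF G] S continuous_on_eq_continuous_at by blast
   have "((%t. G (\<gamma> t)) \<longlongrightarrow> G z0) (at_right 0)" by (rule isCont_tendsto_compose[OF Gc g])
   then have "((%t. G (\<gamma> t) *v u) \<longlongrightarrow> G z0 *v u) (at_right 0)"
    unfolding matrix_vector_mult_def by (intro tendsto_vec_lambda tendsto_sum tendsto_mult tendsto_vec_nth tendsto_const)
   then show ?thesis by (intro tendsto_intros)
  qed
  \<comment> \<open>For \<open>j\<close> in \<open>I\<close> the modulus of \<open>u $ j\<close> is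
    \<open>t\<close> times that of \<open>w t $ j\<close>, hence bounded by a multiple of
    \<open>norm (G (\<gamma> t) *v u)\<close>, which tends to 0.\<close>
  have uI: "u $ j = 0" if j: "j \<in> I" for j
  proof -
   have "c * cmod (u $ j) <= K * norm (G z0 *v u)"
   proof (rule tendsto_lowerbound[OF lim])
    have "c * cmod (u $ j) <= K * norm (G (\<gamma> t) *v u)" if t: "0 < t" "t < min e0 e1" for t
    proof -
     have "cmod (u $ j) = t * cmod (w t $ j)" unfolding w_def dmat_vector using j t by (simp add: norm_mult norm_divide)
     also have "... <= t * norm (w t)" using t by (intro mult_left_mono Finite_Cartesian_Product.norm_nth_le) auto
     finally have "c * cmod (u $ j) <= c * (t * norm (w t))" using c by (intro mult_left_mono) auto
     also have "... <= K * norm (G (\<gamma> t) *v u)" using est[OF t] by (simp add: mult.assoc)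
     finally show ?thesis .
    qed
    then show "\<forall>\<^sub>F t in at_right 0. c * cmod (u $ j) <= K * norm (G (\<gamma> t) *v u)"
     unfolding eventually_at_right_field using c e1 by (intro exI[of _ "min e0 e1"]) auto
   qed simp
   then have "c * cmod (u $ j) <= 0" using u by simp
   then show ?thesis using c by (simp add: mult_le_0_iff)
  qed
  \<comment> \<open>As \<open>u\<close> vanishes on \<open>I\<close>, the diagonal factor acts on it
    trivially, so \<open>P *v u\<close> lies in the kernel of \<open>N z0\<close>. The kernel
    consists of images of vectors supported in \<open>I\<close>, which forces
    \<open>u = 0\<close>.\<close>
  have "Q z0 *v u = G z0 *v u" unfolding QG[OF S(2)] matrix_vector_mul_assoc[symmetric]
   by (rule arg_cong[where f="%x. G z0 *v x"]) (use uI in \<open>auto simp: vec_eq_iff dmat_vector\<close>)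
  then have "N z0 *v (P *v u) = 0" using u unfolding Q_def by (simp add: matrix_vector_mul_assoc)
  from PI(4)[OF this] obtain u' where u': "P *v u = P *v u'" "\<And>j. j \<notin> I ==> u' $ j = 0" by auto
  have "u = u'" by (rule Pinj[OF u'(1)])
  then have "u = 0" using uI u'(2) by (simp add: vec_eq_iff) metis
  then show False using u by simp
 qed
 have "continuous_on S (%z. det (G z))" by (intro holomorphic_on_imp_continuous_on mholo_det G)
 then have "isCont (%z. det (G z)) z0" using S continuous_on_eq_continuous_at by blast
 then obtain r0 where r0: "r0 > 0" "\<And>z. dist z0 z < r0 ==> det (G z) ~= 0"
  using continuous_at_avoid[of z0 "%z. det (G z)" 0] G0 by auto
 obtain r1 where r1: "r1 > 0" "ball z0 r1 \<subseteq> S" using S by (meson openE)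
 define r where "r = min r0 r1"
 have r: "r > 0" "ball z0 r \<subseteq> S" "\<And>z. z \<in> ball z0 r ==> det (G z) ~= 0"
  using r0 r1 unfolding r_def by auto
 \<comment> \<open>The two diagonal matrices have product \<open>(z - z0) \<cdot> mat 1\<close>, so
   this is a holomorphic continuation of \<open>(z - z0)\<close> times the inverse of
   \<open>N z\<close>.\<close>
 define B where "B = (%z. P ** dmat I 1 (z - z0) ** matrix_inv (G z))"
 have NB: "N z ** B z = (z - z0) \<cdot> mat 1" if z: "z \<in> ball z0 r" for z
 proof -
  have "N z ** B z = Q z ** dmat I 1 (z - z0) ** matrix_inv (G z)" unfolding B_def Q_def by (simp add: matrix_mul_assoc)
  also have "... = G z ** (dmat I (z - z0) 1 ** dmat I 1 (z - z0)) ** matrix_inv (G z)"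
   using QG[of z] z r by (auto simp: matrix_mul_assoc)
  also have "dmat I (z - z0) 1 ** dmat I 1 (z - z0) = (z - z0) \<cdot> mat 1"
   unfolding dmat_mult by (simp add: vec_eq_iff dmat_def mat_def)
  finally show ?thesis using matrix_inv_inverse[OF r(3)[OF z]] by (simp add: mscale_mult_left mscale_mult_right)
 qed
 have detN: "det (N z) = (det (G z) / det P) * (z - z0) ^ card I" if z: "z \<in> ball z0 r" for z
 proof -
  have "det (N z) * det P = det (Q z)" unfolding Q_def by (simp add: det_mul)
  also have "... = det (G z) * (z - z0) ^ card I" using QG[of z] z r by (auto simp: det_mul det_dmat)
  finally show ?thesis using PI(1) by (simp add: field_simps)
 qed
 show thesis
 proof (rule that[of r B])
  show "r > 0" "ball z0 r \<subseteq> S" by (fact r)+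
  show "det (N z) ~= 0" if "z \<in> ball z0 r - {z0}" for z using detN[of z] that r(3)[of z] PI(1) by auto
  have "mholo (%z. dmat I 1 (z - z0)) (ball z0 r)" unfolding mholo_def
  proof (intro allI)
   fix i j
   show "(%z. dmat I 1 (z - z0) $ i $ j) holomorphic_on ball z0 r"
    unfolding dmat_def by (cases "i = j"; cases "j \<in> I") (auto intro!: holomorphic_intros)
  qed
  then show "mholo B (ball z0 r)" unfolding B_def by (intro mholo_mult mholo_const mholo_inv mholo_subset[OF G r(2)] r(3))
  show "B z = (z - z0) \<cdot> matrix_inv (N z)" if z: "z \<in> ball z0 r - {z0}" for z
  proof -
   have "N z ** ((1 / (z - z0)) \<cdot> B z) = mat 1" using NB[of z] z by (simp add: mscale_mult_right)
   from matrix_inv_eqI(1)[OF this] show ?thesis using z by simp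
  qed
  show "N z0 ** B z0 = 0" using NB[of z0] r(1) by (simp add: ms.zero_left)
  show "zorder (%z. det (N z)) z0 = int (vec.dim {v. N z0 *v v = 0})"
  proof (rule zorder_eqI[of "ball z0 r" z0 "%z. det (G z) / det P"])
   show "(%z. det (G z) / det P) holomorphic_on ball z0 r"
    by (intro holomorphic_intros mholo_det mholo_subset[OF G r(2)]) (rule PI(1))
   show "det (N w) = det (G w) / det P * (w - z0) powi int (vec.dim {v. N z0 *v v = 0})"
    if "w \<in> ball z0 r" "w ~= z0" for w using detN[OF that(1)] PI(2) by simp
  qed (use r G0 PI(1) in auto)
 qed
qed

section \<open>The boundary value problem\<close>

text \<open>The passage from \<open>(Y, Z)\<close> to the boundary data
  \<open>T Y + T-perp Z\<close> and \<open>T (Z - H Y) - T-perp Y\<close> preserves the symplectic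
  form, because \<open>T\<close> and \<open>H\<close> are Hermitian and \<open>H\<close> acts within
  the range of \<open>T\<close>. The Lagrange bracket therefore keeps its shape in the new
  coordinates.\<close>

lemma boundary_bracket:
 fixes T H :: "complex^'m^'m" and Y Z :: "complex^'p^'m" and U W :: "complex^'q^'m"
 assumes T: "ctranspose T = T" "T ** T = T" and H: "ctranspose H = H" "T ** H = H" "H ** T = H"
 shows "ctranspose U ** Z - ctranspose W ** Y =
  ctranspose (T ** U + (mat 1 - T) ** W) ** (T ** (Z - H ** Y) - (mat 1 - T) ** Y) -
  ctranspose (T ** (W - H ** U) - (mat 1 - T) ** U) ** (T ** Y + (mat 1 - T) ** Z)"
proof -
 have TT: "A ** T ** T = A ** T" for A :: "complex^'m^'q" by (simp add: matrix_mul_assoc[symmetric] T)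
 have TH: "A ** T ** H = A ** H" for A :: "complex^'m^'q" by (simp add: matrix_mul_assoc[symmetric] H)
 have HT: "A ** H ** T = A ** H" for A :: "complex^'m^'q" by (simp add: matrix_mul_assoc[symmetric] H)
 show ?thesis by (simp add: ctranspose_add ctranspose_diff ctranspose_mult T H mm.add_left mm.add_right
    mm.diff_left mm.diff_right matrix_mul_assoc TT TH HT algebra_simps)
qed

text \<open>The boundary data are full coordinates: here they recover \<open>Y\<close> and
  \<open>Z\<close>, and \<open>boundary_data_inverse\<close> shows that they can be
  prescribed.\<close>

lemma boundary_data:
 fixes T H :: "complex^'m^'m" and Y Z :: "complex^'p^'m"
 assumes T: "T ** T = T" and H: "T ** H = H" "H ** T = H"
 defines "d \<equiv> T ** (Z - H ** Y) - (mat 1 - T) ** Y" and "c \<equiv> T ** Y + (mat 1 - T) ** Z"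
 shows "Y = T ** c - (mat 1 - T) ** d" "Z = (mat 1 - T) ** c + H ** c + T ** d" unfolding c_def d_def
 by (simp_all add: mm.add_left mm.add_right mm.diff_left mm.diff_right matrix_mul_assoc T H algebra_simps)

lemma boundary_data_inverse:
 fixes T H :: "complex^'m^'m" and c d :: "complex^'p^'m"
 assumes T: "T ** T = T" and H: "T ** H = H" "H ** T = H"
 defines "Y \<equiv> T ** c - (mat 1 - T) ** d" and "Z \<equiv> (mat 1 - T) ** c + H ** c + T ** d"
 shows "T ** (Z - H ** Y) - (mat 1 - T) ** Y = d" "T ** Y + (mat 1 - T) ** Z = c" unfolding Y_def Z_def
 by (simp_all add: mm.add_left mm.add_right mm.diff_left mm.diff_right matrix_mul_assoc T H algebra_simps)

text \<open>A vector as a one-column matrix, so that the statements about matrix solutions apply to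
  it with \<open>'p = 1\<close>.\<close>

definition colm :: "complex^'m => complex^1^'m" where "colm v = (\<chi> i j. v $ i)"

lemma mult_colm: "A ** colm v = colm (A *v v)"
 by (simp add: vec_eq_iff colm_def matrix_matrix_mult_def matrix_vector_mult_def)

lemma colm_inj [simp]: "colm v = colm w \<longleftrightarrow> v = w" by (auto simp: vec_eq_iff colm_def)

lemma colm_zero [simp]: "colm 0 = 0" by (simp add: vec_eq_iff colm_def)

lemma colm_surj: "\<exists>v. C = colm v" by (intro exI[of _ "\<chi> i. C $ i $ 1"]) (simp add: vec_eq_iff colm_def)

lemma norm_colm [simp]: "norm (colm v) = norm v"
proof -
 have "(norm (colm v))^2 = (norm v)^2" unfolding norm_matrix_sq by (simp add: colm_def norm_vec_def L2_set_def sum_nonneg)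
 then show ?thesis by (simp add: power2_eq_iff_nonneg)
qed

lemma ctranspose_mult_self: "(ctranspose Y ** Y) $ 1 $ 1 = complex_of_real ((norm (Y::complex^1^'m))^2)"
proof -
 have "(ctranspose Y ** Y) $ 1 $ 1 = (\<Sum>i\<in>UNIV. cnj (Y $ i $ 1) * Y $ i $ 1)" by (simp add: matrix_matrix_mult_def)
 also have "... = (\<Sum>i\<in>UNIV. complex_of_real ((cmod (Y $ i $ 1))^2))"
  by (intro sum.cong refl) (simp only: complex_norm_square mult.commute)
 also have "... = complex_of_real ((norm Y)^2)" unfolding norm_matrix_sq by simp
 finally show ?thesis .
qed

lemma quadratic_form_eq: "(\<Sum>i\<in>UNIV. cnj (v $ i) * (A *v v) $ i) = (ctranspose (colm v) ** (A ** colm v)) $ 1 $ 1"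
proof -
 have "(ctranspose (colm v) ** colm w) $ 1 $ 1 = (\<Sum>i\<in>UNIV. cnj (v $ i) * w $ i)" for w
  by (simp add: matrix_matrix_mult_def colm_def)
 then show ?thesis by (simp only: mult_colm)
qed

lemma integral_entry:
 fixes F :: "real => complex^'n^'m"
 assumes "F integrable_on S"
 shows "integral S F $ i $ j = integral S (%x. F x $ i $ j)"
proof -
 have "bounded_linear (%A::complex^'n^'m. A $ i $ j)"
  by (intro bounded_linear_compose[OF bounded_linear_vec_nth] bounded_linear_vec_nth)
 from integral_linear[OF assms this] show ?thesis by (simp add: o_def)
qed

locale sl_problem = sl_potential \<sigma> for \<sigma> :: "real => complex^'m^'m" +
 fixes T1 T2 H1 H2 :: "complex^'m^'m"
 assumes herm: "AE x in lebesgue_on {0<..<pi}. \<sigma> x = ctranspose (\<sigma> x)"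
  and T1: "T1 = ctranspose T1" "T1 = T1 ** T1"
  and T2: "T2 = ctranspose T2" "T2 = T2 ** T2"
  and H1: "H1 = ctranspose H1" "H1 = T1 ** H1 ** T1"
  and H2: "H2 = ctranspose H2" "H2 = T2 ** H2 ** T2"
begin

abbreviation "emult \<equiv> eigen_mult \<sigma> T1 T2 H1 H2"
abbreviation "weyl \<equiv> weyl_matrix \<sigma> T1 T2 H1 H2"

lemma T1_simps: "ctranspose T1 = T1" "T1 ** T1 = T1"
 and T2_simps: "ctranspose T2 = T2" "T2 ** T2 = T2"
 and H1_simps: "ctranspose H1 = H1"
 and H2_simps: "ctranspose H2 = H2"
 using T1(1)[symmetric] T1(2)[symmetric] T2(1)[symmetric] T2(2)[symmetric] H1(1)[symmetric] H2(1)[symmetric] by auto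

lemma T1H1: "T1 ** H1 = H1" "H1 ** T1 = H1"
proof -
 have "T1 ** (T1 ** H1 ** T1) = T1 ** H1 ** T1" by (simp add: matrix_mul_assoc T1_simps)
 then show "T1 ** H1 = H1" unfolding H1(2)[symmetric] .
 have "T1 ** H1 ** T1 ** T1 = T1 ** H1 ** T1" by (simp add: matrix_mul_assoc[symmetric] T1_simps)
 then show "H1 ** T1 = H1" unfolding H1(2)[symmetric] .
qed

lemma T2H2: "T2 ** H2 = H2" "H2 ** T2 = H2"
proof -
 have "T2 ** (T2 ** H2 ** T2) = T2 ** H2 ** T2" by (simp add: matrix_mul_assoc T2_simps)
 then show "T2 ** H2 = H2" unfolding H2(2)[symmetric] .
 have "T2 ** H2 ** T2 ** T2 = T2 ** H2 ** T2" by (simp add: matrix_mul_assoc[symmetric] T2_simps)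
 then show "H2 ** T2 = H2" unfolding H2(2)[symmetric] .
qed

text \<open>\<open>phi\<close> and \<open>psi\<close> form the fundamental system dual to the
  boundary coordinates at 0: the data (\<open>V1\<close>, \<open>V1_perp\<close>) are (0, I) for
  \<open>phi\<close> and (I, 0) for \<open>psi\<close>.\<close>

definition phi where "phi \<mu> x = fst (sol \<mu> T1 (mat 1 - T1 + H1) x)"
definition phi' where "phi' \<mu> x = snd (sol \<mu> T1 (mat 1 - T1 + H1) x)"
definition psi where "psi \<mu> x = fst (sol \<mu> (- (mat 1 - T1)) T1 x)"
definition psi' where "psi' \<mu> x = snd (sol \<mu> (- (mat 1 - T1)) T1 x)"

definition V2_perp :: "(real => complex^'p^'m) => (real => complex^'p^'m) => complex^'p^'m" where
 "V2_perp Y Z = T2 ** Y pi + (mat 1 - T2) ** Z pi"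

definition Nmat :: "complex => complex^'m^'m" where "Nmat \<mu> = V2 T2 H2 (phi \<mu>) (phi' \<mu>)"

definition Smat :: "complex => complex^'m^'m" where "Smat \<mu> = V2 T2 H2 (psi \<mu>) (psi' \<mu>)"

lemma phi_system: "sl_system \<sigma> \<mu> (phi \<mu>) (phi' \<mu>)"
 and psi_system: "sl_system \<sigma> \<mu> (psi \<mu>) (psi' \<mu>)"
 unfolding phi_def[abs_def] phi'_def[abs_def] psi_def[abs_def] psi'_def[abs_def] by (rule sol_system)+

lemma phi_0: "phi \<mu> 0 = T1" "phi' \<mu> 0 = mat 1 - T1 + H1"
 and psi_0: "psi \<mu> 0 = - (mat 1 - T1)" "psi' \<mu> 0 = T1" by (simp_all add: phi_def phi'_def psi_def psi'_def sol_0)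

lemma phi_boundary: "V1 T1 H1 (phi \<mu>) (phi' \<mu>) = 0" "V1_perp T1 (phi \<mu>) (phi' \<mu>) = mat 1"
 using boundary_data_inverse[of T1 H1 "mat 1" 0] T1_simps T1H1 by (simp_all add: V1_def V1_perp_def phi_0 mm.zero_right)

lemma psi_boundary: "V1 T1 H1 (psi \<mu>) (psi' \<mu>) = mat 1" "V1_perp T1 (psi \<mu>) (psi' \<mu>) = 0"
 using boundary_data_inverse[of T1 H1 0 "mat 1"] T1_simps T1H1 by (simp_all add: V1_def V1_perp_def psi_0 mm.zero_right)

lemma V_linear:
 fixes Y Z U W :: "real => complex^'q^'m" and C D :: "complex^'p^'q"
 shows "V1 T1 H1 (%x. Y x ** C + U x ** D) (%x. Z x ** C + W x ** D) = V1 T1 H1 Y Z ** C + V1 T1 H1 U W ** D"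
  and "V1_perp T1 (%x. Y x ** C + U x ** D) (%x. Z x ** C + W x ** D) = V1_perp T1 Y Z ** C + V1_perp T1 U W ** D"
  and "V2 T2 H2 (%x. Y x ** C + U x ** D) (%x. Z x ** C + W x ** D) = V2 T2 H2 Y Z ** C + V2 T2 H2 U W ** D"
  and "V2_perp (%x. Y x ** C + U x ** D) (%x. Z x ** C + W x ** D) = V2_perp Y Z ** C + V2_perp U W ** D"
 by (simp_all add: V1_def V1_perp_def V2_def V2_perp_def mm.add_left mm.add_right mm.diff_left mm.diff_right
   matrix_mul_assoc algebra_simps)

text \<open>Both sides have the same initial values by \<open>boundary_data\<close>, and solutions
  are unique. Thus the boundary data at 0 are the coefficients in the fundamental system.\<close>

lemma general_solution:
 fixes Y Z :: "real => complex^'p^'m"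
 assumes Y: "sl_system \<sigma> \<mu> Y Z" and x: "x \<in> {0..pi}"
 shows "Y x = phi \<mu> x ** V1_perp T1 Y Z + psi \<mu> x ** V1 T1 H1 Y Z"
  and "Z x = phi' \<mu> x ** V1_perp T1 Y Z + psi' \<mu> x ** V1 T1 H1 Y Z"
proof -
 let ?c = "V1_perp T1 Y Z" and ?d = "V1 T1 H1 Y Z"
 let ?U = "%x. phi \<mu> x ** ?c + psi \<mu> x ** ?d" and ?W = "%x. phi' \<mu> x ** ?c + psi' \<mu> x ** ?d"
 have U: "sl_system \<sigma> \<mu> ?U ?W" by (intro sl_system_add sl_system_mult phi_system psi_system)
 note bd = boundary_data[OF T1_simps(2) T1H1, where Y="Y 0" and Z="Z 0", folded V1_def V1_perp_def]
 have "Y 0 = ?U 0" "Z 0 = ?W 0" using bd by (simp_all add: phi_0 psi_0 mm.add_left mm.minus_left mm.diff_left)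
 then have "(Y x, Z x) = (?U x, ?W x)" using sl_system_eq_sol[OF Y x] sl_system_eq_sol[OF U x] by simp
 then show "Y x = ?U x" "Z x = ?W x" by auto
qed

lemma lagrange_boundary:
 fixes Y Z :: "real => complex^'p^'m" and U W :: "real => complex^'q^'m"
 assumes Y: "sl_system \<sigma> \<mu> Y Z" and U: "sl_system \<sigma> \<nu> U W"
 shows "ctranspose (V2_perp U W) ** V2 T2 H2 Y Z - ctranspose (V2 T2 H2 U W) ** V2_perp Y Z
  - (ctranspose (V1_perp T1 U W) ** V1 T1 H1 Y Z - ctranspose (V1 T1 H1 U W) ** V1_perp T1 Y Z)
  = (cnj \<nu> - \<mu>) \<cdot> integral {0..pi} (%x. ctranspose (U x) ** Y x)"
 unfolding lagrange_identity[OF herm Y U, symmetric]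
  boundary_bracket[OF T2_simps H2_simps T2H2, of "U pi" "Z pi" "W pi" "Y pi"]
  boundary_bracket[OF T1_simps H1_simps T1H1, of "U 0" "Z 0" "W 0" "Y 0"]
  V1_def V2_def V1_perp_def V2_perp_def ..

lemma sl_system_continuous:
 "sl_system \<sigma> \<mu> Y Z ==> continuous_on {0..pi} Y" "sl_system \<sigma> \<mu> Y Z ==> continuous_on {0..pi} Z"
 unfolding sl_system_def using primitive_on_continuous by blast+

lemma phi_mult_system: "sl_system \<sigma> \<mu> (%x. phi \<mu> x ** C) (%x. phi' \<mu> x ** C)"
 by (rule sl_system_mult[OF phi_system])

lemma phi_mult_boundary: "V1 T1 H1 (%x. phi \<mu> x ** C) (%x. phi' \<mu> x ** C) = 0"
 "V1_perp T1 (%x. phi \<mu> x ** C) (%x. phi' \<mu> x ** C) = C"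
 "V2 T2 H2 (%x. phi \<mu> x ** C) (%x. phi' \<mu> x ** C) = Nmat \<mu> ** C"
 "V2_perp (%x. phi \<mu> x ** C) (%x. phi' \<mu> x ** C) = V2_perp (phi \<mu>) (phi' \<mu>) ** C"
 using V_linear[of "phi \<mu>" C "phi \<mu>" 0 "phi' \<mu>" "phi' \<mu>"]
 by (simp_all add: mm.zero_right mm.zero_left phi_boundary Nmat_def)

lemma Nmat_holo: "mholo Nmat S" and Smat_holo: "mholo Smat S" and V2_perp_phi_holo: "mholo (%\<mu>. V2_perp (phi \<mu>) (phi' \<mu>)) S"
proof -
 have p: "mholo (%\<mu>. phi \<mu> pi) S" "mholo (%\<mu>. phi' \<mu> pi) S" "mholo (%\<mu>. psi \<mu> pi) S" "mholo (%\<mu>. psi' \<mu> pi) S"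
  unfolding mholo_def phi_def phi'_def psi_def psi'_def by (auto intro!: sol_holomorphic)
 show "mholo Nmat S" "mholo Smat S" "mholo (%\<mu>. V2_perp (phi \<mu>) (phi' \<mu>)) S"
  unfolding Nmat_def[abs_def] Smat_def[abs_def] V2_def V2_perp_def by (intro mholo_diff mholo_add mholo_mult mholo_const p)+
qed

text \<open>If \<open>Y = phi C\<close> vanishes, the integral equation for \<open>Y\<close> leaves
  a quasi-derivative with zero integral over every \<open>{0..x}\<close>; being continuous, it
  vanishes at 0. So the boundary data at 0 vanish, and \<open>C\<close> is one of them.\<close>

lemma phi_mult_nontrivial:
 fixes C :: "complex^'p^'m"
 assumes "\<And>x. x \<in> {0..pi} ==> phi \<mu> x ** C = 0"
 shows "C = 0"
proof -
 let ?Y = "%x. phi \<mu> x ** C" and ?Z = "%x. phi' \<mu> x ** C"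
 have s: "primitive_on 0 pi ?Y (%x. \<sigma> x ** ?Y x + ?Z x)"
  using phi_mult_system[of \<mu> C] unfolding sl_system_def by blast
 have Zc: "continuous_on {0..pi} ?Z" by (rule sl_system_continuous(2)[OF phi_mult_system])
 have I: "integral {0..x} ?Z = 0" if x: "x \<in> {0..pi}" for x
 proof -
  have "?Y x - ?Y 0 = integral {0..x} (%x. \<sigma> x ** ?Y x + ?Z x)" by (rule primitive_on_diff[OF s]) (use x in auto)
  also have "... = integral {0..x} ?Z" by (rule integral_cong) (use x assms in \<open>auto simp: mm.zero_right\<close>)
  finally show ?thesis using assms x by auto
 qed
 have Z0: "?Z 0 = 0"
 proof -
  have "((%x. integral {0..x} ?Z) has_vector_derivative ?Z 0) (at 0 within {0..pi})"
   by (rule integral_has_vector_derivative[OF Zc]) simp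
  moreover have "((%x. integral {0..x} ?Z) has_vector_derivative 0) (at 0 within {0..pi})"
   by (rule has_vector_derivative_transform[OF _ _ has_vector_derivative_const[of 0]]) (use I in auto)
  ultimately show ?thesis by (intro vector_derivative_unique_within[of 0 "{0..pi}" "%x. integral {0..x} ?Z"])
     (auto simp: trivial_limit_within islimpt_Icc not_le)
 qed
 have "V1_perp T1 ?Y ?Z = 0" unfolding V1_perp_def using assms[of 0] Z0 by (simp add: mm.zero_right)
 then show ?thesis unfolding phi_mult_boundary .
qed

section \<open>Coercivity of the characteristic matrix off the real axis\<close>

definition energy :: "complex => complex^'m => real" where
 "energy \<mu> v = integral {0..pi} (%x. (norm (phi \<mu> x ** colm v))^2)"

lemma phi_mult_continuous: "continuous_on {0..pi} (%x. phi \<mu> x ** C)"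
 by (rule sl_system_continuous(1)[OF phi_mult_system])

lemma energy_integrable: "(%x. (norm (phi \<mu> x ** colm v))^2) integrable_on {0..pi}"
 by (intro integrable_continuous_real continuous_intros phi_mult_continuous)

text \<open>Lagrange's identity of \<open>phi v\<close> with itself. The bracket at 0 vanishes since
  \<open>V1\<close> does, and the bracket at \<open>pi\<close> contains
  \<open>Nmat \<mu> *v v\<close> as a factor in both terms.\<close>

lemma energy_bound:
 "2 * \<bar>Im \<mu>\<bar> * energy \<mu> v <= 2 * norm (V2_perp (phi \<mu>) (phi' \<mu>)) * norm v * norm (Nmat \<mu> *v v)"
proof -
 let ?Y = "%x. phi \<mu> x ** colm v" and ?e = "V2_perp (phi \<mu>) (phi' \<mu>) ** colm v" and ?b = "Nmat \<mu> ** colm v"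
 have "(%x. ctranspose (?Y x) ** ?Y x) integrable_on {0..pi}"
  by (intro integrable_continuous_real mm.continuous_on bounded_linear.continuous_on[OF bounded_linear_ctranspose] phi_mult_continuous)
 then have "integral {0..pi} (%x. ctranspose (?Y x) ** ?Y x) $ 1 $ 1 = integral {0..pi} (%x. complex_of_real ((norm (?Y x))^2))"
  by (simp add: integral_entry ctranspose_mult_self)
 also have "... = complex_of_real (energy \<mu> v)"
  using integral_linear[OF energy_integrable[of \<mu> v] bounded_linear_of_real[where 'a=complex]] unfolding energy_def by (simp add: o_def)
 finally have I: "integral {0..pi} (%x. ctranspose (?Y x) ** ?Y x) $ 1 $ 1 = complex_of_real (energy \<mu> v)" .
 have e0: "0 <= energy \<mu> v" unfolding energy_def by (rule integral_nonneg[OF energy_integrable]) simp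
 have "ctranspose ?e ** ?b - ctranspose ?b ** ?e = (cnj \<mu> - \<mu>) \<cdot> integral {0..pi} (%x. ctranspose (?Y x) ** ?Y x)"
  using lagrange_boundary[OF phi_mult_system[of \<mu> "colm v"] phi_mult_system[of \<mu> "colm v"]]
  by (simp add: phi_mult_boundary mm.zero_right mm.zero_left)
 then have "(ctranspose ?e ** ?b - ctranspose ?b ** ?e) $ 1 $ 1 = (cnj \<mu> - \<mu>) * complex_of_real (energy \<mu> v)"
  using I by simp
 moreover have "cnj \<mu> - \<mu> = - 2 * \<i> * complex_of_real (Im \<mu>)" by (simp add: complex_eq_iff)
 ultimately have "cmod ((ctranspose ?e ** ?b - ctranspose ?b ** ?e) $ 1 $ 1) = 2 * \<bar>Im \<mu>\<bar> * energy \<mu> v"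
  using e0 by (simp add: norm_mult)
 then have "2 * \<bar>Im \<mu>\<bar> * energy \<mu> v <= norm (ctranspose ?e ** ?b - ctranspose ?b ** ?e)"
  using cmod_entry_le[of "ctranspose ?e ** ?b - ctranspose ?b ** ?e" 1 1] by simp
 also have "... <= norm ?e * norm ?b + norm ?b * norm ?e" by (rule order_trans[OF norm_triangle_ineq4 add_mono])
    (use norm_matmul_le[of "ctranspose ?e" ?b] norm_matmul_le[of "ctranspose ?b" ?e] in simp_all)
 also have "... = 2 * norm ?e * norm (Nmat \<mu> *v v)" by (simp add: mult_colm)
 also have "... <= 2 * (norm (V2_perp (phi \<mu>) (phi' \<mu>)) * norm v) * norm (Nmat \<mu> *v v)"
  using norm_matmul_le[of "V2_perp (phi \<mu>) (phi' \<mu>)" "colm v"] by (intro mult_right_mono mult_left_mono) auto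
 finally show ?thesis by (simp add: mult.assoc)
qed

lemma energy_pos:
 assumes "v ~= 0"
 shows "energy \<mu> v > 0"
proof -
 have e0: "0 <= energy \<mu> v" unfolding energy_def by (rule integral_nonneg[OF energy_integrable]) simp
 moreover have "energy \<mu> v ~= 0"
 proof
  assume "energy \<mu> v = 0"
  then have z: "((%x. (norm (phi \<mu> x ** colm v))^2) has_integral 0) (cbox 0 pi)"
   using energy_integrable[of \<mu> v] unfolding energy_def by (metis box_real(2) integrable_integral)
  have "phi \<mu> x ** colm v = 0" if x: "x \<in> {0..pi}" for x
  proof -
   have "(norm (phi \<mu> x ** colm v))^2 = 0" by (rule has_integral_0_cbox_imp_0[OF _ _ z])
      (use x in \<open>auto intro!: continuous_intros phi_mult_continuous simp: box_real not_le[THEN iffD2, OF pi_gt_zero]\<close>)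
   then show ?thesis by simp
  qed
  then have "colm v = 0" by (rule phi_mult_nontrivial)
  then show False using assms colm_inj[of v 0] by simp
 qed
 ultimately show ?thesis by simp
qed

lemma det_Nmat_nonreal:
 assumes "Im \<mu> ~= 0"
 shows "det (Nmat \<mu>) ~= 0"
proof
 assume "det (Nmat \<mu>) = 0"
 then obtain v where v: "Nmat \<mu> *v v = 0" "v ~= 0" unfolding det_eq_0_iff_kernel by blast
 have "2 * \<bar>Im \<mu>\<bar> * energy \<mu> v <= 0" using energy_bound[of \<mu> v] v by simp
 moreover have "2 * \<bar>Im \<mu>\<bar> * energy \<mu> v > 0" using energy_pos[OF v(2)] assms by simp
 ultimately show False by simp
qed

end

section \<open>Conjugation of vectors and the rank of Hermitian matrices\<close>

definition cnjv :: "complex^'n => complex^'n" where "cnjv v = (\<chi> i. cnj (v $ i))"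

lemma cnjv_cnjv [simp]: "cnjv (cnjv v) = v" by (simp add: cnjv_def vec_eq_iff)

lemma cnjv_span: "v \<in> vec.span S ==> cnjv v \<in> vec.span (cnjv ` S)"
proof (induction rule: vec.span_induct_alt)
 case base
 have "cnjv 0 = (0::complex^'a)" by (simp add: cnjv_def vec_eq_iff)
 then show ?case by (simp add: vec.span_zero)
next
 case (step c x y)
 have "cnjv (c *s x + y) = cnj c *s cnjv x + cnjv y" by (simp add: cnjv_def vec_eq_iff)
 then show ?case using step by (simp add: vec.span_add vec.span_scale vec.span_base)
qed

text \<open>Conjugation is only semilinear, so the dimension formula for linear images does not
  apply directly; a basis is transported by hand, conjugation being an involution that maps spans to
  spans.\<close>

lemma dim_cnjv_image: "vec.dim (cnjv ` S) = vec.dim S"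
proof -
 obtain B where B: "B \<subseteq> S" "vec.independent B" "S \<subseteq> vec.span B" "card B = vec.dim S"
  using vec.basis_exists by blast
 have inj: "inj (cnjv :: complex^'a => _)" by (metis cnjv_cnjv injI)
 show ?thesis
 proof (rule vec.dim_unique[of "cnjv ` B"])
  show "cnjv ` B \<subseteq> cnjv ` S" using B by auto
  show "cnjv ` S \<subseteq> vec.span (cnjv ` B)" using B(3) cnjv_span by auto
  show "card (cnjv ` B) = vec.dim S" using B(4) inj by (simp add: card_image inj_on_subset)
  show "vec.independent (cnjv ` B)" unfolding vec.dependent_def
  proof
   assume "\<exists>a\<in>cnjv ` B. a \<in> vec.span (cnjv ` B - {a})"
   then obtain b where b: "b \<in> B" "cnjv b \<in> vec.span (cnjv ` B - {cnjv b})" by auto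
   have "cnjv ` B - {cnjv b} = cnjv ` (B - {b})" using inj by (auto simp: inj_def)
   then have "b \<in> vec.span (cnjv ` cnjv ` (B - {b}))" using cnjv_span[OF b(2)] by simp
   then have "b \<in> vec.span (B - {b})" by (simp add: image_image)
   then show False using b(1) B(2) unfolding vec.dependent_def by blast
  qed
 qed
qed

section \<open>Weight matrices\<close>

text \<open>\<open>rank\<close> unfolds to the dimension of the row space. The rows of a Hermitian
  matrix are the conjugates of its columns, so this is the dimension of the column space, that is of
  the range.\<close>

lemma rank_hermitian:
 fixes A :: "complex^'n^'n"
 assumes "ctranspose A = A"
 shows "rank A = vec.dim (range (%v. A *v v))"
proof -
 have "row i A = cnjv (column i A)" for i using assms by (simp add: vec_eq_iff row_def column_def cnjv_def)
 then have "rows A = cnjv ` columns A" unfolding rows_def columns_def by auto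
 then have "rank A = vec.dim (columns A)" unfolding row_rank_def_gen by (simp add: dim_cnjv_image)
 also have "vec.dim (columns A) = vec.dim (range (%v. A *v v))"
 proof -
  have "column i A = A *v axis i 1" for i by (simp add: vec_eq_iff column_def matrix_vector_mult_axis)
  then have "columns A \<subseteq> range (%v. A *v v)" unfolding columns_def by auto
  moreover have "range (%v. A *v v) \<subseteq> vec.span (columns A)" using matrix_vector_mult_in_columnspace_gen by auto
  ultimately show ?thesis by (intro antisym vec.dim_mono) (auto intro: vec.span_base)
 qed
 finally show ?thesis .
qed

section \<open>Local lower bounds, the Weyl matrix and multiplicities\<close>

context sl_problem
begin

lemma sol_pair_diff_le:
 assumes R: "cmod \<mu> <= R" "cmod \<nu> <= R" and x: "x \<in> {0..pi}"
 shows "norm (phi \<mu> x - phi \<nu> x) <= sol_const R * (pi * (cmod (\<mu> - \<nu>) * (sol_const R * norm (T1, mat 1 - T1 + H1))))"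
 unfolding phi_def by (rule order_trans[OF _ sol_lipschitz[OF R(2,1) x]]) (metis fst_diff norm_fst_le prod.collapse)

text \<open>At \<open>\<mu>0\<close> the energy is continuous and positive on the compact unit
  sphere, which gives a constant; homogeneity extends it to all vectors and the Lipschitz bound for
  \<open>phi\<close> to nearby \<mu>.\<close>

lemma energy_lower_bound:
 obtains q e0 where "q > 0" "e0 > 0" "\<And>\<mu> v. cmod (\<mu> - \<mu>0) < e0 ==> q * (norm v)^2 <= energy \<mu> v"
proof -
 define R where "R = cmod \<mu>0 + 1"
 define L where "L = sol_const R * (pi * (sol_const R * norm (T1, mat 1 - T1 + H1)))"
 have L0: "0 <= L" unfolding L_def using less_imp_le[OF sol_const_pos] by (intro mult_nonneg_nonneg) auto
 have lip: "norm (phi \<mu> x - phi \<mu>0 x) <= L * cmod (\<mu> - \<mu>0)" if "cmod (\<mu> - \<mu>0) < 1" "x \<in> {0..pi}" for \<mu> x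
 proof -
  have "cmod \<mu> <= R" "cmod \<mu>0 <= R" using that norm_triangle_ineq[of "\<mu> - \<mu>0" \<mu>0] unfolding R_def by auto
  from sol_pair_diff_le[OF this that(2)] show ?thesis unfolding L_def by (simp add: mult_ac)
 qed
 have scale: "energy \<mu> (c *\<^sub>R v) = c^2 * energy \<mu> v" for \<mu> c v
 proof -
  have "colm (c *\<^sub>R v) = c *\<^sub>R colm v" for v :: "complex^'m" by (simp add: colm_def vec_eq_iff)
  then show ?thesis unfolding energy_def by (simp add: mm.scaleR_right power_mult_distrib)
 qed
 \<comment> \<open>The inequality \<open>(p + q)^2 <= 2 * p^2 + 2 * q^2\<close> under the integral,
   \<open>q\<close> being the Lipschitz bound for the change of \<open>phi\<close>.\<close>
 have cmp: "energy \<mu>0 v <= 2 * energy \<mu> v + 2 * pi * (L * cmod (\<mu> - \<mu>0) * norm v)^2"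
  if \<mu>: "cmod (\<mu> - \<mu>0) < 1" for \<mu> v
 proof -
  have "energy \<mu>0 v <= integral {0..pi} (%x. 2 * (norm (phi \<mu> x ** colm v))^2 + 2 * (L * cmod (\<mu> - \<mu>0) * norm v)^2)"
   unfolding energy_def
  proof (rule integral_le[OF energy_integrable])
   show "(%x. 2 * (norm (phi \<mu> x ** colm v))^2 + 2 * (L * cmod (\<mu> - \<mu>0) * norm v)^2) integrable_on {0..pi}"
    by (intro integrable_add integrable_on_mult_right energy_integrable integrable_const_ivl)
   fix x assume x: "x \<in> {0..pi}"
   have "norm ((phi \<mu> x - phi \<mu>0 x) ** colm v) <= L * cmod (\<mu> - \<mu>0) * norm v"
    by (rule order_trans[OF norm_matmul_le]) (simp add: mult_right_mono lip[OF \<mu> x])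
   moreover have "norm (phi \<mu>0 x ** colm v) <= norm (phi \<mu> x ** colm v) + norm ((phi \<mu> x - phi \<mu>0 x) ** colm v)"
    using norm_triangle_ineq4[of "phi \<mu> x ** colm v" "(phi \<mu> x - phi \<mu>0 x) ** colm v"] by (simp add: mm.diff_left)
   ultimately have "(norm (phi \<mu>0 x ** colm v))^2 <= (norm (phi \<mu> x ** colm v) + L * cmod (\<mu> - \<mu>0) * norm v)^2"
    by (intro power_mono) auto
   also have "... <= 2 * (norm (phi \<mu> x ** colm v))^2 + 2 * (L * cmod (\<mu> - \<mu>0) * norm v)^2"
    using sum_squares_bound[of "norm (phi \<mu> x ** colm v)" "L * cmod (\<mu> - \<mu>0) * norm v"] by (simp add: power2_sum)
   finally show "(norm (phi \<mu>0 x ** colm v))^2 <= 2 * (norm (phi \<mu> x ** colm v))^2 + 2 * (L * cmod (\<mu> - \<mu>0) * norm v)^2" .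
  qed
  also have "... = 2 * energy \<mu> v + 2 * pi * (L * cmod (\<mu> - \<mu>0) * norm v)^2"
   unfolding energy_def by (subst integral_add) (auto intro!: integrable_on_mult_right energy_integrable integrable_const_ivl)
  finally show ?thesis .
 qed
 have "continuous_on UNIV (energy \<mu>0)"
 proof -
  have "bounded_linear (colm :: complex^'m => _)"
   by (rule bounded_linear_intro[where K=1]) (simp_all add: colm_def vec_eq_iff, metis colm_def norm_colm order_refl)
  then have c: "continuous_on UNIV (colm :: complex^'m => _)" by (rule linear_continuous_on)
  have "continuous_on (UNIV \<times> cbox 0 pi) (%(v::complex^'m, x). (norm (phi \<mu>0 x ** colm v))^2)"
  proof -
   have p: "continuous_on {0..pi} (phi \<mu>0)" by (rule sl_system_continuous(1)[OF phi_system])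
   have "continuous_on (UNIV \<times> {0..pi}) (%z::(complex^'m)\<times>real. phi \<mu>0 (snd z))"
    by (rule continuous_on_compose2[OF p]) (auto intro!: continuous_intros)
   moreover have "continuous_on (UNIV \<times> {0..pi}) (%z::(complex^'m)\<times>real. colm (fst z))"
    by (rule continuous_on_compose2[OF c]) (auto intro!: continuous_intros)
   ultimately show ?thesis unfolding case_prod_unfold box_real by (intro continuous_intros mm.continuous_on)
  qed
  then have "continuous_on UNIV (%v. integral (cbox 0 pi) (%x. (norm (phi \<mu>0 x ** colm v))^2))"
   by (rule integral_continuous_on_param)
  then show ?thesis unfolding energy_def[abs_def] by (simp add: box_real)
 qed
 then have "continuous_on (sphere 0 1) (energy \<mu>0)" by (rule continuous_on_subset) auto
 moreover have "sphere (0::complex^'m) 1 ~= {}" by simp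
 ultimately obtain v0 where v0: "v0 \<in> sphere 0 1" "\<And>v. v \<in> sphere 0 1 ==> energy \<mu>0 v0 <= energy \<mu>0 v"
  using continuous_attains_inf[of "sphere 0 1" "energy \<mu>0"] compact_sphere by blast
 define q0 where "q0 = energy \<mu>0 v0"
 have q0: "q0 > 0" unfolding q0_def using v0(1) by (intro energy_pos) auto
 have low: "q0 * (norm v)^2 <= energy \<mu>0 v" for v
 proof (cases "v = 0")
  case False
  have "v = norm v *\<^sub>R ((1 / norm v) *\<^sub>R v)" using False by simp
  then have "energy \<mu>0 v = (norm v)^2 * energy \<mu>0 ((1 / norm v) *\<^sub>R v)" by (metis scale)
  moreover have "q0 <= energy \<mu>0 ((1 / norm v) *\<^sub>R v)" unfolding q0_def using False by (intro v0(2)) simp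
  ultimately show ?thesis using mult_left_mono[of q0 "energy \<mu>0 ((1 / norm v) *\<^sub>R v)" "(norm v)^2"]
   by (simp add: mult.commute)
 next
  case True
  then show ?thesis using scale[of \<mu>0 0 0] by simp
 qed
 \<comment> \<open>Within this radius the perturbation term is at most half of
   \<open>q0 * (norm v)^2\<close>; \<open>cmp\<close> then leaves the constant
   \<open>q0 / 4\<close>. The summand 1 covers \<open>L = 0\<close>.\<close>
 define e0 where "e0 = min 1 (sqrt (q0 / (4 * pi * (L^2 + 1))))"
 have e0: "e0 > 0" unfolding e0_def using q0 by (auto intro!: divide_pos_pos mult_pos_pos add_nonneg_pos)
 show thesis
 proof (rule that[of "q0 / 4" e0])
  show "q0 / 4 > 0" "e0 > 0" using q0 e0 by auto
  fix \<mu> and v :: "complex^'m" assume \<mu>: "cmod (\<mu> - \<mu>0) < e0"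
  have "(cmod (\<mu> - \<mu>0))^2 <= q0 / (4 * pi * (L^2 + 1))"
  proof -
   have "(cmod (\<mu> - \<mu>0))^2 <= (sqrt (q0 / (4 * pi * (L^2 + 1))))^2"
    using \<mu> unfolding e0_def by (intro power_mono) auto
   also have "... = q0 / (4 * pi * (L^2 + 1))" using q0 by (intro real_sqrt_pow2) (auto intro!: divide_nonneg_nonneg mult_nonneg_nonneg)
   finally show ?thesis .
  qed
  then have "4 * pi * (L^2 + 1) * (cmod (\<mu> - \<mu>0))^2 <= q0"
   using pi_gt_zero by (subst (asm) pos_le_divide_eq) (auto simp: mult_ac intro!: mult_pos_pos add_nonneg_pos)
  moreover have "4 * pi * L^2 * (cmod (\<mu> - \<mu>0))^2 <= 4 * pi * (L^2 + 1) * (cmod (\<mu> - \<mu>0))^2"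
   by (intro mult_right_mono mult_left_mono) auto
  ultimately have "4 * pi * L^2 * (cmod (\<mu> - \<mu>0))^2 <= q0" by linarith
  then have "4 * pi * L^2 * (cmod (\<mu> - \<mu>0))^2 * (norm v)^2 <= q0 * (norm v)^2" by (rule mult_right_mono) simp
  then have "2 * pi * (L * cmod (\<mu> - \<mu>0) * norm v)^2 <= q0 * (norm v)^2 / 2" by (simp add: power_mult_distrib mult_ac)
  then show "q0 / 4 * (norm v)^2 <= energy \<mu> v" using low[of v] cmp[of \<mu> v] \<mu> unfolding e0_def by simp
 qed
qed

text \<open>\<open>energy_bound\<close> with imaginary part \<open>t\<close>, combined with the
  local lower bound for the energy and a local bound for \<open>V2_perp\<close> of
  \<open>phi\<close>. This is the ray hypothesis of
  \<open>simple_pole_matrix_inverse\<close>.\<close>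

lemma Nmat_ray_bound:
 fixes l :: real
 obtains c e0 where "c > 0" "e0 > 0"
  "\<And>t v. 0 < t ==> t < e0 ==> c * t * norm v <= norm (Nmat (complex_of_real l + \<i> * complex_of_real t) *v v)"
proof -
 obtain q e0 where q: "q > 0" "e0 > 0"
  "\<And>\<mu> v. cmod (\<mu> - complex_of_real l) < e0 ==> q * (norm v)^2 <= energy \<mu> v" using energy_lower_bound by blast
 have "continuous_on (cball (complex_of_real l) e0) (%\<mu>. V2_perp (phi \<mu>) (phi' \<mu>))"
  by (rule mholo_continuous_on[OF V2_perp_phi_holo])
 then have "bounded ((%\<mu>. V2_perp (phi \<mu>) (phi' \<mu>)) ` cball (complex_of_real l) e0)"
  by (intro compact_imp_bounded compact_continuous_image) auto
 then obtain K where K: "K > 0" "\<And>\<mu>. \<mu> \<in> cball (complex_of_real l) e0 ==> norm (V2_perp (phi \<mu>) (phi' \<mu>)) <= K"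
  unfolding bounded_pos by blast
 show thesis
 proof (rule that[of "q / K" e0])
  fix t :: real and v :: "complex^'m" assume t: "0 < t" "t < e0"
  let ?\<mu> = "complex_of_real l + \<i> * complex_of_real t"
  have d: "cmod (?\<mu> - complex_of_real l) < e0" using t by (simp add: norm_mult)
  then have d': "?\<mu> \<in> cball (complex_of_real l) e0" by (simp add: dist_norm norm_minus_commute)
  show "q / K * t * norm v <= norm (Nmat ?\<mu> *v v)"
  proof (cases "v = 0")
   case False
   have "2 * t * (q * (norm v)^2) <= 2 * \<bar>Im ?\<mu>\<bar> * energy ?\<mu> v" using q(3)[OF d] t by simp
   also have "... <= 2 * norm (V2_perp (phi ?\<mu>) (phi' ?\<mu>)) * norm v * norm (Nmat ?\<mu> *v v)" by (rule energy_bound)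
   also have "... <= 2 * K * norm v * norm (Nmat ?\<mu> *v v)" by (intro mult_right_mono mult_left_mono K(2)[OF d']) auto
   finally have "norm v * (q * t * norm v) <= norm v * (K * norm (Nmat ?\<mu> *v v))" by (simp add: power2_eq_square mult_ac)
   then have "q * t * norm v <= K * norm (Nmat ?\<mu> *v v)" using False by simp
   then show ?thesis using K(1) by (simp add: field_simps)
  qed simp
 qed (use q K in auto)
qed

text \<open>With \<open>V1 = mat 1\<close> a Weyl solution must be \<open>phi M + psi\<close>, where
  \<open>M\<close> is its \<open>V1_perp\<close>; the condition at \<open>pi\<close> becomes
  \<open>Nmat M + Smat = 0\<close>, which has one solution when \<open>Nmat\<close> is
  invertible.\<close>

lemma weyl_matrix_eq:
 assumes d: "det (Nmat \<mu>) ~= 0"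
 shows "weyl_solution \<sigma> T1 T2 H1 H2 \<mu> (%x. phi \<mu> x ** (- (matrix_inv (Nmat \<mu>) ** Smat \<mu>)) + psi \<mu> x ** mat 1)
   (%x. phi' \<mu> x ** (- (matrix_inv (Nmat \<mu>) ** Smat \<mu>)) + psi' \<mu> x ** mat 1)" (is "weyl_solution _ _ _ _ _ _ ?F ?G")
  and "weyl \<mu> = - (matrix_inv (Nmat \<mu>) ** Smat \<mu>)"
proof -
 let ?M = "- (matrix_inv (Nmat \<mu>) ** Smat \<mu>)"
 have s: "sl_system \<sigma> \<mu> ?F ?G" by (intro sl_system_add sl_system_mult phi_system psi_system)
 have NM: "Nmat \<mu> ** ?M + Smat \<mu> = 0" using matrix_inv_inverse(1)[OF d] by (simp add: mm.minus_right matrix_mul_assoc)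
 show w: "weyl_solution \<sigma> T1 T2 H1 H2 \<mu> ?F ?G" unfolding weyl_solution_def solves_ell_iff
  using s NM by (simp only: V_linear phi_boundary psi_boundary flip: Nmat_def Smat_def) (simp add: mm.zero_left)
 have p: "V1_perp T1 ?F ?G = ?M" by (simp only: V_linear phi_boundary psi_boundary) (simp add: mm.zero_left)
 show "weyl \<mu> = ?M" unfolding weyl_matrix_def
 proof (rule the_equality)
  show "\<exists>\<Phi> \<Psi>. weyl_solution \<sigma> T1 T2 H1 H2 \<mu> \<Phi> \<Psi> & ?M = V1_perp T1 \<Phi> \<Psi>"
   using w p[symmetric] by blast
 next
  fix M assume "\<exists>\<Phi> \<Psi>. weyl_solution \<sigma> T1 T2 H1 H2 \<mu> \<Phi> \<Psi> & M = V1_perp T1 \<Phi> \<Psi>"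
  then obtain Y Z where YZ: "sl_system \<sigma> \<mu> Y Z" "V1 T1 H1 Y Z = mat 1" "V2 T2 H2 Y Z = 0" "M = V1_perp T1 Y Z"
   unfolding weyl_solution_def solves_ell_iff by auto
  have g: "Y pi = phi \<mu> pi ** M + psi \<mu> pi ** mat 1" "Z pi = phi' \<mu> pi ** M + psi' \<mu> pi ** mat 1"
   using general_solution[OF YZ(1), of pi] YZ by auto
  have "V2 T2 H2 Y Z = V2 T2 H2 (%x. phi \<mu> x ** M + psi \<mu> x ** mat 1) (%x. phi' \<mu> x ** M + psi' \<mu> x ** mat 1)"
   unfolding V2_def g ..
  also have "... = Nmat \<mu> ** M + Smat \<mu>" by (simp only: V_linear flip: Nmat_def Smat_def) simp
  finally have "Nmat \<mu> ** M = - Smat \<mu>" using YZ(3) by (simp add: eq_neg_iff_add_eq_0)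
  then have "matrix_inv (Nmat \<mu>) ** (Nmat \<mu> ** M) = matrix_inv (Nmat \<mu>) ** (- Smat \<mu>)" by simp
  then show "M = ?M" using matrix_inv_inverse(2)[OF d] by (simp add: matrix_mul_assoc mm.minus_right)
 qed
qed

text \<open>Mapping \<open>v\<close> to \<open>phi v\<close>, extended by 0 outside
  \<open>{0..pi}\<close>, is linear, injective by \<open>phi_mult_nontrivial\<close>, and carries
  the kernel of \<open>Nmat \<mu>\<close> onto the eigenspace.\<close>

lemma eigen_mult_eq: "emult \<mu> = vec.dim {v. Nmat \<mu> *v v = 0}"
proof -
 interpret fs: vector_space "%c (Y::real => complex^1^'m) x. c \<cdot> Y x"
  by unfold_locales (auto simp: fun_eq_iff vec_eq_iff algebra_simps)
 interpret pr: finite_dimensional_vector_space_pair_1 "(*s) :: complex => complex^'m => _" "cart_basis" "%c (Y::real => complex^1^'m) x. c \<cdot> Y x"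
  by unfold_locales
 define f where "f = (%(v::complex^'m) x. if x \<in> {0..pi} then phi \<mu> x ** colm v else 0)"
 have colm_add: "colm (v + w) = colm v + colm w" and colm_scale: "colm (c *s v) = c \<cdot> colm v" for v w :: "complex^'m" and c
  by (simp_all add: colm_def vec_eq_iff)
 have lin: "Vector_Spaces.linear (*s) (%c (Y::real => complex^1^'m) x. c \<cdot> Y x) f" by unfold_locales
    (auto simp: f_def fun_eq_iff colm_add colm_scale mm.add_right mscale_mult_right ms.zero_right)
 have inj: "inj f"
 proof (rule injI)
  fix v w assume "f v = f w"
  then have "phi \<mu> x ** (colm v - colm w) = 0" if "x \<in> {0..pi}" for x
   using that unfolding f_def by (auto simp: fun_eq_iff mm.diff_right split: if_splits)
  then have "colm v - colm w = 0" by (rule phi_mult_nontrivial)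
  then show "v = w" by simp
 qed
 have "eigenspace \<sigma> T1 T2 H1 H2 \<mu> = f ` {v. Nmat \<mu> *v v = 0}"
 proof (intro set_eqI iffI)
  fix Y assume "Y \<in> eigenspace \<sigma> T1 T2 H1 H2 \<mu>"
  then obtain Z where Y: "\<And>x. x \<notin> {0..pi} ==> Y x = 0" "sl_system \<sigma> \<mu> Y Z" "V1 T1 H1 Y Z = 0" "V2 T2 H2 Y Z = 0"
   unfolding eigenspace_def solves_ell_iff by auto
  obtain v where v: "V1_perp T1 Y Z = colm v" using colm_surj by blast
  have g: "Y x = phi \<mu> x ** colm v" "Z x = phi' \<mu> x ** colm v" if "x \<in> {0..pi}" for x
   using general_solution[OF Y(2) that] v Y(3) by (auto simp: mm.zero_right)
  have "V2 T2 H2 Y Z = V2 T2 H2 (%x. phi \<mu> x ** colm v) (%x. phi' \<mu> x ** colm v)"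
   unfolding V2_def using g[of pi] by simp
  then have "Nmat \<mu> ** colm v = 0" using Y(4) by (simp only: phi_mult_boundary)
  then have "Nmat \<mu> *v v = 0" unfolding mult_colm by (metis colm_inj colm_zero)
  moreover have "Y = f v" unfolding f_def using g Y(1) by (auto simp: fun_eq_iff)
  ultimately show "Y \<in> f ` {v. Nmat \<mu> *v v = 0}" by blast
 next
  fix Y assume "Y \<in> f ` {v. Nmat \<mu> *v v = 0}"
  then obtain v where v: "Y = f v" "Nmat \<mu> *v v = 0" by auto
  have eq: "Y x = phi \<mu> x ** colm v" if "x \<in> {0..pi}" for x using that v unfolding f_def by simp
  note p = phi_mult_system[of \<mu> "colm v", unfolded sl_system_def]
  have "sl_system \<sigma> \<mu> Y (%x. phi' \<mu> x ** colm v)" unfolding sl_system_def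
   by (rule conjI, rule primitive_on_cong[OF conjunct1[OF p]], simp_all add: eq)
     (rule primitive_on_cong[OF conjunct2[OF p]], simp_all add: eq)
  moreover have "V1 T1 H1 Y (%x. phi' \<mu> x ** colm v) = V1 T1 H1 (%x. phi \<mu> x ** colm v) (%x. phi' \<mu> x ** colm v)"
   "V2 T2 H2 Y (%x. phi' \<mu> x ** colm v) = V2 T2 H2 (%x. phi \<mu> x ** colm v) (%x. phi' \<mu> x ** colm v)"
   unfolding V1_def V2_def by (simp_all add: eq)
  moreover have "Nmat \<mu> ** colm v = 0" using v(2) by (simp add: mult_colm)
  ultimately have "sl_system \<sigma> \<mu> Y (%x. phi' \<mu> x ** colm v) & V1 T1 H1 Y (%x. phi' \<mu> x ** colm v) = 0
    & V2 T2 H2 Y (%x. phi' \<mu> x ** colm v) = 0" by (simp only: phi_mult_boundary simp_thms)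
  then show "Y \<in> eigenspace \<sigma> T1 T2 H1 H2 \<mu>"
   unfolding eigenspace_def solves_ell_iff using v(1) by (auto simp: f_def)
 qed
 then show ?thesis unfolding eigen_mult_def
  using pr.dim_image_eq[OF lin inj_on_subset[OF inj subset_UNIV], of "{v. Nmat \<mu> *v v = 0}"] by simp
qed

end

section \<open>Residues of the Weyl matrix\<close>

context sl_problem
begin

definition gram :: "complex => complex^'m^'m" where
 "gram \<mu> = integral {0..pi} (%x. ctranspose (phi \<mu> x) ** phi \<mu> x)"

lemma phi_continuous: "continuous_on {0..pi} (phi \<mu>)" by (rule sl_system_continuous(1)[OF phi_system])

lemma gram_integrable: "(%x. ctranspose (phi \<mu> x) ** phi \<mu> x) integrable_on {0..pi}"
 by (intro integrable_continuous_real mm.continuous_on bounded_linear.continuous_on[OF bounded_linear_ctranspose] phi_continuous)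

lemma gram_hermitian: "ctranspose (gram \<mu>) = gram \<mu>"
 using integral_linear[OF gram_integrable bounded_linear_ctranspose, of \<mu>]
 unfolding gram_def by (simp add: o_def ctranspose_mult)

lemma gram_sandwich:
 "ctranspose A ** gram \<mu> ** C = integral {0..pi} (%x. ctranspose (phi \<mu> x ** A) ** (phi \<mu> x ** C))"
proof -
 have "bounded_linear (%X. ctranspose A ** X ** C)"
  by (intro bounded_linear_compose[OF mm.bounded_linear_left mm.bounded_linear_right])
 from integral_linear[OF gram_integrable this, of \<mu>] show ?thesis
  unfolding gram_def by (simp add: o_def ctranspose_mult matrix_mul_assoc)
qed

text \<open>The simple pole lemma applied to \<open>Nmat\<close> at a real point. \<open>A\<close>
  continues \<open>(z - l)\<close> times the Weyl matrix across \<open>l\<close>, so its value there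
  is the residue; \<open>Nmat \<alpha> = 0\<close> says that the columns of \<alpha> are
  coefficients of eigenfunctions.\<close>

lemma residue_data:
 fixes l :: real
 defines "\<alpha> \<equiv> matrix_residue (weyl) (complex_of_real l)"
 shows "\<exists>r A. r > 0 & mholo A (ball (complex_of_real l) r) & A (complex_of_real l) = \<alpha> \<and>
  (\<forall>z\<in>ball (complex_of_real l) r - {complex_of_real l}. det (Nmat z) ~= 0 \<and>
    A z = (z - complex_of_real l) \<cdot> (- (matrix_inv (Nmat z) ** Smat z))) \<and>
  Nmat (complex_of_real l) ** \<alpha> = 0 \<and>
  zorder (%z. det (Nmat z)) (complex_of_real l) = int (emult (complex_of_real l))"
proof -
 let ?l = "complex_of_real l"
 obtain c e0 where c: "c > 0" "e0 > 0"
  "\<And>t v. 0 < t ==> t < e0 ==> c * t * norm v <= norm (Nmat (?l + \<i> * complex_of_real t) *v v)"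
  using Nmat_ray_bound by blast
 have "\<exists>r B. r > 0 & (\<forall>z\<in>ball ?l r - {?l}. det (Nmat z) ~= 0 & B z = (z - ?l) \<cdot> matrix_inv (Nmat z)) \<and>
   mholo B (ball ?l r) & Nmat ?l ** B ?l = 0 & zorder (%z. det (Nmat z)) ?l = int (vec.dim {v. Nmat ?l *v v = 0})"
 proof (rule simple_pole_matrix_inverse[of UNIV ?l Nmat c e0])
  fix r B
  assume "r > 0" "\<And>z. z \<in> ball ?l r - {?l} ==> det (Nmat z) ~= 0" "mholo B (ball ?l r)"
   "\<And>z. z \<in> ball ?l r - {?l} ==> B z = (z - ?l) \<cdot> matrix_inv (Nmat z)"
   "Nmat ?l ** B ?l = 0" "zorder (%z. det (Nmat z)) ?l = int (vec.dim {v. Nmat ?l *v v = 0})"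
  then show ?thesis by blast
 qed (auto intro: c Nmat_holo)
 then obtain r B where rB: "r > 0" "\<And>z. z \<in> ball ?l r - {?l} ==> det (Nmat z) ~= 0"
  "\<And>z. z \<in> ball ?l r - {?l} ==> B z = (z - ?l) \<cdot> matrix_inv (Nmat z)"
  "mholo B (ball ?l r)" "Nmat ?l ** B ?l = 0" "zorder (%z. det (Nmat z)) ?l = int (vec.dim {v. Nmat ?l *v v = 0})" by blast
 define A where "A = (%z. - (B z ** Smat z))"
 have A: "mholo A (ball ?l r)" unfolding A_def by (intro mholo_minus mholo_mult rB Smat_holo)
 have Aeq: "A z = (z - ?l) \<cdot> (- (matrix_inv (Nmat z) ** Smat z))" if "z \<in> ball ?l r - {?l}" for z
  unfolding A_def rB(3)[OF that] by (simp add: mscale_mult_left ms.minus_right)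
 have "residue (%w. weyl w $ i $ j) ?l = A ?l $ i $ j" for i j
 proof -
  have "residue (%w. weyl w $ i $ j) ?l = residue (%w. A w $ i $ j / (w - ?l)) ?l"
  proof (rule residue_cong)
   have "eventually (%w. w \<in> ball ?l r - {?l}) (at ?l)" using rB(1) eventually_at_in_open[of "ball ?l r" ?l] by simp
   then show "eventually (%w. weyl w $ i $ j = A w $ i $ j / (w - ?l)) (at ?l)"
    by eventually_elim (simp add: weyl_matrix_eq(2) rB(2) Aeq)
  qed simp
  also have "... = A ?l $ i $ j" by (rule residue_simple[of "ball ?l r"]) (use rB(1) mholoD[OF A] in auto)
  finally show ?thesis .
 qed
 then have A\<alpha>: "A ?l = \<alpha>" unfolding \<alpha>_def matrix_residue_def by (simp add: vec_eq_iff)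
 have "Nmat ?l ** A ?l = - (Nmat ?l ** B ?l ** Smat ?l)" unfolding A_def by (simp add: mm.minus_right matrix_mul_assoc)
 then have "Nmat ?l ** \<alpha> = 0" unfolding A\<alpha> rB(5) by (simp add: mm.zero_left)
 with rB(1) A A\<alpha> rB(2) Aeq rB(6)[folded eigen_mult_eq] show ?thesis by blast
qed

lemma zorder_det_Nmat: "zorder (%z. det (Nmat z)) (complex_of_real l) = int (emult (complex_of_real l))"
 using residue_data[of l] by blast

text \<open>Lagrange's identity for the Weyl solution at \<open>\<mu>\<close> and the eigenfunctions \<open>phi l C\<close>, in the limit
 \<open>\<mu> \<rightarrow> l\<close>: multiplied by \<open>\<mu> - l\<close>, the Weyl solution tends to \<open>phi l \<alpha>\<close>.\<close>

lemma residue_reproducing: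
 fixes l :: real and C :: "complex^'p^'m"
 defines "\<alpha> \<equiv> matrix_residue (weyl) (complex_of_real l)"
 assumes C: "Nmat (complex_of_real l) ** C = 0"
 shows "C = ctranspose \<alpha> ** gram (complex_of_real l) ** C"
proof -
 let ?l = "complex_of_real l"
 obtain r A where rA: "r > 0" "mholo A (ball ?l r)" "A ?l = \<alpha>" "\<And>z. z \<in> ball ?l r - {?l} ==> det (Nmat z) ~= 0"
  "\<And>z. z \<in> ball ?l r - {?l} ==> A z = (z - ?l) \<cdot> (- (matrix_inv (Nmat z) ** Smat z))"
  unfolding \<alpha>_def using residue_data[of l] by blast
 define R where "R = \<bar>l\<bar> + 1"
 define L where "L = sol_const R * (pi * (sol_const R * norm (T1, mat 1 - T1 + H1)))"
 define K\<phi> where "K\<phi> = sol_const R * norm (T1, mat 1 - T1 + H1)"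
 define K\<psi> where "K\<psi> = sol_const R * norm (- (mat 1 - T1), T1)"
 have pos: "0 <= L" "0 <= K\<phi>" "0 <= K\<psi>"
  unfolding L_def K\<phi>_def K\<psi>_def using less_imp_le[OF sol_const_pos] by (auto intro!: mult_nonneg_nonneg)
 \<comment> \<open>A bound for the distance of \<open>\<mu> - l\<close> times the Weyl solution from
   \<open>phi l \<alpha>\<close>: the variation of \<open>phi\<close>, the variation of
   \<open>A\<close>, and the \<open>psi\<close> part, which has no pole.\<close>
 define \<delta> where "\<delta> = (%\<mu>. L * cmod (\<mu> - ?l) * norm (A \<mu>) + K\<phi> * norm (A \<mu> - \<alpha>) + cmod (\<mu> - ?l) * K\<psi>)"
 have est: "norm (C - ctranspose \<alpha> ** gram ?l ** C) <= pi * (\<delta> \<mu> * (K\<phi> * norm C))"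
  if \<mu>: "\<mu> \<in> ball ?l (min r 1) - {?l}" for \<mu>
 proof -
  have \<mu>r: "\<mu> \<in> ball ?l r - {?l}" and \<mu>1: "cmod (\<mu> - ?l) <= 1" using \<mu> by (auto simp: dist_norm norm_minus_commute)
  have R: "cmod \<mu> <= R" "cmod ?l <= R" using \<mu>1 norm_triangle_ineq[of "\<mu> - ?l" ?l] unfolding R_def by auto
  define M where "M = - (matrix_inv (Nmat \<mu>) ** Smat \<mu>)"
  let ?U = "%x. phi \<mu> x ** M + psi \<mu> x ** mat 1" and ?W = "%x. phi' \<mu> x ** M + psi' \<mu> x ** mat 1"
  let ?Y = "%x. phi ?l x ** C" and ?Z = "%x. phi' ?l x ** C"
  have w: "weyl_solution \<sigma> T1 T2 H1 H2 \<mu> ?U ?W" unfolding M_def by (rule weyl_matrix_eq(1)[OF rA(4)[OF \<mu>r]])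
  then have U: "sl_system \<sigma> \<mu> ?U ?W" "V1 T1 H1 ?U ?W = mat 1" "V2 T2 H2 ?U ?W = 0"
   unfolding weyl_solution_def solves_ell_iff by auto
  \<comment> \<open>Both \<open>V2\<close> forms vanish, so the bracket at \<open>pi\<close> is 0.
    At 0 only the pairing of \<open>V1 = mat 1\<close> of the Weyl solution with
    \<open>V1_perp = C\<close> of the eigenfunctions remains.\<close>
  have "C = (cnj \<mu> - ?l) \<cdot> integral {0..pi} (%x. ctranspose (?U x) ** ?Y x)"
   using lagrange_boundary[OF phi_mult_system[of ?l C] U(1)] unfolding phi_mult_boundary U C
   by (simp add: mm.zero_right mm.zero_left)
  also have "... = integral {0..pi} (%x. ctranspose ((\<mu> - ?l) \<cdot> ?U x) ** ?Y x)"
  proof -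
   have "(%x. ctranspose (?U x) ** ?Y x) integrable_on {0..pi}"
    by (intro integrable_continuous_real mm.continuous_on bounded_linear.continuous_on[OF bounded_linear_ctranspose]
      sl_system_continuous(1)[OF U(1)] phi_mult_continuous)
   from integral_linear[OF this ms.bounded_linear_right[of "cnj \<mu> - ?l"]] show ?thesis
    by (simp add: o_def ctranspose_mscale mscale_mult_left)
  qed
  finally have C1: "C = integral {0..pi} (%x. ctranspose ((\<mu> - ?l) \<cdot> ?U x) ** ?Y x)" .
  have cU: "continuous_on {0..pi} (%x. (\<mu> - ?l) \<cdot> ?U x)"
   by (intro ms.continuous_on continuous_on_const sl_system_continuous(1)[OF U(1)])
  have i1: "(%x. ctranspose ((\<mu> - ?l) \<cdot> ?U x) ** ?Y x) integrable_on {0..pi}"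
   and i2: "(%x. ctranspose (phi ?l x ** \<alpha>) ** ?Y x) integrable_on {0..pi}"
   by (intro integrable_continuous_real mm.continuous_on bounded_linear.continuous_on[OF bounded_linear_ctranspose]
      cU phi_mult_continuous)+
  have "C - ctranspose \<alpha> ** gram ?l ** C = integral {0..pi} (%x. ctranspose ((\<mu> - ?l) \<cdot> ?U x) ** ?Y x)
    - integral {0..pi} (%x. ctranspose (phi ?l x ** \<alpha>) ** ?Y x)" unfolding gram_sandwich using C1 by argo
  also have "... = integral {0..pi} (%x. ctranspose ((\<mu> - ?l) \<cdot> ?U x) ** ?Y x - ctranspose (phi ?l x ** \<alpha>) ** ?Y x)"
   by (rule integral_diff[OF i1 i2, symmetric])
  also have "norm ... <= pi * (\<delta> \<mu> * (K\<phi> * norm C))"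
  proof (rule norm_integral_le_pi[OF integrable_diff[OF i1 i2]])
   have d0: "0 <= \<delta> \<mu>" unfolding \<delta>_def using pos by (intro add_nonneg_nonneg mult_nonneg_nonneg) auto
   then show "0 <= \<delta> \<mu> * (K\<phi> * norm C)" using pos by simp
   fix x assume x: "x \<in> {0..pi}"
   have b1: "norm (phi \<mu> x - phi ?l x) <= L * cmod (\<mu> - ?l)"
    using sol_pair_diff_le[OF R x] unfolding L_def by (simp add: mult_ac)
   have b2: "norm (phi ?l x) <= K\<phi>" unfolding phi_def K\<phi>_def
    by (rule order_trans[OF _ sol_bound[OF R(2) x]]) (metis norm_fst_le prod.collapse)
   have b3: "norm (psi \<mu> x) <= K\<psi>" unfolding psi_def K\<psi>_def
    by (rule order_trans[OF _ sol_bound[OF R(1) x]]) (metis norm_fst_le prod.collapse)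
   have "(\<mu> - ?l) \<cdot> ?U x - phi ?l x ** \<alpha> =
     (phi \<mu> x - phi ?l x) ** A \<mu> + phi ?l x ** (A \<mu> - \<alpha>) + (\<mu> - ?l) \<cdot> psi \<mu> x"
    unfolding rA(5)[OF \<mu>r] M_def by (simp add: ms.add_right mscale_mult_right mm.diff_left mm.diff_right ms.diff_right)
   also have "norm ... <= norm ((phi \<mu> x - phi ?l x) ** A \<mu>) + norm (phi ?l x ** (A \<mu> - \<alpha>)) + norm ((\<mu> - ?l) \<cdot> psi \<mu> x)"
    by (intro norm_triangle_le add_mono norm_triangle_ineq order_refl)
   also have "... <= \<delta> \<mu>" unfolding \<delta>_def norm_mscale
    by (intro add_mono order_trans[OF norm_matmul_le] mult_mono b1 b2 b3 order_refl mult_nonneg_nonneg pos norm_ge_zero)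
   finally have d: "norm ((\<mu> - ?l) \<cdot> ?U x - phi ?l x ** \<alpha>) <= \<delta> \<mu>" .
   have "ctranspose ((\<mu> - ?l) \<cdot> ?U x) ** ?Y x - ctranspose (phi ?l x ** \<alpha>) ** ?Y x =
     ctranspose ((\<mu> - ?l) \<cdot> ?U x - phi ?l x ** \<alpha>) ** ?Y x" by (simp only: ctranspose_diff mm.diff_left)
   also have "norm ... <= norm ((\<mu> - ?l) \<cdot> ?U x - phi ?l x ** \<alpha>) * norm (?Y x)"
    using norm_matmul_le[of "ctranspose ((\<mu> - ?l) \<cdot> ?U x - phi ?l x ** \<alpha>)" "?Y x"] by simp
   also have "... <= \<delta> \<mu> * (K\<phi> * norm C)"
    by (intro mult_mono d order_trans[OF norm_matmul_le] b2 order_refl mult_nonneg_nonneg norm_ge_zero d0 pos)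
   finally show "norm (ctranspose ((\<mu> - ?l) \<cdot> ?U x) ** ?Y x - ctranspose (phi ?l x ** \<alpha>) ** ?Y x) <= \<delta> \<mu> * (K\<phi> * norm C)" .
  qed simp
  finally show ?thesis .
 qed
 have "isCont A ?l" using mholo_continuous_on[OF rA(2)] rA(1)
  by (metis centre_in_ball continuous_on_eq_continuous_at open_ball)
 then have At: "(A \<longlongrightarrow> \<alpha>) (at ?l)" using rA(3) unfolding isCont_def by simp
 have "((%\<mu>. pi * (\<delta> \<mu> * (K\<phi> * norm C))) \<longlongrightarrow>
   pi * ((L * cmod (?l - ?l) * norm \<alpha> + K\<phi> * norm (\<alpha> - \<alpha>) + cmod (?l - ?l) * K\<psi>) * (K\<phi> * norm C))) (at ?l)"
  unfolding \<delta>_def by (intro tendsto_intros At)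
 then have lim: "((%\<mu>. pi * (\<delta> \<mu> * (K\<phi> * norm C))) \<longlongrightarrow> 0) (at ?l)" by simp
 have "norm (C - ctranspose \<alpha> ** gram ?l ** C) <= 0"
 proof (rule tendsto_lowerbound[OF lim])
  have "eventually (%w. w \<in> ball ?l (min r 1) - {?l}) (at ?l)"
   using rA(1) eventually_at_in_open[of "ball ?l (min r 1)" ?l] by simp
  then show "eventually (%\<mu>. norm (C - ctranspose \<alpha> ** gram ?l ** C) <= pi * (\<delta> \<mu> * (K\<phi> * norm C))) (at ?l)"
   by eventually_elim (rule est)
 qed simp
 then show ?thesis by simp
qed

text \<open>The quadratic form of \<alpha> is the integral of the squared norm of
  \<open>phi l \<alpha> v\<close>. For the rank, the range of \<alpha> is the kernel of
  \<open>Nmat\<close>: one inclusion is \<open>Nmat \<alpha> = 0\<close>, and the reproducing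
  formula writes each kernel vector as \<alpha> times something.\<close>

lemma weight_matrix_properties:
 fixes l :: real
 defines "\<alpha> \<equiv> matrix_residue (weyl) (complex_of_real l)"
 shows "nonneg_definite \<alpha>" "rank \<alpha> = emult (complex_of_real l)"
proof -
 let ?l = "complex_of_real l"
 have N\<alpha>: "Nmat ?l ** \<alpha> = 0" unfolding \<alpha>_def using residue_data[of l] by blast
 have rep: "\<alpha> = ctranspose \<alpha> ** gram ?l ** \<alpha>" using residue_reproducing[OF N\<alpha>] unfolding \<alpha>_def .
 have h: "ctranspose \<alpha> = \<alpha>"
 proof -
  have "ctranspose \<alpha> = ctranspose (ctranspose \<alpha> ** gram ?l ** \<alpha>)" using rep by simp
  also have "... = ctranspose \<alpha> ** gram ?l ** \<alpha>" by (simp add: ctranspose_mult gram_hermitian matrix_mul_assoc)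
  also have "... = \<alpha>" by (rule rep[symmetric])
  finally show ?thesis .
 qed
 show "nonneg_definite \<alpha>" unfolding nonneg_definite_def hermitian_def
 proof (intro conjI h allI)
  fix v :: "complex^'m"
  let ?F = "%x. phi ?l x ** (\<alpha> ** colm v)"
  have i: "(%x. ctranspose (?F x) ** ?F x) integrable_on {0..pi}"
   by (intro integrable_continuous_real mm.continuous_on bounded_linear.continuous_on[OF bounded_linear_ctranspose] phi_mult_continuous)
  have "ctranspose (colm v) ** (\<alpha> ** colm v) = ctranspose (colm v) ** ((ctranspose \<alpha> ** gram ?l ** \<alpha>) ** colm v)"
   using rep by simp
  also have "... = ctranspose (\<alpha> ** colm v) ** gram ?l ** (\<alpha> ** colm v)"
   by (simp add: ctranspose_mult matrix_mul_assoc)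
  also have "... = integral {0..pi} (%x. ctranspose (?F x) ** ?F x)" by (rule gram_sandwich)
  finally have "(ctranspose (colm v) ** (\<alpha> ** colm v)) $ 1 $ 1 = integral {0..pi} (%x. complex_of_real ((norm (?F x))^2))"
   using integral_entry[OF i, of 1 1] by (simp only: ctranspose_mult_self)
  also have "... = complex_of_real (integral {0..pi} (%x. (norm (?F x))^2))"
   using integral_linear[OF _ bounded_linear_of_real[where 'a=complex], of "%x. (norm (?F x))^2" "{0..pi}"]
   by (simp add: o_def integrable_continuous_real continuous_intros phi_mult_continuous)
  finally have "(\<Sum>i\<in>UNIV. cnj (v $ i) * (\<alpha> *v v) $ i) = complex_of_real (integral {0..pi} (%x. (norm (?F x))^2))"
   unfolding quadratic_form_eq .
  moreover have "0 <= integral {0..pi} (%x. (norm (?F x))^2)"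
   by (rule integral_nonneg) (auto intro!: integrable_continuous_real continuous_intros phi_mult_continuous)
  ultimately show "0 <= Re (\<Sum>i\<in>UNIV. cnj (v $ i) * (\<alpha> *v v) $ i)" by simp
 qed
 have "range (%v. \<alpha> *v v) = {v. Nmat ?l *v v = 0}"
 proof (intro set_eqI iffI)
  fix w assume "w \<in> range (%v. \<alpha> *v v)"
  then show "w \<in> {v. Nmat ?l *v v = 0}" using N\<alpha> by (auto simp: matrix_vector_mul_assoc)
 next
  fix w assume "w \<in> {v. Nmat ?l *v v = 0}"
  then have "Nmat ?l ** colm w = 0" by (simp add: mult_colm)
  from residue_reproducing[OF this] have "colm w = \<alpha> ** gram ?l ** colm w" using h unfolding \<alpha>_def by simp
  then have "colm w = colm (\<alpha> *v (gram ?l *v w))" by (simp add: mult_colm matrix_vector_mul_assoc)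
  then have "w = \<alpha> *v (gram ?l *v w)" by simp
  then show "w \<in> range (%v. \<alpha> *v v)" by blast
 qed
 then show "rank \<alpha> = emult ?l" unfolding rank_hermitian[OF h] eigen_mult_eq by simp
qed

end

section \<open>Oscillating integrals\<close>

lemma bounded_bilinear_cmult: "bounded_bilinear ((*) :: complex => complex => complex)" by (rule bounded_bilinear_mult)

text \<open>An index combines a frequency with an upper limit of integration. The explicit
  exponentials are replaced by \<open>k_int\<close>: integrals over initial intervals are of order
  1/\<open>size\<close>. Both \<open>J1\<close> and \<open>J2\<close> are then instances, and
  \<open>decays\<close> is uniform in the upper limit.\<close>

locale oscillating_kernel =
 fixes I :: "'i set" and k :: "'i => real => complex" and X size :: "'i => real" and b \<kappa> :: real
 assumes X: "\<And>i. i \<in> I ==> 0 <= X i & X i <= b"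
  and k_cont: "\<And>i. i \<in> I ==> continuous_on {0..b} (k i)"
  and k_bound: "\<And>i t. i \<in> I ==> 0 <= t ==> t <= X i ==> cmod (k i t) <= \<kappa>"
  and k_int: "\<And>i c. i \<in> I ==> 0 <= c ==> c <= X i ==> 0 < size i ==> cmod (integral {0..c} (k i)) <= \<kappa> / size i"
  and \<kappa>: "\<kappa> > 0"
begin

definition decays :: "(real => complex) => bool" where
 "decays f \<longleftrightarrow> (\<forall>e>0. \<exists>R. \<forall>i\<in>I. R <= size i --> cmod (integral {0..X i} (%t. k i t * f t)) <= e)"

lemma kf_integrable:
 assumes "f absolutely_integrable_on {0..b}" "i \<in> I"
 shows "(%t. k i t * f t) integrable_on {0..X i}"
proof -
 have "(%t. k i t * f t) absolutely_integrable_on {0..b}"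
  by (rule abs_integrable_bilinear_left[OF bounded_bilinear_cmult k_cont[OF assms(2)] assms(1)])
 then have "(%t. k i t * f t) integrable_on {0..b}" by (simp add: absolutely_integrable_on_def)
 then show ?thesis by (rule integrable_subinterval_real) (use X[OF assms(2)] in auto)
qed

lemma decays_add:
 assumes "decays f" "decays g" and i: "f absolutely_integrable_on {0..b}" "g absolutely_integrable_on {0..b}"
 shows "decays (%t. f t + g t)" unfolding decays_def
proof (intro allI impI)
 fix e :: real assume "e > 0"
 then have "e / 2 > 0" by simp
 then obtain R S where R: "\<And>i. i \<in> I ==> R <= size i ==> cmod (integral {0..X i} (%t. k i t * f t)) <= e / 2"
  and S: "\<And>i. i \<in> I ==> S <= size i ==> cmod (integral {0..X i} (%t. k i t * g t)) <= e / 2"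
  using assms(1,2) unfolding decays_def by meson
 show "\<exists>R. \<forall>i\<in>I. R <= size i --> cmod (integral {0..X i} (%t. k i t * (f t + g t))) <= e"
 proof (intro exI[of _ "max R S"] ballI impI)
  fix i' assume i': "i' \<in> I" "max R S <= size i'"
  have "integral {0..X i'} (%t. k i' t * (f t + g t)) =
    integral {0..X i'} (%t. k i' t * f t) + integral {0..X i'} (%t. k i' t * g t)"
   unfolding distrib_left by (rule integral_add[OF kf_integrable[OF i(1) i'(1)] kf_integrable[OF i(2) i'(1)]])
  also have "cmod ... <= e / 2 + e / 2" by (rule norm_triangle_le[OF add_mono]) (use R S i' in auto)
  finally show "cmod (integral {0..X i'} (%t. k i' t * (f t + g t))) <= e" by simp
 qed
qed

lemma decays_cmult:
 assumes "decays f"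
 shows "decays (%t. f t * c)" unfolding decays_def
proof (intro allI impI)
 fix e :: real assume e: "e > 0"
 then have "e / (cmod c + 1) > 0" by (intro divide_pos_pos) (auto intro: add_nonneg_pos)
 then obtain R where R: "\<And>i. i \<in> I ==> R <= size i ==> cmod (integral {0..X i} (%t. k i t * f t)) <= e / (cmod c + 1)"
  using assms unfolding decays_def by meson
 show "\<exists>R. \<forall>i\<in>I. R <= size i --> cmod (integral {0..X i} (%t. k i t * (f t * c))) <= e"
 proof (intro exI[of _ R] ballI impI)
  fix i assume i: "i \<in> I" "R <= size i"
  have "integral {0..X i} (%t. k i t * (f t * c)) = integral {0..X i} (%t. k i t * f t) * c"
   unfolding mult.assoc[symmetric] by (rule integral_mult_left)
  also have "cmod ... <= e / (cmod c + 1) * cmod c" unfolding norm_mult by (intro mult_right_mono R i) auto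
  also have "... <= e" using e norm_ge_zero[of c] by (simp add: field_simps add_pos_nonneg)
  finally show "cmod (integral {0..X i} (%t. k i t * (f t * c))) <= e" .
 qed
qed

text \<open>Dominated convergence makes the approximants close in L1; as the kernels are bounded by
  \<kappa>, replacing \<open>f\<close> by one approximant costs at most \<open>e / 2\<close> for all
  indices at once.\<close>

lemma decays_limit:
 assumes s: "\<And>n. decays (s n)" "\<And>n. s n absolutely_integrable_on {0..b}"
  and f: "f absolutely_integrable_on {0..b}" and g: "g integrable_on {0..b}"
  and bound: "\<And>n t. t \<in> {0..b} ==> cmod (s n t) <= g t" "\<And>t. t \<in> {0..b} ==> cmod (f t) <= g t"
  and lim: "\<And>t. t \<in> {0..b} ==> (%n. s n t) \<longlonglongrightarrow> f t"
 shows "decays f" unfolding decays_def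
proof (intro allI impI)
 fix e :: real assume e: "e > 0"
 have di: "(%t. s n t - f t) absolutely_integrable_on {0..b}" for n by (rule set_integral_diff(1)[OF s(2) f])
 have ni: "(%t. cmod (s n t - f t)) absolutely_integrable_on {0..b}" for n
  using absolutely_integrable_norm[OF di[of n]] by (simp add: o_def)
 have "(%n. integral {0..b} (%t. cmod (s n t - f t))) \<longlonglongrightarrow> integral {0..b} (%t. 0)"
 proof (rule dominated_convergence(2)[where h="%t. 2 * g t"])
  show "(%t. cmod (s n t - f t)) integrable_on {0..b}" for n using ni[of n] by (simp add: absolutely_integrable_on_def)
  show "(%t. 2 * g t) integrable_on {0..b}" using g by (rule integrable_on_mult_right)
  show "norm (cmod (s n t - f t)) <= 2 * g t" if "t \<in> {0..b}" for n t
   using norm_triangle_ineq4[of "s n t" "f t"] bound(1)[OF that, of n] bound(2)[OF that] by simp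
  show "(%n. cmod (s n t - f t)) \<longlonglongrightarrow> 0" if "t \<in> {0..b}" for t
   using lim[OF that] by (intro tendsto_norm_zero LIM_zero)
 qed
 then have "(%n. integral {0..b} (%t. cmod (s n t - f t))) \<longlonglongrightarrow> 0" by simp
 moreover have "e / (2 * \<kappa>) > 0" using e \<kappa> by simp
 ultimately obtain n where n: "norm (integral {0..b} (%t. cmod (s n t - f t)) - 0) < e / (2 * \<kappa>)"
  using LIMSEQ_D by blast
 have "e / 2 > 0" using e by simp
 then obtain R where R: "\<And>i. i \<in> I ==> R <= size i ==> cmod (integral {0..X i} (%t. k i t * s n t)) <= e / 2"
  using s(1)[of n] unfolding decays_def by meson
 show "\<exists>R. \<forall>i\<in>I. R <= size i --> cmod (integral {0..X i} (%t. k i t * f t)) <= e"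
 proof (intro exI[of _ R] ballI impI)
  fix i assume i: "i \<in> I" "R <= size i"
  have nii: "(%t. cmod (s n t - f t)) integrable_on {0..X i}" "(%t. cmod (s n t - f t)) integrable_on {0..b}"
   using ni[of n] X[OF i(1)] by (auto simp: absolutely_integrable_on_def intro: integrable_subinterval_real)
  have "integral {0..X i} (%t. k i t * s n t) - integral {0..X i} (%t. k i t * f t) = integral {0..X i} (%t. k i t * (s n t - f t))"
   unfolding right_diff_distrib by (rule integral_diff[OF kf_integrable[OF s(2) i(1)] kf_integrable[OF f i(1)], symmetric])
  also have "cmod ... <= integral {0..X i} (%t. \<kappa> * cmod (s n t - f t))"
   by (rule integral_norm_bound_integral[OF kf_integrable[OF di i(1)]])
     (use nii k_bound[OF i(1)] in \<open>auto intro!: integrable_on_mult_right mult_right_mono simp: norm_mult\<close>)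
  also have "... = \<kappa> * integral {0..X i} (%t. cmod (s n t - f t))" by simp
  also have "... <= \<kappa> * integral {0..b} (%t. cmod (s n t - f t))"
   by (intro mult_left_mono integral_subset_le nii) (use X[OF i(1)] \<kappa> in auto)
  also have "... <= \<kappa> * (e / (2 * \<kappa>))" using n \<kappa> by (intro mult_left_mono) auto
  also have "... = e / 2" using \<kappa> by simp
  finally have "cmod (integral {0..X i} (%t. k i t * s n t) - integral {0..X i} (%t. k i t * f t)) <= e / 2" .
  moreover have "cmod (integral {0..X i} (%t. k i t * f t)) <= cmod (integral {0..X i} (%t. k i t * s n t)) +
    cmod (integral {0..X i} (%t. k i t * s n t) - integral {0..X i} (%t. k i t * f t))"
   using norm_triangle_ineq4[of "integral {0..X i} (%t. k i t * s n t)" "integral {0..X i} (%t. k i t * s n t) - integral {0..X i} (%t. k i t * f t)"]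
   by simp
  ultimately show "cmod (integral {0..X i} (%t. k i t * f t)) <= e" using R[OF i] by linarith
 qed
qed

lemma indicator_absolutely_integrable:
 assumes "A \<in> sets lebesgue"
 shows "(%t. indicator A t :: complex) absolutely_integrable_on {0..b}"
proof -
 have "(%t. indicator A t *\<^sub>R (1::complex)) absolutely_integrable_on {0..b}"
  by (rule measurable_bounded_by_integrable_imp_absolutely_integrable[where g="%_. 1"])
    (use assms in \<open>auto simp: indicator_def intro!: borel_measurable_indicator' measurable_restrict_space1 borel_measurable_scaleR integrable_const_ivl\<close>)
 then show ?thesis by (rule absolutely_integrable_spike[OF _ negligible_empty]) (auto simp: indicator_def)
qed

lemma decays_indicator_atMost: "decays (indicator {..a})" unfolding decays_def
proof (intro allI impI)
 fix e :: real assume e: "e > 0"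
 show "\<exists>R. \<forall>i\<in>I. R <= size i --> cmod (integral {0..X i} (%t. k i t * indicator {..a} t)) <= e"
 proof (intro exI[of _ "\<kappa> / e"] ballI impI)
  fix i assume i: "i \<in> I" "\<kappa> / e <= size i"
  have s: "0 < size i" using i(2) e \<kappa> by (meson divide_pos_pos less_le_trans)
  have se: "\<kappa> / size i <= e" using i(2) e s by (simp add: field_simps)
  show "cmod (integral {0..X i} (%t. k i t * indicator {..a} t)) <= e"
  proof (cases "0 <= a")
   case True
   have c: "0 <= min a (X i)" "min a (X i) <= X i" using True X[OF i(1)] by auto
   have "integral {0..X i} (%t. k i t * indicator {..a} t) = integral {0..X i} (%t. if t \<in> {0..min a (X i)} then k i t else 0)"
    by (rule integral_cong) (auto simp: indicator_def)
   also have "... = integral {0..min a (X i)} (k i)"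
    unfolding integral_restrict_Int by (rule arg_cong[where f="%S. integral S (k i)"]) (use c in auto)
   finally show ?thesis using k_int[OF i(1) c s] se by simp
  next
   case False
   have "integral {0..X i} (%t. k i t * indicator {..a} t) = integral {0..X i} (%t. 0)"
    by (rule integral_cong) (use False in \<open>auto simp: indicator_def\<close>)
   then show ?thesis using e by simp
  qed
 qed
qed

lemma decays_cong:
 assumes "decays f" "negligible N" "\<And>t. t \<in> {0..b} - N ==> f t = g t"
 shows "decays g"
proof -
 have "integral {0..X i} (%t. k i t * g t) = integral {0..X i} (%t. k i t * f t)" if "i \<in> I" for i
  by (rule integral_spike[OF assms(2)]) (use assms(3) X[OF that] in auto)
 then show ?thesis using assms(1) unfolding decays_def by simp
qed

text \<open>Dynkin's argument. Half-lines generate the Borel sets, are stable under intersection and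
  decay by \<open>k_int\<close>; the sets with decaying indicator are closed under complements and
  disjoint countable unions.\<close>

lemma decays_indicator_borel:
 assumes "A \<in> sets (borel :: real measure)"
 shows "decays (indicator A)"
proof -
 have A: "A \<in> sigma_sets UNIV (range atMost)" using assms by (simp add: borel_eq_atMost sets_measure_of)
 have st: "Int_stable (range (atMost :: real => _))" by (auto simp: Int_stable_def)
 have pw: "range (atMost :: real => _) \<subseteq> Pow UNIV" by auto
 from st pw A show ?thesis
 proof (induction rule: sigma_sets_induct_disjoint)
  case (basic A)
  then show ?case using decays_indicator_atMost by auto
 next
  case empty
  show ?case unfolding decays_def by auto
 next
  case (compl A)
  have A: "A \<in> sets lebesgue" using compl(1) by (simp add: borel_eq_atMost sets_measure_of sets_completionI_sets)
  have m: "(%t. indicator A t * (-1::complex)) absolutely_integrable_on {0..b}"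
   using absolutely_integrable_linear[OF indicator_absolutely_integrable[OF A] bounded_linear_mult_left[of "-1"]]
   by (simp add: o_def)
  have at: "(%t. indicator {..b} t :: complex) absolutely_integrable_on {0..b}" by (rule indicator_absolutely_integrable) simp
  \<comment> \<open>On \<open>{0..b}\<close> the indicator of the complement is that of the
    half-line \<open>{..b}\<close> minus that of \<open>A\<close>.\<close>
  have "decays (%t. indicator {..b} t + indicator A t * (-1))"
   by (rule decays_add[OF decays_indicator_atMost decays_cmult[OF compl(2)] at m])
  then show ?case by (rule decays_cong[OF _ negligible_empty]) (auto simp: indicator_def)
 next
  case (union A)
  have Al: "A n \<in> sets lebesgue" for n
  proof -
   have "A n \<in> sigma_sets UNIV (range atMost)" using union(2) by blast
   then have "A n \<in> sets borel" by (simp add: borel_eq_atMost sets_measure_of)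
   then show ?thesis by (intro sets_completionI_sets) simp
  qed
  define s where "s = (%n t. \<Sum>i<n. indicator (A i) t :: complex)"
  have sI: "s n t = indicator (\<Union>i<n. A i) t" for n t unfolding s_def using union(1)
   by (subst indicator_UN_disjoint) (auto simp: disjoint_family_on_def)
  show ?case
  proof (rule decays_limit[where s=s and g="%_. 1"])
   show ai: "s n absolutely_integrable_on {0..b}" for n
    unfolding s_def by (intro absolutely_integrable_sum indicator_absolutely_integrable Al) auto
   show "decays (s n)" for n
   proof (induction n)
    case 0
    then show ?case unfolding s_def decays_def by auto
   next
    case (Suc n)
    have "s (Suc n) = (%t. s n t + indicator (A n) t)" unfolding s_def by auto
    then show ?case using decays_add[OF Suc union(3) ai indicator_absolutely_integrable[OF Al]] by simp
   qed
   show "(indicator (\<Union> (range A)) :: real => complex) absolutely_integrable_on {0..b}"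
    by (rule indicator_absolutely_integrable) (use Al in auto)
   show "(%n. s n t) \<longlonglongrightarrow> (indicator (\<Union> (range A)) :: real => complex) t" for t
    unfolding sI by (rule LIMSEQ_indicator_UN)
   show "cmod (s n t) <= 1" for n t unfolding sI by (simp add: indicator_def)
  qed (auto simp: indicator_def)
 qed
qed

text \<open>Approximation by simple functions. A Lebesgue measurable set differs from a Borel set by
  a null set, which the integrals do not see.\<close>

theorem riemann_lebesgue:
 assumes f: "f absolutely_integrable_on {0..b}"
 shows "decays f"
proof -
 have "integrable lebesgue (%x. indicator {0..b} x *\<^sub>R f x)" using f unfolding set_integrable_def .
 then have "decays (%x. indicator {0..b} x *\<^sub>R f x)"
 proof (induction rule: integrable_induct)
  case (base A c)
  from base(1) obtain S N N' where A: "A = S \<union> N" "N \<subseteq> N'" "N' \<in> null_sets lborel" "S \<in> sets lborel"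
   by (rule sets_completionE)
  have "N' \<in> null_sets lebesgue" using A(3) by (rule null_sets_completionI)
  then have "negligible N'" by (simp add: negligible_iff_null_sets)
  have "decays (%t. indicator S t * c)" by (rule decays_cmult[OF decays_indicator_borel]) (use A in simp)
  then show ?case
   by (rule decays_cong[OF _ \<open>negligible N'\<close>]) (use A(1,2) in \<open>auto simp: indicator_def\<close>)
 next
  case (add f g)
  have "f absolutely_integrable_on {0..b}" "g absolutely_integrable_on {0..b}"
   using add(1,2) by (auto simp: set_integrable_def intro!: integrable_mult_indicator)
  then show ?case using decays_add[OF add(3,4)] by simp
 next
  case (lim f s)
  have ai: "h absolutely_integrable_on {0..b}" if "integrable lebesgue h" for h :: "real => complex"
   using that by (auto simp: set_integrable_def intro!: integrable_mult_indicator)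
  show ?case
  proof (rule decays_limit[where s=s and g="%t. 2 * cmod (f t)"])
   show "decays (s n)" for n by (rule lim)
   show "s n absolutely_integrable_on {0..b}" for n by (rule ai[OF lim(1)])
   show "f absolutely_integrable_on {0..b}" by (rule ai) (use lim in auto)
   then show "(%t. 2 * cmod (f t)) integrable_on {0..b}"
    by (intro integrable_on_mult_right) (simp add: absolutely_integrable_on_def)
   show "cmod (s n t) <= 2 * cmod (f t)" for n t using lim by auto
   show "(%n. s n t) \<longlonglongrightarrow> f t" for t using lim by auto
  qed auto
 qed
 then show ?thesis by (rule decays_cong[OF _ negligible_empty]) (auto simp: indicator_def)
qed

end

section \<open>Bessel's inequality and a weighted Cauchy-Schwarz inequality\<close>

lemma has_integral_cexp:
 fixes a :: complex
 assumes "a ~= 0" "c <= d"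
 shows "((%t. exp (a * of_real t)) has_integral (exp (a * of_real d) - exp (a * of_real c)) / a) {c..d}"
proof -
 have "((%t. exp (a * of_real t)) has_integral (exp (a * of_real d) / a - exp (a * of_real c) / a)) {c..d}"
 proof (rule fundamental_theorem_of_calculus[OF assms(2)])
  fix x :: real
  have "((%z. exp (a * z) / a) has_field_derivative exp (a * of_real x)) (at (of_real x))"
   using assms(1) by (auto intro!: derivative_eq_intros)
  then have "((%t. exp (a * of_real t) / a) has_vector_derivative exp (a * of_real x)) (at x)"
   using has_vector_derivative_real_field by blast
  then show "((%t. exp (a * of_real t) / a) has_vector_derivative exp (a * of_real x)) (at x within {c..d})"
   by (rule has_vector_derivative_at_within)
 qed
 then show ?thesis by (simp add: diff_divide_distrib)
qed

text \<open>On an interval of length \<open>pi\<close> the exponentials with frequencies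
  \<open>2 n\<close> are orthogonal with squared norm \<open>pi\<close>, whence the constant. These
  are the frequencies that \<open>osc\<close> produces along \<rho> = n + z.\<close>

lemma bessel_inequality:
 fixes g :: "real => complex" and F :: "int set"
 assumes g: "g absolutely_integrable_on {0..pi}" and g2: "(%t. (cmod (g t))^2) integrable_on {0..pi}" and F: "finite F"
 shows "(\<Sum>n\<in>F. (cmod (integral {0..pi} (%t. exp (2 * \<i> * of_int n * of_real t) * g t)))^2)
    <= pi * integral {0..pi} (%t. (cmod (g t))^2)"
proof -
 define e where "e = (%(n::int) (t::real). exp (2 * \<i> * of_int n * of_real t))"
 define c where "c = (%n. integral {0..pi} (%t. e n t * g t))"
 define h where "h = (%t. \<Sum>n\<in>F. c n * e (-n) t)"
 define S where "S = (\<Sum>n\<in>F. (cmod (c n))^2)"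
 have ec: "continuous_on A (e n)" for A n unfolding e_def by (intro continuous_intros)
 have hc: "continuous_on A h" for A unfolding h_def by (intro continuous_intros ec)
 have cnj_e: "cnj (e n t) = e (-n) t" for n t unfolding e_def by (simp add: exp_cnj)
 have orth: "((%t. e n t * e (-m) t) has_integral (if n = m then of_real pi else 0)) {0..pi}" for n m
 proof (cases "n = m")
  case True
  have "(%t. e n t * e (-m) t) = (%t. 1)" unfolding e_def using True by (simp add: exp_add[symmetric] fun_eq_iff)
  then show ?thesis using True has_integral_const_real[of "1::complex" 0 pi] by (simp add: scaleR_conv_of_real)
 next
  case False
  define a where "a = 2 * \<i> * complex_of_int (n - m)"
  have a: "a ~= 0" unfolding a_def using False by simp
  have "(%t. e n t * e (-m) t) = (%t. exp (a * of_real t))"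
   unfolding e_def a_def by (simp add: exp_add[symmetric] fun_eq_iff algebra_simps)
  moreover have "exp (a * of_real pi) = 1" using exp_integer_2pi[of "of_int (n - m)"] unfolding a_def by (simp add: mult_ac)
  ultimately show ?thesis using has_integral_cexp[OF a, of 0 pi] False by simp
 qed
 have eg: "(%t. e n t * g t) integrable_on {0..pi}" for n
  using abs_integrable_bilinear_left[OF bounded_bilinear_cmult ec[of "{0..pi}" n] g]
  by (simp add: absolutely_integrable_on_def)
 have hcnj: "cnj (h t) = (\<Sum>n\<in>F. cnj (c n) * e n t)" for t unfolding h_def by (simp add: cnj_e)
 have gh: "((%t. cnj (h t) * g t) has_integral of_real S) {0..pi}"
 proof -
  have "((%t. \<Sum>n\<in>F. cnj (c n) * (e n t * g t)) has_integral (\<Sum>n\<in>F. cnj (c n) * c n)) {0..pi}"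
   unfolding c_def by (intro has_integral_sum F has_integral_mult_right integrable_integral eg)
  moreover have "(\<Sum>n\<in>F. cnj (c n) * c n) = of_real S"
   unfolding S_def by (simp add: of_real_sum complex_norm_square mult.commute del: of_real_power)
  ultimately show ?thesis unfolding hcnj by (simp add: sum_distrib_right mult.assoc)
 qed
 have hh: "((%t. cnj (h t) * h t) has_integral of_real (pi * S)) {0..pi}"
 proof -
  have "((%t. \<Sum>n\<in>F. \<Sum>m\<in>F. cnj (c n) * c m * (e n t * e (-m) t)) has_integral
    (\<Sum>n\<in>F. \<Sum>m\<in>F. cnj (c n) * c m * (if n = m then of_real pi else 0))) {0..pi}"
   by (intro has_integral_sum F has_integral_mult_right orth)
  moreover have "(\<Sum>n\<in>F. \<Sum>m\<in>F. cnj (c n) * c m * (if n = m then complex_of_real pi else 0)) = (\<Sum>n\<in>F. cnj (c n) * c n * of_real pi)"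
  proof (intro sum.cong refl)
   fix n assume n: "n \<in> F"
   have "(\<Sum>m\<in>F. cnj (c n) * c m * (if n = m then complex_of_real pi else 0)) =
     (\<Sum>m\<in>F. if n = m then cnj (c n) * c m * complex_of_real pi else 0)" by (intro sum.cong refl) auto
   then show "(\<Sum>m\<in>F. cnj (c n) * c m * (if n = m then complex_of_real pi else 0)) = cnj (c n) * c n * of_real pi"
    using n F by simp
  qed
  moreover have "(\<Sum>n\<in>F. cnj (c n) * c n * of_real pi) = of_real (pi * S)"
   unfolding S_def by (simp add: of_real_sum complex_norm_square mult.commute sum_distrib_left del: of_real_power)
  moreover have "(%t. cnj (h t) * h t) = (%t. \<Sum>n\<in>F. \<Sum>m\<in>F. cnj (c n) * c m * (e n t * e (-m) t))"
   unfolding hcnj unfolding h_def by (intro ext trans[OF sum_product] sum.cong refl) (simp add: mult_ac)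
  ultimately show ?thesis by simp
 qed
 have Re_gh: "((%t. Re (cnj (h t) * g t)) has_integral S) {0..pi}"
  using has_integral_linear[OF gh bounded_linear_Re] by (simp add: o_def)
 have hh': "((%t. (cmod (h t))^2) has_integral (pi * S)) {0..pi}"
 proof -
  have "Re (cnj w * w) = (cmod w)^2" for w by (simp add: cmod_power2) (simp add: power2_eq_square)
  then show ?thesis using has_integral_linear[OF hh bounded_linear_Re] by (simp add: o_def)
 qed
 have "((%t. (cmod (g t))^2 - (2 / pi) * Re (cnj (h t) * g t) + (1 / pi^2) * (cmod (h t))^2) has_integral
   (integral {0..pi} (%t. (cmod (g t))^2) - (2 / pi) * S + (1 / pi^2) * (pi * S))) {0..pi}"
  by (intro has_integral_add has_integral_diff has_integral_mult_right integrable_integral g2 Re_gh hh')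
 \<comment> \<open>The integrand is the squared distance of \<open>g\<close> from its Fourier sum
   \<open>h / pi\<close>.\<close>
 moreover have "0 <= (cmod (g t))^2 - (2 / pi) * Re (cnj (h t) * g t) + (1 / pi^2) * (cmod (h t))^2" for t
 proof -
  have "(cmod (g t))^2 - (2 / pi) * Re (cnj (h t) * g t) + (1 / pi^2) * (cmod (h t))^2 = (cmod (g t - of_real (1 / pi) * h t))^2"
   unfolding cmod_power2 by (simp add: power2_eq_square field_simps)
  then show ?thesis by simp
 qed
 ultimately have "0 <= integral {0..pi} (%t. (cmod (g t))^2) - (2 / pi) * S + (1 / pi^2) * (pi * S)"
  by (rule has_integral_nonneg)
 then have "S / pi <= integral {0..pi} (%t. (cmod (g t))^2)" by (simp add: power2_eq_square)
 then have "S <= pi * integral {0..pi} (%t. (cmod (g t))^2)" by (simp add: field_simps)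
 then show ?thesis unfolding S_def c_def e_def .
qed

text \<open>Expand the nonnegative integral of \<open>a * (u - c)^2\<close>, where \<open>c\<close>
  is the weighted integral of \<open>u\<close> divided by \<open>A\<close>. Admitting any positive
  upper bound \<open>A\<close> of the total weight covers weights with zero integral.\<close>

lemma integral_cauchy_schwarz_weighted:
 fixes a u :: "real => real"
 assumes a: "a absolutely_integrable_on {0..b}" "\<And>t. t \<in> {0..b} ==> 0 <= a t" and u: "continuous_on {0..b} u"
  and x: "x \<in> {0..b}" and A: "integral {0..b} a <= A" "0 < A"
 shows "(integral {0..x} (%t. a t * u t))^2 <= A * integral {0..x} (%t. a t * (u t)^2)"
proof -
 have i: "(%t. a t * v t) integrable_on {0..x}" if "continuous_on {0..b} v" for v :: "real => real"
  using abs_integrable_bilinear_right[OF bounded_bilinear_mult that a(1)] x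
  unfolding absolutely_integrable_on_def by (auto intro: integrable_subinterval_real)
 define c where "c = integral {0..x} (%t. a t * u t) / A"
 have iu: "(%t. a t * u t) integrable_on {0..x}" "(%t. a t * (u t)^2) integrable_on {0..x}" "a integrable_on {0..x}"
  using i[OF u] i[of "%t. (u t)^2"] i[of "%_. 1"] u by (auto intro!: continuous_intros)
 have ab: "a integrable_on {0..b}" using a(1) by (simp add: absolutely_integrable_on_def)
 have ax: "integral {0..x} a <= A" using integral_subset_le[of "{0..x}" "{0..b}" a] iu(3) ab a(2) x A(1) by auto
 have "0 <= integral {0..x} (%t. a t * (u t)^2 - 2 * c * (a t * u t) + c^2 * a t)"
 proof (rule integral_nonneg)
  show "(%t. a t * (u t)^2 - 2 * c * (a t * u t) + c^2 * a t) integrable_on {0..x}"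
   by (intro integrable_add integrable_diff integrable_on_mult_right iu)
  fix t assume t: "t \<in> {0..x}"
  have "a t * (u t)^2 - 2 * c * (a t * u t) + c^2 * a t = a t * (u t - c)^2" by (simp add: power2_eq_square algebra_simps)
  then show "0 <= a t * (u t)^2 - 2 * c * (a t * u t) + c^2 * a t" using a(2)[of t] t x by auto
 qed
 also have "... = integral {0..x} (%t. a t * (u t)^2) - 2 * c * integral {0..x} (%t. a t * u t) + c^2 * integral {0..x} a"
 proof -
  have "((%t. a t * (u t)^2 - 2 * c * (a t * u t) + c^2 * a t) has_integral
    (integral {0..x} (%t. a t * (u t)^2) - 2 * c * integral {0..x} (%t. a t * u t) + c^2 * integral {0..x} a)) {0..x}"
   by (intro has_integral_add has_integral_diff has_integral_mult_right integrable_integral iu)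
  then show ?thesis by (rule integral_unique)
 qed
 also have "c^2 * integral {0..x} a <= c^2 * A" by (rule mult_left_mono[OF ax]) simp
 finally have "2 * c * integral {0..x} (%t. a t * u t) - c^2 * A <= integral {0..x} (%t. a t * (u t)^2)" by simp
 moreover have "2 * c * integral {0..x} (%t. a t * u t) - c^2 * A = (integral {0..x} (%t. a t * u t))^2 / A"
  unfolding c_def using A(2) by (simp add: power2_eq_square field_simps)
 ultimately show ?thesis using A(2) by (simp add: pos_divide_le_eq mult.commute)
qed

section \<open>The system in oscillating coordinates\<close>

abbreviation osc :: "complex => real => complex" where "osc \<rho> t \<equiv> exp (2 * \<i> * \<rho> * of_real t)"

lemma primitive_on_cexp: "primitive_on 0 pi (%x. exp ((a::complex) * of_real x)) (%x. a * exp (a * of_real x))"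
proof (rule primitive_on_C1)
 fix x :: real
 have "((%z. exp (a * z)) has_field_derivative a * exp (a * of_real x)) (at (of_real x))"
  by (auto intro!: derivative_eq_intros)
 then show "((%t. exp (a * of_real t)) has_vector_derivative a * exp (a * of_real x)) (at x)"
  using has_vector_derivative_real_field by blast
qed (auto intro!: continuous_intros)

context sl_potential
begin

text \<open>These combinations diagonalise the free system; the factor
  \<open>exp (\<i> * \<rho> * x)\<close> keeps the exponentials bounded when Im \<rho> is bounded
  below. For \<sigma> = 0, \<open>P_fun\<close> is the constant \<open>y + \<i> \<cdot> w\<close>
  and \<open>Q_fun\<close> is \<open>osc \<rho> x \<cdot> (y - \<i> \<cdot> w)\<close>. Taking
  \<open>\<rho> \<cdot> w\<close> as initial value of \<open>Z\<close> balances the two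
  components.\<close>

definition P_fun :: "complex => complex^'p^'m => complex^'p^'m => real => complex^'p^'m" where
 "P_fun \<rho> y w x = exp (\<i> * \<rho> * of_real x) \<cdot>
   (fst (sol (\<rho>^2) y (\<rho> \<cdot> w) x) + (\<i> / \<rho>) \<cdot> snd (sol (\<rho>^2) y (\<rho> \<cdot> w) x))"

definition Q_fun :: "complex => complex^'p^'m => complex^'p^'m => real => complex^'p^'m" where
 "Q_fun \<rho> y w x = exp (\<i> * \<rho> * of_real x) \<cdot>
   (fst (sol (\<rho>^2) y (\<rho> \<cdot> w) x) - (\<i> / \<rho>) \<cdot> snd (sol (\<rho>^2) y (\<rho> \<cdot> w) x))"

lemma PQ_0: "\<rho> ~= 0 ==> P_fun \<rho> y w 0 = y + \<i> \<cdot> w" "\<rho> ~= 0 ==> Q_fun \<rho> y w 0 = y - \<i> \<cdot> w"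
 by (simp_all add: P_fun_def Q_fun_def sol_0)

text \<open>The spectral term cancels against the derivative of the exponential. The linear term in
  \<sigma> couples \<open>P\<close> to \<open>Q\<close> only, hence to an oscillating function, and
  \<sigma> squared carries a factor of order 1/\<rho>.\<close>

lemma P_primitive:
 assumes \<rho>: "\<rho> ~= 0"
 shows "primitive_on 0 pi (P_fun \<rho> y w) (%x. \<sigma> x ** Q_fun \<rho> y w x -
      (\<i> / (2 * \<rho>)) \<cdot> ((\<sigma> x ** \<sigma> x) ** (P_fun \<rho> y w x + Q_fun \<rho> y w x)))"
proof -
 let ?Y = "%x. fst (sol (\<rho>^2) y (\<rho> \<cdot> w) x)" and ?Z = "%x. snd (sol (\<rho>^2) y (\<rho> \<cdot> w) x)"
 have p: "primitive_on 0 pi ?Y (%x. \<sigma> x ** ?Y x + ?Z x)"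
   "primitive_on 0 pi ?Z (%x. - (\<sigma> x ** ?Z x) - (\<sigma> x ** \<sigma> x) ** ?Y x - (\<rho>^2) \<cdot> ?Y x)"
  using sol_system[of "\<rho>^2" y "\<rho> \<cdot> w"] unfolding sl_system_def by auto
 note q = primitive_on_bilinear[OF bounded_bilinear_mscale primitive_on_cexp[of "\<i> * \<rho>"]
   primitive_on_add[OF p(1) primitive_on_linear[OF ms.bounded_linear_right[of "\<i> / \<rho>"] p(2)]]]
 show ?thesis
 proof (rule primitive_on_cong[OF q])
  fix x
  show "exp (\<i> * \<rho> * of_real x) \<cdot> (?Y x + (\<i> / \<rho>) \<cdot> ?Z x) = P_fun \<rho> y w x" unfolding P_fun_def ..
  show "exp (\<i> * \<rho> * of_real x) \<cdot> (\<sigma> x ** ?Y x + ?Z x + (\<i> / \<rho>) \<cdot> (- (\<sigma> x ** ?Z x) - \<sigma> x ** \<sigma> x ** ?Y x - \<rho>^2 \<cdot> ?Y x)) +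
    (\<i> * \<rho> * exp (\<i> * \<rho> * of_real x)) \<cdot> (?Y x + (\<i> / \<rho>) \<cdot> ?Z x) =
    \<sigma> x ** Q_fun \<rho> y w x - (\<i> / (2 * \<rho>)) \<cdot> ((\<sigma> x ** \<sigma> x) ** (P_fun \<rho> y w x + Q_fun \<rho> y w x))"
   unfolding P_fun_def Q_fun_def
   by (simp add: mscale_mult_right mm.add_right mm.diff_right, simp add: vec_eq_iff, use \<rho> in \<open>simp add: field_simps power2_eq_square\<close>)
 qed
qed

text \<open>The free part of \<open>Q_fun\<close> is a multiple of \<open>osc\<close>; dividing it
  out leaves a function whose derivative involves only \<sigma>-terms, again with crossed
  coupling.\<close>

lemma Q_primitive:
 assumes \<rho>: "\<rho> ~= 0"
 shows "primitive_on 0 pi (%x. exp (- 2 * \<i> * \<rho> * of_real x) \<cdot> Q_fun \<rho> y w x)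
   (%x. exp (- 2 * \<i> * \<rho> * of_real x) \<cdot> (\<sigma> x ** P_fun \<rho> y w x +
      (\<i> / (2 * \<rho>)) \<cdot> ((\<sigma> x ** \<sigma> x) ** (P_fun \<rho> y w x + Q_fun \<rho> y w x))))"
proof -
 let ?Y = "%x. fst (sol (\<rho>^2) y (\<rho> \<cdot> w) x)" and ?Z = "%x. snd (sol (\<rho>^2) y (\<rho> \<cdot> w) x)"
 have p: "primitive_on 0 pi ?Y (%x. \<sigma> x ** ?Y x + ?Z x)"
   "primitive_on 0 pi ?Z (%x. - (\<sigma> x ** ?Z x) - (\<sigma> x ** \<sigma> x) ** ?Y x - (\<rho>^2) \<cdot> ?Y x)"
  using sol_system[of "\<rho>^2" y "\<rho> \<cdot> w"] unfolding sl_system_def by auto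
 note q = primitive_on_bilinear[OF bounded_bilinear_mscale primitive_on_cexp[of "- \<i> * \<rho>"]
   primitive_on_add[OF p(1) primitive_on_linear[OF ms.bounded_linear_right[of "- \<i> / \<rho>"] p(2)]]]
 have e: "exp (- 2 * \<i> * \<rho> * of_real x) * exp (\<i> * \<rho> * of_real x) = exp (- \<i> * \<rho> * of_real x)" for x
  by (simp add: exp_add[symmetric] mult.assoc)
 show ?thesis
 proof (rule primitive_on_cong[OF q])
  fix x
  show "exp (- \<i> * \<rho> * of_real x) \<cdot> (?Y x + (- \<i> / \<rho>) \<cdot> ?Z x) = exp (- 2 * \<i> * \<rho> * of_real x) \<cdot> Q_fun \<rho> y w x"
   unfolding Q_fun_def mscale_mscale e by (simp add: vec_eq_iff)
  have 1: "exp (- 2 * \<i> * \<rho> * of_real x) \<cdot> (\<sigma> x ** P_fun \<rho> y w x +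
      (\<i> / (2 * \<rho>)) \<cdot> ((\<sigma> x ** \<sigma> x) ** (P_fun \<rho> y w x + Q_fun \<rho> y w x))) =
    exp (- \<i> * \<rho> * of_real x) \<cdot> (\<sigma> x ** (?Y x + (\<i> / \<rho>) \<cdot> ?Z x) + (\<i> / \<rho>) \<cdot> ((\<sigma> x ** \<sigma> x) ** ?Y x))"
   unfolding P_fun_def Q_fun_def e[symmetric]
   by (simp add: mscale_mult_right mm.add_right mm.diff_right, simp add: vec_eq_iff, use \<rho> in \<open>simp add: field_simps power2_eq_square\<close>)
  show "exp (- \<i> * \<rho> * of_real x) \<cdot> (\<sigma> x ** ?Y x + ?Z x + (- \<i> / \<rho>) \<cdot> (- (\<sigma> x ** ?Z x) - \<sigma> x ** \<sigma> x ** ?Y x - \<rho>^2 \<cdot> ?Y x)) +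
    (- \<i> * \<rho> * exp (- \<i> * \<rho> * of_real x)) \<cdot> (?Y x + (- \<i> / \<rho>) \<cdot> ?Z x) =
    exp (- 2 * \<i> * \<rho> * of_real x) \<cdot> (\<sigma> x ** P_fun \<rho> y w x +
      (\<i> / (2 * \<rho>)) \<cdot> ((\<sigma> x ** \<sigma> x) ** (P_fun \<rho> y w x + Q_fun \<rho> y w x)))" unfolding 1
   by (simp add: mscale_mult_right mm.add_right mm.diff_right, simp add: vec_eq_iff, use \<rho> in \<open>simp add: field_simps power2_eq_square\<close>)
 qed
qed


text \<open>\<open>J1\<close> and \<open>J2\<close> are the first order effects of \<sigma>: they
  arise when the free values of \<open>Q_fun\<close> and \<open>P_fun\<close> are inserted in the
  equations for \<open>P_fun\<close> and \<open>Q_fun\<close>, respectively.\<close>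

definition J1 :: "complex => real => complex^'m^'m" where
 "J1 \<rho> x = integral {0..x} (%t. osc \<rho> t \<cdot> \<sigma> t)"

definition J2 :: "complex => real => complex^'m^'m" where
 "J2 \<rho> x = integral {0..x} (%t. osc \<rho> (x - t) \<cdot> \<sigma> t)"

definition S2 :: real where "S2 = integral {0..pi} (%t. (norm (\<sigma> t))^2)"

definition ka :: "real => real => real" where
 "ka \<kappa> t = \<kappa> * norm (\<sigma> t) + \<kappa> * (norm (\<sigma> t))^2 + 1"

text \<open>The subtracted terms are the values of \<open>P_fun\<close> and \<open>Q_fun\<close> for
  \<sigma> = 0, so this measures the distance from the free solution.\<close>

definition PQ_dev :: "complex => complex^'p^'m => complex^'p^'m => real => real" where
 "PQ_dev \<rho> y w x = norm (P_fun \<rho> y w x - (y + \<i> \<cdot> w)) +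
   norm (Q_fun \<rho> y w x - osc \<rho> x \<cdot> (y - \<i> \<cdot> w))"

lemma ka_absolutely_integrable: "ka \<kappa> absolutely_integrable_on {0..pi}" unfolding ka_def
 by (intro set_integral_add(1) absolutely_integrable_on_const norm_sq_absolutely_integrable
   set_integrable_mult_right norm_sigma_absolutely_integrable) auto

lemma S2_nonneg: "0 <= S2"
 unfolding S2_def by (rule integral_nonneg) (use norm_sq_absolutely_integrable in \<open>auto simp: absolutely_integrable_on_def\<close>)

lemma P_continuous: "\<rho> ~= 0 ==> continuous_on {0..pi} (P_fun \<rho> y w)"
 by (rule primitive_on_continuous[OF P_primitive])

lemma Q_continuous: "continuous_on {0..pi} (Q_fun \<rho> y w)" unfolding Q_fun_def[abs_def]
 by (intro ms.continuous_on continuous_intros sol_continuous)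

lemma PQ_dev_continuous: "\<rho> ~= 0 ==> continuous_on {0..pi} (PQ_dev \<rho> y w)" unfolding PQ_dev_def[abs_def]
 by (intro continuous_intros P_continuous Q_continuous ms.continuous_on)

lemma sigma_cont_integrable:
 fixes F :: "real => complex^'p^'m"
 assumes "continuous_on {0..pi} F" "x <= pi"
 shows "(%t. \<sigma> t ** F t) integrable_on {0..x}" "(%t. (\<sigma> t ** \<sigma> t) ** F t) integrable_on {0..x}"
proof -
 have "(%t. \<sigma> t ** F t) absolutely_integrable_on {0..pi}" "(%t. (\<sigma> t ** \<sigma> t) ** F t) absolutely_integrable_on {0..pi}"
  by (rule abs_integrable_bilinear_right[OF bounded_bilinear_matrix_mult assms(1)]
    sigma_absolutely_integrable sigma_sq_absolutely_integrable)+
 then show "(%t. \<sigma> t ** F t) integrable_on {0..x}" "(%t. (\<sigma> t ** \<sigma> t) ** F t) integrable_on {0..x}"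
  using assms(2) by (auto simp: absolutely_integrable_on_def intro: integrable_subinterval_real)
qed

lemma norm_cont_integrable:
 fixes u :: "real => real"
 assumes "continuous_on {0..pi} u" "x <= pi"
 shows "(%t. norm (\<sigma> t) * u t) integrable_on {0..x}" "(%t. (norm (\<sigma> t))^2 * u t) integrable_on {0..x}"
  "(%t. ka \<kappa> t * u t) integrable_on {0..x}"
proof -
 have "(%t. norm (\<sigma> t) * u t) absolutely_integrable_on {0..pi}" "(%t. (norm (\<sigma> t))^2 * u t) absolutely_integrable_on {0..pi}"
  "(%t. ka \<kappa> t * u t) absolutely_integrable_on {0..pi}"
  by (rule abs_integrable_bilinear_right[OF bounded_bilinear_mult assms(1)]
    norm_sigma_absolutely_integrable norm_sq_absolutely_integrable ka_absolutely_integrable)+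
 then show "(%t. norm (\<sigma> t) * u t) integrable_on {0..x}" "(%t. (norm (\<sigma> t))^2 * u t) integrable_on {0..x}"
  "(%t. ka \<kappa> t * u t) integrable_on {0..x}"
  using assms(2) by (auto simp: absolutely_integrable_on_def intro: integrable_subinterval_real)
qed

lemma exp_sigma_integrable:
 assumes "continuous_on {0..pi} e" "x <= pi"
 shows "(%t. e t \<cdot> \<sigma> t) integrable_on {0..x}"
proof -
 have "(%t. e t \<cdot> \<sigma> t) absolutely_integrable_on {0..pi}"
  by (rule abs_integrable_bilinear_left[OF bounded_bilinear_mscale assms(1) sigma_absolutely_integrable])
 then show ?thesis using assms(2) by (auto simp: absolutely_integrable_on_def intro: integrable_subinterval_real)
qed

text \<open>Both components are driven by oscillating integrals of \<open>\<sigma>\<close> against the free solution;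
 everything else is controlled by the deviation itself or is of order \<open>1 / \<rho>\<close>.\<close>

lemma PQ_dev_estimate:
 fixes y w :: "complex^'p^'m"
 assumes \<rho>: "1 <= cmod \<rho>" and \<kappa>: "1 <= \<kappa>" and e\<kappa>: "\<And>s. s \<in> {0..pi} ==> cmod (osc \<rho> s) <= \<kappa>"
  and x: "x \<in> {0..pi}"
 defines "p0 \<equiv> y + \<i> \<cdot> w" and "q0 \<equiv> y - \<i> \<cdot> w"
 shows "PQ_dev \<rho> y w x <= (norm (J1 \<rho> x) * norm q0 + norm (J2 \<rho> x) * norm p0 + \<kappa> * S2 * (norm p0 + \<kappa> * norm q0) / cmod \<rho>)
   + integral {0..x} (%t. ka \<kappa> t * PQ_dev \<rho> y w t)"
proof -
 have \<rho>0: "\<rho> ~= 0" using \<rho> by auto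
 define e where "e = (%s::real. osc \<rho> s)"
 define P where "P = P_fun \<rho> y w"
 define Q where "Q = Q_fun \<rho> y w"
 define dP where "dP = (%t. P t - p0)"
 define dQ where "dQ = (%t. Q t - e t \<cdot> q0)"
 define u where "u = (%t. norm (dP t) + norm (dQ t))"
 define c0 where "c0 = norm p0 + \<kappa> * norm q0"
 define R where "R = (%t. (\<i> / (2 * \<rho>)) \<cdot> ((\<sigma> t ** \<sigma> t) ** (P t + Q t)))"
 have u: "PQ_dev \<rho> y w = u" unfolding PQ_dev_def[abs_def] u_def dP_def dQ_def P_def Q_def e_def p0_def q0_def ..
 have c0: "0 <= c0" unfolding c0_def using \<kappa> by simp
 have ec: "continuous_on A e" for A unfolding e_def by (intro continuous_intros)
 have c: "continuous_on {0..pi} P" "continuous_on {0..pi} Q" "continuous_on {0..pi} dP" "continuous_on {0..pi} dQ" "continuous_on {0..pi} u"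
  unfolding P_def Q_def dP_def dQ_def u_def
  by (intro continuous_intros P_continuous[OF \<rho>0] Q_continuous ms.continuous_on ec)+
 have xp: "x <= pi" using x by simp
 have et: "cmod (e t) <= \<kappa>" if "t \<in> {0..pi}" for t unfolding e_def by (rule e\<kappa>[OF that])
 have Rb: "norm (R t) <= (norm (\<sigma> t))^2 / 2 * u t + (norm (\<sigma> t))^2 * c0 / (2 * cmod \<rho>)" if t: "t \<in> {0..pi}" for t
 proof -
  have "P t + Q t = dP t + dQ t + (p0 + e t \<cdot> q0)" unfolding dP_def dQ_def by simp
  also have "norm ... <= norm (dP t) + norm (dQ t) + (norm p0 + norm (e t \<cdot> q0))"
   by (intro norm_triangle_le add_mono norm_triangle_ineq order_refl)
  also have "... <= u t + c0" unfolding u_def c0_def norm_mscale using et[OF t] by (simp add: mult_right_mono)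
  finally have PQ: "norm (P t + Q t) <= u t + c0" .
  have "norm ((\<sigma> t ** \<sigma> t) ** (P t + Q t)) <= (norm (\<sigma> t))^2 * (u t + c0)"
   by (rule order_trans[OF norm_matmul_le mult_mono[OF _ PQ]])
     (use norm_matmul_le[of "\<sigma> t" "\<sigma> t"] in \<open>auto simp: power2_eq_square\<close>)
  then have "norm (R t) <= 1 / (2 * cmod \<rho>) * ((norm (\<sigma> t))^2 * (u t + c0))"
   unfolding R_def norm_mscale by (simp add: norm_divide norm_mult divide_right_mono)
  also have "... = 1 / (2 * cmod \<rho>) * ((norm (\<sigma> t))^2 * u t) + (norm (\<sigma> t))^2 * c0 / (2 * cmod \<rho>)"
   by (simp add: field_simps add_divide_distrib)
  \<comment> \<open>Here \<open>1 <= cmod \<rho>\<close> is used: the coefficient of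
    \<open>u\<close> becomes independent of \<rho> and fits into \<open>ka \<kappa>\<close>.\<close>
  also have "1 / (2 * cmod \<rho>) * ((norm (\<sigma> t))^2 * u t) <= 1 / 2 * ((norm (\<sigma> t))^2 * u t)"
   by (rule mult_right_mono) (use \<rho> frac_le[of 1 1 2 "2 * cmod \<rho>"] in \<open>auto simp: u_def\<close>)
  finally show ?thesis by simp
 qed
 have Ri: "R integrable_on {0..x}"
 proof -
  have "(%t. (\<sigma> t ** \<sigma> t) ** (P t + Q t)) integrable_on {0..x}"
   by (rule sigma_cont_integrable(2)[OF _ xp]) (intro continuous_intros c)
  from integrable_linear[OF this ms.bounded_linear_right[of "\<i> / (2 * \<rho>)"]] show ?thesis unfolding R_def by (simp add: o_def)
 qed
 define g1 where "g1 = (%t. norm (\<sigma> t) * norm (dQ t) + ((norm (\<sigma> t))^2 / 2 * u t + (norm (\<sigma> t))^2 * c0 / (2 * cmod \<rho>)))"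
 define g2 where "g2 = (%t. \<kappa> * (norm (\<sigma> t) * norm (dP t) + ((norm (\<sigma> t))^2 / 2 * u t + (norm (\<sigma> t))^2 * c0 / (2 * cmod \<rho>))))"
 have sqi: "(%t. (norm (\<sigma> t))^2) integrable_on {0..x}" "(%t. (norm (\<sigma> t))^2) integrable_on {0..pi}"
  using norm_sq_absolutely_integrable xp by (auto simp: absolutely_integrable_on_def intro: integrable_subinterval_real)
 have hi: "(%t. (norm (\<sigma> t))^2 / 2 * u t + (norm (\<sigma> t))^2 * c0 / (2 * cmod \<rho>)) integrable_on {0..x}"
 proof -
  have "(%t. 1 / 2 * ((norm (\<sigma> t))^2 * u t) + c0 / (2 * cmod \<rho>) * (norm (\<sigma> t))^2) integrable_on {0..x}"
   by (intro integrable_add integrable_on_mult_right norm_cont_integrable(2)[OF c(5) xp] sqi)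
  then show ?thesis by (simp add: mult_ac)
 qed
 have g1i: "g1 integrable_on {0..x}" unfolding g1_def
  by (intro integrable_add hi norm_cont_integrable(1)[OF _ xp] continuous_intros c)
 have g2i: "g2 integrable_on {0..x}" unfolding g2_def
  by (intro integrable_on_mult_right integrable_add hi norm_cont_integrable(1)[OF _ xp] continuous_intros c)
 have Pest: "norm (dP x) <= norm (J1 \<rho> x) * norm q0 + integral {0..x} g1"
 proof -
  have "dP x = P x - P 0" unfolding dP_def P_def PQ_0(1)[OF \<rho>0] p0_def ..
  also have "... = integral {0..x} (%t. \<sigma> t ** Q t - R t)"
   unfolding P_def Q_def R_def by (rule primitive_on_diff[OF P_primitive[OF \<rho>0]]) (use x in auto)
  \<comment> \<open>\<open>Q\<close> is split into its free part, which yields \<open>J1\<close>,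
    and the deviation \<open>dQ\<close>, which goes into the Gronwall integral.\<close>
  also have "... = integral {0..x} (%t. (e t \<cdot> \<sigma> t) ** q0 + (\<sigma> t ** dQ t - R t))"
   by (rule integral_cong) (simp add: dQ_def mm.diff_right mscale_mult_left mscale_mult_right)
  also have "... = integral {0..x} (%t. (e t \<cdot> \<sigma> t) ** q0) + integral {0..x} (%t. \<sigma> t ** dQ t - R t)"
   using integrable_linear[OF exp_sigma_integrable[OF ec xp] mm.bounded_linear_left[of q0]]
   by (intro integral_add integrable_diff sigma_cont_integrable(1)[OF c(4) xp] Ri) (simp add: o_def)
  also have "integral {0..x} (%t. (e t \<cdot> \<sigma> t) ** q0) = J1 \<rho> x ** q0"
   using integral_linear[OF exp_sigma_integrable[OF ec xp] mm.bounded_linear_left[of q0]]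
   unfolding J1_def e_def by (simp add: o_def)
  finally have "norm (dP x) <= norm (J1 \<rho> x ** q0) + norm (integral {0..x} (%t. \<sigma> t ** dQ t - R t))"
   by (simp only: norm_triangle_ineq)
  also have "norm (integral {0..x} (%t. \<sigma> t ** dQ t - R t)) <= integral {0..x} g1"
  proof (rule integral_norm_bound_integral[OF _ g1i])
   show "(%t. \<sigma> t ** dQ t - R t) integrable_on {0..x}" by (intro integrable_diff sigma_cont_integrable(1)[OF c(4) xp] Ri)
   fix t assume "t \<in> {0..x}"
   then have t: "t \<in> {0..pi}" using xp by auto
   show "norm (\<sigma> t ** dQ t - R t) <= g1 t" unfolding g1_def
    by (rule order_trans[OF norm_triangle_ineq4 add_mono[OF norm_matmul_le Rb[OF t]]])
  qed
  finally show ?thesis using norm_matmul_le[of "J1 \<rho> x" q0] by linarith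
 qed
 have Qest: "norm (dQ x) <= norm (J2 \<rho> x) * norm p0 + integral {0..x} g2"
 proof -
  define k where "k = (%t::real. e (x - t))"
  have kc: "continuous_on A k" for A unfolding k_def e_def by (intro continuous_intros)
  \<comment> \<open>Multiplication by \<open>e x\<close> turns the factor with exponent
    \<open>- 2 \<i> \<rho> t\<close> into \<open>osc \<rho> (x - t)\<close>; since
    \<open>x - t\<close> lies in \<open>{0..pi}\<close>, this is bounded by \<kappa>.\<close>
  have ke: "e x * exp (- 2 * \<i> * \<rho> * of_real t) = k t" for t
   unfolding k_def e_def by (simp add: exp_add[symmetric] algebra_simps)
  have e1: "e x * exp (- 2 * \<i> * \<rho> * of_real x) = 1" unfolding e_def by (simp add: exp_add[symmetric])
  have k2: "(%t. k t \<cdot> (\<sigma> t ** dP t + R t)) integrable_on {0..x}"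
  proof -
   have "continuous_on {0..pi} (%t. k t \<cdot> dP t)" "continuous_on {0..pi} (%t. k t \<cdot> (P t + Q t))"
    by (intro ms.continuous_on kc c continuous_on_add)+
   note i = sigma_cont_integrable(1)[OF this(1) xp] sigma_cont_integrable(2)[OF this(2) xp]
   have "(%t. (\<i> / (2 * \<rho>)) \<cdot> ((\<sigma> t ** \<sigma> t) ** (k t \<cdot> (P t + Q t)))) integrable_on {0..x}"
    using integrable_linear[OF i(2) ms.bounded_linear_right[of "\<i> / (2 * \<rho>)"]] by (simp only: o_def)
   from integrable_add[OF i(1) this]
   have "(%t. \<sigma> t ** (k t \<cdot> dP t) + (\<i> / (2 * \<rho>)) \<cdot> ((\<sigma> t ** \<sigma> t) ** (k t \<cdot> (P t + Q t)))) integrable_on {0..x}" .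
   moreover have "k t \<cdot> (\<sigma> t ** dP t + R t) = \<sigma> t ** (k t \<cdot> dP t) +
     (\<i> / (2 * \<rho>)) \<cdot> ((\<sigma> t ** \<sigma> t) ** (k t \<cdot> (P t + Q t)))" for t
    unfolding R_def by (simp add: ms.add_right mscale_mult_right mm.add_right mult.commute)
   ultimately show ?thesis by (simp only:)
  qed
  have "exp (- 2 * \<i> * \<rho> * of_real x) \<cdot> Q x - exp (- 2 * \<i> * \<rho> * of_real 0) \<cdot> Q 0 =
    integral {0..x} (%t. exp (- 2 * \<i> * \<rho> * of_real t) \<cdot> (\<sigma> t ** P t + R t))"
   unfolding P_def Q_def R_def by (rule primitive_on_diff[OF Q_primitive[OF \<rho>0]]) (use x in auto)
  then have "e x \<cdot> (exp (- 2 * \<i> * \<rho> * of_real x) \<cdot> Q x - q0) =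
    e x \<cdot> integral {0..x} (%t. exp (- 2 * \<i> * \<rho> * of_real t) \<cdot> (\<sigma> t ** P t + R t))"
   unfolding Q_def PQ_0(2)[OF \<rho>0] q0_def by simp
  also have "e x \<cdot> (exp (- 2 * \<i> * \<rho> * of_real x) \<cdot> Q x - q0) = dQ x"
   unfolding dQ_def ms.diff_right mscale_mscale e1 by simp
  also have "e x \<cdot> integral {0..x} (%t. exp (- 2 * \<i> * \<rho> * of_real t) \<cdot> (\<sigma> t ** P t + R t)) =
    integral {0..x} (%t. k t \<cdot> (\<sigma> t ** P t + R t))"
  proof -
   have "(%t. exp (- 2 * \<i> * \<rho> * of_real t) \<cdot> (\<sigma> t ** P t + R t)) integrable_on {0..x}"
    using primitive_on_integrable(3)[OF Q_primitive[OF \<rho>0, of y w], of 0 x] xp unfolding P_def Q_def R_def by simp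
   from integral_linear[OF this ms.bounded_linear_right[of "e x"]] show ?thesis by (simp only: o_def mscale_mscale ke)
  qed
  also have "... = integral {0..x} (%t. (k t \<cdot> \<sigma> t) ** p0 + k t \<cdot> (\<sigma> t ** dP t + R t))"
   by (rule integral_cong) (simp add: dP_def mm.diff_right mscale_mult_left mscale_mult_right ms.add_right ms.diff_right)
  also have "... = integral {0..x} (%t. (k t \<cdot> \<sigma> t) ** p0) + integral {0..x} (%t. k t \<cdot> (\<sigma> t ** dP t + R t))"
  proof (rule integral_add)
   show "(%t. (k t \<cdot> \<sigma> t) ** p0) integrable_on {0..x}"
    using integrable_linear[OF exp_sigma_integrable[OF kc xp] mm.bounded_linear_left[of p0]] by (simp add: o_def)
  qed (rule k2)
  also have "integral {0..x} (%t. (k t \<cdot> \<sigma> t) ** p0) = J2 \<rho> x ** p0"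
   using integral_linear[OF exp_sigma_integrable[OF kc xp] mm.bounded_linear_left[of p0]]
   unfolding J2_def k_def e_def by (simp add: o_def)
  finally have "norm (dQ x) <= norm (J2 \<rho> x ** p0) + norm (integral {0..x} (%t. k t \<cdot> (\<sigma> t ** dP t + R t)))"
   by (simp only: norm_triangle_ineq)
  also have "norm (integral {0..x} (%t. k t \<cdot> (\<sigma> t ** dP t + R t))) <= integral {0..x} g2"
  proof (rule integral_norm_bound_integral[OF _ g2i])
   show "(%t. k t \<cdot> (\<sigma> t ** dP t + R t)) integrable_on {0..x}" by (rule k2)
   fix t assume tx: "t \<in> {0..x}"
   then have t: "t \<in> {0..pi}" using xp by auto
   have kt: "cmod (k t) <= \<kappa>" unfolding k_def by (rule et) (use tx x in auto)
   show "norm (k t \<cdot> (\<sigma> t ** dP t + R t)) <= g2 t" unfolding g2_def norm_mscale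
    by (intro mult_mono kt order_trans[OF norm_triangle_ineq add_mono[OF norm_matmul_le Rb[OF t]]]) (use \<kappa> in auto)
  qed
  finally show ?thesis using norm_matmul_le[of "J2 \<rho> x" p0] by linarith
 qed
 have "integral {0..x} g1 + integral {0..x} g2 = integral {0..x} (%t. g1 t + g2 t)"
  by (rule integral_add[OF g1i g2i, symmetric])
 also have "... <= integral {0..x} (%t. ka \<kappa> t * u t + \<kappa> * c0 / cmod \<rho> * (norm (\<sigma> t))^2)"
 proof (rule integral_le)
  show "(%t. g1 t + g2 t) integrable_on {0..x}" by (rule integrable_add[OF g1i g2i])
  show "(%t. ka \<kappa> t * u t + \<kappa> * c0 / cmod \<rho> * (norm (\<sigma> t))^2) integrable_on {0..x}"
   by (intro integrable_add integrable_on_mult_right norm_cont_integrable(3)[OF c(5) xp] sqi)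
  fix t
  let ?s = "norm (\<sigma> t)"
  have u0: "0 <= u t" unfolding u_def by simp
  have a: "?s * norm (dQ t) + \<kappa> * (?s * norm (dP t)) <= \<kappa> * ?s * u t"
  proof -
   have "norm (dQ t) <= \<kappa> * norm (dQ t)" using mult_right_mono[OF \<kappa> norm_ge_zero[of "dQ t"]] by simp
   then have "?s * norm (dQ t) <= ?s * (\<kappa> * norm (dQ t))" by (rule mult_left_mono) simp
   then show ?thesis unfolding u_def by (simp add: algebra_simps)
  qed
  have b: "?s^2 / 2 * u t + \<kappa> * (?s^2 / 2 * u t) <= \<kappa> * ?s^2 * u t"
   using mult_right_mono[OF \<kappa>, of "?s^2 / 2 * u t"] u0 by simp
  have d: "?s^2 * c0 / (2 * cmod \<rho>) + \<kappa> * (?s^2 * c0 / (2 * cmod \<rho>)) <= \<kappa> * c0 / cmod \<rho> * ?s^2"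
  proof -
   define A where "A = ?s^2 * c0 / (2 * cmod \<rho>)"
   have "0 <= A" unfolding A_def using c0 by simp
   then have "A <= \<kappa> * A" using mult_right_mono[OF \<kappa>, of A] by simp
   moreover have "\<kappa> * c0 / cmod \<rho> * ?s^2 = 2 * (\<kappa> * A)" unfolding A_def using \<rho>0 by simp
   ultimately show ?thesis unfolding A_def[symmetric] by linarith
  qed
  show "g1 t + g2 t <= ka \<kappa> t * u t + \<kappa> * c0 / cmod \<rho> * ?s^2"
   unfolding g1_def g2_def ka_def using a b d u0 by (simp add: algebra_simps)
 qed
 also have "... = integral {0..x} (%t. ka \<kappa> t * u t) + \<kappa> * c0 / cmod \<rho> * integral {0..x} (%t. (norm (\<sigma> t))^2)"
  by (simp only: integral_add[OF norm_cont_integrable(3)[OF c(5) xp] integrable_on_mult_right[OF sqi(1)]] integral_mult_right)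
 also have "\<kappa> * c0 / cmod \<rho> * integral {0..x} (%t. (norm (\<sigma> t))^2) <= \<kappa> * c0 / cmod \<rho> * S2"
  unfolding S2_def by (intro mult_left_mono integral_subset_le sqi) (use x \<kappa> c0 in auto)
 finally have "integral {0..x} g1 + integral {0..x} g2 <= integral {0..x} (%t. ka \<kappa> t * u t) + \<kappa> * S2 * c0 / cmod \<rho>"
  by (simp add: mult_ac)
 moreover have "u x = norm (dP x) + norm (dQ x)" unfolding u_def ..
 ultimately show ?thesis using Pest Qest unfolding u c0_def by linarith
qed

end

section \<open>Smallness and square summability of the oscillating integrals\<close>

lemma cmod_exp_le:
 assumes "- B <= Im \<rho>" "0 <= B" "0 <= s" "s <= pi"
 shows "cmod (osc \<rho> s) <= exp (2 * pi * B)"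
proof -
 have "(- Im \<rho>) * s <= B * s" by (rule mult_right_mono) (use assms in auto)
 then have "- (2 * Im \<rho> * s) <= 2 * B * s" by (simp add: mult.commute)
 also have "... <= 2 * B * pi" using assms by (intro mult_left_mono) auto
 finally show ?thesis by (simp add: mult_ac)
qed

lemma integral_cexp_le:
 assumes \<rho>: "\<rho> ~= 0" and c: "0 <= c" and k: "1 <= \<kappa>" "cmod (osc \<rho> c) <= \<kappa>"
 shows "cmod (integral {0..c} (%t. osc \<rho> t)) <= \<kappa> / cmod \<rho>"
proof -
 have "integral {0..c} (%t. osc \<rho> t) = (osc \<rho> c - 1) / (2 * \<i> * \<rho>)"
  using has_integral_cexp[of "2 * \<i> * \<rho>" 0 c] \<rho> c by (auto intro: integral_unique)
 then have "cmod (integral {0..c} (%t. osc \<rho> t)) = cmod (osc \<rho> c - 1) / (2 * cmod \<rho>)"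
  by (simp add: norm_divide norm_mult)
 also have "... <= (2 * \<kappa>) / (2 * cmod \<rho>)"
  using norm_triangle_ineq4[of "osc \<rho> c" 1] k by (intro divide_right_mono) auto
 finally show ?thesis by simp
qed

lemma norm_le_card_entries:
 fixes A :: "complex^'m^'m"
 assumes "\<And>i j. cmod (A $ i $ j) <= e"
 shows "norm A <= real CARD('m) * e"
proof -
 have e: "0 <= e" by (rule order_trans[OF norm_ge_zero assms])
 have "(norm A)^2 <= (\<Sum>i\<in>(UNIV::'m set). \<Sum>j\<in>(UNIV::'m set). e^2)"
  unfolding norm_matrix_sq by (intro sum_mono power_mono assms) auto
 also have "... = (real CARD('m) * e)^2" by (simp add: power2_eq_square)
 finally show ?thesis by (rule power2_le_imp_le) (use e in simp)
qed

context sl_potential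
begin

lemma sigma_entry_integrable: "(%t. \<sigma> t $ i $ j) absolutely_integrable_on {0..pi}"
proof -
 have "bounded_linear (%A::complex^'m^'m. A $ i $ j)"
  by (intro bounded_linear_compose[OF bounded_linear_vec_nth] bounded_linear_vec_nth)
 from absolutely_integrable_linear[OF sigma_absolutely_integrable this] show ?thesis by (simp add: o_def)
qed

lemma J_entry:
 assumes "x <= pi"
 shows "J1 \<rho> x $ i $ j = integral {0..x} (%t. osc \<rho> t * \<sigma> t $ i $ j)"
  and "J2 \<rho> x $ i $ j = integral {0..x} (%t. osc \<rho> (x - t) * \<sigma> t $ i $ j)" unfolding J1_def J2_def
 by (subst integral_entry[OF exp_sigma_integrable]; use assms in \<open>auto intro!: continuous_intros\<close>)+

text \<open>Riemann-Lebesgue with the pairs (\<rho>, x) as indices, entry by entry. Uniformity in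
  \<open>x\<close> is what the Gronwall inequality asks for, and uniformity in the half-plane is
  what the large circles ask for.\<close>

lemma J_small:
 assumes B: "0 <= B" and e: "0 < e"
 obtains R where "\<And>\<rho> x. R <= cmod \<rho> ==> \<rho> ~= 0 ==> - B <= Im \<rho> ==> x \<in> {0..pi} ==>
   norm (J1 \<rho> x) <= e & norm (J2 \<rho> x) <= e"
proof -
 let ?\<kappa> = "exp (2 * pi * B)"
 let ?I = "{(\<rho>,x). \<rho> ~= 0 & - B <= Im \<rho> & 0 <= x & x <= pi}"
 have \<kappa>1: "1 <= ?\<kappa>" using B by simp
 interpret k1: oscillating_kernel ?I "%(\<rho>,x) t. osc \<rho> t" snd "%i. cmod (fst i)" pi ?\<kappa>
 proof (unfold_locales, goal_cases)
  case (4 i c)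
  then show ?case using integral_cexp_le[of "fst i" c ?\<kappa>] cmod_exp_le[of B "fst i" c] B \<kappa>1 by (auto simp: case_prod_unfold)
 next
  case (3 i t)
  then show ?case using cmod_exp_le[of B "fst i" t] B by (auto simp: case_prod_unfold)
 qed (auto intro!: continuous_intros)
 interpret k2: oscillating_kernel ?I "%(\<rho>,x) t. osc \<rho> (x - t)" snd "%i. cmod (fst i)" pi ?\<kappa>
 proof (unfold_locales, goal_cases)
  case (4 i c)
  obtain \<rho> x where i: "i = (\<rho>, x)" by (cases i)
  have a: "\<rho> ~= 0" "- B <= Im \<rho>" "0 <= x" "x <= pi" "0 <= c" "c <= x" using 4 i by auto
  have "integral {0..c} (%t. osc \<rho> (x - t)) =
    osc \<rho> x * ((exp ((- 2 * \<i> * \<rho>) * of_real c) - exp ((- 2 * \<i> * \<rho>) * of_real 0)) / (- 2 * \<i> * \<rho>))"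
  proof (rule integral_unique)
   have "((%t. osc \<rho> x * exp ((- 2 * \<i> * \<rho>) * of_real t)) has_integral
     osc \<rho> x * ((exp ((- 2 * \<i> * \<rho>) * of_real c) - exp ((- 2 * \<i> * \<rho>) * of_real 0)) / (- 2 * \<i> * \<rho>))) {0..c}"
    by (intro has_integral_mult_right has_integral_cexp) (use a in auto)
   moreover have "osc \<rho> x * exp ((- 2 * \<i> * \<rho>) * of_real t) = osc \<rho> (x - t)" for t
    by (simp add: exp_add[symmetric] algebra_simps)
   ultimately show "((%t. osc \<rho> (x - t)) has_integral
     osc \<rho> x * ((exp ((- 2 * \<i> * \<rho>) * of_real c) - exp ((- 2 * \<i> * \<rho>) * of_real 0)) / (- 2 * \<i> * \<rho>))) {0..c}"
    by (simp only:)
  qed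
  also have "... = (osc \<rho> x - osc \<rho> (x - c)) / (2 * \<i> * \<rho>)"
  proof -
   have "osc \<rho> x * exp ((- 2 * \<i> * \<rho>) * of_real c) = osc \<rho> (x - c)"
    by (simp add: exp_add[symmetric] algebra_simps)
   then show ?thesis using a(1) by (simp add: field_simps)
  qed
  also have "cmod ... <= (?\<kappa> + ?\<kappa>) / (2 * cmod \<rho>)"
  proof -
   have "cmod (osc \<rho> x) <= ?\<kappa>" "cmod (osc \<rho> (x - c)) <= ?\<kappa>" by (rule cmod_exp_le; use a B in auto)+
   then have "cmod (osc \<rho> x - osc \<rho> (x - c)) <= ?\<kappa> + ?\<kappa>"
    by (rule order_trans[OF norm_triangle_ineq4 add_mono])
   moreover have "cmod (2 * \<i> * \<rho>) = 2 * cmod \<rho>" by (simp add: norm_mult)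
   ultimately show ?thesis unfolding norm_divide by (simp only: divide_right_mono norm_ge_zero mult_nonneg_nonneg zero_le_numeral)
  qed
  finally show ?case using i by simp
 next
  case (3 i t)
  obtain \<rho> x where i: "i = (\<rho>, x)" by (cases i)
  show ?case using 3 cmod_exp_le[of B \<rho> "x - t"] B i by auto
 qed (auto intro!: continuous_intros)
 define e1 where "e1 = e / real CARD('m)"
 have e1: "e1 > 0" unfolding e1_def using e by simp
 have "\<exists>R. \<forall>i j. \<forall>ix\<in>?I. R i j <= cmod (fst ix) --> cmod (integral {0..snd ix} (%t. (case ix of (\<rho>,x) => %t. osc \<rho> t) t * \<sigma> t $ i $ j)) <= e1"
  by (intro choice allI) (use k1.riemann_lebesgue[OF sigma_entry_integrable] e1 in \<open>unfold k1.decays_def, blast\<close>)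
 then obtain R1 where R1: "\<And>i j ix. ix \<in> ?I ==> R1 i j <= cmod (fst ix) ==> cmod (integral {0..snd ix} (%t. (case ix of (\<rho>,x) => %t. osc \<rho> t) t * \<sigma> t $ i $ j)) <= e1"
  by blast
 have "\<exists>R. \<forall>i j. \<forall>ix\<in>?I. R i j <= cmod (fst ix) --> cmod (integral {0..snd ix} (%t. (case ix of (\<rho>,x) => %t. osc \<rho> (x - t)) t * \<sigma> t $ i $ j)) <= e1"
  by (intro choice allI) (use k2.riemann_lebesgue[OF sigma_entry_integrable] e1 in \<open>unfold k2.decays_def, blast\<close>)
 then obtain R2 where R2: "\<And>i j ix. ix \<in> ?I ==> R2 i j <= cmod (fst ix) ==> cmod (integral {0..snd ix} (%t. (case ix of (\<rho>,x) => %t. osc \<rho> (x - t)) t * \<sigma> t $ i $ j)) <= e1"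
  by blast
 \<comment> \<open>There are finitely many entries, so one threshold serves all of them and both
   integrals.\<close>
 define R where "R = Max ((%(i,j). max (R1 i j) (R2 i j)) ` UNIV)"
 have R: "R1 i j <= R" "R2 i j <= R" for i j
 proof -
  have "max (R1 i j) (R2 i j) <= R" unfolding R_def by (rule Max_ge) (auto intro: image_eqI[of _ _ "(i,j)"])
  then show "R1 i j <= R" "R2 i j <= R" by auto
 qed
 show thesis
 proof (rule that[of R])
  fix \<rho> x assume a: "R <= cmod \<rho>" "\<rho> ~= 0" "- B <= Im \<rho>" "x \<in> {0..pi}"
  have "cmod (J1 \<rho> x $ i $ j) <= e1" "cmod (J2 \<rho> x $ i $ j) <= e1" for i j
   using R1[of "(\<rho>,x)" i j] R2[of "(\<rho>,x)" i j] R[of i j] a by (auto simp: J_entry)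
  then have "norm (J1 \<rho> x) <= real CARD('m) * e1" "norm (J2 \<rho> x) <= real CARD('m) * e1"
   by (auto intro: norm_le_card_entries)
  then show "norm (J1 \<rho> x) <= e & norm (J2 \<rho> x) <= e" unfolding e1_def by simp
 qed
qed

text \<open>The exponential with frequency \<open>n + z\<close> is the Fourier factor with frequency
  \<open>n\<close> times a bounded factor depending on \<open>z\<close>, which is absorbed into the
  function. Bessel's inequality then applies to each entry, with a bound independent of
  \<open>z\<close> and \<open>x\<close>.\<close>

lemma J_l2:
 assumes B: "0 <= B" and z: "\<bar>Im z\<bar> <= B" and x: "x \<in> {0..pi}" and F: "finite F"
 defines "C \<equiv> (real CARD('m))\<^sup>2 * (pi * ((exp (2 * pi * B))^2 * S2))"
 shows "(\<Sum>n\<in>F. (norm (J1 (of_int n + z) x))^2) <= C" "(\<Sum>n\<in>F. (norm (J2 (of_int n + z) x))^2) <= C"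
proof -
 let ?\<kappa> = "exp (2 * pi * B)"
 have gen: "(\<Sum>n\<in>G. (cmod (integral {0..x} (%t. exp (2 * \<i> * of_int n * of_real t) * (h t * \<sigma> t $ i $ j))))^2) <= pi * (?\<kappa>\<^sup>2 * S2)"
  if h: "continuous_on {0..pi} h" "\<And>t. t \<in> {0..x} ==> cmod (h t) <= ?\<kappa>" and G: "finite G" for h i j G
 proof -
  \<comment> \<open>Extension by 0 beyond \<open>x\<close>, since Bessel's inequality lives on the
    full interval.\<close>
  define g where "g = (%t. if t \<in> {0..x} then h t * \<sigma> t $ i $ j else 0)"
  have hs: "(%t. h t * \<sigma> t $ i $ j) absolutely_integrable_on {0..pi}"
   by (rule abs_integrable_bilinear_left[OF bounded_bilinear_cmult h(1) sigma_entry_integrable])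
  then have "(%t. h t * \<sigma> t $ i $ j) absolutely_integrable_on {0..x}"
   by (rule absolutely_integrable_on_subinterval) (use x in auto)
  then have gi: "g absolutely_integrable_on {0..pi}" unfolding set_integrable_def g_def
   by (rule Bochner_Integration.integrable_cong[THEN iffD1, rotated -1]) (use x in \<open>auto simp: indicator_def\<close>)
  have bd: "(cmod (g t))^2 <= ?\<kappa>\<^sup>2 * (norm (\<sigma> t))^2" for t
  proof (cases "t \<in> {0..x}")
   case True
   have "cmod (g t) <= ?\<kappa> * norm (\<sigma> t)" unfolding g_def using True h(2)[OF True]
    by (simp add: norm_mult mult_mono cmod_entry_le)
   then have "(cmod (g t))^2 <= (?\<kappa> * norm (\<sigma> t))^2" by (intro power_mono) auto
   then show ?thesis by (simp add: power_mult_distrib)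
  next
   case False
   then have "g t = 0" unfolding g_def by (simp only: if_False)
   then show ?thesis by simp
  qed
  have sqi: "(%t. ?\<kappa>\<^sup>2 * (norm (\<sigma> t))^2) integrable_on {0..pi}"
   using norm_sq_absolutely_integrable by (intro integrable_on_mult_right) (simp add: absolutely_integrable_on_def)
  have gm: "g \<in> borel_measurable (lebesgue_on {0..pi})" by (rule absolutely_integrable_imp_borel_measurable[OF gi]) simp
  have "(%t. (cmod (g t))^2) absolutely_integrable_on {0..pi}"
   by (rule measurable_bounded_by_integrable_imp_absolutely_integrable[OF _ _ sqi]) (use gm bd in auto)
  then have g2: "(%t. (cmod (g t))^2) integrable_on {0..pi}" by (simp add: absolutely_integrable_on_def)
  have "integral {0..x} (%t. exp (2 * \<i> * of_int n * of_real t) * (h t * \<sigma> t $ i $ j)) =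
    integral {0..pi} (%t. exp (2 * \<i> * of_int n * of_real t) * g t)" for n
  proof -
   have "integral {0..pi} (%t. exp (2 * \<i> * of_int n * of_real t) * g t) =
     integral {0..pi} (%t. if t \<in> {0..x} then exp (2 * \<i> * of_int n * of_real t) * (h t * \<sigma> t $ i $ j) else 0)"
    by (rule integral_cong) (simp add: g_def)
   also have "... = integral {0..x} (%t. exp (2 * \<i> * of_int n * of_real t) * (h t * \<sigma> t $ i $ j))"
    unfolding integral_restrict_Int by (rule arg_cong2[where f=integral]) (use x in auto)
   finally show ?thesis ..
  qed
  then have "(\<Sum>n\<in>G. (cmod (integral {0..x} (%t. exp (2 * \<i> * of_int n * of_real t) * (h t * \<sigma> t $ i $ j))))^2)
    <= pi * integral {0..pi} (%t. (cmod (g t))^2)" using bessel_inequality[OF gi g2 G] by simp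
  also have "integral {0..pi} (%t. (cmod (g t))^2) <= integral {0..pi} (%t. ?\<kappa>\<^sup>2 * (norm (\<sigma> t))^2)"
   by (rule integral_le[OF g2 sqi]) (rule bd)
  also have "... = ?\<kappa>\<^sup>2 * S2" unfolding S2_def by simp
  finally show ?thesis by simp
 qed
 have xp: "x <= pi" using x by simp
 have iz: "- B <= Im z" using z by linarith
 have tot: "(\<Sum>n\<in>F. (norm (J n))^2) <= C"
  if J: "\<And>i j. (\<Sum>n\<in>F. (cmod (J n $ i $ j))^2) <= pi * (?\<kappa>\<^sup>2 * S2)" for J :: "int => complex^'m^'m"
 proof -
  have "(\<Sum>n\<in>F. (norm (J n))^2) = (\<Sum>i\<in>UNIV. \<Sum>j\<in>UNIV. \<Sum>n\<in>F. (cmod (J n $ i $ j))^2)"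
   unfolding norm_matrix_sq by (subst sum.swap, rule sum.cong[OF refl], rule sum.swap)
  also have "... <= (\<Sum>i\<in>(UNIV::'m set). \<Sum>j\<in>(UNIV::'m set). pi * (?\<kappa>\<^sup>2 * S2))"
   by (intro sum_mono J)
  also have "... = C" unfolding C_def by (simp add: power2_eq_square)
  finally show ?thesis .
 qed
 show "(\<Sum>n\<in>F. (norm (J1 (of_int n + z) x))^2) <= C"
 proof (rule tot)
  fix i j
  have E: "exp (2 * \<i> * (of_int n + z) * of_real t) = exp (2 * \<i> * of_int n * of_real t) * exp (2 * \<i> * z * of_real t)" for n t
   by (simp add: exp_add[symmetric] algebra_simps)
  have bd: "cmod (exp (2 * \<i> * z * of_real t)) <= ?\<kappa>" if "t \<in> {0..x}" for t
   by (rule cmod_exp_le[OF iz B]) (use that x in auto)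
  have hc: "continuous_on {0..pi} (%t. exp (2 * \<i> * z * of_real t))" by (intro continuous_intros)
  show "(\<Sum>n\<in>F. (cmod (J1 (of_int n + z) x $ i $ j))^2) <= pi * (?\<kappa>\<^sup>2 * S2)"
   unfolding J_entry(1)[OF xp] E mult.assoc[of _ _ "\<sigma> _ $ i $ j"] by (rule gen[OF hc bd F])
 qed
 show "(\<Sum>n\<in>F. (norm (J2 (of_int n + z) x))^2) <= C"
 proof (rule tot)
  fix i j
  \<comment> \<open>In \<open>J2\<close> the variable enters as \<open>x - t\<close>: this splits
    off a factor of modulus 1 and leaves the Fourier frequency \<open>- n\<close>, so the sum is
    later reindexed by negation.\<close>
  have E: "exp (2 * \<i> * (of_int n + z) * of_real (x - t)) = exp (2 * \<i> * of_int n * of_real x) *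
    (exp (2 * \<i> * of_int (- n) * of_real t) * exp (2 * \<i> * z * of_real (x - t)))" for n t
   unfolding exp_add[symmetric] by (rule arg_cong[where f=exp]) (simp add: algebra_simps)
  have bd: "cmod (exp (2 * \<i> * z * of_real (x - t))) <= ?\<kappa>" if "t \<in> {0..x}" for t
   by (rule cmod_exp_le[OF iz B]) (use that x in auto)
  have hc: "continuous_on {0..pi} (%t. exp (2 * \<i> * z * of_real (x - t)))" by (intro continuous_intros)
  have eq: "cmod (J2 (of_int n + z) x $ i $ j) = cmod (integral {0..x} (%t. exp (2 * \<i> * of_int (- n) * of_real t) * (exp (2 * \<i> * z * of_real (x - t)) * \<sigma> t $ i $ j)))" for n
  proof -
   have "J2 (of_int n + z) x $ i $ j = integral {0..x} (%t. exp (2 * \<i> * of_int n * of_real x) *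
      (exp (2 * \<i> * of_int (- n) * of_real t) * (exp (2 * \<i> * z * of_real (x - t)) * \<sigma> t $ i $ j)))"
    unfolding J_entry(2)[OF xp] E mult.assoc[of _ _ "\<sigma> _ $ i $ j"] mult.assoc[of _ _ "_ * \<sigma> _ $ i $ j"] ..
   also have "... = exp (2 * \<i> * of_int n * of_real x) *
     integral {0..x} (%t. exp (2 * \<i> * of_int (- n) * of_real t) * (exp (2 * \<i> * z * of_real (x - t)) * \<sigma> t $ i $ j))"
    by (rule integral_mult_right)
   finally show ?thesis by (simp add: norm_mult)
  qed
  have "(\<Sum>n\<in>F. (cmod (J2 (of_int n + z) x $ i $ j))^2) =
    (\<Sum>n\<in>uminus ` F. (cmod (integral {0..x} (%t. exp (2 * \<i> * of_int n * of_real t) * (exp (2 * \<i> * z * of_real (x - t)) * \<sigma> t $ i $ j))))^2)"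
   unfolding eq by (subst sum.reindex) (simp_all add: o_def)
  also have "... <= pi * (?\<kappa>\<^sup>2 * S2)" by (rule gen[OF hc bd]) (use F in simp_all)
  finally show "(\<Sum>n\<in>F. (cmod (J2 (of_int n + z) x $ i $ j))^2) <= pi * (?\<kappa>\<^sup>2 * S2)" .
 qed
qed

end

section \<open>Deviation of the solutions from the free ones\<close>

abbreviation "cpi \<rho> \<equiv> cos (\<rho> * complex_of_real pi)"
abbreviation "spi \<rho> \<equiv> sin (\<rho> * complex_of_real pi)"

context sl_potential
begin

lemma ka_nonneg: "1 <= \<kappa> ==> 0 <= ka \<kappa> t" unfolding ka_def by (intro add_nonneg_nonneg mult_nonneg_nonneg) auto

text \<open>All driving terms in \<open>PQ_dev_estimate\<close> are small for large \<rho>,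
  uniformly in \<open>x\<close>, and Gronwall's inequality with the fixed weight
  \<open>ka \<kappa>\<close> transfers this to the deviation.\<close>

lemma PQ_dev_small:
 assumes B: "0 <= B" and e: "0 < e"
 shows "\<exists>R\<ge>1. \<forall>\<rho> (y::complex^'m^'m) w. R <= cmod \<rho> --> - B <= Im \<rho> --> PQ_dev \<rho> y w pi <= e * (norm y + norm w)"
proof -
 define \<kappa> where "\<kappa> = exp (2 * pi * B)"
 define D where "D = exp (2 * integral {0..pi} (ka \<kappa>))"
 have \<kappa>1: "1 <= \<kappa>" unfolding \<kappa>_def using B by simp
 have D: "D > 0" unfolding D_def by simp
 \<comment> \<open>The two oscillating terms contribute \<open>e1\<close> each and the 1/\<rho> term
   \<open>2 * e1\<close>; the Gronwall bound doubles this and multiplies it by \<open>D\<close>,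
   whence the 8.\<close>
 define e1 where "e1 = e / (8 * D)"
 have e1: "e1 > 0" unfolding e1_def using e D by simp
 obtain R0 where R0: "\<And>\<rho> x. R0 <= cmod \<rho> ==> \<rho> ~= 0 ==> - B <= Im \<rho> ==> x \<in> {0..pi} ==>
   norm (J1 \<rho> x) <= e1 & norm (J2 \<rho> x) <= e1" using J_small[OF B e1] by blast
 define G where "G = \<kappa> * S2 * (1 + \<kappa>)"
 have G: "0 <= G" unfolding G_def using S2_nonneg \<kappa>1 by simp
 show ?thesis
 proof (intro exI[of _ "max 1 (max R0 (G / (2 * e1)))"] conjI allI impI)
  fix \<rho> :: complex and y w :: "complex^'m^'m"
  assume "max 1 (max R0 (G / (2 * e1))) <= cmod \<rho>" and im: "- B <= Im \<rho>"
  then have \<rho>: "1 <= cmod \<rho>" "R0 <= cmod \<rho>" "G / (2 * e1) <= cmod \<rho>" by auto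
  have \<rho>0: "\<rho> ~= 0" using \<rho>(1) by auto
  define s where "s = norm y + norm w"
  have s: "0 <= s" unfolding s_def by simp
  have p0: "norm (y + \<i> \<cdot> w) <= s" unfolding s_def by (rule order_trans[OF norm_triangle_ineq]) (simp add: norm_mscale)
  have q0: "norm (y - \<i> \<cdot> w) <= s" unfolding s_def by (rule order_trans[OF norm_triangle_ineq4]) (simp add: norm_mscale)
  have "PQ_dev \<rho> y w pi <= 2 * (4 * e1 * s) * exp (2 * integral {0..pi} (ka \<kappa>))"
  proof (rule gronwall_bound[OF ka_absolutely_integrable ka_nonneg[OF \<kappa>1] PQ_dev_continuous[OF \<rho>0]])
   show "0 <= 4 * e1 * s" using e1 s by simp
   fix x assume x: "x \<in> {0..pi}"
   have "cmod (osc \<rho> t) <= \<kappa>" if "t \<in> {0..pi}" for t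
    unfolding \<kappa>_def by (rule cmod_exp_le[OF im B]) (use that in auto)
   note PQ_dev_estimate[OF \<rho>(1) \<kappa>1 this x, of y w]
   moreover have "norm (J1 \<rho> x) * norm (y - \<i> \<cdot> w) <= e1 * s" "norm (J2 \<rho> x) * norm (y + \<i> \<cdot> w) <= e1 * s"
    using R0[OF \<rho>(2) \<rho>0 im x] p0 q0 e1 by (auto intro!: mult_mono)
   moreover have "\<kappa> * S2 * (norm (y + \<i> \<cdot> w) + \<kappa> * norm (y - \<i> \<cdot> w)) / cmod \<rho> <= 2 * e1 * s"
   proof -
    have "\<kappa> * S2 * (norm (y + \<i> \<cdot> w) + \<kappa> * norm (y - \<i> \<cdot> w)) <= \<kappa> * S2 * (s + \<kappa> * s)"
     using p0 q0 \<kappa>1 S2_nonneg by (intro mult_left_mono add_mono) auto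
    also have "... = G * s" unfolding G_def by (simp add: algebra_simps)
    also have "G * s <= (2 * e1 * cmod \<rho>) * s" using \<rho>(3) e1 s by (intro mult_right_mono) (simp_all add: field_simps)
    finally show ?thesis using \<rho>(1) \<rho>0 by (simp add: divide_le_eq mult_ac)
   qed
   ultimately show "PQ_dev \<rho> y w x <= 4 * e1 * s + integral {0..x} (%t. ka \<kappa> t * PQ_dev \<rho> y w t)" by linarith
  qed simp
  also have "... = e * s" unfolding D_def[symmetric] e1_def using D by simp
  finally show "PQ_dev \<rho> y w pi <= e * (norm y + norm w)" unfolding s_def .
 qed auto
qed

lemma sum_inverse_squares_le:
 assumes "finite F"
 shows "(\<Sum>n\<in>F. inverse ((real n)^2)) <= (\<Sum>n. inverse ((real n)^2))"
 using inverse_power_summable[of 2, where 'a=real] by (intro sum_le_suminf assms) auto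

text \<open>The sum of squared deviations satisfies a Gronwall inequality itself: weighted
  Cauchy-Schwarz turns the square of the integral term into an integral of squares, and the driving
  terms sum by \<open>J_l2\<close>. \<open>y\<close> and \<open>w\<close> may depend on
  \<open>n\<close> because the initial data of the scaled \<open>phi\<close> contain the term
  \<open>H1 / \<rho>\<close>.\<close>

lemma PQ_dev_l2:
 assumes B: "0 <= B"
 shows "\<exists>C\<ge>0. \<forall>z F (y::nat => complex^'m^'m) w K. \<bar>Im z\<bar> <= B --> \<bar>Re z\<bar> <= 2 --> finite F --> (\<forall>n\<in>F. 4 <= n) -->
   0 <= K --> (\<forall>n\<in>F. norm (y n) + norm (w n) <= K) -->
   (\<Sum>n\<in>F. (PQ_dev (of_nat n + z) (y n) (w n) pi)^2) <= C * K^2"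
proof -
 define \<kappa> where "\<kappa> = exp (2 * pi * B)"
 define A where "A = integral {0..pi} (ka \<kappa>) + 1"
 define CJ where "CJ = (real CARD('m))^2 * (pi * (\<kappa>^2 * S2))"
 define G where "G = \<kappa> * S2 * (1 + \<kappa>)"
 define Z where "Z = (\<Sum>n. inverse ((real n)^2))"
 define D where "D = exp (2 * integral {0..pi} (%t. 2 * A * ka \<kappa> t))"
 have \<kappa>1: "1 <= \<kappa>" unfolding \<kappa>_def using B by simp
 note kai = ka_absolutely_integrable[of \<kappa>] and kan = ka_nonneg[OF \<kappa>1]
 have A: "0 < A" "integral {0..pi} (ka \<kappa>) <= A" unfolding A_def
  using integral_nonneg[of "ka \<kappa>" "{0..pi}"] kai kan by (auto simp: absolutely_integrable_on_def)
 have G: "0 <= G" unfolding G_def using S2_nonneg \<kappa>1 by simp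
 have CJ: "0 <= CJ" unfolding CJ_def using S2_nonneg by simp
 have Z: "0 <= Z" unfolding Z_def by (rule suminf_nonneg) (use inverse_power_summable[of 2, where 'a=real] in auto)
 \<comment> \<open>6 is 2 from separating the integral term times 3 from squaring three driving
   terms; \<open>2 * CJ\<close> accounts for \<open>J1\<close> and \<open>J2\<close>, and
   \<open>4 * G^2 * Z\<close> for the 1/\<rho> term.\<close>
 define E where "E = 6 * (2 * CJ + 4 * G^2 * Z)"
 have E: "0 <= E" unfolding E_def using CJ Z by simp
 show ?thesis
 proof (intro exI[of _ "2 * E * D"] conjI allI impI)
  show "0 <= 2 * E * D" unfolding D_def using E by simp
  fix z F K and y w :: "nat => complex^'m^'m"
  assume z: "\<bar>Im z\<bar> <= B" "\<bar>Re z\<bar> <= 2" and F: "finite F" "\<forall>n\<in>F. 4 <= n" and K: "0 <= K" "\<forall>n\<in>F. norm (y n) + norm (w n) <= K"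
  define d where "d = (%n. PQ_dev (of_nat n + z) (y n) (w n))"
  \<comment> \<open>With \<open>n >= 4\<close> and \<open>\<bar>Re z\<bar> <= 2\<close> the real
    part of \<open>n + z\<close> is at least \<open>n - 2\<close>, which is at least
    \<open>n / 2\<close>.\<close>
  have \<rho>: "real n / 2 <= cmod (of_nat n + z)" "1 <= cmod (of_nat n + z)" "of_nat n + z ~= 0" if "n \<in> F" for n
  proof -
   have n4: "4 <= real n" using F that by force
   have "\<bar>Re (of_nat n + z)\<bar> <= cmod (of_nat n + z)" by (rule abs_Re_le_cmod)
   then show "real n / 2 <= cmod (of_nat n + z)" using n4 z by simp
   then show "1 <= cmod (of_nat n + z)" using n4 by linarith
   then show "of_nat n + z ~= 0" by auto
  qed
  have dc: "continuous_on {0..pi} (d n)" if "n \<in> F" for n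
   unfolding d_def by (rule PQ_dev_continuous[OF \<rho>(3)[OF that]])
  have ki: "(%t. ka \<kappa> t * (d n t)^2) integrable_on {0..x}" if "n \<in> F" "x \<in> {0..pi}" for n x
   by (rule norm_cont_integrable(3)) (use that in \<open>auto intro!: continuous_intros dc\<close>)
  have ptw: "(d n x)^2 <= 6 * K^2 * ((norm (J1 (of_nat n + z) x))^2 + (norm (J2 (of_nat n + z) x))^2 + 4 * G^2 * inverse ((real n)^2))
     + 2 * A * integral {0..x} (%t. ka \<kappa> t * (d n t)^2)" if n: "n \<in> F" and x: "x \<in> {0..pi}" for n x
  proof -
   let ?\<rho> = "of_nat n + z"
   define a b g I where "a = norm (J1 ?\<rho> x)" and "b = norm (J2 ?\<rho> x)" and "g = 2 * G / real n"
    and "I = integral {0..x} (%t. ka \<kappa> t * d n t)"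
   have n0: "real n > 0" using F n by force
   have yw: "norm (y n) + norm (w n) <= K" using K n by auto
   have p0: "norm (y n + \<i> \<cdot> w n) <= K" by (rule order_trans[OF norm_triangle_ineq]) (use yw in \<open>simp add: norm_mscale\<close>)
   have q0: "norm (y n - \<i> \<cdot> w n) <= K" by (rule order_trans[OF norm_triangle_ineq4]) (use yw in \<open>simp add: norm_mscale\<close>)
   have "cmod (exp (2 * \<i> * ?\<rho> * of_real t)) <= \<kappa>" if "t \<in> {0..pi}" for t
    unfolding \<kappa>_def by (rule cmod_exp_le[OF _ B]) (use that z in auto)
   note PQ_dev_estimate[OF \<rho>(2)[OF n] \<kappa>1 this x, of "y n" "w n"]
   moreover have "norm (J1 ?\<rho> x) * norm (y n - \<i> \<cdot> w n) <= a * K" "norm (J2 ?\<rho> x) * norm (y n + \<i> \<cdot> w n) <= b * K"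
    using p0 q0 by (auto intro!: mult_left_mono simp: a_def b_def)
   moreover have "\<kappa> * S2 * (norm (y n + \<i> \<cdot> w n) + \<kappa> * norm (y n - \<i> \<cdot> w n)) / cmod ?\<rho> <= g * K"
   proof -
    have "\<kappa> * S2 * (norm (y n + \<i> \<cdot> w n) + \<kappa> * norm (y n - \<i> \<cdot> w n)) <= \<kappa> * S2 * (K + \<kappa> * K)"
     using p0 q0 \<kappa>1 S2_nonneg by (intro mult_left_mono add_mono) auto
    also have "... = G * K" unfolding G_def by (simp add: algebra_simps)
    finally have "\<kappa> * S2 * (norm (y n + \<i> \<cdot> w n) + \<kappa> * norm (y n - \<i> \<cdot> w n)) / cmod ?\<rho> <= (G * K) / (real n / 2)"
     using \<rho>[OF n] n0 G K by (intro frac_le) auto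
    then show ?thesis unfolding g_def by (simp add: mult_ac)
   qed
   ultimately have "d n x <= (a + b + g) * K + I" unfolding d_def I_def by (simp add: algebra_simps)
   moreover have "0 <= d n x" unfolding d_def PQ_dev_def by simp
   ultimately have "(d n x)^2 <= ((a + b + g) * K + I)^2" by (rule power_mono)
   also have "... <= 2 * ((a + b + g) * K)^2 + 2 * I^2"
    using zero_le_power2[of "(a + b + g) * K - I"] unfolding power2_sum power2_diff by linarith
   also have "((a + b + g) * K)^2 <= 3 * (a^2 + b^2 + g^2) * K^2"
   proof -
    have "(a + b + g)^2 <= 3 * (a^2 + b^2 + g^2)"
     using zero_le_power2[of "a - b"] zero_le_power2[of "a - g"] zero_le_power2[of "b - g"]
     unfolding power2_diff by (simp add: power2_eq_square algebra_simps)
    then show ?thesis unfolding power_mult_distrib by (rule mult_right_mono) simp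
   qed
   also have "I^2 <= A * integral {0..x} (%t. ka \<kappa> t * (d n t)^2)"
    unfolding I_def by (rule integral_cauchy_schwarz_weighted[OF kai kan dc[OF n] x A(2) A(1)])
   finally show ?thesis unfolding a_def b_def g_def by (simp add: power_divide power_mult_distrib field_simps)
  qed
  define v where "v = (%t. \<Sum>n\<in>F. (d n t)^2)"
  have "v pi <= 2 * (E * K^2) * exp (2 * integral {0..pi} (%t. 2 * A * ka \<kappa> t))"
  proof (rule gronwall_bound[where b=pi and u=v and x=pi])
   show "(%t. 2 * A * ka \<kappa> t) absolutely_integrable_on {0..pi}" using kai by (intro set_integrable_mult_right)
   show "0 <= 2 * A * ka \<kappa> t" for t using A kan by simp
   show "continuous_on {0..pi} v" unfolding v_def by (intro continuous_intros dc)
   show "0 <= E * K^2" using E by simp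
   fix x assume x: "x \<in> {0..pi}"
   have iF: "(\<Sum>n\<in>F. (norm (J (of_nat n + z) x))^2) <= CJ" if "\<And>F. finite F ==> (\<Sum>n\<in>F. (norm (J (of_int n + z) x))^2) <= CJ" for J :: "complex => real => complex^'m^'m"
   proof -
    have "(\<Sum>n\<in>int ` F. (norm (J (of_int n + z) x))^2) = (\<Sum>n\<in>F. (norm (J (of_nat n + z) x))^2)"
     by (subst sum.reindex) auto
    then show ?thesis using that[of "int ` F"] F by simp
   qed
   have J1: "(\<Sum>n\<in>F. (norm (J1 (of_nat n + z) x))^2) <= CJ"
    by (rule iF) (unfold CJ_def \<kappa>_def, rule J_l2(1)[OF B z(1) x])
   have J2: "(\<Sum>n\<in>F. (norm (J2 (of_nat n + z) x))^2) <= CJ"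
    by (rule iF) (unfold CJ_def \<kappa>_def, rule J_l2(2)[OF B z(1) x])
   have "v x <= (\<Sum>n\<in>F. 6 * K^2 * ((norm (J1 (of_nat n + z) x))^2 + (norm (J2 (of_nat n + z) x))^2 + 4 * G^2 * inverse ((real n)^2))
     + 2 * A * integral {0..x} (%t. ka \<kappa> t * (d n t)^2))" unfolding v_def by (intro sum_mono ptw x)
   also have "... = 6 * K^2 * ((\<Sum>n\<in>F. (norm (J1 (of_nat n + z) x))^2) + (\<Sum>n\<in>F. (norm (J2 (of_nat n + z) x))^2) + 4 * G^2 * (\<Sum>n\<in>F. inverse ((real n)^2)))
     + 2 * A * (\<Sum>n\<in>F. integral {0..x} (%t. ka \<kappa> t * (d n t)^2))"
    by (simp only: sum.distrib sum_distrib_left[symmetric])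
   also have "6 * K^2 * ((\<Sum>n\<in>F. (norm (J1 (of_nat n + z) x))^2) + (\<Sum>n\<in>F. (norm (J2 (of_nat n + z) x))^2) + 4 * G^2 * (\<Sum>n\<in>F. inverse ((real n)^2))) \<le>
     6 * K^2 * (CJ + CJ + 4 * G^2 * Z)" unfolding Z_def by (intro mult_left_mono add_mono J1 J2 sum_inverse_squares_le F(1)) auto
   also have "... = E * K^2" unfolding E_def by simp
   also have "(\<Sum>n\<in>F. integral {0..x} (%t. ka \<kappa> t * (d n t)^2)) = integral {0..x} (%t. \<Sum>n\<in>F. ka \<kappa> t * (d n t)^2)"
    by (rule integral_sum[symmetric]) (use F ki x in auto)
   also have "2 * A * integral {0..x} (%t. \<Sum>n\<in>F. ka \<kappa> t * (d n t)^2) = integral {0..x} (%t. 2 * A * ka \<kappa> t * v t)"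
    unfolding v_def by (simp only: integral_mult_right[symmetric] sum_distrib_left mult.assoc)
   finally show "v x <= E * K^2 + integral {0..x} (%t. 2 * A * ka \<kappa> t * v t)" by simp
  qed simp
  also have "... = 2 * E * D * K^2" unfolding D_def by simp
  finally show "(\<Sum>n\<in>F. (PQ_dev (of_nat n + z) (y n) (w n) pi)^2) <= 2 * E * D * K^2" unfolding v_def d_def .
 qed
qed

text \<open>\<open>Y\<close> and \<open>Z / \<rho>\<close> are recovered from \<open>P_fun\<close>
  and \<open>Q_fun\<close> by dividing by \<open>exp (\<i> \<rho> pi)\<close>; the inverse of this
  exponential has modulus \<open>exp (pi * Im \<rho>)\<close>.\<close>

lemma sol_at_pi:
 assumes \<rho>: "\<rho> ~= 0"
 shows "norm (fst (sol (\<rho>^2) y (\<rho> \<cdot> w) pi) - (cpi \<rho> \<cdot> y + spi \<rho> \<cdot> w)) <= exp (pi * Im \<rho>) * PQ_dev \<rho> y w pi"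
  and "norm ((1 / \<rho>) \<cdot> snd (sol (\<rho>^2) y (\<rho> \<cdot> w) pi) - (cpi \<rho> \<cdot> w - spi \<rho> \<cdot> y)) <= exp (pi * Im \<rho>) * PQ_dev \<rho> y w pi"
proof -
 define Y where "Y = fst (sol (\<rho>^2) y (\<rho> \<cdot> w) pi)"
 define Z where "Z = snd (sol (\<rho>^2) y (\<rho> \<cdot> w) pi)"
 define E where "E = exp (\<i> * \<rho> * of_real pi)"
 have E0: "E ~= 0" unfolding E_def by simp
 have E2: "osc \<rho> pi = E^2" unfolding E_def by (simp add: power2_eq_square exp_add[symmetric] mult.assoc)
 have c: "cpi \<rho> = (E + inverse E) / 2" and s: "spi \<rho> = (E - inverse E) / (2 * \<i>)"
  unfolding E_def cos_exp_eq sin_exp_eq by (simp_all add: exp_minus mult.assoc)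
 have nE: "cmod (inverse E) = exp (pi * Im \<rho>)" unfolding E_def by (simp add: exp_minus[symmetric] norm_inverse mult.commute)
 define dP where "dP = P_fun \<rho> y w pi - (y + \<i> \<cdot> w)"
 define dQ where "dQ = Q_fun \<rho> y w pi - E^2 \<cdot> (y - \<i> \<cdot> w)"
 have dev: "PQ_dev \<rho> y w pi = norm dP + norm dQ" unfolding PQ_dev_def dP_def dQ_def E2 ..
 have P: "P_fun \<rho> y w pi = E \<cdot> (Y + (\<i> / \<rho>) \<cdot> Z)" and Q: "Q_fun \<rho> y w pi = E \<cdot> (Y - (\<i> / \<rho>) \<cdot> Z)"
  unfolding P_fun_def Q_fun_def E_def Y_def Z_def by simp_all
 have 1: "Y - (cpi \<rho> \<cdot> y + spi \<rho> \<cdot> w) = (inverse E / 2) \<cdot> (dP + dQ)"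
  unfolding c s dP_def dQ_def P Q using E0 \<rho> by (simp add: vec_eq_iff field_simps power2_eq_square)
 have 2: "(1 / \<rho>) \<cdot> Z - (cpi \<rho> \<cdot> w - spi \<rho> \<cdot> y) = (inverse E / (2 * \<i>)) \<cdot> (dP - dQ)"
  unfolding c s dP_def dQ_def P Q using E0 \<rho> by (simp add: vec_eq_iff field_simps power2_eq_square)
 have "exp (pi * Im \<rho>) / 2 * norm (dP + dQ) <= exp (pi * Im \<rho>) * PQ_dev \<rho> y w pi"
  unfolding dev using norm_triangle_ineq[of dP dQ] by (simp add: mult_left_mono) (smt (verit) norm_ge_zero)
 then show "norm (fst (sol (\<rho>^2) y (\<rho> \<cdot> w) pi) - (cpi \<rho> \<cdot> y + spi \<rho> \<cdot> w)) <= exp (pi * Im \<rho>) * PQ_dev \<rho> y w pi"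
  unfolding Y_def[symmetric] 1 norm_mscale norm_divide nE by simp
 have "exp (pi * Im \<rho>) / 2 * norm (dP - dQ) <= exp (pi * Im \<rho>) * PQ_dev \<rho> y w pi"
  unfolding dev using norm_triangle_ineq4[of dP dQ] by (simp add: mult_left_mono) (smt (verit) norm_ge_zero)
 then show "norm ((1 / \<rho>) \<cdot> snd (sol (\<rho>^2) y (\<rho> \<cdot> w) pi) - (cpi \<rho> \<cdot> w - spi \<rho> \<cdot> y)) <= exp (pi * Im \<rho>) * PQ_dev \<rho> y w pi"
  unfolding Z_def[symmetric] 2 norm_mscale norm_divide norm_mult nE by simp
qed

end

section \<open>Asymptotics of the boundary forms\<close>

text \<open>The matrix with eigenvalue \<open>a\<close> on the range and \<open>b\<close> on the
  kernel of the projection \<open>T\<close>. For fixed \<open>T\<close> these multiply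
  componentwise, so they are invertible for nonzero and unitary for unimodular parameters (Hermitian
  \<open>T\<close>).\<close>

definition pr :: "complex^'m^'m => complex => complex => complex^'m^'m" where
 "pr T a b = a \<cdot> T + b \<cdot> (mat 1 - T)"

lemma projection_complement:
 fixes T :: "complex^'m^'m"
 assumes "T ** T = T"
 shows "T ** (mat 1 - T) = 0" "(mat 1 - T) ** T = 0" "(mat 1 - T) ** (mat 1 - T) = mat 1 - T"
 using assms by (simp_all add: mm.diff_left mm.diff_right)

lemma pr_mult:
 assumes "T ** T = T"
 shows "pr T a b ** pr T c d = pr T (a * c) (b * d)" unfolding pr_def using projection_complement[OF assms] assms
 by (simp add: mm.add_left mm.add_right mscale_mult_left mscale_mult_right mm.zero_left ms.zero_right mult.commute)

lemma pr_one: "pr T 1 1 = mat 1" unfolding pr_def by simp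

lemma det_pr:
 assumes "T ** T = T" "a ~= 0" "b ~= 0"
 shows "det (pr T a b) ~= 0"
proof -
 have "pr T a b ** pr T (1 / a) (1 / b) = mat 1" using assms by (simp add: pr_mult pr_one)
 then have "det (pr T a b) * det (pr T (1 / a) (1 / b)) = 1" by (metis det_mul det_I)
 then show ?thesis by auto
qed

lemma cmod_sin_cos_le: "cmod (sin (z * of_real pi)) <= exp (pi * \<bar>Im z\<bar>)" "cmod (cos (z * of_real pi)) <= exp (pi * \<bar>Im z\<bar>)"
proof -
 have e: "cmod (exp (\<i> * (z * of_real pi))) <= exp (pi * \<bar>Im z\<bar>)" "cmod (exp (- (\<i> * (z * of_real pi)))) <= exp (pi * \<bar>Im z\<bar>)"
  using mult_right_mono[of "- Im z" "\<bar>Im z\<bar>" pi] mult_right_mono[of "Im z" "\<bar>Im z\<bar>" pi]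
  by (simp_all add: mult.commute[of pi])
 have "cmod (exp (\<i> * (z * of_real pi)) - exp (- (\<i> * (z * of_real pi)))) <= exp (pi * \<bar>Im z\<bar>) + exp (pi * \<bar>Im z\<bar>)"
  by (rule order_trans[OF norm_triangle_ineq4 add_mono[OF e]])
 then show "cmod (sin (z * of_real pi)) <= exp (pi * \<bar>Im z\<bar>)" unfolding sin_exp_eq norm_divide by (simp add: norm_mult)
 have "cmod (exp (\<i> * (z * of_real pi)) + exp (- (\<i> * (z * of_real pi)))) <= exp (pi * \<bar>Im z\<bar>) + exp (pi * \<bar>Im z\<bar>)"
  by (rule order_trans[OF norm_triangle_ineq add_mono[OF e]])
 then show "cmod (cos (z * of_real pi)) <= exp (pi * \<bar>Im z\<bar>)" unfolding cos_exp_eq norm_divide by simp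
qed

context sl_problem
begin

text \<open>The left factor divides by \<rho> the \<open>T2\<close> part of \<open>V2\<close>, where
  the quasi-derivative enters. The right factors bring the initial values of \<open>phi\<close> and
  \<open>psi\<close> to the form \<open>y\<close>, \<open>\<rho> \<cdot> w\<close> with bounded
  \<open>y\<close> and \<open>w\<close>. The sign makes \<open>W0\<close> the leading term.\<close>

definition Nhat :: "complex => complex^'m^'m" where
 "Nhat \<rho> = - (pr T2 (1 / \<rho>) 1 ** Nmat (\<rho>^2) ** pr T1 1 \<rho>)"

definition Uhat :: "complex => complex^'m^'m" where "Uhat \<rho> = pr T2 (1 / \<rho>) 1 ** Smat (\<rho>^2) ** pr T1 \<rho> 1"

lemma Nmat_eq_Nhat:
 assumes "\<rho> ~= 0"
 shows "Nmat (\<rho>^2) = - (pr T2 \<rho> 1 ** Nhat \<rho> ** pr T1 1 (1 / \<rho>))"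
proof -
 have "pr T2 \<rho> 1 ** Nhat \<rho> ** pr T1 1 (1 / \<rho>) =
   - ((pr T2 \<rho> 1 ** pr T2 (1 / \<rho>) 1) ** Nmat (\<rho>^2) ** (pr T1 1 \<rho> ** pr T1 1 (1 / \<rho>)))"
  unfolding Nhat_def by (simp add: mm.minus_left mm.minus_right matrix_mul_assoc)
 then show ?thesis using assms by (simp add: pr_mult T1_simps T2_simps pr_one)
qed

lemma det_Nhat: "\<rho> ~= 0 ==> det (Nhat \<rho>) ~= 0 \<longleftrightarrow> det (Nmat (\<rho>^2)) ~= 0"
proof -
 assume \<rho>: "\<rho> ~= 0"
 have "Nhat \<rho> = pr T2 (- (1 / \<rho>)) (- 1) ** Nmat (\<rho>^2) ** pr T1 1 \<rho>"
  unfolding Nhat_def mm.minus_left[symmetric] by (simp add: pr_def ms.minus_left)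
 then show ?thesis
  using \<rho> det_pr[OF T2_simps(2), of "- (1 / \<rho>)" "- 1"] det_pr[OF T1_simps(2), of 1 \<rho>] by (simp add: det_mul)
qed

text \<open>The left scalings of \<open>Nmat\<close> and \<open>Smat\<close> cancel; the right ones
  survive, as \<open>pr T1 \<rho> 1\<close> is \<rho> times the inverse of
  \<open>pr T1 1 \<rho>\<close>. At \<rho> near \<open>n\<close> they become the outer factors of
  the asymptotic formula.\<close>

lemma weyl_matrix_hat:
 assumes \<rho>: "\<rho> ~= 0" and d: "det (Nhat \<rho>) ~= 0"
 shows "weyl (\<rho>^2) = (1 / \<rho>) \<cdot> (pr T1 1 \<rho> ** (matrix_inv (Nhat \<rho>) ** Uhat \<rho>) ** pr T1 1 \<rho>)"
proof -
 have dN: "det (Nmat (\<rho>^2)) ~= 0" using det_Nhat[OF \<rho>] d by simp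
 let ?X = "- (pr T1 1 (1 / \<rho>) ** matrix_inv (Nmat (\<rho>^2)) ** pr T2 \<rho> 1)"
 note p = pr_mult[OF T1_simps(2)] pr_mult[OF T2_simps(2)]
 have "Nhat \<rho> ** ?X = pr T2 (1 / \<rho>) 1 ** (Nmat (\<rho>^2) ** (pr T1 1 \<rho> ** pr T1 1 (1 / \<rho>)) ** matrix_inv (Nmat (\<rho>^2))) ** pr T2 \<rho> 1"
  unfolding Nhat_def by (simp add: mm.minus_left mm.minus_right matrix_mul_assoc)
 also have "... = mat 1" using \<rho> matrix_inv_inverse[OF dN] by (simp add: p pr_one)
 finally have X: "matrix_inv (Nhat \<rho>) = ?X" by (rule matrix_inv_eqI)
 have "pr T1 1 \<rho> ** (?X ** Uhat \<rho>) ** pr T1 1 \<rho> =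
   - ((pr T1 1 \<rho> ** pr T1 1 (1 / \<rho>)) ** matrix_inv (Nmat (\<rho>^2)) ** (pr T2 \<rho> 1 ** pr T2 (1 / \<rho>) 1) ** Smat (\<rho>^2) ** (pr T1 \<rho> 1 ** pr T1 1 \<rho>))"
  unfolding Uhat_def by (simp add: mm.minus_left mm.minus_right matrix_mul_assoc)
 also have "... = - (matrix_inv (Nmat (\<rho>^2)) ** Smat (\<rho>^2) ** pr T1 \<rho> \<rho>)" using \<rho> by (simp add: p pr_one)
 also have "pr T1 \<rho> \<rho> = \<rho> \<cdot> mat 1" unfolding pr_def by (simp add: ms.diff_right)
 finally show ?thesis unfolding X weyl_matrix_eq(2)[OF dN] using \<rho> by (simp add: mscale_mult_right ms.minus_right)
qed

lemma V2_hat: "pr T2 (1 / \<rho>) 1 ** (T2 ** (Z - H2 ** Y) - (mat 1 - T2) ** Y) =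
  T2 ** ((1 / \<rho>) \<cdot> Z) - (1 / \<rho>) \<cdot> (H2 ** Y) - (mat 1 - T2) ** (Y::complex^'m^'m)"
proof -
 have "pr T2 (1 / \<rho>) 1 ** T2 = (1 / \<rho>) \<cdot> T2" "pr T2 (1 / \<rho>) 1 ** (mat 1 - T2) = mat 1 - T2"
  unfolding pr_def using projection_complement[OF T2_simps(2)] T2_simps(2)
  by (simp_all add: mm.add_left mscale_mult_left ms.zero_right)
 then have "pr T2 (1 / \<rho>) 1 ** (T2 ** (Z - H2 ** Y) - (mat 1 - T2) ** Y) = (1 / \<rho>) \<cdot> T2 ** (Z - H2 ** Y) - (mat 1 - T2) ** Y"
  by (simp only: mm.diff_right matrix_mul_assoc)
 also have "(1 / \<rho>) \<cdot> T2 ** (Z - H2 ** Y) = T2 ** ((1 / \<rho>) \<cdot> Z) - (1 / \<rho>) \<cdot> (H2 ** Y)"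
  by (simp add: mm.diff_right mscale_mult_left mscale_mult_right matrix_mul_assoc T2H2 ms.diff_right)
 finally show ?thesis .
qed

text \<open>\<open>bform\<close> is minus the row-scaled \<open>V2\<close> form at \<open>pi\<close>
  for the initial values \<open>y\<close>, \<open>\<rho> \<cdot> w\<close>. \<open>bform0\<close>
  inserts the free solution and omits the \<open>H2\<close> term, which is of lower order.\<close>

definition "soly \<rho> y w = fst (sol (\<rho>^2) (y::complex^'m^'m) (\<rho> \<cdot> w) pi)"
definition "solz \<rho> y w = snd (sol (\<rho>^2) (y::complex^'m^'m) (\<rho> \<cdot> w) pi)"
definition "bform \<rho> y w = (mat 1 - T2) ** soly \<rho> y w - T2 ** ((1 / \<rho>) \<cdot> solz \<rho> y w) + (1 / \<rho>) \<cdot> (H2 ** soly \<rho> y w)"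
definition "bform0 \<rho> y w = (mat 1 - T2) ** (cpi \<rho> \<cdot> y + spi \<rho> \<cdot> w)
  - T2 ** (cpi \<rho> \<cdot> w - spi \<rho> \<cdot> (y::complex^'m^'m))"

text \<open>The right factor turns the initial values of \<open>phi\<close> into \<open>T1\<close>
  and \<rho> times \<open>(mat 1 - T1) + (1 / \<rho>) \<cdot> H1\<close>, so \<open>H1\<close> too
  enters as a perturbation of order 1/\<rho>.\<close>

lemma Nhat_bform:
 assumes \<rho>: "\<rho> ~= 0"
 shows "Nhat \<rho> = bform \<rho> T1 ((mat 1 - T1) + (1 / \<rho>) \<cdot> H1)"
proof -
 let ?C = "pr T1 1 \<rho>"
 note pc = projection_complement[OF T1_simps(2)]
 have "(phi (\<rho>^2) pi ** ?C, phi' (\<rho>^2) pi ** ?C) = sol (\<rho>^2) (phi (\<rho>^2) 0 ** ?C) (phi' (\<rho>^2) 0 ** ?C) pi"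
  by (rule sl_system_eq_sol[OF phi_mult_system]) simp
 moreover have "phi (\<rho>^2) 0 ** ?C = T1"
  unfolding phi_0 pr_def using pc T1_simps by (simp add: mm.add_right mscale_mult_right ms.zero_right)
 moreover have "phi' (\<rho>^2) 0 ** ?C = \<rho> \<cdot> ((mat 1 - T1) + (1 / \<rho>) \<cdot> H1)"
 proof -
  have "H1 ** (mat 1 - T1) = 0" by (simp add: mm.diff_right T1H1)
  then show ?thesis unfolding phi_0 pr_def using pc T1_simps T1H1 \<rho>
   by (simp add: mm.add_right mm.add_left mscale_mult_right ms.zero_right ms.add_right)
 qed
 ultimately have "phi (\<rho>^2) pi ** ?C = soly \<rho> T1 ((mat 1 - T1) + (1 / \<rho>) \<cdot> H1)" "phi' (\<rho>^2) pi ** ?C = solz \<rho> T1 ((mat 1 - T1) + (1 / \<rho>) \<cdot> H1)"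
  unfolding soly_def solz_def by (metis fst_conv, metis snd_conv)
 note e = this
 have "Nmat (\<rho>^2) ** ?C = T2 ** (phi' (\<rho>^2) pi ** ?C - H2 ** (phi (\<rho>^2) pi ** ?C)) - (mat 1 - T2) ** (phi (\<rho>^2) pi ** ?C)"
  unfolding Nmat_def V2_def by (simp add: mm.diff_left mm.diff_right matrix_mul_assoc)
 then show ?thesis unfolding Nhat_def bform_def matrix_mul_assoc[symmetric] by (simp only: e V2_hat) simp
qed

lemma Uhat_bform:
 assumes \<rho>: "\<rho> ~= 0"
 shows "Uhat \<rho> = - bform \<rho> (- (mat 1 - T1)) T1"
proof -
 let ?C = "pr T1 \<rho> 1"
 note pc = projection_complement[OF T1_simps(2)]
 have "sl_system \<sigma> (\<rho>^2) (%x. psi (\<rho>^2) x ** ?C) (%x. psi' (\<rho>^2) x ** ?C)"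
  by (rule sl_system_mult[OF psi_system])
 then have "(psi (\<rho>^2) pi ** ?C, psi' (\<rho>^2) pi ** ?C) = sol (\<rho>^2) (psi (\<rho>^2) 0 ** ?C) (psi' (\<rho>^2) 0 ** ?C) pi"
  by (rule sl_system_eq_sol) simp
 moreover have "psi (\<rho>^2) 0 ** ?C = - (mat 1 - T1)"
  unfolding psi_0 pr_def mm.minus_left mm.add_right mscale_mult_right pc by (simp add: ms.zero_right)
 moreover have "psi' (\<rho>^2) 0 ** ?C = \<rho> \<cdot> T1"
  unfolding psi_0 pr_def mm.add_right mscale_mult_right pc T1_simps by simp
 ultimately have "psi (\<rho>^2) pi ** ?C = soly \<rho> (- (mat 1 - T1)) T1" "psi' (\<rho>^2) pi ** ?C = solz \<rho> (- (mat 1 - T1)) T1"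
  unfolding soly_def solz_def by (metis fst_conv, metis snd_conv)
 note e = this
 have "Smat (\<rho>^2) ** ?C = T2 ** (psi' (\<rho>^2) pi ** ?C - H2 ** (psi (\<rho>^2) pi ** ?C)) - (mat 1 - T2) ** (psi (\<rho>^2) pi ** ?C)"
  unfolding Smat_def V2_def by (simp add: mm.diff_left mm.diff_right matrix_mul_assoc)
 then show ?thesis unfolding Uhat_def bform_def matrix_mul_assoc[symmetric] by (simp only: e V2_hat) simp
qed

lemma W0_bform0: "W0 T1 T2 \<rho> = bform0 \<rho> T1 (mat 1 - T1)" and U0_bform0: "U0 T1 T2 \<rho> = - bform0 \<rho> (- (mat 1 - T1)) T1"
 unfolding W0_def U0_def bform0_def
 by (simp_all only: mm.add_right mm.diff_right mm.minus_right mscale_mult_right ms.add_right ms.diff_right ms.minus_right) simp_all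

lemma bform0_diff: "bform0 \<rho> y (w + (1 / \<rho>) \<cdot> h) - bform0 \<rho> y w =
  (spi \<rho> / \<rho>) \<cdot> ((mat 1 - T2) ** h) - (cpi \<rho> / \<rho>) \<cdot> (T2 ** h)" unfolding bform0_def
 by (simp only: mm.add_right mm.diff_right mscale_mult_right ms.add_right ms.diff_right mscale_mscale) simp

definition "tau2 = norm (mat 1 - T2) + norm T2 + norm H2"
definition "tau1 = norm T1 + norm (mat 1 - T1) + norm H1"

lemma bform_estimate:
 assumes \<rho>: "1 <= cmod \<rho>"
 shows "norm (bform \<rho> y w - bform0 \<rho> y w) <= 2 * tau2 * exp (pi * \<bar>Im \<rho>\<bar>) * (PQ_dev \<rho> y w pi + (norm y + norm w) / cmod \<rho>)"
proof -
 have \<rho>0: "\<rho> ~= 0" using \<rho> by auto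
 define E where "E = exp (pi * \<bar>Im \<rho>\<bar>)"
 define d where "d = PQ_dev \<rho> y w pi"
 define Y0 where "Y0 = cpi \<rho> \<cdot> y + spi \<rho> \<cdot> w"
 define Z0 where "Z0 = cpi \<rho> \<cdot> w - spi \<rho> \<cdot> y"
 define DY where "DY = soly \<rho> y w - Y0"
 define DZ where "DZ = (1 / \<rho>) \<cdot> solz \<rho> y w - Z0"
 have d0: "0 <= d" unfolding d_def PQ_dev_def by simp
 have E0: "0 <= E" unfolding E_def by simp
 have "exp (pi * Im \<rho>) * d <= E * d" unfolding E_def using d0 by (intro mult_right_mono) auto
 then have D: "norm DY <= E * d" "norm DZ <= E * d"
  using sol_at_pi[OF \<rho>0, of y w] unfolding DY_def DZ_def Y0_def Z0_def soly_def solz_def d_def by (simp_all only: order_trans)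
 have Y0: "norm Y0 <= E * (norm y + norm w)"
 proof -
  have "norm Y0 <= cmod (cpi \<rho>) * norm y + cmod (spi \<rho>) * norm w"
   unfolding Y0_def by (rule order_trans[OF norm_triangle_ineq]) (simp add: norm_mscale)
  also have "... <= E * norm y + E * norm w"
   unfolding E_def by (intro add_mono mult_right_mono cmod_sin_cos_le norm_ge_zero)
  finally show ?thesis by (simp add: algebra_simps)
 qed
 have eq: "bform \<rho> y w - bform0 \<rho> y w = ((mat 1 - T2) ** DY - T2 ** DZ) + (1 / \<rho>) \<cdot> (H2 ** (DY + Y0))"
  unfolding bform_def bform0_def DY_def DZ_def Y0_def[symmetric] Z0_def[symmetric] by (simp add: mm.diff_right)
 have "norm (bform \<rho> y w - bform0 \<rho> y w) <= (norm ((mat 1 - T2) ** DY) + norm (T2 ** DZ)) + norm ((1 / \<rho>) \<cdot> (H2 ** (DY + Y0)))"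
  unfolding eq by (rule order_trans[OF norm_triangle_ineq add_mono[OF norm_triangle_ineq4 order_refl]])
 also have "norm ((mat 1 - T2) ** DY) <= norm (mat 1 - T2) * (E * d)"
  by (rule order_trans[OF norm_matmul_le mult_left_mono[OF D(1)]]) simp
 also have "norm (T2 ** DZ) <= norm T2 * (E * d)" by (rule order_trans[OF norm_matmul_le mult_left_mono[OF D(2)]]) simp
 also have "norm ((1 / \<rho>) \<cdot> (H2 ** (DY + Y0))) <= norm H2 * (E * d) + norm H2 * (E * ((norm y + norm w) / cmod \<rho>))"
 proof -
  have "norm (H2 ** (DY + Y0)) <= norm H2 * (E * d + E * (norm y + norm w))"
   by (rule order_trans[OF norm_matmul_le mult_left_mono[OF order_trans[OF norm_triangle_ineq add_mono[OF D(1) Y0]]]]) simp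
  then have "norm ((1 / \<rho>) \<cdot> (H2 ** (DY + Y0))) <= norm H2 * (E * d + E * (norm y + norm w)) / cmod \<rho>"
   unfolding norm_mscale by (simp add: norm_divide divide_right_mono)
  also have "... = norm H2 * (E * d) / cmod \<rho> + norm H2 * (E * ((norm y + norm w) / cmod \<rho>))"
   by (simp add: algebra_simps add_divide_distrib)
  also have "norm H2 * (E * d) / cmod \<rho> <= norm H2 * (E * d) / 1"
   by (rule divide_left_mono[OF \<rho>]) (use d0 E0 \<rho>0 in auto)
  finally show ?thesis by simp
 qed
 finally have "norm (bform \<rho> y w - bform0 \<rho> y w) <= tau2 * (E * d) + norm H2 * (E * ((norm y + norm w) / cmod \<rho>))"
  unfolding tau2_def by (simp add: algebra_simps)
 also have "tau2 * (E * d) <= 2 * tau2 * E * d" 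
 proof -
  have "0 <= tau2 * (E * d)" using d0 E0 unfolding tau2_def by simp
  moreover have "2 * tau2 * E * d = 2 * (tau2 * (E * d))" by (simp only: mult.assoc)
  ultimately show ?thesis by linarith
 qed
 also have "norm H2 * (E * ((norm y + norm w) / cmod \<rho>)) <= (2 * tau2) * (E * ((norm y + norm w) / cmod \<rho>))"
  by (rule mult_right_mono) (use E0 in \<open>auto simp: tau2_def\<close>)
 finally show ?thesis unfolding E_def[symmetric] d_def[symmetric] by (simp add: algebra_simps)
qed

abbreviation "errN \<rho> \<equiv> norm (Nhat \<rho> - W0 T1 T2 \<rho>)"
abbreviation "errU \<rho> \<equiv> norm (Uhat \<rho> - U0 T1 T2 \<rho>)"

text \<open>Reduces both matrix errors to a deviation plus 1/\<rho>. The last two conclusions bound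
  the initial data in question, as the bounds on \<open>PQ_dev\<close> require.\<close>

lemma hat_estimate:
 assumes \<rho>: "1 <= cmod \<rho>"
 shows "errN \<rho> <= 3 * tau2 * (1 + tau1) * exp (pi * \<bar>Im \<rho>\<bar>) * (PQ_dev \<rho> T1 ((mat 1 - T1) + (1 / \<rho>) \<cdot> H1) pi + 1 / cmod \<rho>)"
  and "errU \<rho> <= 3 * tau2 * (1 + tau1) * exp (pi * \<bar>Im \<rho>\<bar>) * (PQ_dev \<rho> (- (mat 1 - T1)) T1 pi + 1 / cmod \<rho>)"
  and "norm T1 + norm ((mat 1 - T1) + (1 / \<rho>) \<cdot> H1) <= tau1"
  and "norm (- (mat 1 - T1)) + norm T1 <= tau1"
proof -
 have \<rho>0: "\<rho> ~= 0" using \<rho> by auto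
 define E where "E = exp (pi * \<bar>Im \<rho>\<bar>)"
 have E0: "0 <= E" unfolding E_def by simp
 have t2: "0 <= tau2" and t1: "0 <= tau1" unfolding tau1_def tau2_def by simp_all
 have "norm ((1 / \<rho>) \<cdot> H1) <= norm H1"
  unfolding norm_mscale norm_divide using \<rho> \<rho>0 mult_right_mono[OF \<rho>, of "norm H1"] by (simp add: divide_le_eq mult.commute)
 then show k1: "norm T1 + norm ((mat 1 - T1) + (1 / \<rho>) \<cdot> H1) <= tau1"
  using norm_triangle_ineq[of "mat 1 - T1" "(1 / \<rho>) \<cdot> H1"] unfolding tau1_def by linarith
 show k2: "norm (- (mat 1 - T1)) + norm T1 <= tau1" unfolding tau1_def norm_minus_cancel by simp
 have gen: "2 * tau2 * E * (d + k / cmod \<rho>) + tau2 * E * (tau1 / cmod \<rho>) <= 3 * tau2 * (1 + tau1) * E * (d + 1 / cmod \<rho>)" 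
  if "0 <= d" "k <= tau1" for d k
 proof -
  define X where "X = 1 / cmod \<rho>"
  define A where "A = tau2 * E"
  have A: "0 <= A" unfolding A_def using t2 E0 by simp
  have X: "0 <= X" unfolding X_def by simp
  have "k * X <= tau1 * X" using that X by (simp add: mult_right_mono)
  then have "A * (k * X) <= A * (tau1 * X)" by (rule mult_left_mono[OF _ A])
  moreover have "0 <= A * d" "0 <= A * X" "0 <= A * (tau1 * d)" using A X that t1 by simp_all
  ultimately have "2 * (A * d) + 2 * (A * (k * X)) + A * (tau1 * X) <= 3 * (A * d + A * X + A * (tau1 * d) + A * (tau1 * X))"
   by argo
  then show ?thesis unfolding A_def X_def by (simp add: algebra_simps)
 qed
 show "errN \<rho> <= 3 * tau2 * (1 + tau1) * exp (pi * \<bar>Im \<rho>\<bar>) * (PQ_dev \<rho> T1 ((mat 1 - T1) + (1 / \<rho>) \<cdot> H1) pi + 1 / cmod \<rho>)"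
 proof -
  let ?w = "(mat 1 - T1) + (1 / \<rho>) \<cdot> H1"
  let ?e = "bform0 \<rho> T1 ?w - bform0 \<rho> T1 (mat 1 - T1)"
  have "norm ?e <= norm ((spi \<rho> / \<rho>) \<cdot> ((mat 1 - T2) ** H1)) + norm ((cpi \<rho> / \<rho>) \<cdot> (T2 ** H1))"
   unfolding bform0_diff by (rule norm_triangle_ineq4)
  also have "... <= (E / cmod \<rho>) * (norm (mat 1 - T2) * norm H1) + (E / cmod \<rho>) * (norm T2 * norm H1)"
   unfolding norm_mscale norm_divide E_def by (intro add_mono mult_mono divide_right_mono cmod_sin_cos_le norm_matmul_le) auto
  also have "... = E / cmod \<rho> * ((norm (mat 1 - T2) + norm T2) * norm H1)" by (simp add: algebra_simps)
  also have "... <= E / cmod \<rho> * (tau2 * tau1)"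
   unfolding tau1_def tau2_def using E0 by (intro mult_left_mono mult_mono) auto
  finally have e: "norm ?e <= tau2 * E * (tau1 / cmod \<rho>)" by (simp add: mult_ac)
  have "Nhat \<rho> - W0 T1 T2 \<rho> = (bform \<rho> T1 ?w - bform0 \<rho> T1 ?w) + ?e"
   unfolding Nhat_bform[OF \<rho>0] W0_bform0 by simp
  then have "errN \<rho> <= norm (bform \<rho> T1 ?w - bform0 \<rho> T1 ?w) + norm ?e" by (simp only: norm_triangle_ineq)
  also have "... <= 2 * tau2 * E * (PQ_dev \<rho> T1 ?w pi + (norm T1 + norm ?w) / cmod \<rho>) + tau2 * E * (tau1 / cmod \<rho>)"
   unfolding E_def by (rule add_mono[OF bform_estimate[OF \<rho>] e[unfolded E_def]])
  also have "... <= 3 * tau2 * (1 + tau1) * E * (PQ_dev \<rho> T1 ?w pi + 1 / cmod \<rho>)"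
   by (rule gen[OF _ k1]) (simp add: PQ_dev_def)
  finally show ?thesis unfolding E_def .
 qed
 show "errU \<rho> <= 3 * tau2 * (1 + tau1) * exp (pi * \<bar>Im \<rho>\<bar>) * (PQ_dev \<rho> (- (mat 1 - T1)) T1 pi + 1 / cmod \<rho>)"
 proof -
  let ?y = "- (mat 1 - T1)"
  have "errU \<rho> = norm (bform \<rho> ?y T1 - bform0 \<rho> ?y T1)"
   unfolding Uhat_bform[OF \<rho>0] U0_bform0 by (simp only: minus_diff_minus norm_minus_cancel)
  also have "... <= 2 * tau2 * E * (PQ_dev \<rho> ?y T1 pi + (norm ?y + norm T1) / cmod \<rho>)"
   unfolding E_def by (rule bform_estimate[OF \<rho>])
  also have "... <= ... + tau2 * E * (tau1 / cmod \<rho>)" using t1 t2 E0 by simp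
  also have "... <= 3 * tau2 * (1 + tau1) * E * (PQ_dev \<rho> ?y T1 pi + 1 / cmod \<rho>)"
   by (rule gen[OF _ k2]) (simp add: PQ_dev_def)
  finally show ?thesis unfolding E_def .
 qed
qed

text \<open>\<open>W0\<close> grows like \<open>exp (pi * \<bar>Im \<rho>\<bar>)\<close>, so the
  error is small relative to that growth. The half-plane covers large half circles
  (\<open>B = 0\<close>) as well as contours around points of the real axis
  (\<open>B = 1\<close>).\<close>

lemma hat_small:
 assumes B: "0 <= B" and e: "0 < e"
 shows "\<exists>R\<ge>1. \<forall>\<rho>. R <= cmod \<rho> --> - B <= Im \<rho> -->
   errN \<rho> <= e * exp (pi * \<bar>Im \<rho>\<bar>) & errU \<rho> <= e * exp (pi * \<bar>Im \<rho>\<bar>)"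
proof -
 have t2: "0 <= tau2" and t1: "0 <= tau1" unfolding tau1_def tau2_def by simp_all
 define c where "c = 3 * tau2 * (1 + tau1)"
 have c: "0 <= c" unfolding c_def using t1 t2 by simp
 define e1 where "e1 = e / (c * (tau1 + 1) + 1)"
 have cc: "0 < c * (tau1 + 1) + 1" using c t1 by (simp add: add_nonneg_pos)
 have e1: "0 < e1" unfolding e1_def using e cc by simp
 have ce: "c * (e1 * tau1 + e1) <= e"
 proof -
  have "c * (e1 * tau1 + e1) = e1 * (c * (tau1 + 1))" by (simp add: algebra_simps)
  also have "... <= e1 * (c * (tau1 + 1) + 1)" using e1 by (intro mult_left_mono) auto
  also have "... = e" unfolding e1_def using cc by simp
  finally show ?thesis .
 qed
 obtain R where R: "R \<ge> 1" "\<forall>\<rho> (y::complex^'m^'m) w. R <= cmod \<rho> --> - B <= Im \<rho> --> PQ_dev \<rho> y w pi <= e1 * (norm y + norm w)"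
  using PQ_dev_small[OF B e1] by blast
 show ?thesis
 proof (intro exI[of _ "max R (1 / e1)"] conjI allI impI)
  fix \<rho> assume "max R (1 / e1) <= cmod \<rho>" and im: "- B <= Im \<rho>"
  then have \<rho>: "R <= cmod \<rho>" "1 / e1 <= cmod \<rho>" "1 <= cmod \<rho>" using R(1) by auto
  have i: "1 / cmod \<rho> <= e1" using le_imp_inverse_le[OF \<rho>(2)] e1 by (simp add: divide_inverse)
  let ?E = "exp (pi * \<bar>Im \<rho>\<bar>)"
  have gen: "c * ?E * (PQ_dev \<rho> y w pi + 1 / cmod \<rho>) <= e * ?E" if "norm y + norm w <= tau1" for y w :: "complex^'m^'m"
  proof -
   have "PQ_dev \<rho> y w pi + 1 / cmod \<rho> <= e1 * tau1 + e1"
    using R(2)[rule_format, OF \<rho>(1) im, of y w] mult_left_mono[OF that, of e1] e1 i by linarith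
   then have "c * ?E * (PQ_dev \<rho> y w pi + 1 / cmod \<rho>) <= c * ?E * (e1 * tau1 + e1)" using c by (intro mult_left_mono) auto
   also have "... = (c * (e1 * tau1 + e1)) * ?E" by (simp only: mult_ac)
   also have "... <= e * ?E" using ce by (intro mult_right_mono) auto
   finally show ?thesis .
  qed
  note h = hat_estimate[OF \<rho>(3), folded c_def]
  show "errN \<rho> <= e * ?E" by (rule order_trans[OF h(1) gen[OF h(3)]])
  show "errU \<rho> <= e * ?E" by (rule order_trans[OF h(2) gen[OF h(4)]])
 qed (use R in auto)
qed

lemma hat_l2:
 assumes B: "0 <= B"
 shows "\<exists>C\<ge>0. \<forall>z (F::nat set). \<bar>Im z\<bar> <= B --> \<bar>Re z\<bar> <= 2 --> finite F --> (\<forall>n\<in>F. 4 <= n) -->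
   (\<Sum>n\<in>F. (errN (of_nat n + z))^2) <= C & (\<Sum>n\<in>F. (errU (of_nat n + z))^2) <= C"
proof -
 have t2: "0 <= tau2" and t1: "0 <= tau1" unfolding tau1_def tau2_def by simp_all
 define c where "c = 3 * tau2 * (1 + tau1) * exp (pi * B)"
 have c: "0 <= c" unfolding c_def using t1 t2 by simp
 define S where "S = (\<Sum>n. inverse ((real n)^2))"
 have S: "0 <= S" unfolding S_def by (rule suminf_nonneg) (use inverse_power_summable[of 2, where 'a=real] in auto)
 obtain C where C: "C \<ge> 0" "\<forall>z F (y::nat => complex^'m^'m) w K. \<bar>Im z\<bar> <= B --> \<bar>Re z\<bar> <= 2 --> finite F --> (\<forall>n\<in>F. 4 <= n) -->
   0 <= K --> (\<forall>n\<in>F. norm (y n) + norm (w n) <= K) -->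
   (\<Sum>n\<in>F. (PQ_dev (of_nat n + z) (y n) (w n) pi)^2) <= C * K^2" using PQ_dev_l2[OF B] by blast
 show ?thesis
 proof (intro exI[of _ "2 * c^2 * (C * tau1^2 + 4 * S)"] conjI allI impI)
  show "0 <= 2 * c^2 * (C * tau1^2 + 4 * S)" using C S by simp
  fix z and F :: "nat set" assume z: "\<bar>Im z\<bar> <= B" "\<bar>Re z\<bar> <= 2" and F: "finite F" "\<forall>n\<in>F. 4 <= n"
  have \<rho>: "real n / 2 <= cmod (of_nat n + z)" "1 <= cmod (of_nat n + z)" if "n \<in> F" for n
  proof -
   have n4: "4 <= real n" using F that by force
   have "\<bar>Re (of_nat n + z)\<bar> <= cmod (of_nat n + z)" by (rule abs_Re_le_cmod)
   then show "real n / 2 <= cmod (of_nat n + z)" using n4 z by simp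
   then show "1 <= cmod (of_nat n + z)" using n4 by linarith
  qed
  have sq2: "(a + b)^2 <= 2 * (a^2 + b^2)" for a b :: real using sum_squares_bound[of a b] by (simp add: power2_sum)
  have gen: "(\<Sum>n\<in>F. (norm (X n))^2) <= 2 * c^2 * (C * tau1^2 + 4 * S)"
   if X: "\<And>n. n \<in> F ==> norm (X n) <= 3 * tau2 * (1 + tau1) * exp (pi * \<bar>Im (of_nat n + z)\<bar>) * (PQ_dev (of_nat n + z) (y n) (w n) pi + 1 / cmod (of_nat n + z))"
    and yw: "\<forall>n\<in>F. norm (y n) + norm (w n) <= tau1" for X y w :: "nat => complex^'m^'m"
  proof -
   have "(norm (X n))^2 <= 2 * c^2 * ((PQ_dev (of_nat n + z) (y n) (w n) pi)^2 + 4 * inverse ((real n)^2))" if n: "n \<in> F" for n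
   proof -
    define d where "d = PQ_dev (of_nat n + z) (y n) (w n) pi"
    have d: "0 <= d" unfolding d_def PQ_dev_def by simp
    have n0: "0 < real n" using F n by force
    have i: "1 / cmod (of_nat n + z) <= 2 * inverse (real n)"
    proof -
     have "inverse (cmod (of_nat n + z)) <= inverse (real n / 2)" by (rule le_imp_inverse_le[OF \<rho>(1)[OF n]]) (use n0 in simp)
     then show ?thesis by (simp only: inverse_eq_divide) simp
    qed
    have "norm (X n) <= c * (d + 2 * inverse (real n))"
    proof (rule order_trans[OF X[OF n]], unfold d_def[symmetric], rule mult_mono)
     show "3 * tau2 * (1 + tau1) * exp (pi * \<bar>Im (of_nat n + z)\<bar>) <= c"
      unfolding c_def using t1 t2 z by (intro mult_left_mono) auto
    qed (use i d c in auto)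
    then have "(norm (X n))^2 <= (c * (d + 2 * inverse (real n)))^2" by (rule power_mono) simp
    also have "... <= c^2 * (2 * (d^2 + (2 * inverse (real n))^2))" unfolding power_mult_distrib[of c]
     by (rule mult_left_mono[OF sq2]) simp
    finally show ?thesis unfolding d_def[symmetric] by (simp add: power_mult_distrib power_inverse algebra_simps)
   qed
   then have "(\<Sum>n\<in>F. (norm (X n))^2) <= (\<Sum>n\<in>F. 2 * c^2 * ((PQ_dev (of_nat n + z) (y n) (w n) pi)^2 + 4 * inverse ((real n)^2)))"
    by (rule sum_mono)
   also have "... = 2 * c^2 * ((\<Sum>n\<in>F. (PQ_dev (of_nat n + z) (y n) (w n) pi)^2) + 4 * (\<Sum>n\<in>F. inverse ((real n)^2)))"
    by (simp only: sum.distrib sum_distrib_left[symmetric])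
   also have "... <= 2 * c^2 * (C * tau1^2 + 4 * S)"
   proof (intro mult_left_mono add_mono)
    show "(\<Sum>n\<in>F. (PQ_dev (of_nat n + z) (y n) (w n) pi)^2) <= C * tau1^2"
     by (rule mp[OF mp[OF mp[OF mp[OF mp[OF mp[OF C(2)[THEN spec[of _ z], THEN spec[of _ F],
        THEN spec[of _ y], THEN spec[of _ w], THEN spec[of _ tau1]] z(1)] z(2)] F(1)] F(2)] t1] yw])
    show "(\<Sum>n\<in>F. inverse ((real n)^2)) <= S" unfolding S_def by (rule sum_inverse_squares_le[OF F(1)])
   qed simp_all
   finally show ?thesis .
  qed
  show "(\<Sum>n\<in>F. (errN (of_nat n + z))^2) <= 2 * c^2 * (C * tau1^2 + 4 * S)"
  proof (rule gen)
   fix n assume n: "n \<in> F"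
   show "errN (of_nat n + z) <= 3 * tau2 * (1 + tau1) * exp (pi * \<bar>Im (of_nat n + z)\<bar>) *
     (PQ_dev (of_nat n + z) ((%n. T1) n) ((%n. (mat 1 - T1) + (1 / (of_nat n + z)) \<cdot> H1) n) pi + 1 / cmod (of_nat n + z))"
    by (rule hat_estimate(1)[OF \<rho>(2)[OF n]])
  qed (intro ballI hat_estimate(3)[OF \<rho>(2)])
  show "(\<Sum>n\<in>F. (errU (of_nat n + z))^2) <= 2 * c^2 * (C * tau1^2 + 4 * S)"
  proof (rule gen)
   fix n assume n: "n \<in> F"
   show "errU (of_nat n + z) <= 3 * tau2 * (1 + tau1) * exp (pi * \<bar>Im (of_nat n + z)\<bar>) *
     (PQ_dev (of_nat n + z) ((%n. - (mat 1 - T1)) n) ((%n. T1) n) pi + 1 / cmod (of_nat n + z))"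
    by (rule hat_estimate(2)[OF \<rho>(2)[OF n]])
  qed (intro ballI hat_estimate(4)[OF \<rho>(2)])
 qed
qed

end

section \<open>Quantitative invertibility\<close>

lemma ctranspose_pr: "ctranspose T = T ==> ctranspose (pr T a b) = pr T (cnj a) (cnj b)"
 unfolding pr_def by (simp add: ctranspose_add ctranspose_mscale ctranspose_diff)

lemma pr_isometry:
 assumes "ctranspose T = T" "T ** T = T" "cmod a = 1" "cmod b = 1"
 shows "norm (pr T a b *v v) = norm v"
proof -
 have u: "cnj a * a = 1" "cnj b * b = 1" using assms(3,4) by (simp_all add: complex_norm_square[symmetric] mult.commute)
 have "ctranspose (pr T a b ** colm v) ** (pr T a b ** colm v) = ctranspose (colm v) ** ((pr T (cnj a) (cnj b) ** pr T a b) ** colm v)"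
  by (simp add: ctranspose_mult ctranspose_pr[OF assms(1)] matrix_mul_assoc)
 also have "... = ctranspose (colm v) ** colm v" using u by (simp add: pr_mult[OF assms(2)] pr_one)
 finally have "complex_of_real ((norm (pr T a b ** colm v))^2) = complex_of_real ((norm (colm v))^2)"
  unfolding ctranspose_mult_self[symmetric] by simp
 then have "(norm (pr T a b *v v))^2 = (norm v)^2" unfolding mult_colm norm_colm of_real_eq_iff .
 then show ?thesis by simp
qed

text \<open>Each column of the inverse has norm at most \<open>1 / c\<close>; the factor
  \<open>CARD('m)\<close> is the price of passing from entries to the Frobenius norm.\<close>

lemma det_nonzero_lower_bound:
 fixes A :: "complex^'m^'m"
 assumes c: "0 < c" and A: "\<And>v. c * norm v <= norm (A *v v)"
 shows "det A ~= 0" and "norm (matrix_inv A) <= real CARD('m) * (1 / c)"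
proof -
 show d: "det A ~= 0"
 proof
  assume "det A = 0"
  then obtain v where v: "A *v v = 0" "v ~= 0" unfolding det_eq_0_iff_kernel by blast
  then have "0 < c * norm v" using c by simp
  then show False using A[of v] v by simp
 qed
 show "norm (matrix_inv A) <= real CARD('m) * (1 / c)"
 proof (rule norm_le_card_entries)
  fix i j
  let ?v = "matrix_inv A *v axis j 1"
  have "c * norm ?v <= norm (A *v ?v)" by (rule A)
  also have "A *v ?v = axis j 1" by (simp add: matrix_vector_mul_assoc matrix_inv_inverse[OF d])
  finally have "norm ?v <= 1 / c" using c by (simp add: field_simps)
  then show "cmod (matrix_inv A $ i $ j) <= 1 / c"
   using Finite_Cartesian_Product.norm_nth_le[of ?v i] unfolding matrix_vector_mult_axis by linarith
 qed
qed

lemma det_nonzero_imp_lower_bound: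
 fixes A :: "complex^'m^'m"
 assumes d: "det A ~= 0" and K: "norm (matrix_inv A) <= K" "0 < K"
 shows "1 / K * norm v <= norm (A *v v)"
proof -
 have "v = matrix_inv A *v (A *v v)" by (simp add: matrix_vector_mul_assoc matrix_inv_inverse[OF d])
 then have "norm v <= norm (matrix_inv A) * norm (A *v v)" using norm_matvec_le[of "matrix_inv A" "A *v v"] by simp
 also have "... <= K * norm (A *v v)" using K by (intro mult_right_mono) auto
 finally show ?thesis using K by (simp add: field_simps)
qed

lemma mscale_vector: "(c \<cdot> A) *v v = c *s ((A::complex^'n^'m) *v v)"
 by (simp add: vec_eq_iff matrix_vector_mult_def sum_distrib_left mult.assoc)

lemma norm_complex_scale: "norm (c *s (u::complex^'m)) = cmod c * norm u"
 unfolding norm_vec_def vector_scalar_mult_def by (simp add: norm_mult L2_set_right_distrib)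

lemma minus_matrix_vector_mult: "(- A) *v v = - ((A::complex^'m^'m) *v v)"
 by (simp add: vec_eq_iff matrix_vector_mult_def sum_negf)

section \<open>The free problem\<close>

locale projection_pair =
 fixes T1 T2 :: "complex^'m^'m"
 assumes P1: "ctranspose T1 = T1" "T1 ** T1 = T1" and P2: "ctranspose T2 = T2" "T2 ** T2 = T2"
begin

abbreviation "W \<equiv> W0 T1 T2"
abbreviation "U \<equiv> U0 T1 T2"

lemma W_holo: "mholo W S" and U_holo: "mholo U S" unfolding W0_def[abs_def] U0_def[abs_def]
 by (intro mholo_add mholo_mscale mholo_const holomorphic_intros)+

text \<open>Sine and cosine written in exponentials: the coefficients of \<open>W0\<close> then
  combine into products of \<open>pr\<close> matrices with unimodular parameters, that is into
  unitary matrices.\<close>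

lemma W_exp: "W \<rho> = (exp (\<i> * (\<rho> * of_real pi)) / 2) \<cdot> (pr T2 (- \<i>) 1 ** pr T1 1 (- \<i>)) +
   (exp (- (\<i> * (\<rho> * of_real pi))) / 2) \<cdot> (pr T2 \<i> 1 ** pr T1 1 \<i>)"
proof -
 have *: "((e - f) / (2 * \<i>)) \<cdot> (A + D) + ((e + f) / 2) \<cdot> (B - C) =
   (e / 2) \<cdot> ((- \<i>) \<cdot> A + (- \<i>) \<cdot> (- \<i>) \<cdot> C + (B + (- \<i>) \<cdot> D)) + (f / 2) \<cdot> (\<i> \<cdot> A + \<i> \<cdot> \<i> \<cdot> C + (B + \<i> \<cdot> D))"
  for e f and A B C D :: "complex^'m^'m" by (simp add: vec_eq_iff field_simps)
 have pp: "pr T2 a 1 ** pr T1 1 a = a \<cdot> (T2 ** T1) + a \<cdot> a \<cdot> (T2 ** (mat 1 - T1)) +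
   ((mat 1 - T2) ** T1 + a \<cdot> ((mat 1 - T2) ** (mat 1 - T1)))" for a
  unfolding pr_def by (simp only: mm.add_left mm.add_right mscale_mult_left mscale_mult_right ms.add_right mscale_one add_ac)
 show ?thesis unfolding W0_def sin_exp_eq cos_exp_eq pp by (rule *)
qed

text \<open>By \<open>W_exp\<close> and the isometry of the unitary factors, the two summands of
  \<open>W \<rho> *v v\<close> have norms \<open>exp (- pi * Im \<rho>) / 2\<close> and
  \<open>exp (pi * Im \<rho>) / 2\<close> times that of \<open>v\<close>; the reverse triangle
  inequality leaves the hyperbolic sine.\<close>

lemma sinh_lower_bound: "(exp (pi * \<bar>Im \<rho>\<bar>) - exp (- (pi * \<bar>Im \<rho>\<bar>))) / 2 * norm v <= norm (W \<rho> *v v)"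
proof -
 define x where "x = (exp (\<i> * (\<rho> * of_real pi)) / 2) *s ((pr T2 (- \<i>) 1 ** pr T1 1 (- \<i>)) *v v)"
 define y where "y = (exp (- (\<i> * (\<rho> * of_real pi))) / 2) *s ((pr T2 \<i> 1 ** pr T1 1 \<i>) *v v)"
 have iso: "norm ((pr T2 a 1 ** pr T1 1 a) *v v) = norm v" if "cmod a = 1" for a
  unfolding matrix_vector_mul_assoc[symmetric] using that P1 P2 by (simp add: pr_isometry)
 have W: "W \<rho> *v v = x + y" unfolding W_exp x_def y_def by (simp only: matrix_vector_mult_add_rdistrib mscale_vector)
 have "norm x = exp (- (pi * Im \<rho>)) / 2 * norm v" "norm y = exp (pi * Im \<rho>) / 2 * norm v"
  unfolding x_def y_def norm_complex_scale by (simp_all add: iso norm_divide mult.commute)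
 moreover have "norm y - norm x <= norm (x + y)" "norm x - norm y <= norm (x + y)"
  using norm_diff_ineq[of y x] norm_diff_ineq[of x y] by (simp_all add: add.commute)
 ultimately show ?thesis unfolding W by (cases "0 <= Im \<rho>") (simp_all add: algebra_simps diff_divide_distrib)
qed

lemma det_W_nonreal:
 assumes "Im \<rho> ~= 0"
 shows "det (W \<rho>) ~= 0" by (rule det_nonzero_lower_bound(1)[OF _ sinh_lower_bound]) (use assms in simp)

text \<open>The hyperbolic sine of \<open>pi * t\<close> is at least \<open>t\<close>, so the simple
  pole lemma applies to \<open>W0\<close> with constant 1.\<close>

lemma zorder_det_W: "zorder (%z. det (W z)) (of_real x) = int (vec.dim {v. W (of_real x) *v v = 0})"
proof (rule simple_pole_matrix_inverse[of UNIV "of_real x" W 1 1])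
 fix t :: real and v :: "complex^'m" assume t: "0 < t" "t < 1"
 have "t <= (exp (pi * t) - exp (- (pi * t))) / 2"
 proof -
  have "1 + pi * t <= exp (pi * t)" "exp (- (pi * t)) <= 1" using exp_ge_add_one_self[of "pi * t"] t by simp_all
  moreover have "2 * t <= pi * t" using pi_ge_two t by (intro mult_right_mono) auto
  moreover have "t <= (X - Y) / 2" if "1 + p <= X" "Y <= 1" "2 * t <= p" for X Y p :: real using that by argo
  ultimately show ?thesis by blast
 qed
 then have "t * norm v <= (exp (pi * t) - exp (- (pi * t))) / 2 * norm v" by (rule mult_right_mono) simp
 also have "... <= norm (W (of_real x + \<i> * of_real t) *v v)"
  using sinh_lower_bound[of "of_real x + \<i> * of_real t" v] t by simp
 finally show "1 * t * norm v <= norm (W (of_real x + \<i> * of_real t) *v v)" by simp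
qed (auto intro: W_holo)

lemma W_shift1: "W (\<rho> + 1) = - W \<rho>" and U_shift1: "U (\<rho> + 1) = - U \<rho>"
 unfolding W0_def U0_def distrib_right mult_1 sin_add cos_add sin_of_real cos_of_real by (simp_all add: ms.minus_left)

lemma WU_shift: "W (\<rho> + of_nat n) = (- 1) ^ n \<cdot> W \<rho>" "U (\<rho> + of_nat n) = (- 1) ^ n \<cdot> U \<rho>"
proof (induction n)
 case (Suc n)
 have e: "\<rho> + of_nat (Suc n) = (\<rho> + of_nat n) + 1" by simp
 case 1 show ?case unfolding e W_shift1 Suc by (simp add: ms.minus_left)
 case 2 show ?case unfolding e U_shift1 Suc by (simp add: ms.minus_left)
qed simp_all

lemma W_shift_norm: "norm (W (\<rho> + of_nat n) *v v) = norm (W \<rho> *v v)"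
 by (cases "even n") (simp_all add: WU_shift ms.minus_left minus_matrix_vector_mult)

lemma ker_W_shift: "{v. W (\<rho> + of_nat n) *v v = 0} = {v. W \<rho> *v v = 0}" using W_shift_norm by (metis norm_eq_zero)

lemma det_W_shift: "det (W (\<rho> + of_nat n)) ~= 0 \<longleftrightarrow> det (W \<rho>) ~= 0"
proof -
 have "W (\<rho> + of_nat n) = pr T1 ((- 1) ^ n) ((- 1) ^ n) ** W \<rho>"
  unfolding WU_shift pr_def by (simp add: ms.diff_right mscale_mult_left)
 then show ?thesis using det_pr[OF P1(2), of "(- 1) ^ n" "(- 1) ^ n"] by (simp add: det_mul)
qed

lemma E0_shift:
 assumes "det (W \<rho>) ~= 0"
 shows "E0 T1 T2 (\<rho> + of_nat n) = E0 T1 T2 \<rho>"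
proof -
 have s: "(- 1 :: complex) ^ n * (- 1) ^ n = 1" by (simp add: power_mult_distrib[symmetric])
 have "matrix_inv (W (\<rho> + of_nat n)) = (- 1) ^ n \<cdot> matrix_inv (W \<rho>)"
  by (rule matrix_inv_eqI(1)) (simp add: WU_shift mscale_mult_left mscale_mult_right matrix_inv_inverse[OF assms] s)
 then show ?thesis unfolding E0_def WU_shift by (simp add: mscale_mult_left mscale_mult_right s)
qed

text \<open>Sine is odd and cosine even; the sign changes are produced by unitary factors. Lower
  bounds for \<open>W0\<close> thereby pass from the right to the left half-plane.\<close>

lemma W_minus: "W (- \<rho>) = pr T2 (- 1) 1 ** W \<rho> ** pr T1 1 (- 1)"
proof -
 note p1 = projection_complement[OF P1(2)] and p2 = projection_complement[OF P2(2)]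
 define Q1 where "Q1 = mat 1 - T1"
 define Q2 where "Q2 = mat 1 - T2"
 have l: "pr T2 (- 1) 1 ** T2 = - T2" "pr T2 (- 1) 1 ** Q2 = Q2"
  unfolding pr_def mm.add_left mscale_mult_left Q2_def p2 P2 by (simp_all add: ms.minus_left)
 have r: "T1 ** pr T1 1 (- 1) = T1" "Q1 ** pr T1 1 (- 1) = - Q1" unfolding pr_def mm.add_right mscale_mult_right Q1_def p1 P1
  by (simp_all only: ms.minus_left ms.zero_right mscale_one add_0_left add_0_right minus_zero)
 have *: "pr T2 (- 1) 1 ** (A ** B) ** pr T1 1 (- 1) = (pr T2 (- 1) 1 ** A) ** (B ** pr T1 1 (- 1))" for A B :: "complex^'m^'m"
  by (simp add: matrix_mul_assoc)
 have "pr T2 (- 1) 1 ** W \<rho> ** pr T1 1 (- 1) = spi \<rho> \<cdot> (- (T2 ** T1) - Q2 ** Q1) + cpi \<rho> \<cdot> (Q2 ** T1 - T2 ** Q1)"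
  unfolding W0_def Q1_def[symmetric] Q2_def[symmetric]
  by (simp only: mm.add_left mm.add_right mm.diff_left mm.diff_right mscale_mult_left mscale_mult_right * l r
    mm.minus_left mm.minus_right minus_minus diff_conv_add_uminus)
 also have "... = W (- \<rho>)"
  unfolding W0_def Q1_def[symmetric] Q2_def[symmetric] by (simp add: ms.minus_left ms.minus_right ms.diff_right ms.add_right)
 finally show ?thesis ..
qed

lemma W_minus_lower_bound:
 assumes "\<And>v. c * norm v <= norm (W \<rho> *v v)"
 shows "c * norm v <= norm (W (- \<rho>) *v v)"
proof -
 have "c * norm v = c * norm (pr T1 1 (- 1) *v v)" by (simp add: pr_isometry[OF P1])
 also have "... <= norm (W \<rho> *v (pr T1 1 (- 1) *v v))" by (rule assms)
 also have "... = norm (pr T2 (- 1) 1 *v (W \<rho> *v (pr T1 1 (- 1) *v v)))" by (simp add: pr_isometry[OF P2])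
 finally show ?thesis unfolding W_minus by (simp add: matrix_vector_mul_assoc matrix_mul_assoc)
qed

lemma open_det_W: "open {\<rho>. det (W \<rho>) ~= 0}"
proof -
 have "continuous_on UNIV (%\<rho>. det (W \<rho>))" by (intro holomorphic_on_imp_continuous_on mholo_det W_holo)
 then show ?thesis using open_Collect_neq[of "%\<rho>. det (W \<rho>)" "%_. 0"] by simp
qed

lemma W_compact_lower_bound:
 assumes C: "compact C" and d: "\<And>\<rho>. \<rho> \<in> C ==> det (W \<rho>) ~= 0"
 shows "\<exists>\<kappa>>0. \<forall>\<rho>\<in>C. \<forall>v. \<kappa> * norm v <= norm (W \<rho> *v v)"
proof -
 have "continuous_on C (%\<rho>. matrix_inv (W \<rho>))" unfolding continuous_on_eq_continuous_within
 proof
  fix \<rho> assume r: "\<rho> \<in> C"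
  let ?S = "{\<rho>. det (W \<rho>) ~= 0}"
  have "open ?S" by (rule open_det_W)
  moreover have "continuous_on ?S (%\<rho>. matrix_inv (W \<rho>))" by (intro mholo_continuous_on mholo_inv W_holo) auto
  ultimately show "continuous (at \<rho> within C) (%\<rho>. matrix_inv (W \<rho>))"
   using d[OF r] by (meson continuous_at_imp_continuous_at_within continuous_on_eq_continuous_at mem_Collect_eq)
 qed
 then have "bounded ((%\<rho>. matrix_inv (W \<rho>)) ` C)" using C compact_continuous_image compact_imp_bounded by blast
 then obtain K where K: "K > 0" "\<And>\<rho>. \<rho> \<in> C ==> norm (matrix_inv (W \<rho>)) <= K" unfolding bounded_pos by blast
 show ?thesis by (intro exI[of _ "1 / K"] conjI ballI allI det_nonzero_imp_lower_bound d K(2)) (use K(1) in auto)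
qed

text \<open>Two regimes. At height at least \<eta> above the real axis
  \<open>sinh_lower_bound\<close> is enough. Close to the axis the circle is near
  \<open>n + c\<close> or its negative, and antiperiodicity and parity move the point to a fixed
  disc about \<open>c\<close>, on which the determinant has no zero.\<close>

lemma W_circle_lower_bound:
 fixes c :: real
 assumes c: "det (W (of_real c)) ~= 0"
 shows "\<exists>\<kappa>>0. \<forall>(n::nat) \<rho> v. cmod \<rho> = real n + c --> 0 <= Im \<rho> --> \<kappa> * exp (pi * Im \<rho>) * norm v <= norm (W \<rho> *v v)"
proof -
 obtain \<epsilon> where \<epsilon>: "\<epsilon> > 0" "cball (of_real c) \<epsilon> \<subseteq> {\<rho>. det (W \<rho>) ~= 0}"
  using c open_det_W unfolding open_contains_cball by blast
 have "\<exists>\<kappa>>0. \<forall>\<rho>\<in>cball (of_real c) \<epsilon>. \<forall>v. \<kappa> * norm v <= norm (W \<rho> *v v)"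
  by (rule W_compact_lower_bound) (use \<epsilon>(2) in auto)
 then obtain \<kappa>1 where \<kappa>1: "\<kappa>1 > 0" "\<And>\<rho> v. \<rho> \<in> cball (of_real c) \<epsilon> ==> \<kappa>1 * norm v <= norm (W \<rho> *v v)"
  by blast
 define \<eta> where "\<eta> = \<epsilon> / 2"
 define \<kappa>2 where "\<kappa>2 = (1 - exp (- (2 * pi * \<eta>))) / 2"
 define \<kappa>3 where "\<kappa>3 = \<kappa>1 * exp (- (pi * \<eta>))"
 have \<eta>: "\<eta> > 0" unfolding \<eta>_def using \<epsilon> by simp
 have \<kappa>2: "\<kappa>2 > 0" unfolding \<kappa>2_def using \<eta> by simp
 have \<kappa>3: "\<kappa>3 > 0" unfolding \<kappa>3_def using \<kappa>1 by simp
 show ?thesis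
 proof (intro exI[of _ "min \<kappa>2 \<kappa>3"] conjI allI impI)
  show "0 < min \<kappa>2 \<kappa>3" using \<kappa>2 \<kappa>3 by simp
  fix n \<rho> v assume \<rho>: "cmod \<rho> = real n + c" "0 <= Im \<rho>"
  define b where "b = Im \<rho>"
  have b: "0 <= b" unfolding b_def using \<rho> by simp
  have "\<kappa>2 * exp (pi * b) * norm v <= norm (W \<rho> *v v) \<or> \<kappa>3 * exp (pi * b) * norm v <= norm (W \<rho> *v v)"
  proof (cases "\<eta> <= b")
   case True
   have "exp (- (pi * b)) = exp (- (2 * pi * b)) * exp (pi * b)" by (simp add: exp_add[symmetric])
   also have "... <= exp (- (2 * pi * \<eta>)) * exp (pi * b)" using True by (intro mult_right_mono) auto
   finally have "\<kappa>2 * exp (pi * b) <= (exp (pi * b) - exp (- (pi * b))) / 2"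
    unfolding \<kappa>2_def by (simp add: algebra_simps diff_divide_distrib)
   then have "\<kappa>2 * exp (pi * b) * norm v <= (exp (pi * b) - exp (- (pi * b))) / 2 * norm v" by (rule mult_right_mono) simp
   then show ?thesis using sinh_lower_bound[of \<rho> v] b unfolding b_def[symmetric] by simp
  next
   case False
   \<comment> \<open>A point at height \<open>b\<close> on this arc has real part within
     \<open>b\<close> of \<open>n + c\<close>, so its translate by \<open>n\<close> is within
     \<open>2 * b < \<epsilon>\<close> of \<open>c\<close>.\<close>
   have m: "\<kappa>1 * norm u <= norm (W \<rho>' *v u)" if r: "cmod \<rho>' = real n + c" "\<bar>Im \<rho>'\<bar> = b" "0 <= Re \<rho>'" for \<rho>' u
   proof -
    have "cmod \<rho>' <= \<bar>Re \<rho>'\<bar> + \<bar>Im \<rho>'\<bar>" by (rule cmod_le)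
    then have "\<bar>Re \<rho>' - (real n + c)\<bar> <= b" using r abs_Re_le_cmod[of \<rho>'] by linarith
    moreover have "cmod (of_real c - (\<rho>' - of_nat n)) <= \<bar>Re (of_real c - (\<rho>' - of_nat n))\<bar> + \<bar>Im (of_real c - (\<rho>' - of_nat n))\<bar>" by (rule cmod_le)
    ultimately have "cmod (of_real c - (\<rho>' - of_nat n)) <= \<epsilon>" using r(2) False unfolding \<eta>_def by simp
    then have "\<kappa>1 * norm u <= norm (W (\<rho>' - of_nat n) *v u)" by (intro \<kappa>1) (simp add: dist_norm)
    then show ?thesis using W_shift_norm[of "\<rho>' - of_nat n" n u] by simp
   qed
   have "\<kappa>1 * norm v <= norm (W \<rho> *v v)"
   proof (cases "0 <= Re \<rho>")
    case True
    then show ?thesis using \<rho> by (intro m) (auto simp: b_def)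
   next
    case False
    then have "\<kappa>1 * norm v <= norm (W (- (- \<rho>)) *v v)"
     using \<rho> by (intro W_minus_lower_bound m) (auto simp: b_def)
    then show ?thesis by simp
   qed
   moreover have "\<kappa>3 * exp (pi * b) <= \<kappa>1 * 1"
    unfolding \<kappa>3_def mult.assoc exp_add[symmetric] using \<kappa>1 False by (intro mult_left_mono) auto
   then have "\<kappa>3 * exp (pi * b) * norm v <= \<kappa>1 * 1 * norm v" by (rule mult_right_mono) simp
   ultimately show ?thesis by simp
  qed
  moreover have "min \<kappa>2 \<kappa>3 * exp (pi * b) * norm v <= \<kappa>2 * exp (pi * b) * norm v" "min \<kappa>2 \<kappa>3 * exp (pi * b) * norm v <= \<kappa>3 * exp (pi * b) * norm v"
   by (intro mult_right_mono; simp)+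
  ultimately show "min \<kappa>2 \<kappa>3 * exp (pi * Im \<rho>) * norm v <= norm (W \<rho> *v v)" unfolding b_def by linarith
 qed
qed

text \<open>\<open>W 0 *v v = 0\<close> means \<open>T1 *v v = T2 *v v\<close>; then
  \<open>T1 *v v\<close> lies in both ranges and \<open>v - T1 *v v\<close> in both kernels. The
  kernel is the direct sum of the common range, which carries the free eigenvalue 0, and the common
  kernel.\<close>

lemma dim_ker_W_0: "vec.dim {v. W 0 *v v = 0} = vec.dim {v. T1 *v v = v & T2 *v v = v} + p_perp T1 T2"
proof -
 let ?A = "{v. T1 *v v = v & T2 *v v = v}" and ?B = "{v. T1 *v v = 0} \<inter> {v. T2 *v v = 0}"
 have W: "W 0 = (mat 1 - T2) ** T1 - T2 ** (mat 1 - T1)" unfolding W0_def by (simp add: ms.zero_left)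
 have T1i: "T1 *v (T1 *v v) = T1 *v v" and T2i: "T2 *v (T2 *v v) = T2 *v v" for v
  by (simp_all add: matrix_vector_mul_assoc P1 P2)
 note vd = matrix_vector_mult_diff_rdistrib matrix_vector_mult_diff_distrib matrix_vector_right_distrib
 have Wv: "W 0 *v v = (T1 *v v - T2 *v (T1 *v v)) - (T2 *v v - T2 *v (T1 *v v))" for v
  unfolding W vd matrix_vector_mul_assoc[symmetric] by (simp add: vd)
 have "{v. W 0 *v v = 0} = {x + y |x y. x \<in> ?A & y \<in> ?B}"
 proof (intro set_eqI iffI)
  fix v assume "v \<in> {v. W 0 *v v = 0}"
  then have e: "T1 *v v = T2 *v v" by (simp add: Wv)
  have t2: "T2 *v (T1 *v v) = T1 *v v" unfolding e T2i ..
  have "T1 *v (v - T1 *v v) = 0" "T2 *v (v - T1 *v v) = 0" unfolding vd T1i t2 by (simp_all add: e)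
  then have "T1 *v v \<in> ?A" "v - T1 *v v \<in> ?B" using T1i[of v] t2 by blast+
  moreover have "v = T1 *v v + (v - T1 *v v)" by simp
  ultimately show "v \<in> {x + y |x y. x \<in> ?A & y \<in> ?B}" by blast
 next
  fix v assume "v \<in> {x + y |x y. x \<in> ?A & y \<in> ?B}"
  then show "v \<in> {v. W 0 *v v = 0}" by (auto simp: Wv vd)
 qed
 moreover have "?A \<inter> ?B = {0}" by auto
 moreover have sA: "vec.subspace ?A" and sB: "vec.subspace ?B" by (auto simp: vec.subspace_def vd vector_scalar_commute)
 ultimately show ?thesis using vec.dim_sums_Int[OF sA sB] unfolding p_perp_def by simp
qed

end

section \<open>The comparison problem with zero potential\<close>

lemma dim_ker_equivalent:
 fixes A B X :: "complex^'m^'m"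
 assumes A: "det A ~= 0" and B: "det B ~= 0"
 shows "vec.dim {v. (A ** X ** B) *v v = 0} = vec.dim {v. X *v v = 0}"
proof -
 let ?K = "{v. (A ** X ** B) *v v = 0}"
 have Ai: "matrix_inv A *v (A *v v) = v" and Bi: "B *v (matrix_inv B *v v) = v" and Bj: "matrix_inv B *v (B *v v) = v" for v
  by (simp_all add: matrix_vector_mul_assoc matrix_inv_inverse A B)
 have z: "A *v v = 0 \<longleftrightarrow> v = 0" for v using Ai[of v] by auto
 have eq: "(A ** X ** B) *v v = A *v (X *v (B *v v))" for v by (simp add: matrix_vector_mul_assoc matrix_mul_assoc)
 have "{v. X *v v = 0} = (%v. B *v v) ` ?K"
 proof (intro set_eqI iffI)
  fix v assume "v \<in> {v. X *v v = 0}"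
  then show "v \<in> (%v. B *v v) ` ?K" by (intro image_eqI[of _ _ "matrix_inv B *v v"]) (simp_all add: Bi eq z)
 qed (auto simp: eq z)
 moreover have "vec.dim ((%v. B *v v) ` ?K) = vec.dim ?K"
  by (rule vec.dim_image_eq[OF matrix_vector_mul_linear_gen]) (metis Bj inj_onI)
 ultimately show ?thesis by simp
qed

context projection_pair
begin

lemma free_problem: "sl_problem (%_. 0) T1 T2 0 0"
proof
 show "L2_on {0<..<pi} (%_. 0 :: complex^'m^'m)" unfolding L2_on_def by simp
qed (simp_all add: P1 P2 mm.zero_right)

interpretation free: sl_problem "%_. 0" T1 T2 0 0 by (rule free_problem)

lemma free_solution:
 assumes \<rho>: "\<rho> ~= 0" and x: "x \<in> {0..pi}"
 shows "free.sol (\<rho>^2) y (\<rho> \<cdot> w) x = (cos (\<rho> * of_real x) \<cdot> y + sin (\<rho> * of_real x) \<cdot> w,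
   \<rho> \<cdot> (cos (\<rho> * of_real x) \<cdot> w - sin (\<rho> * of_real x) \<cdot> (y::complex^'m^'m)))"
proof -
 let ?Y = "%x. cos (\<rho> * of_real x) \<cdot> y + sin (\<rho> * of_real x) \<cdot> w"
 let ?Z = "%x. \<rho> \<cdot> (cos (\<rho> * of_real x) \<cdot> w - sin (\<rho> * of_real x) \<cdot> y)"
 have c: "((%x. cos (\<rho> * of_real x)) has_vector_derivative - \<rho> * sin (\<rho> * of_real x)) (at x)" for x
 proof -
  have "((%z. cos (\<rho> * z)) has_field_derivative - \<rho> * sin (\<rho> * of_real x)) (at (of_real x))"
   by (auto intro!: derivative_eq_intros)
  then show ?thesis using has_vector_derivative_real_field by blast
 qed
 have s: "((%x. sin (\<rho> * of_real x)) has_vector_derivative \<rho> * cos (\<rho> * of_real x)) (at x)" for x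
 proof -
  have "((%z. sin (\<rho> * z)) has_field_derivative \<rho> * cos (\<rho> * of_real x)) (at (of_real x))"
   by (auto intro!: derivative_eq_intros)
  then show ?thesis using has_vector_derivative_real_field by blast
 qed
 note d = bounded_linear.has_vector_derivative[OF ms.bounded_linear_left]
 have "(?Y has_vector_derivative (- \<rho> * sin (\<rho> * of_real x)) \<cdot> y + (\<rho> * cos (\<rho> * of_real x)) \<cdot> w) (at x)" for x
  by (intro has_vector_derivative_add d c s)
 moreover have "(- \<rho> * sin (\<rho> * of_real x)) \<cdot> y + (\<rho> * cos (\<rho> * of_real x)) \<cdot> w = ?Z x" for x
  by (simp add: vec_eq_iff algebra_simps)
 ultimately have Y: "(?Y has_vector_derivative ?Z x) (at x)" for x by (simp only:)
 have "(?Z has_vector_derivative \<rho> \<cdot> ((- \<rho> * sin (\<rho> * of_real x)) \<cdot> w - (\<rho> * cos (\<rho> * of_real x)) \<cdot> y)) (at x)" for x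
  by (intro bounded_linear.has_vector_derivative[OF ms.bounded_linear_right] has_vector_derivative_diff d c s)
 moreover have "\<rho> \<cdot> ((- \<rho> * sin (\<rho> * of_real x)) \<cdot> w - (\<rho> * cos (\<rho> * of_real x)) \<cdot> y) = - (\<rho>^2 \<cdot> ?Y x)" for x
  by (simp add: vec_eq_iff algebra_simps power2_eq_square)
 ultimately have Z: "(?Z has_vector_derivative - (\<rho>^2 \<cdot> ?Y x)) (at x)" for x by (simp only:)
 have "sl_system (%_. 0) (\<rho>^2) ?Y ?Z" unfolding sl_system_def mm.zero_left add_0_left minus_zero diff_0 diff_zero
  by (intro conjI primitive_on_C1 Y Z) (auto intro!: continuous_intros ms.continuous_on)
 from free.sl_system_eq_sol[OF this x] show ?thesis by (simp add: ms.zero_left)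
qed

text \<open>With zero potential the solution is explicit and the \<open>H\<close> terms are absent,
  so the leading term \<open>W0\<close> is the whole scaled characteristic matrix.\<close>

lemma free_Nhat: "\<rho> ~= 0 ==> free.Nhat \<rho> = W \<rho>"
 unfolding free.Nhat_bform free.W0_bform0 free.bform_def free.bform0_def free.soly_def free.solz_def ms.zero_right add_0_right
 by (simp add: free_solution mm.zero_left ms.zero_right)

lemma free_mult_nonzero:
 assumes "\<rho> ~= 0"
 shows "eigen_mult (%_. 0) T1 T2 0 0 (\<rho>^2) = vec.dim {v. W \<rho> *v v = 0}"
proof -
 have N: "free.Nmat (\<rho>^2) = pr T2 (- \<rho>) (- 1) ** W \<rho> ** pr T1 1 (1 / \<rho>)"
  unfolding free.Nmat_eq_Nhat[OF assms] free_Nhat[OF assms] mm.minus_left[symmetric] by (simp add: pr_def ms.minus_left)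
 show ?thesis unfolding free.eigen_mult_eq N
  by (rule dim_ker_equivalent) (use assms det_pr[OF P2(2), of "- \<rho>" "- 1"] det_pr[OF P1(2), of 1 "1 / \<rho>"] in auto)
qed

text \<open>The scaling by \<rho> degenerates at 0, so this eigenvalue is read off from the explicit
  solution \<open>T1 + x (mat 1 - T1)\<close>.\<close>

lemma free_mult_zero: "eigen_mult (%_. 0) T1 T2 0 0 0 = vec.dim {v. T1 *v v = v & T2 *v v = v}"
proof -
 let ?Y = "%x. T1 + complex_of_real x \<cdot> (mat 1 - T1)" and ?Z = "%x::real. mat 1 - T1"
 have "(complex_of_real has_vector_derivative 1) (at x)" for x using has_vector_derivative_real_field[of "%z. z" 1 x] by simp
 then have "(?Y has_vector_derivative 0 + 1 \<cdot> (mat 1 - T1)) (at x)" for x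
  by (intro has_vector_derivative_add has_vector_derivative_const bounded_linear.has_vector_derivative[OF ms.bounded_linear_left])
 then have "(?Y has_vector_derivative ?Z x) (at x)" for x by simp
 then have "sl_system (%_. 0) 0 ?Y ?Z"
  unfolding sl_system_def mm.zero_left ms.zero_left add_0_left minus_zero diff_0 diff_zero
  by (intro conjI primitive_on_C1) (auto intro!: continuous_intros)
 from free.sl_system_eq_sol[OF this, of pi]
 have sol: "free.sol 0 T1 (mat 1 - T1) pi = (T1 + complex_of_real pi \<cdot> (mat 1 - T1), mat 1 - T1)" by (simp add: ms.zero_left)
 have N: "free.Nmat 0 = T2 ** (mat 1 - T1) - (mat 1 - T2) ** (T1 + complex_of_real pi \<cdot> (mat 1 - T1))"
  unfolding free.Nmat_def V2_def free.phi_def free.phi'_def by (simp add: sol mm.zero_left)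
 have T1i: "T1 *v (T1 *v v) = T1 *v v" and T2i: "T2 *v (T2 *v v) = T2 *v v" for v
  by (simp_all add: matrix_vector_mul_assoc P1 P2)
 note vd = matrix_vector_mult_diff_rdistrib matrix_vector_mult_diff_distrib matrix_vector_right_distrib
 have "{v. free.Nmat 0 *v v = 0} = {v. T1 *v v = v & T2 *v v = v}"
 proof (intro set_eqI iffI)
  fix v assume v: "v \<in> {v. free.Nmat 0 *v v = 0}"
  define a where "a = T1 *v v"
  define b where "b = v - T1 *v v"
  have "free.Nmat 0 *v v = T2 *v b - ((a + of_real pi *s b) - T2 *v (a + of_real pi *s b))"
   unfolding N a_def b_def vd matrix_vector_mul_assoc[symmetric] by (simp add: vd matrix_vector_mult_add_rdistrib mscale_vector)
  then have e: "T2 *v b = (a + of_real pi *s b) - T2 *v (a + of_real pi *s b)" using v by simp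
  \<comment> \<open>The right-hand side of \<open>e\<close> is annihilated by \<open>T2\<close>,
    which is idempotent.\<close>
  then have "T2 *v (T2 *v b) = 0" by (simp add: vd T2i)
  then have Tb: "T2 *v b = 0" unfolding T2i .
  have g: "a + of_real pi *s b = T2 *v a" using e Tb by (simp add: vd vector_scalar_commute)
  text \<open>Both \<open>a = T1 v\<close> and \<open>T2 a\<close> are orthogonal to \<open>b = v - T1 v\<close>.\<close>
  have herm: "(ctranspose (colm b) ** colm (T *v a)) $ 1 $ 1 = (ctranspose (colm (T *v b)) ** colm a) $ 1 $ 1"
   if "ctranspose T = T" for T unfolding mult_colm[symmetric] ctranspose_mult that by (simp add: matrix_mul_assoc)
  have Ta: "T1 *v a = a" unfolding a_def by (rule T1i)
  have T1b: "T1 *v b = 0" unfolding b_def vd T1i by simp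
  have ba: "(ctranspose (colm b) ** colm a) $ 1 $ 1 = 0" using herm[OF P1(1)] by (simp add: Ta T1b mm.zero_left)
  have bT: "(ctranspose (colm b) ** colm (T2 *v a)) $ 1 $ 1 = 0" using herm[OF P2(1)] by (simp add: Tb mm.zero_left)
  have "colm (a + of_real pi *s b) = colm a + of_real pi \<cdot> colm b" by (simp add: vec_eq_iff colm_def)
  then have "(ctranspose (colm b) ** (colm a + of_real pi \<cdot> colm b)) $ 1 $ 1 = 0" using bT unfolding g[symmetric] by simp
  then have "of_real pi * (ctranspose (colm b) ** colm b) $ 1 $ 1 = 0" using ba by (simp add: mm.add_right mscale_mult_right)
  then have "b = 0" by (simp add: ctranspose_mult_self)
  then show "v \<in> {v. T1 *v v = v & T2 *v v = v}" using g unfolding a_def b_def by auto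
 next
  fix v assume "v \<in> {v. T1 *v v = v & T2 *v v = v}"
  then have v: "T1 *v v = v" "T2 *v v = v" by auto
  have z: "(mat 1 - T1) *v v = 0" unfolding vd using v by simp
  have "(T1 + complex_of_real pi \<cdot> (mat 1 - T1)) *v v = v"
   unfolding matrix_vector_mult_add_rdistrib mscale_vector z by (simp add: v)
  then have "free.Nmat 0 *v v = 0"
   unfolding N matrix_vector_mult_diff_rdistrib[of "_ ** _"] matrix_vector_mul_assoc[symmetric] z by (simp add: vd v)
  then show "v \<in> {v. free.Nmat 0 *v v = 0}" by simp
 qed
 then show ?thesis unfolding free.eigen_mult_eq by simp
qed

text \<open>Away from the closed nonnegative half axis the square root is nonreal, and there
  \<open>W0\<close> is invertible.\<close>

lemma free_mult_other:
 assumes "\<nexists>x. 0 <= x & \<mu> = complex_of_real (x^2)"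
 shows "eigen_mult (%_. 0) T1 T2 0 0 \<mu> = 0"
proof -
 have \<mu>: "(csqrt \<mu>)^2 = \<mu>" by simp
 have n0: "csqrt \<mu> ~= 0" using assms by (metis \<mu> order_refl of_real_0 zero_power2 power_zero_numeral)
 have "Im (csqrt \<mu>) ~= 0"
 proof
  assume i: "Im (csqrt \<mu>) = 0"
  then have r: "csqrt \<mu> = of_real (Re (csqrt \<mu>))" by (simp add: complex_eq_iff)
  then have "\<mu> = of_real ((Re (csqrt \<mu>))^2)" by (metis \<mu> of_real_power)
  moreover have "0 <= Re (csqrt \<mu>)" using csqrt_principal[of \<mu>] by auto
  ultimately show False using assms by blast
 qed
 from det_W_nonreal[OF this] have "det (W (csqrt \<mu>)) ~= 0" .
 then have "{v. W (csqrt \<mu>) *v v = 0} = {0}" unfolding det_eq_0_iff_kernel by auto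
 then show ?thesis using free_mult_nonzero[OF n0] \<mu> by simp
qed

lemma zero_enumerationD:
 assumes r: "zero_enumeration T1 T2 r"
 shows "k \<in> {1..CARD('m)} ==> 0 <= r k & r k < 1"
  and "0 <= x ==> x < 1 ==> card {k\<in>{1..CARD('m)}. r k = x} = vec.dim {v. W (of_real x) *v v = 0}"
proof -
 have "r ` {1..CARD('m)} \<subseteq> {0..<1}" using r unfolding zero_enumeration_def by blast
 then show "0 <= r k & r k < 1" if "k \<in> {1..CARD('m)}" using that by (metis atLeastLessThan_iff imageI subsetD)
 show "card {k\<in>{1..CARD('m)}. r k = x} = vec.dim {v. W (of_real x) *v v = 0}" if "0 <= x" "x < 1"
 proof -
  have "x \<in> {0..<1}" using that by simp
  then have "int (card {k\<in>{1..CARD('m)}. r k = x}) = zorder (%z. det (W z)) (of_real x)"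
   using r unfolding zero_enumeration_def by blast
  then show ?thesis unfolding zorder_det_W of_nat_eq_iff .
 qed
qed

text \<open>For \<open>x = j + y > 0\<close> the multiplicity of \<open>x^2\<close> is the kernel
  dimension of \<open>W0\<close> at \<open>y\<close>, by periodicity up to sign, hence the number of
  \<open>k\<close> with \<open>r k = y\<close>. At 0 that kernel exceeds the eigenspace by
  \<open>p_perp\<close> dimensions, which is the number of indices missing from the row
  \<open>n = 0\<close>.\<close>

lemma free_enumeration:
 assumes r: "zero_enumeration T1 T2 r"
 shows "finite {p\<in>index_set T1 T2. complex_of_real ((real (fst p) + r (snd p))^2) = \<mu>} \<and>
   card {p\<in>index_set T1 T2. complex_of_real ((real (fst p) + r (snd p))^2) = \<mu>} = eigen_mult (%_. 0) T1 T2 0 0 \<mu>"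
proof -
 let ?S = "{1..CARD('m)}"
 note r01 = zero_enumerationD(1)[OF r] and rc = zero_enumerationD(2)[OF r]
 have rmono: "mono_on ?S r" using r unfolding zero_enumeration_def by blast
 define q where "q = vec.dim {v. W 0 *v v = 0}"
 have q: "q = vec.dim {v. T1 *v v = v & T2 *v v = v} + p_perp T1 T2" unfolding q_def by (rule dim_ker_W_0)
 have q0: "card {k\<in>?S. r k = 0} = q" using rc[of 0] unfolding q_def by simp
 \<comment> \<open>\<open>r\<close> is nonnegative and nondecreasing, so its zeros fill an initial
   segment; removing the first \<open>p_perp\<close> indices from the row \<open>n = 0\<close> then
   removes only zeros.\<close>
 have Z: "{k\<in>?S. r k = 0} = {1..q}"
 proof -
  have down: "k' \<in> {k\<in>?S. r k = 0}" if "k \<in> {k\<in>?S. r k = 0}" "1 <= k'" "k' <= k" for k k'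
  proof -
   have "k' \<in> ?S" using that by auto
   moreover have "r k' <= r k" by (rule mono_onD[OF rmono]) (use that in auto)
   ultimately show ?thesis using r01[of k'] that by auto
  qed
  let ?Z = "{k\<in>?S. r k = 0}"
  have fin: "finite ?Z" by simp
  show ?thesis
  proof (cases "?Z = {}")
   case True
   have "q = 0" using q0 unfolding True by simp
   then show ?thesis unfolding True by simp
  next
   case False
   have "?Z = {1..Max ?Z}"
   proof (intro set_eqI iffI)
    fix k assume "k \<in> {1..Max ?Z}"
    then show "k \<in> ?Z" using down[OF Max_in[OF fin False]] by auto
   qed (use Max_ge[OF fin] in auto)
   then have "Max ?Z = q" using q0 by (metis card_atLeastAtMost diff_Suc_1)
   then show ?thesis using \<open>?Z = {1..Max ?Z}\<close> by simp
  qed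
 qed
 show ?thesis
 proof (cases "\<exists>x. 0 <= x & \<mu> = complex_of_real (x^2)")
  case False
  have em: "{p\<in>index_set T1 T2. complex_of_real ((real (fst p) + r (snd p))^2) = \<mu>} = {}"
  proof -
   have "complex_of_real ((real (fst p) + r (snd p))^2) ~= \<mu>" if "p \<in> index_set T1 T2" for p
   proof
    assume "complex_of_real ((real (fst p) + r (snd p))^2) = \<mu>"
    moreover have "0 <= real (fst p) + r (snd p)" using that r01[of "snd p"] unfolding index_set_def by auto
    ultimately show False using False by blast
   qed
   then show ?thesis by blast
  qed
  show ?thesis unfolding em using free_mult_other[OF False] by simp
 next
  case True
  then obtain x where x: "0 <= x" "\<mu> = complex_of_real (x^2)" by blast
  define j where "j = nat \<lfloor>x\<rfloor>"
  define y where "y = x - real j"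
  have xy: "x = real j + y" "0 <= y" "y < 1" 
 proof -
   have "y = frac x" unfolding y_def j_def frac_def using x(1) by simp
   then show "0 <= y" "y < 1" by (simp_all add: frac_lt_1)
   show "x = real j + y" unfolding y_def by simp
  qed
  have set_eq: "{p\<in>index_set T1 T2. complex_of_real ((real (fst p) + r (snd p))^2) = \<mu>} = {p\<in>index_set T1 T2. fst p = j & r (snd p) = y}"
  proof -
   have "complex_of_real ((real (fst p) + r (snd p))^2) = \<mu> \<longleftrightarrow> fst p = j & r (snd p) = y" if "p \<in> index_set T1 T2" for p
   proof -
    have rp: "0 <= r (snd p)" "r (snd p) < 1" using that r01[of "snd p"] unfolding index_set_def by auto
    have "complex_of_real ((real (fst p) + r (snd p))^2) = \<mu> \<longleftrightarrow> (real (fst p) + r (snd p))\<^sup>2 = x^2"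
     unfolding x(2) of_real_eq_iff ..
    also have "... \<longleftrightarrow> real (fst p) + r (snd p) = x"
     using rp x(1) power2_eq_iff_nonneg[of "real (fst p) + r (snd p)" x] by simp
    also have "... \<longleftrightarrow> fst p = j & r (snd p) = y"
    proof
     assume e: "real (fst p) + r (snd p) = x"
     then have "real (fst p) < real j + 1" "real j < real (fst p) + 1" using xy rp by argo+
     then have "fst p < j + 1" "j < fst p + 1" by simp_all
     then have "fst p = j" by simp
     then show "fst p = j & r (snd p) = y" using e xy(1) by simp
    qed (use xy in auto)
    finally show ?thesis .
   qed
   then show ?thesis by blast
  qed
  have inj: "inj_on (Pair j) A" for A :: "nat set" by (auto simp: inj_on_def)
  have full: "{p\<in>index_set T1 T2. fst p = j & r (snd p) = y} = Pair j ` {k\<in>?S. r k = y & (j = 0 --> p_perp T1 T2 < k)}"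
   by (force simp: index_set_def)
  have card: "card {k\<in>?S. r k = y & (j = 0 --> p_perp T1 T2 < k)} = eigen_mult (%_. 0) T1 T2 0 0 \<mu>"
  proof (cases "x = 0")
   case True
   then have jy: "j = 0" "y = 0" using xy by auto
   have "{k\<in>?S. r k = y & (j = 0 --> p_perp T1 T2 < k)} = {k\<in>?S. r k = 0} - {1..p_perp T1 T2}" unfolding jy by auto
   also have "... = {1 + p_perp T1 T2..q}" unfolding Z by auto
   finally have "card {k\<in>?S. r k = y & (j = 0 --> p_perp T1 T2 < k)} = q - p_perp T1 T2" by simp
   also have "... = eigen_mult (%_. 0) T1 T2 0 0 \<mu>" unfolding q x(2) True by (simp add: free_mult_zero)
   finally show ?thesis .
  next
   case False
   have all: "{k\<in>?S. r k = y & (j = 0 --> p_perp T1 T2 < k)} = {k\<in>?S. r k = y}"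
   proof -
    \<comment> \<open>Here \<open>y\<close> is nonzero, so \<open>k\<close> lies beyond the
      \<open>q\<close> zeros of \<open>r\<close>, and \<open>q\<close> is at least
      \<open>p_perp\<close>.\<close>
    have "p_perp T1 T2 < k" if "j = 0" "k \<in> ?S" "r k = y" for k
    proof -
     have "r k ~= 0" using that xy False by auto
     then have "k \<notin> {1..q}" using Z by blast
     then show ?thesis using that(2) q by auto
    qed
    then show ?thesis by blast
   qed
   have "eigen_mult (%_. 0) T1 T2 0 0 \<mu> = vec.dim {v. W (of_real x) *v v = 0}"
    using free_mult_nonzero[of "of_real x"] False unfolding x(2) by simp
   also have "of_real x = of_real y + (of_nat j :: complex)" unfolding xy(1) by simp
   finally show ?thesis unfolding all ker_W_shift rc[OF xy(2,3)] by simp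
  qed
  show ?thesis unfolding set_eq full using card by (simp add: card_image[OF inj])
 qed
qed

end

section \<open>Counting eigenvalues\<close>

lemma det_near_one: "\<exists>e>0. \<forall>X::complex^'m^'m. norm (X - mat 1) <= e --> cmod (det X - 1) < 1"
proof -
 have "continuous_on UNIV (%X::complex^'m^'m. det X)" unfolding det_def by (intro continuous_intros)
 then have "isCont (%X::complex^'m^'m. det X) (mat 1)" by (simp add: continuous_on_eq_continuous_at)
 then obtain d where d: "d > 0" "\<And>X::complex^'m^'m. dist X (mat 1) < d ==> dist (det X) (det (mat 1 :: complex^'m^'m)) < 1"
  unfolding continuous_at_eps_delta by (metis zero_less_one)
 show ?thesis by (intro exI[of _ "d / 2"]) (use d in \<open>auto simp: dist_norm\<close>)
qed

lemma finite_zeros_compact: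
 fixes h :: "complex => complex"
 assumes h: "h holomorphic_on UNIV" "h a ~= 0" and K: "compact K"
 shows "finite {z\<in>K. h z = 0}"
proof (cases "h constant_on UNIV")
 case True
 then have "h z ~= 0" for z using h(2) unfolding constant_on_def by (metis UNIV_I)
 then show ?thesis by simp
next
 case False
 show ?thesis by (rule holomorphic_compact_finite_zeros[OF h(1) open_UNIV connected_UNIV K _ False]) simp
qed

text \<open>On a circle inside a slightly larger ball the winding numbers are 1 for inner and 0 for
  outer points, which reduces the weighted zero counts to sums over the open disc. The points
  \<open>a\<close> and \<open>b\<close> exclude functions that vanish identically.\<close>

lemma Rouche_disk:
 fixes f g :: "complex => complex"
 assumes f: "f holomorphic_on UNIV" and g: "g holomorphic_on UNIV" and R: "0 < R"
  and nz: "f a ~= 0" "g b ~= 0"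
  and less: "\<And>z. cmod z = R ==> cmod (g z - f z) < cmod (f z)"
 shows "finite {z. cmod z < R & g z = 0}" "finite {z. cmod z < R & f z = 0}"
  "(\<Sum>z | cmod z < R & g z = 0. zorder g z) = (\<Sum>z | cmod z < R & f z = 0. zorder f z)"
proof -
 have ff: "finite {z\<in>cball 0 (R + 1). f z = 0}" and fg: "finite {z\<in>cball 0 (R + 1). g z = 0}"
  by (rule finite_zeros_compact[OF f nz(1)] finite_zeros_compact[OF g nz(2)]; simp)+
 let ?s = "ball 0 (R + 1) :: complex set"
 have fs: "finite {p\<in>?s. f p = 0}" "finite {p\<in>?s. g p = 0}"
  by (rule finite_subset[OF _ ff], auto) (rule finite_subset[OF _ fg], auto)
 show fd: "finite {z. cmod z < R & g z = 0}" "finite {z. cmod z < R & f z = 0}"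
  by (rule finite_subset[OF _ fs(2)], auto) (rule finite_subset[OF _ fs(1)], auto)
 let ?w = "winding_number (circlepath 0 R)"
 have pim: "path_image (circlepath 0 R) = sphere (0::complex) R" using R by simp
 have w0: "?w z = 0" if "R < cmod z" for z
  by (rule winding_number_zero_outside[of _ "cball 0 R"]) (use that R in \<open>auto simp: pim\<close>)
 have w1: "?w z = 1" if "cmod z < R" for z using winding_number_circlepath[of z 0 R] that by simp
 have eq: "f p + (g p - f p) = g p" for p by simp
 have main: "(\<Sum>p\<in>{p\<in>?s. g p = 0}. ?w p * of_int (zorder g p)) = (\<Sum>p\<in>{p\<in>?s. f p = 0}. ?w p * of_int (zorder f p))"
 proof (rule Rouche_theorem[of ?s f "%p. g p - f p" "circlepath 0 R", unfolded eq])
  show "(%p. g p - f p) holomorphic_on ?s" "f holomorphic_on ?s"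
   using f g by (auto intro!: holomorphic_intros intro: holomorphic_on_subset)
  show "\<forall>z\<in>path_image (circlepath 0 R). cmod (g z - f z) < cmod (f z)" using less unfolding pim by simp
  show "\<forall>z. z \<notin> ?s --> ?w z = 0" using w0 by simp
 qed (use fs R in \<open>auto simp: pim\<close>)
 have red: "(\<Sum>p\<in>{p\<in>?s. h p = 0}. ?w p * of_int (zorder h p)) = of_int (\<Sum>z | cmod z < R & h z = 0. zorder h z)"
  if h: "finite {p\<in>?s. h p = 0}" "\<And>z. cmod z = R ==> h z ~= 0" for h
 proof -
  have "(\<Sum>p\<in>{p\<in>?s. h p = 0}. ?w p * of_int (zorder h p)) = (\<Sum>p | cmod p < R & h p = 0. ?w p * of_int (zorder h p))"
  proof (rule sum.mono_neutral_right[OF h(1)])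
   show "{p. cmod p < R & h p = 0} \<subseteq> {p\<in>?s. h p = 0}" by auto
   show "\<forall>i\<in>{p\<in>?s. h p = 0} - {p. cmod p < R & h p = 0}. ?w i * of_int (zorder h i) = 0"
   proof
    fix i assume i: "i \<in> {p\<in>?s. h p = 0} - {p. cmod p < R & h p = 0}"
    then have "R <= cmod i" "cmod i ~= R" using h(2) by auto
    then show "?w i * of_int (zorder h i) = 0" using w0 by simp
   qed
  qed
  also have "... = (\<Sum>p | cmod p < R & h p = 0. of_int (zorder h p))" by (intro sum.cong) (auto simp: w1)
  finally show ?thesis by simp
 qed
 have nzc: "f z ~= 0" "g z ~= 0" if "cmod z = R" for z using less[OF that] by auto
 show "(\<Sum>z | cmod z < R & g z = 0. zorder g z) = (\<Sum>z | cmod z < R & f z = 0. zorder f z)"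
 proof -
  have "(of_int (\<Sum>z | cmod z < R & g z = 0. zorder g z) :: complex) = of_int (\<Sum>z | cmod z < R & f z = 0. zorder f z)"
   using main red[of g, OF fs(2) nzc(2)] red[of f, OF fs(1) nzc(1)] by (simp only:)
  then show ?thesis by (simp only: of_int_eq_iff)
 qed
qed

text \<open>Down-closed subsets of a totally ordered set are comparable by inclusion, so equal
  finite cardinality forces equality. It turns eigenvalue counts into an identification of
  indices.\<close>

lemma lex_down_closed_eq:
 assumes A: "A \<subseteq> J" "finite A" "\<And>p q. p \<in> J ==> q \<in> A ==> (p, q) \<in> lex_less ==> p \<in> A"
  and B: "B \<subseteq> J" "finite B" "\<And>p q. p \<in> J ==> q \<in> B ==> (p, q) \<in> lex_less ==> p \<in> B"
  and card: "card A = card B"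
 shows "A = B"
proof -
 have tot: "p = q \<or> (p, q) \<in> lex_less \<or> (q, p) \<in> lex_less" for p q :: "nat \<times> nat"
  by (cases p; cases q) auto
 have "A \<subseteq> B \<or> B \<subseteq> A"
 proof (rule ccontr)
  assume "\<not> (A \<subseteq> B \<or> B \<subseteq> A)"
  then obtain a b where ab: "a \<in> A" "a \<notin> B" "b \<in> B" "b \<notin> A" by blast
  then show False using tot[of a b] A B by blast
 qed
 then show ?thesis using card A(2) B(2) card_subset_eq by metis
qed

section \<open>Matching eigenvalues with indices\<close>

context sl_problem
begin

lemma eigen_mult_pos_iff: "0 < emult \<mu> \<longleftrightarrow> det (Nmat \<mu>) = 0"
proof
 assume p: "0 < emult \<mu>"
 show "det (Nmat \<mu>) = 0"
 proof (rule ccontr)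
  assume d: "det (Nmat \<mu>) ~= 0"
  then have "{v. Nmat \<mu> *v v = 0} = {0}" unfolding det_eq_0_iff_kernel by auto
  then show False using p unfolding eigen_mult_eq by simp
 qed
next
 assume "det (Nmat \<mu>) = 0"
 then obtain v where v: "Nmat \<mu> *v v = 0" "v ~= 0" unfolding det_eq_0_iff_kernel by blast
 have "vec.dim {v} <= vec.dim {v. Nmat \<mu> *v v = 0}" by (rule vec.dim_subset) (use v in auto)
 moreover have "vec.dim {v} = 1" using v(2) by (subst vec.dim_eq_card_independent) (auto simp: vec.independent_insert)
 ultimately show "0 < emult \<mu>" unfolding eigen_mult_eq by simp
qed

text \<open>All zeros of \<open>det (Nmat z)\<close> are real and their orders are the
  multiplicities, so counting indices is counting zeros. The enumeration \<open>e\<close> is kept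
  general in order to serve \<open>ev\<close> and the free numbers as well.\<close>

lemma counting:
 assumes e: "\<And>\<mu>. finite {p\<in>J. complex_of_real (e p) = \<mu>} & card {p\<in>J. complex_of_real (e p) = \<mu>} = emult \<mu>"
  and fin: "finite {z. cmod z < R & det (Nmat z) = 0}"
 shows "finite {p\<in>J. \<bar>e p\<bar> < R}"
  "int (card {p\<in>J. \<bar>e p\<bar> < R}) = (\<Sum>z | cmod z < R & det (Nmat z) = 0. zorder (%z. det (Nmat z)) z)"
proof -
 let ?Z = "{z. cmod z < R & det (Nmat z) = 0}"
 let ?A = "%z. {p\<in>J. complex_of_real (e p) = z}"
 have det0: "det (Nmat (complex_of_real (e p))) = 0" if "p \<in> J" for p
 proof -
  have "?A (complex_of_real (e p)) ~= {}" using that by blast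
  then have "0 < emult (complex_of_real (e p))" using e by (metis card_gt_0_iff)
  then show ?thesis by (simp add: eigen_mult_pos_iff)
 qed
 have U: "{p\<in>J. \<bar>e p\<bar> < R} = (\<Union>z\<in>?Z. ?A z)"
 proof (intro set_eqI iffI)
  fix p assume p: "p \<in> {p\<in>J. \<bar>e p\<bar> < R}"
  then have "complex_of_real (e p) \<in> ?Z" using det0 by auto
  then show "p \<in> (\<Union>z\<in>?Z. ?A z)" using p by blast
 qed auto
 show "finite {p\<in>J. \<bar>e p\<bar> < R}" unfolding U using fin e by blast
 have "card {p\<in>J. \<bar>e p\<bar> < R} = (\<Sum>z\<in>?Z. card (?A z))"
  unfolding U by (rule card_UN_disjoint[OF fin]) (use e in auto)
 then have "int (card {p\<in>J. \<bar>e p\<bar> < R}) = (\<Sum>z\<in>?Z. int (card (?A z)))" by simp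
 also have "... = (\<Sum>z\<in>?Z. zorder (%z. det (Nmat z)) z)"
 proof (rule sum.cong[OF refl])
  fix z assume "z \<in> ?Z"
  then have "Im z = 0" using det_Nmat_nonreal by auto
  then have z: "z = of_real (Re z)" by (simp add: complex_eq_iff)
  show "int (card (?A z)) = zorder (%z. det (Nmat z)) z"
   using e[of z] zorder_det_Nmat[of "Re z"] unfolding z[symmetric] by simp
 qed
 finally show "int (card {p\<in>J. \<bar>e p\<bar> < R}) = (\<Sum>z\<in>?Z. zorder (%z. det (Nmat z)) z)" .
qed

end

context sl_problem
begin

interpretation pp: projection_pair T1 T2 by unfold_locales (use T1_simps T2_simps in auto)

interpretation free: sl_problem "%_. 0" T1 T2 0 0 by (rule pp.free_problem)

text \<open>The scalings are the same in both problems, so the quotient of the two determinants is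
  \<open>det X\<close>, where \<open>X\<close> is the inverse of \<open>W0\<close> times
  \<open>Nhat\<close>; on large circles \<open>X\<close> is close to the identity.\<close>

lemma det_ratio:
 assumes c: "det (W0 T1 T2 (of_real c)) ~= 0"
 shows "\<exists>n0. \<forall>n\<ge>n0. 0 < real n + c & (\<forall>z. cmod z = (real n + c)^2 -->
   cmod (det (Nmat z) - det (free.Nmat z)) < cmod (det (free.Nmat z)))"
proof -
 obtain \<kappa> where \<kappa>: "\<kappa> > 0" "\<And>n \<rho> v. cmod \<rho> = real n + c ==> 0 <= Im \<rho> ==> \<kappa> * exp (pi * Im \<rho>) * norm v <= norm (W0 T1 T2 \<rho> *v v)"
  using pp.W_circle_lower_bound[OF c] by blast
 obtain e where e: "e > 0" "\<And>X::complex^'m^'m. norm (X - mat 1) <= e ==> cmod (det X - 1) < 1"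
  using det_near_one by blast
 \<comment> \<open>The inverse of \<open>W0\<close> is at most
   \<open>CARD('m) / (\<kappa> * E)\<close> and the error at most \<open>e1 * E\<close>; the growth
   \<open>E\<close> cancels and the product is \<open>e\<close>.\<close>
 define e1 where "e1 = e * \<kappa> / real CARD('m)"
 have e1: "e1 > 0" unfolding e1_def using e \<kappa> by simp
 obtain R where R: "R \<ge> 1" "\<And>\<rho>. R <= cmod \<rho> ==> - 0 <= Im \<rho> ==> errN \<rho> <= e1 * exp (pi * \<bar>Im \<rho>\<bar>)"
  using hat_small[of 0 e1] e1 by blast
 show ?thesis
 proof (intro exI[of _ "nat \<lceil>R - c\<rceil>"] allI impI conjI)
  fix n assume "nat \<lceil>R - c\<rceil> <= n"
  then have nR: "R <= real n + c" by (simp add: nat_le_iff ceiling_le_iff)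
  then show "0 < real n + c" using R(1) by simp
  fix z assume z: "cmod z = (real n + c)^2"
  \<comment> \<open>The square root in the closed upper half-plane, where \<open>hat_small\<close>
    is available with \<open>B = 0\<close>.\<close>
  define \<rho> where "\<rho> = (if 0 <= Im (csqrt z) then csqrt z else - csqrt z)"
  have \<rho>2: "\<rho>^2 = z" unfolding \<rho>_def by simp
  have im: "0 <= Im \<rho>" unfolding \<rho>_def by auto
  have "(cmod \<rho>)^2 = (real n + c)^2" unfolding norm_power[symmetric] \<rho>2 z ..
  then have m: "cmod \<rho> = real n + c" using nR R(1) by (simp add: power2_eq_iff_nonneg)
  then have \<rho>0: "\<rho> ~= 0" using nR R(1) by auto
  define E where "E = exp (pi * Im \<rho>)"
  have E: "E > 0" unfolding E_def by simp
  have low: "\<kappa> * E * norm v <= norm (W0 T1 T2 \<rho> *v v)" for v unfolding E_def by (rule \<kappa>(2)[OF m im])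
  note inv = det_nonzero_lower_bound[OF mult_pos_pos[OF \<kappa>(1) E] low]
  define X where "X = matrix_inv (W0 T1 T2 \<rho>) ** Nhat \<rho>"
  have "X - mat 1 = matrix_inv (W0 T1 T2 \<rho>) ** (Nhat \<rho> - W0 T1 T2 \<rho>)"
   unfolding X_def by (simp add: mm.diff_right matrix_inv_inverse[OF inv(1)])
  also have "norm ... <= real CARD('m) * (1 / (\<kappa> * E)) * (e1 * E)"
   by (rule order_trans[OF norm_matmul_le mult_mono[OF inv(2)]])
     (use R(2)[of \<rho>] nR m im E \<kappa> in \<open>auto simp: E_def\<close>)
  also have "... = e" unfolding e1_def using E \<kappa>(1) by simp
  finally have X1: "cmod (det X - 1) < 1" by (rule e(2))
  have "Nhat \<rho> = W0 T1 T2 \<rho> ** X" unfolding X_def by (simp add: matrix_mul_assoc matrix_inv_inverse[OF inv(1)])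
  then have dN: "det (Nhat \<rho>) = det (W0 T1 T2 \<rho>) * det X" by (metis det_mul)
  have k: "- (A ** B ** C) = (- A) ** B ** C" for A B C :: "complex^'m^'m" by (simp add: mm.minus_left)
  have N: "det (Nmat z) = det (- pr T2 \<rho> 1) * det (W0 T1 T2 \<rho>) * det X * det (pr T1 1 (1 / \<rho>))"
   unfolding \<rho>2[symmetric] Nmat_eq_Nhat[OF \<rho>0] k det_mul dN by simp
  have N0: "det (free.Nmat z) = det (- pr T2 \<rho> 1) * det (W0 T1 T2 \<rho>) * det (pr T1 1 (1 / \<rho>))"
   unfolding \<rho>2[symmetric] free.Nmat_eq_Nhat[OF \<rho>0] pp.free_Nhat[OF \<rho>0] k det_mul by simp
  have "- pr T2 \<rho> 1 = pr T2 (- \<rho>) (- 1)" by (simp add: pr_def ms.minus_left)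
  then have nz: "det (free.Nmat z) ~= 0"
   unfolding N0 using \<rho>0 inv(1) det_pr[OF T2_simps(2), of "- \<rho>" "- 1"] det_pr[OF T1_simps(2), of 1 "1 / \<rho>"] by simp
  have "det (Nmat z) - det (free.Nmat z) = det (free.Nmat z) * (det X - 1)" unfolding N N0 by (simp add: algebra_simps)
  then have "cmod (det (Nmat z) - det (free.Nmat z)) = cmod (det (free.Nmat z)) * cmod (det X - 1)" by (simp add: norm_mult)
  also have "... < cmod (det (free.Nmat z)) * 1" using X1 nz by (intro mult_strict_left_mono) auto
  finally show "cmod (det (Nmat z) - det (free.Nmat z)) < cmod (det (free.Nmat z))" by simp
 qed
qed

text \<open>By Rouche's theorem both enumerations have equally many indices below the circle. Both
  are monotone along the lexicographic order, so the two index sets are initial segments and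
  coincide.\<close>

lemma index_count:
 assumes r: "zero_enumeration T1 T2 r" and ev: "eigenvalue_enumeration \<sigma> T1 T2 H1 H2 ev"
  and c: "det (W0 T1 T2 (of_real c)) ~= 0"
 shows "\<exists>n0. \<forall>n\<ge>n0. 0 < real n + c & {p\<in>index_set T1 T2. ev p < (real n + c)^2} = {p\<in>index_set T1 T2. real (fst p) + r (snd p) < real n + c} \<and>
   (\<forall>z. cmod z = (real n + c)^2 --> det (Nmat z) ~= 0)"
proof -
 let ?J = "index_set T1 T2" and ?S = "{1..CARD('m)}"
 define e0 where "e0 = (%p. real (fst p) + r (snd p))"
 note r01 = pp.zero_enumerationD(1)[OF r]
 have rmono: "mono_on ?S r" using r unfolding zero_enumeration_def by blast
 have Js: "snd p \<in> ?S" if "p \<in> ?J" for p using that unfolding index_set_def by auto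
 have e0n: "0 <= e0 p" if "p \<in> ?J" for p unfolding e0_def using r01[OF Js[OF that]] by simp
 have e0mono: "e0 p <= e0 q" if pq: "p \<in> ?J" "q \<in> ?J" "(p, q) \<in> lex_less" for p q
 proof -
  have "fst p < fst q \<or> fst p = fst q & snd p < snd q" using pq(3) by (cases p; cases q) auto
  then show ?thesis
  proof
   assume "fst p < fst q"
   then have "real (fst p) + 1 <= real (fst q)" by simp
   then show ?thesis unfolding e0_def using r01[OF Js[OF pq(1)]] r01[OF Js[OF pq(2)]] by argo
  next
   assume a: "fst p = fst q & snd p < snd q"
   then have "r (snd p) <= r (snd q)" by (intro mono_onD[OF rmono] Js pq) auto
   then show ?thesis unfolding e0_def using a by simp
  qed
 qed
 have evmono: "ev p <= ev q" if "p \<in> ?J" "q \<in> ?J" "(p, q) \<in> lex_less" for p q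
  using ev that unfolding eigenvalue_enumeration_def by blast
 have evc: "finite {p\<in>?J. complex_of_real (ev p) = \<mu>} & card {p\<in>?J. complex_of_real (ev p) = \<mu>} = emult \<mu>" for \<mu>
  using ev unfolding eigenvalue_enumeration_def by blast
 have e0c: "finite {p\<in>?J. complex_of_real ((e0 p)^2) = \<mu>} & card {p\<in>?J. complex_of_real ((e0 p)^2) = \<mu>} = eigen_mult (%_. 0) T1 T2 0 0 \<mu>" for \<mu>
  unfolding e0_def by (rule pp.free_enumeration[OF r])
 text \<open>The eigenvalues are bounded below since \<open>(1, 1)\<close> has finitely many predecessors.\<close>
 define L where "L = Min (ev ` ({0} \<times> ?S \<union> {(1, 1)}))"
 have finL: "finite (ev ` ({0} \<times> ?S \<union> {(1, 1)}))" by simp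
 have one: "(1, 1) \<in> ?J" unfolding index_set_def by (auto simp: Suc_le_eq)
 have L: "L <= ev p" if p: "p \<in> ?J" for p
 proof (cases "p \<in> {0} \<times> ?S \<union> {(1, 1)}")
  case True
  then show ?thesis unfolding L_def by (intro Min_le finL imageI)
 next
  case False
  then have "((1, 1), p) \<in> lex_less" using p Js[OF p] by (cases p) (auto simp: index_set_def)
  then have "ev (1, 1) <= ev p" by (rule evmono[OF one p])
  moreover have "L <= ev (1, 1)" unfolding L_def by (intro Min_le finL imageI) simp
  ultimately show ?thesis by simp
 qed
 obtain n1 where n1: "\<And>n. n \<ge> n1 ==> 0 < real n + c"
   "\<And>n z. n \<ge> n1 ==> cmod z = (real n + c)^2 ==> cmod (det (Nmat z) - det (free.Nmat z)) < cmod (det (free.Nmat z))"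
  using det_ratio[OF c] by blast
 define n0 where "n0 = max n1 (nat \<lceil>\<bar>L\<bar> + 1 - c\<rceil>)"
 show ?thesis
 proof (intro exI[of _ n0] allI impI conjI)
  fix n assume n: "n0 <= n"
  then have nn: "n1 <= n" "nat \<lceil>\<bar>L\<bar> + 1 - c\<rceil> <= n" unfolding n0_def by auto
  then have nL: "\<bar>L\<bar> + 1 <= real n + c" by (simp add: nat_le_iff ceiling_le_iff)
  show pos: "0 < real n + c" by (rule n1(1)[OF nn(1)])
  let ?R = "(real n + c)^2"
  have R: "0 < ?R" using pos by simp
  have less: "\<And>z. cmod z = ?R ==> cmod (det (Nmat z) - det (free.Nmat z)) < cmod (det (free.Nmat z))" by (rule n1(2)[OF nn(1)])
  then show "det (Nmat z) ~= 0" if "cmod z = ?R" for z using that by force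
  have nz: "det (free.Nmat \<i>) ~= 0" "det (Nmat \<i>) ~= 0" by (simp_all add: det_Nmat_nonreal free.det_Nmat_nonreal)
  note Ro = Rouche_disk[OF mholo_det[OF free.Nmat_holo] mholo_det[OF Nmat_holo] R nz less]
  note c1 = counting[OF evc Ro(1)] and c2 = free.counting[OF e0c Ro(2)]
  have LR: "\<bar>L\<bar> < ?R"
  proof -
   have "1 <= real n + c" using nL by simp
   from mult_left_mono[OF this, of "real n + c"] have "real n + c <= ?R" unfolding power2_eq_square using pos by simp
   then show ?thesis using nL by simp
  qed
  \<comment> \<open>The radius exceeds the modulus of the lower bound \<open>L\<close>, so negative
    eigenvalues lie in the disc too.\<close>
  have s1: "{p\<in>?J. \<bar>ev p\<bar> < ?R} = {p\<in>?J. ev p < ?R}"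
  proof -
   have "\<bar>ev p\<bar> < ?R \<longleftrightarrow> ev p < ?R" if "p \<in> ?J" for p using L[OF that] LR by (auto simp: abs_if)
   then show ?thesis by blast
  qed
  have s2: "{p\<in>?J. \<bar>(e0 p)\<^sup>2\<bar> < ?R} = {p\<in>?J. e0 p < real n + c}"
  proof -
   have "\<bar>(e0 p)\<^sup>2\<bar> < ?R \<longleftrightarrow> e0 p < real n + c" if "p \<in> ?J" for p
    using e0n[OF that] pos power2_less_imp_less[of "e0 p" "real n + c"] power_strict_mono[of "e0 p" "real n + c" 2] by auto
   then show ?thesis by blast
  qed
  have "{p\<in>?J. ev p < ?R} = {p\<in>?J. e0 p < real n + c}"
  proof (rule lex_down_closed_eq[where J="?J"])
   show "finite {p\<in>?J. ev p < ?R}" using c1(1) unfolding s1 .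
   show "finite {p\<in>?J. e0 p < real n + c}" using c2(1) unfolding s2 .
   show "card {p\<in>?J. ev p < ?R} = card {p\<in>?J. e0 p < real n + c}" using c1(2) c2(2) Ro(3) unfolding s1 s2 by simp
   show "p \<in> {p\<in>?J. ev p < ?R}" if "p \<in> ?J" "q \<in> {p\<in>?J. ev p < ?R}" "(p, q) \<in> lex_less" for p q
    using evmono[of p q] that by auto
   show "p \<in> {p\<in>?J. e0 p < real n + c}" if "p \<in> ?J" "q \<in> {p\<in>?J. e0 p < real n + c}" "(p, q) \<in> lex_less" for p q
    using e0mono[of p q] that by auto
  qed auto
  then show "{p\<in>?J. ev p < ?R} = {p\<in>?J. real (fst p) + r (snd p) < real n + c}" unfolding e0_def .
 qed
qed

end

section \<open>Circle means and residues\<close>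

definition circle_point :: "complex => real => real => complex" where
 "circle_point a \<delta> t = a + of_real \<delta> * exp (2 * of_real pi * \<i> * of_real t)"

text \<open>The contour integral over the circle divided by \<open>2 pi \<i>\<close>, written as an
  integral over \<open>{0..1}\<close>, so that Cauchy-Schwarz and finite sums can be taken under it
  for matrix-valued functions.\<close>

definition circle_mean :: "(complex => complex^'n^'m) => complex => real => complex^'n^'m" where
 "circle_mean F a \<delta> = integral {0..1} (%t. (of_real \<delta> * exp (2 * of_real pi * \<i> * of_real t)) \<cdot> F (circle_point a \<delta> t))"

lemma circle_point_continuous: "continuous_on A (circle_point a \<delta>)"
 unfolding circle_point_def[abs_def] by (intro continuous_intros)

lemma circle_point_sphere: "0 < \<delta> ==> circle_point a \<delta> t \<in> sphere a \<delta>"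
 unfolding circle_point_def by (simp add: dist_norm norm_mult)

lemma circle_mean_continuous:
 assumes "0 < \<delta>" "continuous_on (sphere a \<delta>) F"
 shows "continuous_on {0..1} (%t. F (circle_point a \<delta> t))"
 by (rule continuous_on_compose2[OF assms(2) circle_point_continuous]) (use assms circle_point_sphere in blast)

lemma circle_mean_integrable:
 assumes "0 < \<delta>" "continuous_on (sphere a \<delta>) F"
 shows "(%t. (of_real \<delta> * exp (2 * of_real pi * \<i> * of_real t)) \<cdot> F (circle_point a \<delta> t)) integrable_on {0..1}"
 by (intro integrable_continuous_real ms.continuous_on circle_mean_continuous assms continuous_intros)

lemma circle_mean_entry:
 assumes "0 < \<delta>" "continuous_on (sphere a \<delta>) F"
 shows "2 * pi * \<i> * circle_mean F a \<delta> $ i $ j = contour_integral (circlepath a \<delta>) (%z. F z $ i $ j)"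
proof -
 have "circle_mean F a \<delta> $ i $ j = integral {0..1} (%t. of_real \<delta> * exp (2 * of_real pi * \<i> * of_real t) * F (circle_point a \<delta> t) $ i $ j)"
  unfolding circle_mean_def by (subst integral_entry[OF circle_mean_integrable[OF assms]]) simp
 then have "2 * pi * \<i> * circle_mean F a \<delta> $ i $ j =
   integral {0..1} (%t. 2 * pi * \<i> * (of_real \<delta> * exp (2 * of_real pi * \<i> * of_real t) * F (circle_point a \<delta> t) $ i $ j))"
  by (simp only: integral_mult_right)
 also have "... = contour_integral (circlepath a \<delta>) (%z. F z $ i $ j)" unfolding contour_integral_integral
  by (rule integral_cong, simp only: vector_derivative_circlepath) (simp add: circlepath circle_point_def mult_ac)
 finally show ?thesis .
qed

lemma circle_mean_diff:
 assumes "0 < \<delta>" "continuous_on (sphere a \<delta>) F" "continuous_on (sphere a \<delta>) G"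
 shows "circle_mean (%z. F z - G z) a \<delta> = circle_mean F a \<delta> - circle_mean G a \<delta>"
 unfolding circle_mean_def ms.diff_right by (intro integral_diff circle_mean_integrable assms)

lemma circle_mean_linear:
 assumes \<delta>: "0 < \<delta>" and F: "continuous_on (sphere a \<delta>) F"
 shows "circle_mean (%z. A ** F z ** B) a \<delta> = A ** circle_mean F a \<delta> ** B"
proof -
 have "bounded_linear (%X. A ** X ** B)" by (intro bounded_linear_compose[OF mm.bounded_linear_left] mm.bounded_linear_right)
 from integral_linear[OF circle_mean_integrable[OF \<delta> F] this] show ?thesis
  unfolding circle_mean_def by (simp add: o_def mscale_mult_left mscale_mult_right)
qed

lemma circle_mean_shift: "circle_mean F (b + a) \<delta> = circle_mean (%z. F (b + z)) a \<delta>"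
 unfolding circle_mean_def circle_point_def by (simp add: add.assoc)

lemma circle_mean_cong:
 assumes "0 < \<delta>" "\<And>z. z \<in> sphere a \<delta> ==> F z = G z"
 shows "circle_mean F a \<delta> = circle_mean G a \<delta>"
 unfolding circle_mean_def by (intro integral_cong) (simp only: assms(2)[OF circle_point_sphere[OF assms(1)]])

lemma circle_mean_mscale: "circle_mean (%z. c \<cdot> F z) a \<delta> = c \<cdot> circle_mean F a \<delta>" if "0 < \<delta>" "continuous_on (sphere a \<delta>) F"
 using integral_linear[OF circle_mean_integrable[OF that] ms.bounded_linear_right[of c]]
 unfolding circle_mean_def by (simp add: o_def mult.commute)

text \<open>Cauchy-Schwarz on a parameter interval of length 1. Square summability in
  \<open>n\<close> at each point of the circle, with a uniform bound, thus passes to the circle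
  means.\<close>

lemma norm_circle_mean_sq_le:
 fixes F :: "complex => complex^'n^'m"
 assumes \<delta>: "0 < \<delta>" and F: "continuous_on (sphere a \<delta>) F"
 shows "(norm (circle_mean F a \<delta>))^2 <= \<delta>^2 * integral {0..1} (%t. (norm (F (circle_point a \<delta> t)))^2)"
proof -
 let ?u = "%t. norm (F (circle_point a \<delta> t))"
 have uc: "continuous_on {0..1} ?u" by (intro continuous_on_norm circle_mean_continuous assms)
 have "norm (circle_mean F a \<delta>) <= integral {0..1} (%t. \<delta> * ?u t)" unfolding circle_mean_def
  by (rule integral_norm_bound_integral[OF circle_mean_integrable[OF assms]])
    (use uc \<delta> in \<open>auto intro!: integrable_continuous_real continuous_intros simp: norm_mscale norm_mult\<close>)
 also have "... = \<delta> * integral {0..1} ?u" by (rule integral_mult_right)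
 finally have "(norm (circle_mean F a \<delta>))^2 <= (\<delta> * integral {0..1} ?u)^2" by (rule power_mono) simp
 also have "... = \<delta>^2 * (integral {0..1} (%t. 1 * ?u t))^2" by (simp add: power_mult_distrib)
 also have "(integral {0..1} (%t. 1 * ?u t))^2 <= 1 * integral {0..1} (%t. 1 * (?u t)^2)"
  by (rule integral_cauchy_schwarz_weighted[OF absolutely_integrable_continuous_real _ uc]) auto
 finally show ?thesis by (simp add: mult_left_mono)
qed

lemma matrix_residue_circle_mean:
 fixes F :: "complex => complex^'m^'m"
 assumes S: "open S" "cball a \<delta> \<subseteq> S" "0 < \<delta>" and F: "mholo F (S - {a})"
 shows "matrix_residue F a = circle_mean F a \<delta>"
proof -
 have aS: "a \<in> S" using S by auto
 have sub: "sphere a \<delta> \<subseteq> S - {a}" using S by auto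
 have Fc: "continuous_on (sphere a \<delta>) F" by (rule mholo_continuous_on[OF mholo_subset[OF F sub]])
 have "2 * pi * \<i> * circle_mean F a \<delta> $ i $ j = 2 * pi * \<i> * residue (%w. F w $ i $ j) a" for i j
  unfolding circle_mean_entry[OF S(3) Fc] by (rule contour_integral_unique[OF base_residue[OF S(1) aS S(3) mholoD[OF F] S(2)]])
 then show ?thesis unfolding matrix_residue_def vec_eq_iff by simp
qed

section \<open>The Weyl matrix in the variable \<rho>\<close>

context sl_problem
begin

text \<open>The factor \<open>2 * \<rho>\<close> comes from the substitution \<lambda> = \<rho>^2:
  with it, residues in \<rho> at positive points equal residues of the Weyl matrix in
  \<lambda>.\<close>

definition Mfun :: "complex => complex^'m^'m" where
 "Mfun \<rho> = (2 * \<rho>) \<cdot> (- (matrix_inv (Nmat (\<rho>^2)) ** Smat (\<rho>^2)))"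

lemma square_mholo: "mholo F UNIV ==> mholo (%\<rho>. F (\<rho>^2)) S"
 unfolding mholo_def by (auto intro!: holomorphic_on_compose_gen[of "%\<rho>. \<rho>^2" S _ UNIV, unfolded o_def] holomorphic_intros)

lemma Mfun_holo: "(\<And>\<rho>. \<rho> \<in> S ==> det (Nmat (\<rho>^2)) ~= 0) ==> mholo Mfun S"
 unfolding Mfun_def[abs_def]
 by (intro mholo_mscale mholo_minus mholo_mult mholo_inv square_mholo Nmat_holo Smat_holo holomorphic_intros)

lemma residue_Mfun:
 assumes s: "0 < s"
 shows "residue (%\<rho>. Mfun \<rho> $ i $ j) (of_real s) = matrix_residue (weyl) (complex_of_real (s^2)) $ i $ j"
proof -
 let ?l = "complex_of_real (s^2)" and ?s = "complex_of_real s"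
 let ?\<alpha> = "matrix_residue (weyl) ?l"
 obtain \<eta> A where A: "\<eta> > 0" "mholo A (ball ?l \<eta>)" "A ?l = ?\<alpha>"
  "\<And>z. z \<in> ball ?l \<eta> - {?l} ==> A z = (z - ?l) \<cdot> (- (matrix_inv (Nmat z) ** Smat z))"
  using residue_data[of "s^2"] by blast
 let ?S = "{\<rho>. \<rho>^2 \<in> ball ?l \<eta>} \<inter> {\<rho>. 0 < Re \<rho>}"
 have S: "open ?S"
 proof (rule open_Int)
  show "open {\<rho>::complex. \<rho>^2 \<in> ball ?l \<eta>}"
   by (rule open_Collect_less[of "%\<rho>. dist ?l (\<rho>^2)" "%_. \<eta>", folded mem_ball]) (intro continuous_intros)+
  show "open {\<rho>. 0 < Re \<rho>}" by (rule open_halfspace_Re_gt)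
 qed
 have sS: "?s \<in> ?S" using s A(1) by simp
 \<comment> \<open>What remains of \<open>Mfun\<close> after \<rho> - s is cancelled from \<rho>^2 -
   s^2. The half-plane keeps \<rho> + s away from 0, and at \<open>s\<close> the scalar factor is
   1.\<close>
 let ?h = "%\<rho>. 2 * \<rho> * A (\<rho>^2) $ i $ j / (\<rho> + ?s)"
 have "(%\<rho>. A (\<rho>^2) $ i $ j) holomorphic_on ?S"
  by (rule holomorphic_on_compose_gen[of "%\<rho>. \<rho>^2" ?S "%z. A z $ i $ j" "ball ?l \<eta>", unfolded o_def])
    (use mholoD[OF A(2)] in \<open>auto intro!: holomorphic_intros\<close>)
 moreover have "\<rho> + ?s ~= 0" if "\<rho> \<in> ?S" for \<rho>
 proof
  assume "\<rho> + ?s = 0"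
  then have "Re \<rho> + s = 0" by (metis Re_complex_of_real plus_complex.sel(1) zero_complex.sel(1))
  then show False using that s by simp
 qed
 ultimately have h: "?h holomorphic_on ?S" by (intro holomorphic_intros) auto
 have "residue (%\<rho>. Mfun \<rho> $ i $ j) ?s = residue (%\<rho>. ?h \<rho> / (\<rho> - ?s)) ?s"
 proof (rule residue_cong[OF _ refl])
  have "eventually (%\<rho>. \<rho> \<in> ?S - {?s}) (at ?s)" using S sS by (metis eventually_at_in_open)
  then show "eventually (%\<rho>. Mfun \<rho> $ i $ j = ?h \<rho> / (\<rho> - ?s)) (at ?s)"
  proof eventually_elim
   case (elim \<rho>)
   have p: "\<rho> + ?s ~= 0" using elim \<open>\<And>\<rho>. \<rho> \<in> ?S ==> \<rho> + ?s ~= 0\<close> by blast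
   have m: "\<rho> - ?s ~= 0" using elim by simp
   have l: "\<rho>^2 - ?l = (\<rho> + ?s) * (\<rho> - ?s)" by (simp add: power2_eq_square algebra_simps)
   then have "\<rho>^2 ~= ?l" using p m by auto
   then have "A (\<rho>^2) = (\<rho>^2 - ?l) \<cdot> (- (matrix_inv (Nmat (\<rho>^2)) ** Smat (\<rho>^2)))" using elim by (intro A(4)) auto
   then have "A (\<rho>^2) $ i $ j = (\<rho> + ?s) * (\<rho> - ?s) * (- (matrix_inv (Nmat (\<rho>^2)) ** Smat (\<rho>^2))) $ i $ j"
    unfolding l by (simp only: mscale_nth)
   then show ?case unfolding Mfun_def mscale_nth using p m by simp
  qed
 qed
 also have "... = ?h ?s" by (rule residue_simple[OF S sS h])
 also have "... = ?\<alpha> $ i $ j" using s A(3) by (simp add: field_simps)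
 finally show ?thesis .
qed

text \<open>Substituting \<open>\<lambda> = \<rho>\<^sup>2\<close> in the Weyl matrix turns the eigenvalues into simple poles on the positive
 half axis.\<close>

lemma residue_sum:
 fixes a \<delta> :: real
 assumes \<delta>: "0 < \<delta>" "\<delta> < a" and nz: "\<And>\<rho>. \<rho> \<in> sphere (of_real a) \<delta> ==> det (Nmat (\<rho>^2)) ~= 0"
 defines "L \<equiv> {l. (a - \<delta>)^2 < l & l < (a + \<delta>)^2 & det (Nmat (of_real l)) = 0}"
 shows "(\<Sum>l\<in>L. matrix_residue (weyl) (of_real l)) = circle_mean Mfun (of_real a) \<delta>"
proof -
 let ?a = "complex_of_real a"
 \<comment> \<open>An intermediate radius: the ball contains the circle in its interior and stays
   within Re \<rho> > 0.\<close>
 define b where "b = (\<delta> + a) / 2"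
 have b: "\<delta> < b" "b < a" unfolding b_def using \<delta> by auto
 define f where "f = (%\<rho>. det (Nmat (\<rho>^2)))"
 have fh: "f holomorphic_on UNIV" unfolding f_def by (intro mholo_det square_mholo Nmat_holo)
 have "f (?a + of_real \<delta>) ~= 0" unfolding f_def by (rule nz) (use \<delta> in \<open>simp add: dist_norm\<close>)
 then have finK: "finite {\<rho>\<in>cball ?a b. f \<rho> = 0}" by (rule finite_zeros_compact[OF fh _ compact_cball])
 let ?S = "ball ?a b"
 define pts where "pts = {\<rho>\<in>?S. f \<rho> = 0}"
 have fin: "finite pts" by (rule finite_subset[OF _ finK]) (auto simp: pts_def)
 let ?w = "winding_number (circlepath ?a \<delta>)"
 have pim: "path_image (circlepath ?a \<delta>) = sphere ?a \<delta>" using \<delta> by simp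
 have w0: "?w z = 0" if "\<delta> < dist ?a z" for z
  by (rule winding_number_zero_outside[of _ "cball ?a \<delta>"]) (use that \<delta> in \<open>auto simp: pim\<close>)
 have w1: "?w z = 1" if "dist ?a z < \<delta>" for z using winding_number_circlepath[of z ?a \<delta>] that by (simp add: dist_norm norm_minus_commute)
 have holo: "mholo Mfun (?S - pts)" by (rule Mfun_holo) (auto simp: pts_def f_def)
 have sub: "sphere ?a \<delta> \<subseteq> ?S - pts" using nz b by (auto simp: pts_def f_def)
 have Mc: "continuous_on (sphere ?a \<delta>) Mfun" by (rule mholo_continuous_on[OF mholo_subset[OF holo sub]])
 define P where "P = {\<rho>\<in>pts. dist ?a \<rho> < \<delta>}"
 have bij: "P = (%l. complex_of_real (sqrt l)) ` L"
 proof (intro set_eqI iffI)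
  fix \<rho> assume "\<rho> \<in> P"
  then have \<rho>: "dist ?a \<rho> < \<delta>" "f \<rho> = 0" unfolding P_def pts_def by auto
  have re: "\<bar>a - Re \<rho>\<bar> < \<delta>" using \<rho>(1) abs_Re_le_cmod[of "?a - \<rho>"] by (simp add: dist_norm)
  then have pos: "0 < Re \<rho>" using \<delta> by simp
  \<comment> \<open>\<open>Nmat\<close> is invertible at nonreal points, so \<rho>^2 is real, and
    with Re \<rho> > 0 so is \<rho>.\<close>
  have "Im (\<rho>^2) = 0" using \<rho>(2) det_Nmat_nonreal unfolding f_def by blast
  then have im: "Im \<rho> = 0" using pos by (simp add: power2_eq_square)
  define s where "s = Re \<rho>"
  have r: "\<rho> = of_real s" using im by (simp add: complex_eq_iff s_def)
  have s: "a - \<delta> < s" "s < a + \<delta>" "0 < s" using re pos unfolding s_def by auto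
  have "s^2 \<in> L" unfolding L_def using s \<delta> \<rho>(2) unfolding r f_def by (auto intro!: power_strict_mono)
  moreover have "\<rho> = complex_of_real (sqrt (s^2))" using s r by simp
  ultimately show "\<rho> \<in> (%l. complex_of_real (sqrt l)) ` L" by blast
 next
  fix \<rho> assume "\<rho> \<in> (%l. complex_of_real (sqrt l)) ` L"
  then obtain l where l: "\<rho> = complex_of_real (sqrt l)" "l \<in> L" by blast
  then have l2: "(a - \<delta>)^2 < l" "l < (a + \<delta>)^2" "det (Nmat (of_real l)) = 0" unfolding L_def by auto
  have l0: "0 <= l" using l2(1) zero_le_power2[of "a - \<delta>"] by linarith
  have "a - \<delta> < sqrt l" by (rule real_less_rsqrt[OF l2(1)])
  moreover have "sqrt l < a + \<delta>" by (rule real_less_lsqrt) (use l2(2) \<delta> l0 in auto)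
  ultimately have "\<bar>a - sqrt l\<bar> < \<delta>" by argo
  then have d: "dist ?a \<rho> < \<delta>" unfolding l(1) dist_of_real by (simp add: dist_real_def)
  have "\<rho>^2 = of_real l" unfolding l(1) using l0 by (simp flip: of_real_power)
  then show "\<rho> \<in> P" unfolding P_def pts_def f_def using d b l2(3) by simp
 qed
 have L0: "0 < l" if "l \<in> L" for l using that zero_le_power2[of "a - \<delta>"] unfolding L_def by (simp only: mem_Collect_eq) linarith
 have inj: "inj_on (%l. complex_of_real (sqrt l)) L" by (rule inj_onI) simp
 have "(\<Sum>l\<in>L. matrix_residue (weyl) (of_real l)) $ i $ j = circle_mean Mfun ?a \<delta> $ i $ j" for i j
 proof -
  have "contour_integral (circlepath ?a \<delta>) (%\<rho>. Mfun \<rho> $ i $ j) = 2 * pi * \<i> * (\<Sum>p\<in>pts. ?w p * residue (%\<rho>. Mfun \<rho> $ i $ j) p)"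
  proof (rule Residue_theorem[of ?S])
   show "\<forall>z. z \<notin> ?S --> ?w z = 0" using w0 b by auto
   show "path_image (circlepath ?a \<delta>) \<subseteq> ?S - pts" unfolding pim by (rule sub)
  qed (use fin mholoD[OF holo] in auto)
  also have "(\<Sum>p\<in>pts. ?w p * residue (%\<rho>. Mfun \<rho> $ i $ j) p) = (\<Sum>p\<in>P. ?w p * residue (%\<rho>. Mfun \<rho> $ i $ j) p)"
  proof (rule sum.mono_neutral_right[OF fin])
   show "\<forall>p\<in>pts - P. ?w p * residue (%\<rho>. Mfun \<rho> $ i $ j) p = 0"
   proof
    fix p assume p: "p \<in> pts - P"
    then have "p \<notin> sphere ?a \<delta>" "\<not> dist ?a p < \<delta>" using sub unfolding P_def by auto
    then have "\<delta> < dist ?a p" by simp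
    then show "?w p * residue (%\<rho>. Mfun \<rho> $ i $ j) p = 0" using w0 by simp
   qed
  qed (auto simp: P_def)
  also have "... = (\<Sum>p\<in>P. residue (%\<rho>. Mfun \<rho> $ i $ j) p)" by (intro sum.cong) (auto simp: P_def w1)
  also have "... = (\<Sum>l\<in>L. residue (%\<rho>. Mfun \<rho> $ i $ j) (of_real (sqrt l)))"
   unfolding bij by (subst sum.reindex[OF inj]) (simp add: o_def)
  also have "... = (\<Sum>l\<in>L. matrix_residue (weyl) (of_real l) $ i $ j)"
  proof (rule sum.cong[OF refl])
   fix l assume "l \<in> L"
   then have "0 < l" by (rule L0)
   then show "residue (%\<rho>. Mfun \<rho> $ i $ j) (of_real (sqrt l)) = matrix_residue (weyl) (of_real l) $ i $ j"
    using residue_Mfun[of "sqrt l" i j] by (simp flip: of_real_power)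
  qed
  finally have "2 * pi * \<i> * circle_mean Mfun ?a \<delta> $ i $ j = 2 * pi * \<i> * (\<Sum>l\<in>L. matrix_residue (weyl) (of_real l) $ i $ j)"
   unfolding circle_mean_entry[OF \<delta>(1) Mc] .
  then show ?thesis by simp
 qed
 then show ?thesis by (simp add: vec_eq_iff)
qed

lemma Mfun_hat:
 assumes "\<rho> ~= 0" "det (Nhat \<rho>) ~= 0"
 shows "Mfun \<rho> = 2 \<cdot> (pr T1 1 \<rho> ** (matrix_inv (Nhat \<rho>) ** Uhat \<rho>) ** pr T1 1 \<rho>)"
proof -
 have d: "det (Nmat (\<rho>^2)) ~= 0" using assms det_Nhat by blast
 show ?thesis unfolding Mfun_def weyl_matrix_eq(2)[OF d, symmetric] weyl_matrix_hat[OF assms] using assms(1) by simp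
qed

end

section \<open>Singular values\<close>

lemma gram_eigenvalue:
 fixes A :: "complex^'m^'m"
 assumes "(ctranspose A ** A) *v v = \<mu> *s v"
 shows "complex_of_real ((norm (A *v v))^2) = \<mu> * complex_of_real ((norm v)^2)"
proof -
 have "complex_of_real ((norm (A *v v))^2) = (ctranspose (colm (A *v v)) ** colm (A *v v)) $ 1 $ 1"
  by (simp only: ctranspose_mult_self norm_colm)
 also have "... = (ctranspose (A ** colm v) ** (A ** colm v)) $ 1 $ 1" by (simp only: mult_colm[of A v])
 also have "... = (ctranspose (colm v) ** ((ctranspose A ** A) ** colm v)) $ 1 $ 1"
  by (simp add: ctranspose_mult matrix_mul_assoc)
 also have "(ctranspose A ** A) ** colm v = \<mu> \<cdot> colm v" unfolding mult_colm assms by (simp add: vec_eq_iff colm_def)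
 finally show ?thesis by (simp add: mscale_mult_right ctranspose_mult_self)
qed

lemma singular_value_le_norm:
 assumes "s \<in> singular_values A"
 shows "0 <= s" "s <= norm A"
proof -
 obtain v where v: "v ~= 0" "(ctranspose A ** A) *v v = complex_of_real (s^2) *s v" and s: "0 <= s"
  using assms unfolding singular_values_def by blast
 show "0 <= s" by (rule s)
 have "(norm (A *v v))^2 = s^2 * (norm v)^2" using gram_eigenvalue[OF v(2)] by (simp flip: of_real_mult of_real_power)
 then have "norm (A *v v) = s * norm v" using s by (metis norm_ge_zero power_mult_distrib power2_eq_iff_nonneg mult_nonneg_nonneg)
 then have "s * norm v <= norm A * norm v" using norm_matvec_le[of A v] by simp
 then show "s <= norm A" using v(1) by simp
qed

lemma resolvent_vector: "(B - z \<cdot> mat 1) *v v = B *v v - z *s (v::complex^'m)"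
 by (simp add: matrix_vector_mult_diff_rdistrib mscale_vector)

lemma resolvent_holo: "mholo (%z. B - z \<cdot> mat 1) S" by (intro mholo_diff mholo_mscale mholo_const holomorphic_intros)

text \<open>Their squares are zeros, in a bounded disc, of the characteristic determinant of the
  Gram matrix; this entire function is not identically 0, as a Gram matrix has no eigenvalue
  -1.\<close>

lemma finite_singular_values: "finite (singular_values (A::complex^'m^'m))"
proof -
 let ?B = "ctranspose A ** A"
 let ?f = "%z. det (?B - z \<cdot> mat 1)"
 have f: "?f holomorphic_on UNIV" by (intro mholo_det resolvent_holo)
 have f1: "?f (- 1) ~= 0"
 proof
  assume "?f (- 1) = 0"
  then obtain v where v: "v ~= 0" "?B *v v = (- 1) *s v"
   unfolding det_eq_0_iff_kernel resolvent_vector right_minus_eq by blast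
  have "(norm (A *v v))^2 = - ((norm v)^2)"
   using gram_eigenvalue[OF v(2)] by (simp flip: of_real_mult of_real_power of_real_minus)
  then show False using v(1) zero_le_power2[of "norm (A *v v)"] by simp
 qed
 have f0: "?f (complex_of_real (s^2)) = 0" if "s \<in> singular_values A" for s
  using that unfolding singular_values_def det_eq_0_iff_kernel resolvent_vector by auto
 have "finite {z\<in>cball 0 ((norm A)^2). ?f z = 0}" by (rule finite_zeros_compact[OF f f1 compact_cball])
 moreover have "(%s. complex_of_real (s^2)) ` singular_values A \<subseteq> {z\<in>cball 0 ((norm A)^2). ?f z = 0}"
  using f0 singular_value_le_norm by (auto simp: norm_power intro!: power_mono)
 moreover have "inj_on (%s. complex_of_real (s^2)) (singular_values A)"
  by (rule inj_onI) (metis of_real_eq_iff power2_eq_iff_nonneg singular_value_le_norm(1))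
 ultimately show ?thesis by (meson finite_imageD finite_subset)
qed

text \<open>If a Gram matrix had no eigenvalue, its resolvent would be entire and vanish at infinity.\<close>

lemma singular_values_nonempty: "singular_values (A::complex^'m^'m) ~= {}"
proof -
 let ?B = "ctranspose A ** A"
 have "\<exists>z. det (?B - z \<cdot> mat 1) = 0"
 proof (rule ccontr)
  assume "\<not> ?thesis"
  then have nz: "det (?B - z \<cdot> mat 1) ~= 0" for z by blast
  let ?R = "%z. matrix_inv (?B - z \<cdot> mat 1)"
  have R: "mholo ?R UNIV" by (intro mholo_inv resolvent_holo nz)
  have lim: "((%z. ?R z $ i $ j) \<longlongrightarrow> 0) at_infinity" for i j
  proof (rule tendsto_0_le[where K=1])
   show "((%z::complex. inverse (complex_of_real (norm z - norm ?B)) * of_nat CARD('m)) \<longlongrightarrow> 0) at_infinity"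
   proof -
    have "filterlim (%z::complex. - norm ?B + norm z) at_top at_infinity"
     by (rule filterlim_tendsto_add_at_top[OF tendsto_const filterlim_norm_at_top])
    from tendsto_inverse_0_at_top[OF this]
    have "((%z::complex. inverse (norm z - norm ?B)) \<longlongrightarrow> 0) at_infinity" by simp
    then have "((%z::complex. complex_of_real (inverse (norm z - norm ?B)) * of_nat CARD('m)) \<longlongrightarrow> of_real 0 * of_nat CARD('m)) at_infinity"
     by (intro tendsto_intros)
    then show ?thesis by simp
   qed
   have "eventually (%z::complex. norm ?B + 1 <= norm z) at_infinity" by (rule eventually_at_infinityI)
   then show "eventually (%z. norm (?R z $ i $ j) <= norm (inverse (complex_of_real (norm z - norm ?B)) * of_nat CARD('m)) * 1) at_infinity"
   proof eventually_elim
    case (elim z)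
    have "(norm z - norm ?B) * norm v <= norm ((?B - z \<cdot> mat 1) *v v)" for v unfolding resolvent_vector
     using norm_triangle_ineq2[of "z *s v" "?B *v v"] norm_matvec_le[of ?B v]
     by (simp add: norm_complex_scale norm_minus_commute algebra_simps)
    from det_nonzero_lower_bound(2)[OF _ this] elim
    have "norm (?R z) <= real CARD('m) * (1 / (norm z - norm ?B))" by simp
    then have "norm (?R z $ i $ j) <= real CARD('m) * (1 / (norm z - norm ?B))" using cmod_entry_le[of "?R z" i j] by linarith
    moreover have "cmod (complex_of_real (norm z - norm ?B)) = norm z - norm ?B"
     using elim by (simp add: norm_of_real del: of_real_diff)
    ultimately show ?case unfolding norm_mult norm_inverse by (simp only: norm_of_nat divide_inverse mult_1_left mult_1_right mult.commute)
   qed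
  qed
  have "?R z $ i $ j = 0" for z i j by (rule Liouville_weak[OF mholoD[OF R] lim])
  then have "?R 0 = 0" by (simp add: vec_eq_iff)
  then have "(mat 1 :: complex^'m^'m) = 0" using matrix_inv_inverse(1)[OF nz[of 0]] by (simp add: mm.zero_right)
  then have "(mat 1 :: complex^'m^'m) $ undefined $ undefined = 0" by simp
  then show False by (simp add: mat_def)
 qed
 then obtain z v where v: "v ~= 0" "?B *v v = z *s v" unfolding det_eq_0_iff_kernel resolvent_vector by auto
 define s where "s = norm (A *v v) / norm v"
 have "z * complex_of_real ((norm v)^2) = complex_of_real ((norm (A *v v))^2)" by (rule gram_eigenvalue[OF v(2), symmetric])
 then have "z = complex_of_real (s^2)" unfolding s_def using v(1) by (simp add: power_divide field_simps)
 then have "s \<in> singular_values A" unfolding singular_values_def s_def using v by auto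
 then show ?thesis by blast
qed

text \<open>Finiteness and nonemptiness make \<open>Max\<close> an actual singular value. The
  comparison allows square summability to be proved in the Frobenius norm.\<close>

lemma matrix_norm_le_norm: "0 <= matrix_norm A" "matrix_norm A <= norm A"
proof -
 have "matrix_norm A \<in> singular_values A"
  unfolding matrix_norm_def by (rule Max_in[OF finite_singular_values singular_values_nonempty])
 then show "0 <= matrix_norm A" "matrix_norm A <= norm A" by (auto intro: singular_value_le_norm)
qed

text \<open>Exactly one index of each value survives, its first one. This is how the modified weight
  matrices turn a sum over indices into a sum over distinct eigenvalues.\<close>

lemma sum_first_occurrences:
 fixes e :: "nat => real" and R :: "real => 'a::comm_monoid_add"
 assumes "finite S"
 shows "(\<Sum>s\<in>S. if \<exists>t\<in>S. t < s & e t = e s then 0 else R (e s)) = (\<Sum>l\<in>e ` S. R l)"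
proof -
 define S' where "S' = {s\<in>S. \<not> (\<exists>t\<in>S. t < s & e t = e s)}"
 have "(\<Sum>s\<in>S. if \<exists>t\<in>S. t < s & e t = e s then 0 else R (e s)) = (\<Sum>s\<in>S'. R (e s))"
  by (rule sum.mono_neutral_cong_right[OF assms]) (auto simp: S'_def)
 also have "... = (\<Sum>l\<in>e ` S'. R l)"
 proof (rule sum.reindex[symmetric, unfolded o_def])
  show "inj_on e S'"
  proof (rule inj_onI)
   fix s t assume "s \<in> S'" "t \<in> S'" "e s = e t"
   then show "s = t" unfolding S'_def by (cases s t rule: linorder_cases) auto
  qed
 qed
 also have "e ` S' = e ` S"
 proof (intro set_eqI iffI)
  fix l assume "l \<in> e ` S"
  then obtain s where s: "s \<in> S" "e s = l" by blast
  define t where "t = (LEAST t. t \<in> S & e t = l)"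
  have t: "t \<in> S & e t = l" unfolding t_def by (rule LeastI[of _ s]) (use s in simp)
  have "t \<in> S'" unfolding S'_def
  proof (intro CollectI conjI notI)
   assume "\<exists>u\<in>S. u < t & e u = e t"
   then obtain u where "u \<in> S" "u < t" "e u = e t" by blast
   then show False using not_less_Least[of u "%t. t \<in> S & e t = l"] t unfolding t_def by auto
  qed (use t in blast)
  then show "l \<in> e ` S'" using t by blast
 qed (auto simp: S'_def)
 finally show ?thesis .
qed

lemma (in projection_pair) zero_gap:
 "\<exists>\<delta>>0. \<delta> <= 1 / 2 & (\<forall>z\<in>cball x \<delta>. z ~= x --> det (W z) ~= 0)"
proof -
 have h: "(%z. det (W z)) holomorphic_on UNIV" by (intro mholo_det W_holo)
 have i: "det (W \<i>) ~= 0" by (rule det_W_nonreal) simp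
 have "finite {z\<in>cball x 1. det (W z) = 0}" by (rule finite_zeros_compact[OF h i compact_cball])
 from finite_set_avoid[OF this, of x] obtain d where d: "d > 0" "\<And>z. z \<in> cball x 1 ==> det (W z) = 0 ==> z ~= x ==> d <= dist x z"
  by blast
 show ?thesis
 proof (intro exI[of _ "min (d / 2) (1 / 2)"] conjI ballI impI notI)
  fix z assume z: "z \<in> cball x (min (d / 2) (1 / 2))" "z ~= x" "det (W z) = 0"
  then have "d <= dist x z" by (intro d(2)) auto
  then show False using z(1) d(1) by simp
 qed (use d in auto)
qed

section \<open>Sums of weight matrices as contour integrals\<close>

context sl_problem
begin

interpretation pp: projection_pair T1 T2 by unfold_locales (use T1_simps T2_simps in auto)

text \<open>\<open>index_count\<close> at \<open>r k - \<delta>\<close> and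
  \<open>r k + \<delta>\<close> shows that the eigenvalues between the two squares are those with
  indices \<open>(n, s)\<close>, \<open>r s = r k\<close>. Their residues, taken once per distinct
  value, are collected by the circle in the \<rho>-plane.\<close>

lemma weight_sum:
 assumes r: "zero_enumeration T1 T2 r" and ev: "eigenvalue_enumeration \<sigma> T1 T2 H1 H2 ev"
  and k: "k \<in> {1..CARD('m)}" and \<delta>: "0 < \<delta>" "\<delta> <= 1 / 2"
  and gap: "\<forall>z\<in>cball (of_real (r k)) \<delta>. z ~= of_real (r k) --> det (W0 T1 T2 z) ~= 0"
 shows "\<exists>n1. \<forall>n\<ge>n1. (\<Sum>s | s \<in> {1..CARD('m)} & r s = r k. weight_matrix' \<sigma> T1 T2 H1 H2 ev (n, s))
    = circle_mean Mfun (of_real (real n + r k)) \<delta> & (\<forall>\<rho>\<in>sphere (of_real (real n + r k)) \<delta>. det (Nmat (\<rho>^2)) ~= 0)"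
proof -
 let ?J = "index_set T1 T2" and ?S = "{1..CARD('m)}"
 let ?x = "r k"
 define S' where "S' = {s\<in>?S. r s = ?x}"
 note r01 = pp.zero_enumerationD(1)[OF r]
 have rz: "det (W0 T1 T2 (of_real (r s))) = 0" if s: "s \<in> ?S" for s
 proof -
  note c = pp.zero_enumerationD(2)[OF r conjunct1[OF r01[OF s]] conjunct2[OF r01[OF s]]]
  have "card {k\<in>?S. r k = r s} > 0" using s by (auto simp: card_gt_0_iff)
  then have "\<not> {v. W0 T1 T2 (of_real (r s)) *v v = 0} \<subseteq> {0}" unfolding c by (metis vec.dim_eq_0 less_irrefl)
  then show ?thesis unfolding det_eq_0_iff_kernel by blast
 qed
 have mem: "complex_of_real (?x - \<delta>) \<in> cball (of_real ?x) \<delta>" "complex_of_real (?x + \<delta>) \<in> cball (of_real ?x) \<delta>"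
  using \<delta> by (simp_all only: mem_cball dist_of_real) (simp_all add: dist_real_def)
 have c1: "det (W0 T1 T2 (of_real (?x - \<delta>))) ~= 0" and c2: "det (W0 T1 T2 (of_real (?x + \<delta>))) ~= 0"
  using gap mem \<delta>(1) by (simp_all only: of_real_eq_iff) auto
 obtain n1 where n1: "\<forall>n\<ge>n1. 0 < real n + (?x - \<delta>) & {p\<in>?J. ev p < (real n + (?x - \<delta>))^2} = {p\<in>?J. real (fst p) + r (snd p) < real n + (?x - \<delta>)} \<and>
   (\<forall>z. cmod z = (real n + (?x - \<delta>))^2 --> det (Nmat z) ~= 0)" using index_count[OF r ev c1] by blast
 obtain n2 where n2: "\<forall>n\<ge>n2. 0 < real n + (?x + \<delta>) & {p\<in>?J. ev p < (real n + (?x + \<delta>))^2} = {p\<in>?J. real (fst p) + r (snd p) < real n + (?x + \<delta>)} \<and>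
   (\<forall>z. cmod z = (real n + (?x + \<delta>))^2 --> det (Nmat z) ~= 0)" using index_count[OF r ev c2] by blast
 show ?thesis
 proof (intro exI[of _ "max (max n1 n2) 2"] allI impI)
  fix n assume "max (max n1 n2) 2 <= n"
  then have n: "n1 <= n" "n2 <= n" "2 <= n" by auto
  define a where "a = real n + ?x"
  have ad: "a - \<delta> = real n + (?x - \<delta>)" "a + \<delta> = real n + (?x + \<delta>)" unfolding a_def by auto
  note m1 = n1[rule_format, OF n(1), folded ad] and m2 = n2[rule_format, OF n(2), folded ad]
  have a: "\<delta> < a" using m1 by simp
  have nz: "det (Nmat (\<rho>^2)) ~= 0" if \<rho>: "\<rho> \<in> sphere (of_real a) \<delta>" for \<rho>
  proof (cases "Im \<rho> = 0")
   case False
   have "\<bar>Re (of_real a - \<rho>)\<bar> <= \<delta>" using \<rho> abs_Re_le_cmod[of "of_real a - \<rho>"] by (simp add: dist_norm)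
   then have "0 < Re \<rho>" using a by simp
   then have "Im (\<rho>^2) ~= 0" using False by (simp add: power2_eq_square)
   then show ?thesis by (rule det_Nmat_nonreal)
  next
   case True
   then have e: "\<rho> = of_real (Re \<rho>)" by (simp add: complex_eq_iff)
   have "dist (complex_of_real a) (of_real (Re \<rho>)) = \<delta>" using \<rho> e by simp
   then have "\<bar>a - Re \<rho>\<bar> = \<delta>" unfolding dist_of_real by (simp add: dist_real_def)
   then have "Re \<rho> = a - \<delta> \<or> Re \<rho> = a + \<delta>" by (auto simp: abs_if split: if_splits)
   moreover have "cmod (\<rho>^2) = (Re \<rho>)^2" by (subst e) (simp add: norm_power)
   ultimately show ?thesis using m1 m2 by auto
  qed
  have int: "p \<in> Pair n ` S'" if p: "p \<in> ?J" "(a - \<delta>)^2 <= ev p" "ev p < (a + \<delta>)^2" for p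
  proof -
   have "p \<notin> {p\<in>?J. ev p < (a - \<delta>)^2}" "p \<in> {p\<in>?J. ev p < (a + \<delta>)^2}" using p by auto
   then have e: "a - \<delta> <= real (fst p) + r (snd p)" "real (fst p) + r (snd p) < a + \<delta>" using m1 m2 p(1) by auto
   have s: "snd p \<in> ?S" using p(1) unfolding index_set_def by auto
   note rs = r01[OF s] and rk = r01[OF k]
   let ?y = "real (fst p) + r (snd p) - real n"
   have close: "\<bar>?x - ?y\<bar> <= \<delta>" using e unfolding a_def by argo
   \<comment> \<open>By periodicity up to sign \<open>?y\<close> is a zero of \<open>det W0\<close>;
     it lies within \<delta> of \<open>r k\<close>, and \<open>gap\<close> leaves \<open>r k\<close>
     as the only zero there.\<close>
   have "det (W0 T1 T2 (of_real ?y)) = 0"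
   proof -
    have "of_real ?y + of_nat n = of_real (r (snd p)) + (of_nat (fst p) :: complex)" by simp
    then show ?thesis using rz[OF s] pp.det_W_shift[of "of_real ?y" n] pp.det_W_shift[of "of_real (r (snd p))" "fst p"] by metis
   qed
   moreover have "complex_of_real ?y \<in> cball (of_real ?x) \<delta>" using close unfolding mem_cball dist_of_real by (simp add: dist_real_def)
   ultimately have "complex_of_real ?y = of_real ?x" using gap by blast
   then have y: "real (fst p) + r (snd p) = real n + ?x" unfolding of_real_eq_iff by argo
   then have "real (fst p) < real n + 1" "real n < real (fst p) + 1" using rs rk by argo+
   then have "fst p < n + 1" "n < fst p + 1" by simp_all
   then have f: "fst p = n" by simp
   then have "snd p \<in> S'" unfolding S'_def using s y by simp
   then show ?thesis using f by (cases p) auto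
  qed
  have int': "(n, s) \<in> ?J & (a - \<delta>)^2 < ev (n, s) & ev (n, s) < (a + \<delta>)^2" if s: "s \<in> S'" for s
  proof -
   have J: "(n, s) \<in> ?J" using s n unfolding S'_def index_set_def by auto
   have e: "real (fst (n, s)) + r (snd (n, s)) = a" using s unfolding S'_def a_def by simp
   have "(n, s) \<notin> {p\<in>?J. real (fst p) + r (snd p) < a - \<delta>}" "(n, s) \<in> {p\<in>?J. real (fst p) + r (snd p) < a + \<delta>}"
    using e J \<delta> by auto
   then have "(n, s) \<notin> {p\<in>?J. ev p < (a - \<delta>)^2}" "(n, s) \<in> {p\<in>?J. ev p < (a + \<delta>)^2}" using m1 m2 by blast+
   then have l: "(a - \<delta>)^2 <= ev (n, s)" "ev (n, s) < (a + \<delta>)^2" using J by auto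
   have "{p\<in>?J. complex_of_real (ev p) = complex_of_real (ev (n, s))} ~= {}" using J by blast
   then have "0 < emult (complex_of_real (ev (n, s)))" using ev unfolding eigenvalue_enumeration_def by (metis card_gt_0_iff)
   then have "det (Nmat (complex_of_real (ev (n, s)))) = 0" by (simp add: eigen_mult_pos_iff)
   \<comment> \<open>The index sets give only a weak lower inequality; the absence of zeros on the
     circle of radius \<open>(a - \<delta>)^2\<close> makes it strict.\<close>
   then have "cmod (complex_of_real (ev (n, s))) ~= (a - \<delta>)^2" using m1 by blast
   then have "ev (n, s) ~= (a - \<delta>)^2" by auto
   then show ?thesis using l J by auto
  qed
  let ?R = "%l. matrix_residue (weyl) (complex_of_real l)"
  have w': "weight_matrix' \<sigma> T1 T2 H1 H2 ev (n, s) = (if \<exists>t\<in>S'. t < s & ev (n, t) = ev (n, s) then 0 else ?R (ev (n, s)))"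
   if s: "s \<in> S'" for s
  proof -
   \<comment> \<open>The modified weight matrix refers to all earlier indices, but an index with the
     same eigenvalue lies in the same window, hence in the same group.\<close>
   have "(\<exists>q\<in>?J. (q, (n, s)) \<in> lex_less & ev q = ev (n, s)) \<longleftrightarrow> (\<exists>t\<in>S'. t < s & ev (n, t) = ev (n, s))"
   proof
    assume "\<exists>q\<in>?J. (q, (n, s)) \<in> lex_less & ev q = ev (n, s)"
    then obtain q where q: "q \<in> ?J" "(q, (n, s)) \<in> lex_less" "ev q = ev (n, s)" by blast
    have "q \<in> Pair n ` S'" by (rule int[OF q(1)]) (use int'[OF s] q(3) in auto)
    then obtain t where "t \<in> S'" "q = (n, t)" by blast
    then show "\<exists>t\<in>S'. t < s & ev (n, t) = ev (n, s)" using q by auto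
   next
    assume "\<exists>t\<in>S'. t < s & ev (n, t) = ev (n, s)"
    then obtain t where t: "t \<in> S'" "t < s" "ev (n, t) = ev (n, s)" by blast
    then show "\<exists>q\<in>?J. (q, (n, s)) \<in> lex_less & ev q = ev (n, s)" using int'[OF t(1)] by (intro bexI[of _ "(n, t)"]) auto
   qed
   then show ?thesis unfolding weight_matrix'_def weight_matrix_def by simp
  qed
  have L: "{l. (a - \<delta>)^2 < l & l < (a + \<delta>)^2 & det (Nmat (of_real l)) = 0} = (%s. ev (n, s)) ` S'"
  proof (intro set_eqI iffI)
   fix l assume "l \<in> {l. (a - \<delta>)^2 < l & l < (a + \<delta>)^2 & det (Nmat (of_real l)) = 0}"
   then have l: "(a - \<delta>)^2 < l" "l < (a + \<delta>)^2" "det (Nmat (of_real l)) = 0" by auto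
   have "0 < emult (complex_of_real l)" using l(3) by (simp add: eigen_mult_pos_iff)
   then have "0 < card {p\<in>?J. complex_of_real (ev p) = complex_of_real l}"
    using ev unfolding eigenvalue_enumeration_def by metis
   then obtain p where p: "p \<in> ?J" "ev p = l" by (auto simp: card_gt_0_iff)
   then have "p \<in> Pair n ` S'" using l by (intro int) auto
   then show "l \<in> (%s. ev (n, s)) ` S'" using p(2) by auto
  next
   fix l assume "l \<in> (%s. ev (n, s)) ` S'"
   then obtain s where s: "s \<in> S'" "l = ev (n, s)" by blast
   have "{p\<in>?J. complex_of_real (ev p) = complex_of_real l} ~= {}" using int'[OF s(1)] s(2) by blast
   then have "0 < emult (complex_of_real l)" using ev unfolding eigenvalue_enumeration_def by (metis card_gt_0_iff)
   then show "l \<in> {l. (a - \<delta>)^2 < l & l < (a + \<delta>)^2 & det (Nmat (of_real l)) = 0}"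
    using int'[OF s(1)] s(2) by (simp add: eigen_mult_pos_iff)
  qed
  have "(\<Sum>s\<in>S'. weight_matrix' \<sigma> T1 T2 H1 H2 ev (n, s)) = (\<Sum>s\<in>S'. if \<exists>t\<in>S'. t < s & ev (n, t) = ev (n, s) then 0 else ?R (ev (n, s)))"
   by (rule sum.cong[OF refl w'])
  also have "... = (\<Sum>l\<in>(%s. ev (n, s)) ` S'. ?R l)" by (rule sum_first_occurrences) (simp add: S'_def)
  also have "... = circle_mean Mfun (of_real a) \<delta>" unfolding L[symmetric] by (rule residue_sum[OF \<delta>(1) a nz])
  finally have "(\<Sum>s\<in>S'. weight_matrix' \<sigma> T1 T2 H1 H2 ev (n, s)) = circle_mean Mfun (of_real a) \<delta>" .
  then show "(\<Sum>s | s \<in> ?S & r s = ?x. weight_matrix' \<sigma> T1 T2 H1 H2 ev (n, s)) = circle_mean Mfun (of_real (real n + ?x)) \<delta> \<and>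
    (\<forall>\<rho>\<in>sphere (of_real (real n + ?x)) \<delta>. det (Nmat (\<rho>^2)) ~= 0)"
   using nz unfolding S'_def a_def by blast
 qed
qed

end

section \<open>Asymptotics of the weight matrices\<close>

lemma mholo_compose: "mholo F T ==> g holomorphic_on S ==> g ` S \<subseteq> T ==> mholo (%z. F (g z)) S"
 unfolding mholo_def using holomorphic_on_compose_gen[of g S _ T, unfolded o_def] by blast

lemma mholo_pr: "f holomorphic_on S ==> g holomorphic_on S ==> mholo (%z. pr T (f z) (g z)) S"
 unfolding pr_def by (intro mholo_add mholo_mscale mholo_const)

context sl_problem
begin

interpretation pp: projection_pair T1 T2 by unfold_locales (use T1_simps T2_simps in auto)

lemma hat_holo: "0 \<notin> S ==> mholo Nhat S" "0 \<notin> S ==> mholo Uhat S" unfolding Nhat_def[abs_def] Uhat_def[abs_def]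
 by (intro mholo_minus mholo_mult mholo_pr square_mholo Nmat_holo Smat_holo holomorphic_intros; auto)+

text \<open>Half of \<open>Mfun\<close> at \<open>n + z\<close> after multiplication by
  \<open>pr T1 1 (1 / n)\<close> on both sides. With this normalisation the limit for large
  \<open>n\<close> is \<open>E0\<close>.\<close>

definition Hfun :: "nat => complex => complex^'m^'m" where
 "Hfun n z = pr T1 1 ((of_nat n + z) / of_nat n) ** (matrix_inv (Nhat (of_nat n + z)) ** Uhat (of_nat n + z)) **
   pr T1 1 ((of_nat n + z) / of_nat n)"

lemma Hfun_holo:
 assumes "\<And>z. z \<in> S ==> of_nat n + z ~= 0" "\<And>z. z \<in> S ==> det (Nhat (of_nat n + z)) ~= 0"
 shows "mholo (Hfun n) S" unfolding Hfun_def[abs_def]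
proof (intro mholo_mult mholo_inv mholo_pr)
 show "mholo (%z. Nhat (of_nat n + z)) S" "mholo (%z. Uhat (of_nat n + z)) S"
  by (rule mholo_compose[OF hat_holo(1)[of "- {0}"]] mholo_compose[OF hat_holo(2)[of "- {0}"]];
    use assms(1) in \<open>auto intro!: holomorphic_intros\<close>)+
qed (use assms(2) in \<open>cases "n = 0"; auto intro!: holomorphic_intros simp: divide_inverse\<close>)+

lemma E0_holo: "(\<And>z. z \<in> S ==> det (W0 T1 T2 z) ~= 0) ==> mholo (E0 T1 T2) S"
 unfolding E0_def[abs_def] by (intro mholo_mult mholo_inv mholo_subset[OF pp.W_holo] mholo_subset[OF pp.U_holo]) auto

text \<open>With \<open>X\<close> the inverse of \<open>Nhat\<close> times \<open>Uhat\<close> and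
  \<open>E\<close> the periodic matrix \<open>E0\<close>, the relation \<open>W0 E = U0\<close>
  gives \<open>Nhat (X - E) = (Uhat - U0) - (Nhat - W0) E\<close>. So \<open>X - E\<close> is linear
  in the two errors, and \<open>Nhat\<close> inherits half of the lower bound of
  \<open>W0\<close>.\<close>

lemma Hfun_diff_bound:
 assumes \<kappa>: "0 < \<kappa>" and low: "\<And>v. \<kappa> * norm v <= norm (W0 T1 T2 z *v v)" and n: "1 <= n" and z: "cmod z <= 2"
  and ME: "norm (E0 T1 T2 z) <= ME"
  and Nd: "errN (of_nat n + z) <= \<kappa> / 2"
 defines "h \<equiv> 2 * norm (mat 1 - T1) * (2 + 2 * norm (mat 1 - T1))"
 defines "c \<equiv> (1 + h) * (real CARD('m) * (2 / \<kappa>) * (1 + ME)) + h * ME"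
 shows "det (Nhat (of_nat n + z)) ~= 0"
  and "norm (Hfun n z - E0 T1 T2 z) <= c * (errU (of_nat n + z) +
     errN (of_nat n + z) + inverse (real n))"
proof -
 define \<rho> where "\<rho> = of_nat n + z"
 have \<rho>: "\<rho> = z + of_nat n" unfolding \<rho>_def by (simp add: add.commute)
 define I1 where "I1 = real CARD('m) * (2 / \<kappa>)"
 define u where "u = errU \<rho>"
 define w where "w = errN \<rho>"
 define \<tau> where "\<tau> = norm (mat 1 - T1)"
 have \<tau>0: "0 <= \<tau>" unfolding \<tau>_def by simp
 have h: "h = 2 * \<tau> * (2 + 2 * \<tau>)" unfolding h_def \<tau>_def ..
 have h0: "0 <= h" unfolding h using \<tau>0 by simp
 have ME0: "0 <= ME" using ME norm_ge_zero order_trans by blast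
 have I0: "0 <= I1" unfolding I1_def using \<kappa> by simp
 have uw: "0 <= u" "0 <= w" unfolding u_def w_def by simp_all
 have lowN: "\<kappa> / 2 * norm v <= norm (Nhat \<rho> *v v)" for v
 proof -
  have "\<kappa> * norm v <= norm (W0 T1 T2 \<rho> *v v)" unfolding \<rho> pp.W_shift_norm by (rule low)
  also have "W0 T1 T2 \<rho> *v v = Nhat \<rho> *v v - (Nhat \<rho> - W0 T1 T2 \<rho>) *v v" by (simp add: matrix_vector_mult_diff_rdistrib)
  also have "norm ... <= norm (Nhat \<rho> *v v) + norm ((Nhat \<rho> - W0 T1 T2 \<rho>) *v v)" by (rule norm_triangle_ineq4)
  also have "norm ((Nhat \<rho> - W0 T1 T2 \<rho>) *v v) <= \<kappa> / 2 * norm v"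
   by (rule order_trans[OF norm_matvec_le mult_right_mono]) (use Nd in \<open>auto simp: \<rho>_def\<close>)
  finally show ?thesis by simp
 qed
 have k2: "0 < \<kappa> / 2" using \<kappa> by simp
 note inv = det_nonzero_lower_bound[OF k2 lowN]
 show dN: "det (Nhat (of_nat n + z)) ~= 0" using inv(1) unfolding \<rho>_def .
 have dWz: "det (W0 T1 T2 z) ~= 0" by (rule det_nonzero_lower_bound(1)[OF \<kappa> low])
 then have dW: "det (W0 T1 T2 \<rho>) ~= 0" unfolding \<rho> pp.det_W_shift .
 define E where "E = E0 T1 T2 z"
 have E: "E = matrix_inv (W0 T1 T2 \<rho>) ** U0 T1 T2 \<rho>"
 proof -
  have "E = E0 T1 T2 \<rho>" unfolding E_def \<rho> by (rule pp.E0_shift[OF dWz, symmetric])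
  then show ?thesis unfolding E0_def .
 qed
 have WE: "W0 T1 T2 \<rho> ** E = U0 T1 T2 \<rho>" unfolding E by (simp add: matrix_mul_assoc matrix_inv_inverse[OF dW])
 define X where "X = matrix_inv (Nhat \<rho>) ** Uhat \<rho>"
 have "X - E = matrix_inv (Nhat \<rho>) ** ((Uhat \<rho> - U0 T1 T2 \<rho>) - (Nhat \<rho> - W0 T1 T2 \<rho>) ** E)"
 proof -
  have "matrix_inv (Nhat \<rho>) ** ((Uhat \<rho> - U0 T1 T2 \<rho>) - (Nhat \<rho> - W0 T1 T2 \<rho>) ** E)
    = matrix_inv (Nhat \<rho>) ** Uhat \<rho> - (matrix_inv (Nhat \<rho>) ** Nhat \<rho>) ** E"
   by (simp add: mm.diff_left mm.diff_right WE matrix_mul_assoc)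
  then show ?thesis unfolding X_def by (simp add: matrix_inv_inverse[OF inv(1)])
 qed
 also have "norm ... <= I1 * (u + w * ME)"
 proof (rule order_trans[OF norm_matmul_le mult_mono])
  show "norm (matrix_inv (Nhat \<rho>)) <= I1" using inv(2) unfolding I1_def by simp
  have "norm ((Nhat \<rho> - W0 T1 T2 \<rho>) ** E) <= w * ME"
   unfolding w_def by (rule order_trans[OF norm_matmul_le mult_left_mono]) (use ME in \<open>auto simp: E_def\<close>)
  then show "norm ((Uhat \<rho> - U0 T1 T2 \<rho>) - (Nhat \<rho> - W0 T1 T2 \<rho>) ** E) <= u + w * ME"
   unfolding u_def by (intro order_trans[OF norm_triangle_ineq4 add_left_mono])
 qed (use I0 in auto)
 also have "... <= I1 * ((1 + ME) * (u + w))" using uw ME0 by (intro mult_left_mono[OF _ I0]) (simp add: algebra_simps)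
 finally have d: "norm (X - E) <= I1 * (1 + ME) * (u + w)" by (simp add: mult.assoc)
 define D where "D = (z / of_nat n) \<cdot> (mat 1 - T1)"
 have n0: "0 < real n" using n by simp
 have i1: "inverse (real n) <= 1" using n by (simp add: inverse_le_1_iff)
 have in0: "0 <= inverse (real n)" by simp
 have prD: "pr T1 1 (\<rho> / of_nat n) = mat 1 + D"
 proof -
  have "\<rho> / of_nat n = 1 + z / of_nat n" unfolding \<rho>_def using n0 by (simp add: add_divide_distrib)
  then show ?thesis unfolding pr_def D_def by (simp add: ms.add_left)
 qed
 have nD: "norm D <= 2 * \<tau> * inverse (real n)"
 proof -
  have "norm D = cmod z * inverse (real n) * \<tau>" unfolding D_def norm_mscale \<tau>_def by (simp add: norm_mult norm_inverse divide_inverse)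
  also have "... <= 2 * inverse (real n) * \<tau>" using z \<tau>0 by (intro mult_right_mono) auto
  finally show ?thesis by (simp add: mult_ac)
 qed
 have nD1: "norm D <= 2 * \<tau>" by (rule order_trans[OF nD]) (use mult_left_mono[OF i1, of "2 * \<tau>"] \<tau>0 in simp)
 have nX: "norm X <= ME + norm (X - E)" using norm_triangle_ineq[of E "X - E"] ME unfolding E_def[symmetric] by simp
 \<comment> \<open>The outer factors are \<open>mat 1 + D\<close> with \<open>D\<close> of order
   1/n; each extra term contains at least one factor \<open>D\<close>.\<close>
 have "Hfun n z - E = (X - E) + (D ** X + X ** D + D ** (X ** D))"
  unfolding Hfun_def \<rho>_def[symmetric] X_def[symmetric] prD by (simp add: mm.add_left mm.add_right matrix_mul_assoc)
 then have "norm (Hfun n z - E) <= norm (X - E) + (norm (D ** X) + norm (X ** D) + norm (D ** (X ** D)))"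
  by (simp only: order_trans[OF norm_triangle_ineq add_left_mono[OF order_trans[OF norm_triangle_ineq add_right_mono[OF norm_triangle_ineq]]]])
 also have "norm (D ** X) + norm (X ** D) + norm (D ** (X ** D)) <= norm D * norm X + norm X * norm D + norm D * (norm X * norm D)"
  by (rule add_mono[OF add_mono[OF norm_matmul_le norm_matmul_le]
     order_trans[OF norm_matmul_le mult_left_mono[OF norm_matmul_le norm_ge_zero]]])
 also have "... = norm D * ((2 + norm D) * norm X)" by (simp add: algebra_simps)
 also have "... <= (2 * \<tau> * inverse (real n)) * ((2 + 2 * \<tau>) * (ME + norm (X - E)))"
  using nD nD1 nX \<tau>0 by (intro mult_mono) auto
 also have "... = h * ((ME + norm (X - E)) * inverse (real n))" unfolding h by (simp only: mult_ac)
 also have "... <= h * (ME * inverse (real n) + norm (X - E))"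
 proof (rule mult_left_mono[OF _ h0])
  show "(ME + norm (X - E)) * inverse (real n) <= ME * inverse (real n) + norm (X - E)"
   using mult_left_mono[OF i1 norm_ge_zero[of "X - E"]] by (simp add: distrib_right)
 qed
 finally have "norm (Hfun n z - E) <= (1 + h) * norm (X - E) + h * ME * inverse (real n)" by (simp add: algebra_simps)
 also have "... <= (1 + h) * (I1 * (1 + ME) * (u + w)) + h * ME * inverse (real n)"
  using d h0 by (intro add_right_mono mult_left_mono) auto
 also have "... <= c * (u + w + inverse (real n))"
 proof -
  define q where "q = (1 + h) * (I1 * (1 + ME))"
  have q: "0 <= q" unfolding q_def using h0 I0 ME0 by simp
  have c: "c = q + h * ME" unfolding c_def q_def I1_def ..
  have "0 <= q * inverse (real n)" "0 <= h * ME * (u + w)" using q h0 ME0 uw in0 by simp_all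
  then have "q * (u + w) + h * ME * inverse (real n) <= (q + h * ME) * (u + w + inverse (real n))"
   by (simp add: distrib_left distrib_right)
  then show ?thesis unfolding c q_def by (simp only: mult.assoc)
 qed
 finally show "norm (Hfun n z - E0 T1 T2 z) <= c * (errU (of_nat n + z) +
     errN (of_nat n + z) + inverse (real n))" unfolding E_def u_def w_def \<rho>_def .
qed

text \<open>At each point of the circle the three errors are square summable in \<open>n\<close>,
  with one bound for the whole circle; \<open>norm_circle_mean_sq_le\<close> integrates this over
  the circle.\<close>

lemma Hfun_l2:
 fixes x \<delta> :: real
 assumes x: "0 <= x" "x < 1" and \<delta>: "0 < \<delta>" "\<delta> <= 1 / 2"
  and nz: "\<And>z. z \<in> sphere (of_real x) \<delta> ==> det (W0 T1 T2 z) ~= 0"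
 shows "\<exists>n1 C. (\<forall>n\<ge>n1. \<forall>z\<in>sphere (of_real x) \<delta>. of_nat n + z ~= 0 & det (Nhat (of_nat n + z)) ~= 0) \<and>
   (\<forall>F. finite F --> (\<forall>n\<in>F. n1 <= n) --> (\<Sum>n\<in>F. (norm (circle_mean (%z. Hfun n z - E0 T1 T2 z) (of_real x) \<delta>))^2) <= C)"
proof -
 let ?C = "sphere (complex_of_real x) \<delta>"
 have zb: "\<bar>Im z\<bar> <= 1" "\<bar>Re z\<bar> <= 2" "cmod z <= 2" if z: "z \<in> ?C" for z
 proof -
  have d: "cmod (of_real x - z) = \<delta>" using z by (simp add: dist_norm)
  have "cmod z <= cmod (of_real x) + cmod (of_real x - z)" using norm_triangle_ineq4[of "of_real x" "of_real x - z"] by simp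
  then show c: "cmod z <= 2" using d x \<delta> by simp
  then show "\<bar>Re z\<bar> <= 2" using abs_Re_le_cmod[of z] by simp
  show "\<bar>Im z\<bar> <= 1" using abs_Im_le_cmod[of "of_real x - z"] d \<delta> by simp
 qed
 have "\<exists>\<kappa>>0. \<forall>z\<in>?C. \<forall>v. \<kappa> * norm v <= norm (W0 T1 T2 z *v v)"
  by (rule pp.W_compact_lower_bound) (use nz in auto)
 then obtain \<kappa> where \<kappa>: "\<kappa> > 0" "\<And>z v. z \<in> ?C ==> \<kappa> * norm v <= norm (W0 T1 T2 z *v v)" by blast
 have E0c: "continuous_on ?C (E0 T1 T2)" by (rule mholo_continuous_on[OF E0_holo[OF nz]])
 then have "bounded (E0 T1 T2 ` ?C)" by (intro compact_imp_bounded compact_continuous_image) auto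
 then obtain ME where ME: "ME > 0" "\<And>z. z \<in> ?C ==> norm (E0 T1 T2 z) <= ME" unfolding bounded_pos by blast
 \<comment> \<open>On the circle \<open>\<bar>Im z\<bar> <= 1\<close>, so the growth factor is at
   most \<open>exp pi\<close> and the error at most \<open>\<kappa> / 2\<close>, as
   \<open>Hfun_diff_bound\<close> requires.\<close>
 define e where "e = \<kappa> / (2 * exp pi)"
 have e: "0 < e" unfolding e_def using \<kappa> by simp
 have "\<exists>R\<ge>1. \<forall>\<rho>. R <= cmod \<rho> --> - 1 <= Im \<rho> -->
   errN \<rho> <= e * exp (pi * \<bar>Im \<rho>\<bar>) & errU \<rho> <= e * exp (pi * \<bar>Im \<rho>\<bar>)"
  by (rule hat_small[OF _ e]) simp
 then obtain R where R: "R \<ge> 1" "\<And>\<rho>. R <= cmod \<rho> ==> - 1 <= Im \<rho> ==> errN \<rho> <= e * exp (pi * \<bar>Im \<rho>\<bar>)"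
  by blast
 have "\<exists>C\<ge>0. \<forall>z (F::nat set). \<bar>Im z\<bar> <= 1 --> \<bar>Re z\<bar> <= 2 --> finite F --> (\<forall>n\<in>F. 4 <= n) -->
   (\<Sum>n\<in>F. (errN (of_nat n + z))^2) <= C & (\<Sum>n\<in>F. (errU (of_nat n + z))^2) <= C" by (rule hat_l2) simp
 then obtain C0 where C0: "C0 \<ge> 0" "\<And>z F. \<bar>Im z\<bar> <= 1 ==> \<bar>Re z\<bar> <= 2 ==> finite F ==> (\<forall>n\<in>F. 4 <= n) ==>
   (\<Sum>n\<in>F. (errN (of_nat n + z))^2) <= C0 & (\<Sum>n\<in>F. (errU (of_nat n + z))^2) <= C0" by blast
 \<comment> \<open>4 is the threshold of \<open>hat_l2\<close>; \<open>R + 2\<close> gives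
   \<open>cmod (n + z) >= R\<close>, because \<open>cmod z <= 2\<close>.\<close>
 define n1 where "n1 = max 4 (nat \<lceil>R + 2\<rceil>)"
 define S where "S = (\<Sum>n. inverse ((real n)^2))"
 define h where "h = 2 * norm (mat 1 - T1) * (2 + 2 * norm (mat 1 - T1))"
 define c where "c = (1 + h) * (real CARD('m) * (2 / \<kappa>) * (1 + ME)) + h * ME"
 have big: "real n \<ge> R + 2" "4 <= n" if "n1 <= n" for n
 proof -
  have "nat \<lceil>R + 2\<rceil> <= n" "4 <= n" using that unfolding n1_def by simp_all
  then show "real n \<ge> R + 2" "4 <= n" using real_nat_ceiling_ge[of "R + 2"] of_nat_mono[of "nat \<lceil>R + 2\<rceil>" n, where 'a=real] by linarith+
 qed
 have Rn: "R <= cmod (of_nat n + z)" if "n1 <= n" "z \<in> ?C" for n z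
 proof -
  have "real n <= cmod (of_nat n + z) + cmod z" using norm_triangle_ineq4[of "of_nat n + z" z] by simp
  then show ?thesis using big(1)[OF that(1)] zb(3)[OF that(2)] by linarith
 qed
 have Nd: "errN (of_nat n + z) <= \<kappa> / 2" if "n1 <= n" "z \<in> ?C" for n z
 proof -
  have "errN (of_nat n + z) <= e * exp (pi * \<bar>Im (of_nat n + z)\<bar>)"
   by (rule R(2)[OF Rn[OF that]]) (use zb(1)[OF that(2)] in simp)
  also have "... <= e * exp (pi * 1)" using e zb(1)[OF that(2)] by (intro mult_left_mono) auto
  finally show ?thesis unfolding e_def by simp
 qed
 have n1: "1 <= n" if "n1 <= n" for n using big(2)[OF that] by simp
 note HB = Hfun_diff_bound[OF \<kappa>(1) \<kappa>(2) n1 zb(3) ME(2) Nd, folded h_def, folded c_def]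
 have nz': "of_nat n + z ~= 0" if "n1 <= n" "z \<in> ?C" for n z using Rn[OF that] R(1) by auto
 have cont: "continuous_on ?C (%z. Hfun n z - E0 T1 T2 z)" if "n1 <= n" for n
  by (intro continuous_on_diff E0c mholo_continuous_on[OF Hfun_holo] nz' HB(1)) (use that in auto)
 have H2: "(\<Sum>n\<in>F. (norm (Hfun n z - E0 T1 T2 z))^2) <= 3 * c^2 * (C0 + C0 + S)"
  if F: "finite F" "\<forall>n\<in>F. n1 <= n" and z: "z \<in> ?C" for F z
 proof -
  let ?u = "%n. errU (of_nat n + z)"
  let ?w = "%n. errN (of_nat n + z)"
  have sq: "(p + q + s)^2 <= 3 * (p^2 + q^2 + s^2)" for p q s :: real
   using sum_squares_bound[of p q] sum_squares_bound[of p s] sum_squares_bound[of q s]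
   by (simp add: power2_eq_square algebra_simps)
  have F4: "\<forall>n\<in>F. 4 <= n" using F(2) big(2) by blast
  have "(norm (Hfun n z - E0 T1 T2 z))^2 <= 3 * c^2 * ((?u n)^2 + (?w n)^2 + inverse ((real n)^2))" if n: "n \<in> F" for n
  proof -
   have nn: "n1 <= n" using F n by blast
   have "(norm (Hfun n z - E0 T1 T2 z))^2 <= (c * (?u n + ?w n + inverse (real n)))^2"
    by (rule power_mono[OF HB(2)[OF z nn z z nn z]]) simp
   also have "... <= c^2 * (3 * ((?u n)^2 + (?w n)^2 + (inverse (real n))^2))"
    unfolding power_mult_distrib[of c] by (rule mult_left_mono[OF sq]) simp
   finally show ?thesis by (simp add: power_inverse algebra_simps)
  qed
  then have "(\<Sum>n\<in>F. (norm (Hfun n z - E0 T1 T2 z))^2) <= (\<Sum>n\<in>F. 3 * c^2 * ((?u n)^2 + (?w n)^2 + inverse ((real n)^2)))"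
   by (rule sum_mono)
  also have "... = 3 * c^2 * ((\<Sum>n\<in>F. (?u n)^2) + (\<Sum>n\<in>F. (?w n)^2) + (\<Sum>n\<in>F. inverse ((real n)^2)))"
   by (simp only: sum.distrib sum_distrib_left[symmetric])
  also have "... <= 3 * c^2 * (C0 + C0 + S)"
   using C0(2)[OF zb(1)[OF z] zb(2)[OF z] F(1) F4] sum_inverse_squares_le[OF F(1)] unfolding S_def
   by (intro mult_left_mono add_mono) auto
  finally show ?thesis .
 qed
 show ?thesis
 proof (intro exI[of _ n1] exI[of _ "\<delta>^2 * (3 * c^2 * (C0 + C0 + S))"] conjI allI impI ballI)
  fix n z assume "n1 <= n" "z \<in> ?C"
  then show "of_nat n + z ~= 0" "det (Nhat (of_nat n + z)) ~= 0" using nz' HB(1) by blast+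
 next
  fix F :: "nat set" assume F: "finite F" "\<forall>n\<in>F. n1 <= n"
  let ?g = "%n t. (norm (Hfun n (circle_point (of_real x) \<delta> t) - E0 T1 T2 (circle_point (of_real x) \<delta> t)))^2"
  have gi: "?g n integrable_on {0..1}" if "n \<in> F" for n using circle_mean_continuous[OF \<delta>(1) cont[of n]] F that
   by (intro integrable_continuous_real continuous_on_power continuous_on_norm) auto
  have "(\<Sum>n\<in>F. (norm (circle_mean (%z. Hfun n z - E0 T1 T2 z) (of_real x) \<delta>))^2) <= (\<Sum>n\<in>F. \<delta>^2 * integral {0..1} (?g n))"
   by (rule sum_mono) (rule norm_circle_mean_sq_le[OF \<delta>(1) cont], use F in blast)
  also have "... = \<delta>^2 * integral {0..1} (%t. \<Sum>n\<in>F. ?g n t)"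
   by (simp only: sum_distrib_left[symmetric] integral_sum[OF F(1) gi])
  also have "... <= \<delta>^2 * integral {0..1} (%t::real. 3 * c^2 * (C0 + C0 + S))"
  proof (intro mult_left_mono integral_le)
   show "(%t. \<Sum>n\<in>F. ?g n t) integrable_on {0..1}" by (rule integrable_sum[OF F(1) gi])
   show "(\<Sum>n\<in>F. ?g n t) <= 3 * c^2 * (C0 + C0 + S)" for t by (rule H2[OF F circle_point_sphere[OF \<delta>(1)]])
  qed auto
  also have "... = \<delta>^2 * (3 * c^2 * (C0 + C0 + S))" by simp
  finally show "(\<Sum>n\<in>F. (norm (circle_mean (%z. Hfun n z - E0 T1 T2 z) (of_real x) \<delta>))^2) <= \<delta>^2 * (3 * c^2 * (C0 + C0 + S))" .
 qed
qed

text \<open>The weight sum and \<open>A_mat\<close> are circle means over circles of the same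
  radius, the former about \<open>n + r k\<close> and moved to \<open>r k\<close> by translation.
  Hence \<open>K n\<close> is \<open>pi\<close> times the circle mean of \<open>Hfun n - E0\<close>
  for large \<open>n\<close>.\<close>

lemma weight_asymptotics:
 assumes r: "zero_enumeration T1 T2 r" and ev: "eigenvalue_enumeration \<sigma> T1 T2 H1 H2 ev" and k: "k \<in> {1..CARD('m)}"
 defines "K \<equiv> %n. (pi / 2) *\<^sub>R (pr T1 1 (1 / of_nat n) **
   (\<Sum>s | s \<in> {1..CARD('m)} & r s = r k. weight_matrix' \<sigma> T1 T2 H1 H2 ev (n, s)) ** pr T1 1 (1 / of_nat n)) - A_mat T1 T2 r k"
 shows "\<exists>n1 C. \<forall>F. finite F --> (\<forall>n\<in>F. n1 <= n) --> (\<Sum>n\<in>F. (norm (K n))^2) <= C"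
proof -
 let ?x = "complex_of_real (r k)"
 have "r k \<in> {0..<1}" using r k unfolding zero_enumeration_def by blast
 then have x: "0 <= r k" "r k < 1" by auto
 obtain \<delta> where \<delta>: "0 < \<delta>" "\<delta> <= 1 / 2" and gap: "\<forall>z\<in>cball ?x \<delta>. z ~= ?x --> det (W0 T1 T2 z) ~= 0"
  using pp.zero_gap[of ?x] by blast
 have nz: "det (W0 T1 T2 z) ~= 0" if "z \<in> sphere ?x \<delta>" for z
  by (rule gap[rule_format]) (use that \<delta> in auto)
 obtain n1 C where n1: "\<forall>n\<ge>n1. \<forall>z\<in>sphere ?x \<delta>. of_nat n + z ~= 0 & det (Nhat (of_nat n + z)) ~= 0"
  and C: "\<forall>F. finite F --> (\<forall>n\<in>F. n1 <= n) --> (\<Sum>n\<in>F. (norm (circle_mean (%z. Hfun n z - E0 T1 T2 z) ?x \<delta>))^2) <= C"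
  using Hfun_l2[OF x \<delta> nz] by blast
 obtain n2 where n2: "\<forall>n\<ge>n2. (\<Sum>s | s \<in> {1..CARD('m)} & r s = r k. weight_matrix' \<sigma> T1 T2 H1 H2 ev (n, s))
    = circle_mean Mfun (of_real (real n + r k)) \<delta> & (\<forall>\<rho>\<in>sphere (of_real (real n + r k)) \<delta>. det (Nmat (\<rho>^2)) ~= 0)"
  using weight_sum[OF r ev k \<delta> gap] by blast
 have A: "A_mat T1 T2 r k = pi *\<^sub>R circle_mean (E0 T1 T2) ?x \<delta>"
 proof -
  have "matrix_residue (E0 T1 T2) ?x = circle_mean (E0 T1 T2) ?x \<delta>"
  proof (rule matrix_residue_circle_mean)
   show "open ({z. det (W0 T1 T2 z) ~= 0} \<union> ball ?x \<delta>)" by (intro open_Un pp.open_det_W open_ball)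
   have "z \<in> ball ?x \<delta>" if "z \<in> cball ?x \<delta>" "det (W0 T1 T2 z) = 0" for z
   proof -
    have "z = ?x" using gap that by blast
    then show ?thesis using \<delta>(1) by simp
   qed
   then show "cball ?x \<delta> \<subseteq> {z. det (W0 T1 T2 z) ~= 0} \<union> ball ?x \<delta>" by blast
   show "mholo (E0 T1 T2) ({z. det (W0 T1 T2 z) ~= 0} \<union> ball ?x \<delta> - {?x})"
    by (rule E0_holo) (use gap in auto)
  qed (rule \<delta>)
  then show ?thesis unfolding A_mat_def by simp
 qed
 have K: "K n = pi *\<^sub>R circle_mean (%z. Hfun n z - E0 T1 T2 z) ?x \<delta>" if n: "max 1 (max n1 n2) <= n" for n
 proof -
  have nn: "n1 <= n" "n2 <= n" "1 <= n" using n by auto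
  have nc: "(of_nat n :: complex) ~= 0" using nn by simp
  let ?p = "pr T1 1 (1 / of_nat n)"
  have Hc: "continuous_on (sphere ?x \<delta>) (Hfun n)" by (rule mholo_continuous_on[OF Hfun_holo]) (use n1 nn in auto)
  have Ec: "continuous_on (sphere ?x \<delta>) (E0 T1 T2)" by (rule mholo_continuous_on[OF E0_holo[OF nz]])
  have a: "complex_of_real (real n + r k) = of_nat n + ?x" by simp
  note n2n = n2[THEN spec, THEN mp, OF nn(2), unfolded a]
  have sp: "of_nat n + z \<in> sphere (of_nat n + ?x) \<delta>" if "z \<in> sphere ?x \<delta>" for z using that by (simp add: dist_norm)
  have Mz: "det (Nmat ((of_nat n + z)^2)) ~= 0" if "z \<in> sphere ?x \<delta>" for z
   by (rule bspec[OF conjunct2[OF n2n] sp[OF that]])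
  have Mc: "continuous_on (sphere ?x \<delta>) (%z. Mfun (of_nat n + z))"
  proof (rule mholo_continuous_on[OF mholo_compose[OF Mfun_holo]])
   show "det (Nmat (\<rho>^2)) ~= 0" if "\<rho> \<in> (%z. of_nat n + z) ` sphere ?x \<delta>" for \<rho>
   proof -
    from that obtain z where "z \<in> sphere ?x \<delta>" "\<rho> = of_nat n + z" by blast
    then show ?thesis using Mz by simp
   qed
  qed (auto intro!: holomorphic_intros)
  have "?p ** (\<Sum>s | s \<in> {1..CARD('m)} & r s = r k. weight_matrix' \<sigma> T1 T2 H1 H2 ev (n, s)) ** ?p = ?p ** circle_mean Mfun (of_nat n + ?x) \<delta> ** ?p"
   by (simp only: conjunct1[OF n2n])
  also have "... = circle_mean (%z. ?p ** Mfun (of_nat n + z) ** ?p) ?x \<delta>"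
   unfolding circle_mean_shift by (rule circle_mean_linear[OF \<delta>(1) Mc, symmetric])
  also have "... = circle_mean (%z. 2 \<cdot> Hfun n z) ?x \<delta>"
  proof (rule circle_mean_cong[OF \<delta>(1)])
   fix z assume z: "z \<in> sphere ?x \<delta>"
   have M: "Mfun (of_nat n + z) = 2 \<cdot> (pr T1 1 (of_nat n + z) ** (matrix_inv (Nhat (of_nat n + z)) ** Uhat (of_nat n + z)) ** pr T1 1 (of_nat n + z))"
    by (rule Mfun_hat) (use n1 nn z in auto)
   have "?p ** (2 \<cdot> (P ** X ** P)) ** ?p = 2 \<cdot> ((?p ** P) ** X ** (P ** ?p))" for P X :: "complex^'m^'m"
    by (simp add: mscale_mult_left mscale_mult_right matrix_mul_assoc)
   then show "?p ** Mfun (of_nat n + z) ** ?p = 2 \<cdot> Hfun n z" unfolding M Hfun_def by (simp add: pr_mult[OF T1_simps(2)])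
  qed
  also have "... = 2 \<cdot> circle_mean (Hfun n) ?x \<delta>" by (rule circle_mean_mscale[OF \<delta>(1) Hc])
  finally have "K n = (pi / 2) *\<^sub>R (2 \<cdot> circle_mean (Hfun n) ?x \<delta>) - pi *\<^sub>R circle_mean (E0 T1 T2) ?x \<delta>"
   unfolding K_def A by simp
  also have "(pi / 2) *\<^sub>R (2 \<cdot> circle_mean (Hfun n) ?x \<delta>) = pi *\<^sub>R circle_mean (Hfun n) ?x \<delta>"
   using mscale_of_real[of 2 "circle_mean (Hfun n) ?x \<delta>"] by simp
  also have "... - pi *\<^sub>R circle_mean (E0 T1 T2) ?x \<delta> = pi *\<^sub>R circle_mean (%z. Hfun n z - E0 T1 T2 z) ?x \<delta>"
   unfolding circle_mean_diff[OF \<delta>(1) Hc Ec] by (simp add: scaleR_diff_right)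
  finally show ?thesis .
 qed
 show ?thesis
 proof (intro exI[of _ "max 1 (max n1 n2)"] exI[of _ "pi^2 * C"] allI impI)
  fix F assume F: "finite F" "\<forall>n\<in>F. max 1 (max n1 n2) <= n"
  have "(\<Sum>n\<in>F. (norm (K n))^2) = (\<Sum>n\<in>F. pi^2 * (norm (circle_mean (%z. Hfun n z - E0 T1 T2 z) ?x \<delta>))^2)"
   using F by (intro sum.cong refl) (simp add: K power_mult_distrib)
  also have "... = pi^2 * (\<Sum>n\<in>F. (norm (circle_mean (%z. Hfun n z - E0 T1 T2 z) ?x \<delta>))^2)"
   by (rule sum_distrib_left[symmetric])
  also have "... <= pi^2 * C" by (intro mult_left_mono C[rule_format]) (use F in auto)
  finally show "(\<Sum>n\<in>F. (norm (K n))^2) <= pi^2 * C" .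
 qed
qed

end

theorem theorem4p3:
 fixes \<sigma> :: "real \<Rightarrow> complex^'m^'m"
  and T1 T2 H1 H2 :: "complex^'m^'m"
  and r :: "nat \<Rightarrow> real"
  and ev :: "nat \<times> nat \<Rightarrow> real"
 assumes "L2_on {0<..<pi} \<sigma>"
  and "AE x in lebesgue_on {0<..<pi}. \<sigma> x = ctranspose (\<sigma> x)"
  and "T1 = ctranspose T1" and "T1 = T1 ** T1"
  and "T2 = ctranspose T2" and "T2 = T2 ** T2"
  and "H1 = ctranspose H1" and "H1 = T1 ** H1 ** T1"
  and "H2 = ctranspose H2" and "H2 = T2 ** H2 ** T2"
  and "zero_enumeration T1 T2 r"
  and "eigenvalue_enumeration \<sigma> T1 T2 H1 H2 ev"
 shows "(\<forall>p\<in>index_set T1 T2.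
      nonneg_definite (weight_matrix \<sigma> T1 T2 H1 H2 ev p) \<and>
      rank (weight_matrix \<sigma> T1 T2 H1 H2 ev p)
       = eigen_mult \<sigma> T1 T2 H1 H2 (complex_of_real (ev p))) \<and>
     (\<exists>K :: nat \<times> nat \<Rightarrow> complex^'m^'m. (\<forall>n\<ge>1. \<forall>k\<in>{1..CARD('m)}.
        (\<Sum>s | s \<in> {1..CARD('m)} \<and> r s = r k. weight_matrix' \<sigma> T1 T2 H1 H2 ev (n, s))
        = (2 / pi) *\<^sub>R ((T1 + real n *\<^sub>R (mat 1 - T1)) ** (A_mat T1 T2 r k + K (n, k))
                ** (T1 + real n *\<^sub>R (mat 1 - T1)))) \<and>
      (\<lambda>p. (matrix_norm (K p))\<^sup>2) summable_on {1..} \<times> {1..CARD('m)})"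
proof -
 interpret sl_problem \<sigma> T1 T2 H1 H2 by unfold_locales (rule assms)+
 let ?J = "index_set T1 T2" and ?S = "{1..CARD('m)}"
 define \<alpha> where "\<alpha> = (%n k. \<Sum>s | s \<in> ?S & r s = r k. weight_matrix' \<sigma> T1 T2 H1 H2 ev (n, s))"
 \<comment> \<open>The asymptotic formula solved for \<open>K\<close>, the outer factors being
   inverted by \<open>pr T1 1 (1 / n)\<close>; the formula is then an identity and the content lies
   in the summability.\<close>
 define K where "K = (%(n, k). (pi / 2) *\<^sub>R (pr T1 1 (1 / of_nat n) ** \<alpha> n k ** pr T1 1 (1 / of_nat n)) - A_mat T1 T2 r k)"
 have first: "nonneg_definite (weight_matrix \<sigma> T1 T2 H1 H2 ev p) \<and>
   rank (weight_matrix \<sigma> T1 T2 H1 H2 ev p) = eigen_mult \<sigma> T1 T2 H1 H2 (complex_of_real (ev p))" for p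
  unfolding weight_matrix_def using weight_matrix_properties by blast
 have formula: "\<alpha> n k = (2 / pi) *\<^sub>R ((T1 + real n *\<^sub>R (mat 1 - T1)) ** (A_mat T1 T2 r k + K (n, k)) ** (T1 + real n *\<^sub>R (mat 1 - T1)))"
  if n: "1 <= n" for n k
 proof -
  have Q: "T1 + real n *\<^sub>R (mat 1 - T1) = pr T1 1 (of_nat n)"
   unfolding pr_def using mscale_of_real[of "real n" "mat 1 - T1"] by simp
  have one: "pr T1 1 (of_nat n) ** pr T1 1 (1 / of_nat n) = mat 1" "pr T1 1 (1 / of_nat n) ** pr T1 1 (of_nat n) = mat 1"
   using n by (simp_all add: pr_mult[OF T1_simps(2)] pr_one)
  have "A_mat T1 T2 r k + K (n, k) = (pi / 2) *\<^sub>R (pr T1 1 (1 / of_nat n) ** \<alpha> n k ** pr T1 1 (1 / of_nat n))"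
   unfolding K_def by simp
  then have "(2 / pi) *\<^sub>R (pr T1 1 (of_nat n) ** (A_mat T1 T2 r k + K (n, k)) ** pr T1 1 (of_nat n)) =
    (pr T1 1 (of_nat n) ** pr T1 1 (1 / of_nat n)) ** \<alpha> n k ** (pr T1 1 (1 / of_nat n) ** pr T1 1 (of_nat n))"
   by (simp add: mm.scaleR_left mm.scaleR_right matrix_mul_assoc)
  also have "... = \<alpha> n k" unfolding one by simp
  finally show ?thesis unfolding Q ..
 qed
 have "\<forall>k\<in>?S. \<exists>n1 C. \<forall>F. finite F --> (\<forall>n\<in>F. n1 <= n) --> (\<Sum>n\<in>F. (norm (K (n, k)))^2) <= C"
  using weight_asymptotics[OF assms(11,12)] unfolding K_def \<alpha>_def by simp
 then obtain n1 C where C: "\<And>k F. k \<in> ?S ==> finite F ==> (\<forall>n\<in>F. n1 k <= n) ==> (\<Sum>n\<in>F. (norm (K (n, k)))^2) <= C k"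
  by metis
 \<comment> \<open>For each \<open>k\<close> the finitely many terms with \<open>n < n1 k\<close>
   are added as they stand, and the others are bounded by \<open>C k\<close>.\<close>
 let ?D = "%k. (\<Sum>n<n1 k. (norm (K (n, k)))^2) + C k"
 have bound: "sum (%p. (matrix_norm (K p))^2) F <= (\<Sum>k\<in>?S. ?D k)"
  if F: "F \<subseteq> {1..} \<times> ?S" "finite F" for F
 proof -
  have col: "(\<Sum>n\<in>fst ` F. (norm (K (n, k)))^2) <= ?D k" if k: "k \<in> ?S" for k
  proof -
   let ?G = "{n\<in>fst ` F. n1 k <= n}"
   have "(\<Sum>n\<in>fst ` F. (norm (K (n, k)))^2) <= (\<Sum>n\<in>{..<n1 k} \<union> ?G. (norm (K (n, k)))^2)"
    by (rule sum_mono2) (use F in auto)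
   also have "... = (\<Sum>n<n1 k. (norm (K (n, k)))^2) + (\<Sum>n\<in>?G. (norm (K (n, k)))^2)"
    by (rule sum.union_disjoint) (use F in auto)
   also have "(\<Sum>n\<in>?G. (norm (K (n, k)))^2) <= C k" by (rule C[OF k]) (use F in auto)
   finally show ?thesis by simp
  qed
  have "sum (%p. (matrix_norm (K p))^2) F <= sum (%p. (norm (K p))^2) F" by (intro sum_mono power_mono matrix_norm_le_norm)
  also have "... <= sum (%p. (norm (K p))^2) (fst ` F \<times> ?S)" by (rule sum_mono2) (use F in force)+
  also have "... = (\<Sum>n\<in>fst ` F. \<Sum>k\<in>?S. (norm (K (n, k)))^2)"
   unfolding sum.cartesian_product by (simp add: case_prod_unfold)
  also have "... = (\<Sum>k\<in>?S. \<Sum>n\<in>fst ` F. (norm (K (n, k)))^2)" by (rule sum.swap)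
  also have "... <= (\<Sum>k\<in>?S. ?D k)" by (rule sum_mono[OF col])
  finally show ?thesis .
 qed
 have summable: "(%p. (matrix_norm (K p))^2) summable_on {1..} \<times> ?S"
  by (rule nonneg_bdd_above_summable_on) (use bound in \<open>auto simp: bdd_above_def\<close>)
 show ?thesis using first formula summable unfolding \<alpha>_def by blast
qed

end
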